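(* Let $n,m,l$ be positive integers with $\gcd(m,l)=1$, and let $\mathcal{B}_{m/l,n}$ be the Berezin transform of the generalized Hartogs triangle $\Omega^{n+1}_{m/l}=\{(z,w)\in\mathbb{C}^n\times\mathbb{C}:\ \|z\|^m<|w|^l<1\}$. For real $p\ge 1$, the Berezin transform $\mathcal{B}_{m/l,n}$ is unbounded on $L^p(\Omega^{n+1}_{m/l})$ (that is, it is not a bounded operator from $L^p(\Omega^{n+1}_{m/l})$ to $L^p(\Omega^{n+1}_{m/l})$) if and only if $1\le p\le m+nl$.
   Context: $\|\cdot\|$ is the Euclidean norm on $\mathbb{C}^n$, $dV$ is Lebesgue measure, and $L^p$ spaces are taken with respect to $dV$. The Bergman space $A^2(\Omega^{n+1}_{m/l})$ is the closed subspace of holomorphic functions in $L^2(\Omega^{n+1}_{m/l})$, and $B_{m/l,n}((z,w),(\xi,\eta))$ denotes its reproducing kernel (the Bergman kernel of $\Omega^{n+1}_{m/l}$), holomorphic in $(z,w)$ and antiholomorphic in $(\xi,\eta)$. The Berezin transform is the positive integral operator $$\mathcal{B}_{m/l,n}f(z,w)=\int_{\Omega^{n+1}_{m/l}}\frac{|B_{m/l,n}((z,w),(\xi,\eta))|^2}{B_{m/l,n}((z,w),(z,w))}\,f(\xi,\eta)\,dV(\xi,\eta).$$ *)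

theory Defs
  imports "HOL-Analysis.Analysis"
begin

definition hartogs :: "nat \<Rightarrow> nat \<Rightarrow> ((complex ^ 'n) \<times> complex) set" where
  "hartogs m l = {(z, w). norm z ^ m < norm w ^ l \<and> norm w ^ l < 1}"

definition Lp_space :: "real \<Rightarrow> 'a::euclidean_space set \<Rightarrow> ('a \<Rightarrow> complex) set" where
  "Lp_space p S = {f \<in> borel_measurable (lebesgue_on S).
     integrable (lebesgue_on S) (\<lambda>x. norm (f x) powr p)}"

definition Lp_norm :: "real \<Rightarrow> 'a::euclidean_space set \<Rightarrow> ('a \<Rightarrow> complex) \<Rightarrow> real" where
  "Lp_norm p S f = (LINT x|lebesgue_on S. norm (f x) powr p) powr (1 / p)"

text \<open>The type \<open>(complex ^ 'n) \<times> complex\<close> only carries a real vector space structure in the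
  library, so holomorphy in several variables is stated as Frechet differentiability with a
  derivative that commutes with the coordinatewise complex scalar multiplication. It is meant for
  open sets.\<close>

definition holomorphic_several ::
    "((complex ^ 'n) \<times> complex \<Rightarrow> complex) \<Rightarrow> ((complex ^ 'n) \<times> complex) set \<Rightarrow> bool" where
  "holomorphic_several f S \<longleftrightarrow>
     (\<forall>x\<in>S. \<exists>D. (f has_derivative D) (at x) \<and>
        (\<forall>c z w. D (c *s z, c * w) = c * D (z, w)))"

definition bergman_space ::
    "((complex ^ 'n) \<times> complex) set \<Rightarrow> ((complex ^ 'n) \<times> complex \<Rightarrow> complex) set" where
  "bergman_space S = {f \<in> Lp_space 2 S. holomorphic_several f S}"

text \<open>The second conjunct says \<open>f x = \<langle>f, K(\<cdot>, x)\<rangle>\<close> in \<open>L\<^sup>2\<close>. The last one only fixes the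
  values of the total function \<open>K\<close> outside \<open>S \<times> S\<close>, so that the kernel is unique as a
  HOL function.\<close>

definition is_bergman_kernel ::
    "((complex ^ 'n) \<times> complex) set \<Rightarrow>
     ((complex ^ 'n) \<times> complex \<Rightarrow> (complex ^ 'n) \<times> complex \<Rightarrow> complex) \<Rightarrow> bool" where
  "is_bergman_kernel S K \<longleftrightarrow>
     (\<forall>y\<in>S. (\<lambda>x. K x y) \<in> bergman_space S) \<and>
     (\<forall>f\<in>bergman_space S. \<forall>x\<in>S. f x = (LINT y|lebesgue_on S. f y * cnj (K y x))) \<and>
     (\<forall>x y. x \<notin> S \<or> y \<notin> S \<longrightarrow> K x y = 0)"

definition bergman_kernel ::
    "((complex ^ 'n) \<times> complex) set \<Rightarrow>
     (complex ^ 'n) \<times> complex \<Rightarrow> (complex ^ 'n) \<times> complex \<Rightarrow> complex" where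
  "bergman_kernel S = (THE K. is_bergman_kernel S K)"

lemma is_bergman_kernel_unique:
  assumes K: "is_bergman_kernel S K" and L: "is_bergman_kernel S L"
  shows "K = L"
proof -
  have herm: "K x y = cnj (L y x)"
    if K: "is_bergman_kernel S K" and L: "is_bergman_kernel S L" and "x \<in> S" "y \<in> S"
    for K L x y
  proof -
    have Ky: "(\<lambda>t. K t y) \<in> bergman_space S" and Lx: "(\<lambda>t. L t x) \<in> bergman_space S"
      using K L that(3,4) unfolding is_bergman_kernel_def by blast+
    have "\<forall>f\<in>bergman_space S. \<forall>u\<in>S. f u = (LINT t|lebesgue_on S. f t * cnj (L t u))"
      using L unfolding is_bergman_kernel_def by (elim conjE)
    from bspec [OF bspec [OF this Ky] \<open>x \<in> S\<close>]
    have "K x y = (LINT t|lebesgue_on S. K t y * cnj (L t x))" .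
    also have "\<dots> = (LINT t|lebesgue_on S. cnj (L t x * cnj (K t y)))"
      by (simp only: complex_cnj_mult complex_cnj_cnj mult.commute)
    also have "\<dots> = cnj (LINT t|lebesgue_on S. L t x * cnj (K t y))"
      by (rule Bochner_Integration.integral_cnj)
    also have "(LINT t|lebesgue_on S. L t x * cnj (K t y)) = L y x"
    proof -
      have "\<forall>f\<in>bergman_space S. \<forall>u\<in>S. f u = (LINT t|lebesgue_on S. f t * cnj (K t u))"
        using K unfolding is_bergman_kernel_def by (elim conjE)
      from bspec [OF bspec [OF this Lx] \<open>y \<in> S\<close>] show ?thesis by (rule sym)
    qed
    finally show ?thesis .
  qed
  have "K x y = L x y" for x y
  proof (cases "x \<in> S \<and> y \<in> S")
    case True
    then show ?thesis using herm [OF K L, of x y] herm [OF L L, of x y] by simp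
  next
    case False
    then have "K x y = 0" and "L x y = 0"
      using K L unfolding is_bergman_kernel_def by blast+
    then show ?thesis by simp
  qed
  then show ?thesis by blast
qed

definition berezin_integrand ::
    "((complex ^ 'n) \<times> complex) set \<Rightarrow> ((complex ^ 'n) \<times> complex \<Rightarrow> complex) \<Rightarrow>
     (complex ^ 'n) \<times> complex \<Rightarrow> (complex ^ 'n) \<times> complex \<Rightarrow> complex" where
  "berezin_integrand S f x y =
     complex_of_real ((norm (bergman_kernel S x y))\<^sup>2) / bergman_kernel S x x * f y"

definition berezin ::
    "((complex ^ 'n) \<times> complex) set \<Rightarrow> ((complex ^ 'n) \<times> complex \<Rightarrow> complex) \<Rightarrow>
     (complex ^ 'n) \<times> complex \<Rightarrow> complex" where
  "berezin S f x = (LINT y|lebesgue_on S. berezin_integrand S f x y)"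

text \<open>Since the library's integral of a non-integrable function is \<open>0\<close>, well-definedness of the
  operator on \<open>L\<^sup>p\<close> (absolute convergence of the integral almost everywhere) is an explicit part
  of boundedness.\<close>

definition berezin_bounded_on_Lp :: "real \<Rightarrow> ((complex ^ 'n) \<times> complex) set \<Rightarrow> bool" where
  "berezin_bounded_on_Lp p S \<longleftrightarrow>
     (\<forall>f\<in>Lp_space p S.
        (AE x in lebesgue_on S. integrable (lebesgue_on S) (berezin_integrand S f x)) \<and>
        berezin S f \<in> Lp_space p S) \<and>
     (\<exists>C. \<forall>f\<in>Lp_space p S. Lp_norm p S (berezin S f) \<le> C * Lp_norm p S f)"

end

theory Submission
  imports Defs "HOL-Complex_Analysis.Complex_Analysis"
begin

text \<open>Put \<open>Y = |w| powr (2 / m)\<close>, \<open>X = \<parallel>z\<parallel>\<^sup>2 / Y\<^sup>l\<close> and \<open>s = m + n l - 1\<close>. The domain is given by \<open>X < 1\<close>,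
  \<open>0 < Y < 1\<close>, and integrals of \<open>|\<langle>z, e\<rangle>|^(2 k) \<phi>(X) \<psi>(Y)\<close> factor into one-dimensional integrals, with
  \<open>Y^(l k + s)\<close> as the density in \<open>Y\<close>. By rotation invariance the monomials \<open>\<langle>z, e\<rangle>\<^sup>k w\<^sup>j\<close> are orthogonal, which
  gives the kernel as a double series in \<open>\<langle>z, \<xi>\<rangle>\<close> and \<open>w \<eta>\<close> (\<open>\<eta>\<close> conjugated). Grouping \<open>k\<close> by residues modulo \<open>m\<close>
  makes it a sum of \<open>m\<close> products of one-variable series.

  For \<open>p > s + 1\<close>, the \<open>L\<^sup>2\<close> norms of these products, computed by Parseval, show that
  \<open>Y powr (-b) ((1 - X) (1 - Y)) powr (-\<epsilon>)\<close> with \<open>\<epsilon> = 1 / (p - 1)\<close> and \<open>b = s \<epsilon> < 1\<close> is a test function for Schur's test.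

  For \<open>p \<le> s + 1\<close>, the function \<open>1 / (Y (1 - ln Y))\<close> is in \<open>L\<^sup>p\<close>. Since \<open>gcd m l = 1\<close>, some
  monomial \<open>h\<close> of the Bergman space has \<open>|h|\<^sup>2\<close> of constant density in \<open>Y\<close>; the kernel has a non-zero
  component along it, so the Berezin integral diverges like \<open>\<integral> dY / (Y (1 - ln Y))\<close> at almost every point.\<close>

section \<open>Lebesgue measure, isometries and radial integrals\<close>

text \<open>The threshold comes from an asymmetry of the Berezin kernel in \<open>Y\<close>. Its
  bound carries \<open>Y^(r - s)\<close> with \<open>0 \<le> r < m\<close> in the integration
  variable and no power of \<open>Y\<close> in the outer one. Testing with
  \<open>1 / ((1 - X) (1 - Y))\<close> in the outer variable therefore loses \<open>Y^(-s)\<close>.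
  Schur's argument multiplies this by the power \<open>1 - p\<close> of the test function, so that
  function needs \<open>Y powr (-b)\<close> with \<open>b (p - 1) = s\<close>; in the same way
  \<open>\<epsilon> (p - 1) = 1\<close> removes \<open>(1 - X) (1 - Y)\<close>. The other half of
  the test is an integral of \<open>Y powr (r - b)\<close> near 0, which for \<open>r = 0\<close>
  needs \<open>b < 1\<close>, that is \<open>p > s + 1\<close>.

  Zeros of the kernel cause no trouble: on the diagonal each of the \<open>m\<close> products is
  real and nonnegative, so the diagonal value dominates every one of them separately, and the
  monomial factors in the outer variable cancel.

  For small \<open>p\<close> no norms are compared: the integral defining the transform of one
  \<open>L^p\<close> function diverges wherever \<open>z\<close> is nonzero. This needs the value
  \<open>r = 0\<close>, which amounts to solving \<open>l (k + n) \<equiv> 1\<close> modulo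
  \<open>m\<close>.\<close>

lemma nn_integral_lborel_translate:
  fixes f :: "'a::euclidean_space \<Rightarrow> ennreal"
  assumes [measurable]: "f \<in> borel_measurable borel"
  shows "(\<integral>\<^sup>+x. f (x + c) \<partial>lborel) = (\<integral>\<^sup>+x. f x \<partial>lborel)"
proof -
  have "(\<integral>\<^sup>+x. f x \<partial>lborel) = (\<integral>\<^sup>+x. f x \<partial>(distr lborel borel ((+) c)))"
    by (simp add: lborel_distr_plus)
  also have "\<dots> = (\<integral>\<^sup>+x. f (c + x) \<partial>lborel)"
    by (subst nn_integral_distr) auto
  finally show ?thesis by (simp add: add.commute)
qed

text \<open>Two translation invariant measures are proportional (by Fubini for
  \<open>\<integral>\<integral> 1\<^sub>A (T x + y) 1\<^sub>B y\<close>), and the unit ball \<open>B\<close> fixes the factor.\<close>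

lemma lborel_distr_isometry:
  fixes T :: "'a::euclidean_space \<Rightarrow> 'a"
  assumes lin: "linear T" and iso: "\<And>x. norm (T x) = norm x"
  shows "distr lborel borel T = lborel"
proof (rule measure_eqI)
  show "sets (distr lborel borel T) = sets lborel" by simp
  fix A assume "A \<in> sets (distr lborel borel T)"
  then have A[measurable]: "A \<in> sets borel" by simp
  have "continuous_on UNIV T" using lin by (simp add: linear_continuous_on linear_linear)
  then have T[measurable]: "T \<in> borel_measurable borel" by (rule borel_measurable_continuous_onI)
  have inj: "inj T"
    using iso lin by (metis linear_injective_0 norm_eq_zero)
  then have surj: "surj T"
    using lin linear_injective_imp_surjective by blast
  define T' where "T' = inv T"
  have TT': "T (T' y) = y" for y unfolding T'_def by (rule surj_f_inv_f [OF surj])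
  define B where "B = (ball 0 1 :: 'a set)"
  have [measurable]: "B \<in> sets borel" by (simp add: B_def)
  have Tadd: "T (x + y) = T x + T y" and Tdiff: "T (x - y) = T x - T y" for x y
    using lin by (simp_all add: linear_add linear_diff)
  have 1: "(\<integral>\<^sup>+x. indicator A (T x) \<partial>lborel) = (\<integral>\<^sup>+x. indicator A (T x + y) \<partial>lborel)" for y
  proof -
    have "(\<integral>\<^sup>+x. indicator A (T (x + T' y)) \<partial>lborel) = (\<integral>\<^sup>+x. indicator A (T x) \<partial>lborel)"
      by (rule nn_integral_lborel_translate[where f = "\<lambda>x. indicator A (T x)"]) simp
    then show ?thesis by (simp add: Tadd TT')
  qed
  have "emeasure (distr lborel borel T) A * emeasure lborel B
      = (\<integral>\<^sup>+x. indicator A (T x) \<partial>lborel) * (\<integral>\<^sup>+y. indicator B y \<partial>lborel)"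
  proof -
    have "emeasure (distr lborel borel T) A = (\<integral>\<^sup>+x. indicator A x \<partial>(distr lborel borel T))"
      by simp
    also have "\<dots> = (\<integral>\<^sup>+x. indicator A (T x) \<partial>lborel)"
      by (subst nn_integral_distr) auto
    finally show ?thesis by simp
  qed
  also have "\<dots> = (\<integral>\<^sup>+y. (\<integral>\<^sup>+x. indicator A (T x + y) * indicator B y \<partial>lborel) \<partial>lborel)"
    by (subst nn_integral_cmult[symmetric], simp)
       (rule nn_integral_cong, subst 1, subst nn_integral_multc, simp_all)
  also have "\<dots> = (\<integral>\<^sup>+x. (\<integral>\<^sup>+y. indicator A (T x + y) * indicator B y \<partial>lborel) \<partial>lborel)"
    by (rule lborel_pair.Fubini') simp
  also have "\<dots> = (\<integral>\<^sup>+x. (\<integral>\<^sup>+y. indicator A y * indicator B (y - T x) \<partial>lborel) \<partial>lborel)"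
  proof (rule nn_integral_cong)
    fix x
    show "(\<integral>\<^sup>+y. indicator A (T x + y) * indicator B y \<partial>lborel) =
       (\<integral>\<^sup>+y. indicator A y * indicator B (y - T x) \<partial>lborel)"
      using nn_integral_lborel_translate[of "\<lambda>y. indicator A y * indicator B (y - T x)" "T x"]
      by (simp add: add.commute)
  qed
  also have "\<dots> = (\<integral>\<^sup>+y. (\<integral>\<^sup>+x. indicator A y * indicator B (y - T x) \<partial>lborel) \<partial>lborel)"
    by (rule lborel_pair.Fubini'[symmetric]) simp
  also have "\<dots> = (\<integral>\<^sup>+y. indicator A y * emeasure lborel B \<partial>lborel)"
  proof (rule nn_integral_cong)
    fix y
    \<comment> \<open>The set of all \<open>x\<close> with \<open>y - T x \<in> B\<close> is the
      unit ball around \<open>T' y\<close>, so its measure does not depend on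
      \<open>y\<close>.\<close>
    have "indicator B (y - T x) = (indicator B (x + (- T' y)) :: ennreal)" for x
    proof -
      have "norm (y - T x) = norm (T (x - T' y))" by (simp add: Tdiff TT' norm_minus_commute)
      then show ?thesis by (auto simp: B_def indicator_def iso)
    qed
    then have "(\<integral>\<^sup>+x. indicator B (y - T x) \<partial>lborel) = emeasure lborel B"
      using nn_integral_lborel_translate[of "indicator B" "- T' y"] by simp
    then show "(\<integral>\<^sup>+x. indicator A y * indicator B (y - T x) \<partial>lborel) = indicator A y * emeasure lborel B"
      by (simp add: nn_integral_cmult)
  qed
  also have "\<dots> = emeasure lborel A * emeasure lborel B"
    by (simp add: nn_integral_multc)
  finally have "emeasure (distr lborel borel T) A * emeasure lborel B = emeasure lborel A * emeasure lborel B" .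
  moreover have "emeasure lborel B \<noteq> 0"
    unfolding B_def using unit_ball_vol_pos[of "real DIM('a)"] by (simp add: emeasure_ball del: unit_ball_vol_pos)
  moreover have "emeasure lborel B \<noteq> \<infinity>"
    unfolding B_def using emeasure_lborel_ball_finite[of "0::'a" 1] by (simp add: less_top)
  ultimately show "emeasure (distr lborel borel T) A = emeasure lborel A"
    by (metis ennreal_mult_cancel_left infinity_ennreal_def mult.commute)
qed

text \<open>Polar coordinates without a measure on the sphere. The measure with density
  \<open>h\<close> is pushed forward by \<open>norm x powr \<kappa>\<close>; by scaling, the image
  gives \<open>{..<r}\<close> the mass \<open>H * r powr c\<close> with
  \<open>c = (DIM('a) + d) / \<kappa>\<close>. The measure with density
  \<open>H * c * y powr (c - 1)\<close> does the same, and half-lines form a generator stable under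
  intersection.\<close>

lemma nn_integral_radial:
  fixes h :: "'a::euclidean_space \<Rightarrow> ennreal" and d \<kappa> :: real
  assumes [measurable]: "h \<in> borel_measurable borel" "\<phi> \<in> borel_measurable borel"
    and hom: "\<And>c x. c > 0 \<Longrightarrow> h (c *\<^sub>R x) = ennreal (c powr d) * h x"
    and pos: "real DIM('a) + d > 0" "\<kappa> > 0"
    and H: "(\<integral>\<^sup>+x\<in>ball 0 1. h x \<partial>lborel) = ennreal H"
  shows "(\<integral>\<^sup>+x. h x * \<phi> (norm x powr \<kappa>) \<partial>lborel) =
    ennreal H * (\<integral>\<^sup>+y\<in>{0<..}. ennreal ((real DIM('a) + d) / \<kappa> * y powr ((real DIM('a) + d) / \<kappa> - 1)) * \<phi> y \<partial>lborel)"
proof -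
  define c where "c = (real DIM('a) + d) / \<kappa>"
  have c: "c > 0" using pos by (simp add: c_def)
  have [measurable]: "ball (0::'a) 1 \<in> sets borel" by simp
  define M1 where "M1 = distr (density lborel h) borel (\<lambda>x. norm x powr \<kappa>)"
  define M2 where "M2 = density (lborel :: real measure) (\<lambda>y. ennreal H * (ennreal (c * y powr (c - 1)) * indicator {0<..} y))"
  have e1: "emeasure M1 {..<r} = (if r > 0 then ennreal (r powr c) * ennreal H else 0)" for r
  proof -
    have "emeasure M1 {..<r} = emeasure (density lborel h) {x. norm x powr \<kappa> < r}"
      unfolding M1_def by (subst emeasure_distr) (auto intro!: arg_cong2[where f = emeasure])
    also have "\<dots> = (\<integral>\<^sup>+x. h x * indicator {x. norm x powr \<kappa> < r} x \<partial>lborel)"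
      by (subst emeasure_density) auto
    finally have *: "emeasure M1 {..<r} = (\<integral>\<^sup>+x. h x * indicator {x. norm x powr \<kappa> < r} x \<partial>lborel)" .
    show ?thesis
    proof (cases "r > 0")
      case False
      then have "{x::'a. norm x powr \<kappa> < r} = {}" using powr_ge_zero by (auto simp: not_less intro: order.trans)
      then show ?thesis using False * by simp
    next
      case True
      define R where "R = r powr (1 / \<kappa>)"
      have R: "R > 0" using True by (simp add: R_def)
      have rR: "r = R powr \<kappa>" using True pos by (simp add: R_def powr_powr)
      have iff: "norm x powr \<kappa> < r \<longleftrightarrow> norm x < R" for x :: 'a
        unfolding rR using R pos
        by (metis norm_ge_zero less_eq_real_def not_le powr_less_mono2 powr_mono2)
      have "(\<integral>\<^sup>+x. h x * indicator {x. norm x powr \<kappa> < r} x \<partial>lborel) =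
         (\<integral>\<^sup>+x. h x * indicator (ball 0 R) x \<partial>lborel)"
        by (auto intro!: nn_integral_cong simp: indicator_def iff)
      also have "\<dots> = (\<integral>\<^sup>+x. h x * indicator (ball 0 R) x \<partial>(density (distr lborel borel (\<lambda>x. 0 + R *\<^sub>R x)) (\<lambda>_. \<bar>R\<bar>^DIM('a))))"
        using lborel_affine[of R "0::'a"] R by simp
      also have "\<dots> = (\<integral>\<^sup>+x. \<bar>R\<bar>^DIM('a) * (h (R *\<^sub>R x) * indicator (ball 0 R) (R *\<^sub>R x)) \<partial>lborel)"
      proof -
        have [measurable]: "ball (0::'a) R \<in> sets borel" by simp
        have [measurable]: "(\<lambda>x. h x * indicator (ball 0 R) x) \<in> borel_measurable borel" by measurable
        have "(\<integral>\<^sup>+x. h x * indicator (ball 0 R) x \<partial>(density (distr lborel borel (\<lambda>x. 0 + R *\<^sub>R x)) (\<lambda>_. \<bar>R\<bar>^DIM('a))))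
          = (\<integral>\<^sup>+x. \<bar>R\<bar>^DIM('a) * (h x * indicator (ball 0 R) x) \<partial>(distr lborel borel (\<lambda>x. 0 + R *\<^sub>R x)))"
          by (rule nn_integral_density) simp_all
        also have "\<dots> = (\<integral>\<^sup>+x. \<bar>R\<bar>^DIM('a) * (h (0 + R *\<^sub>R x) * indicator (ball 0 R) (0 + R *\<^sub>R x)) \<partial>lborel)"
          by (rule nn_integral_distr) simp_all
        finally show ?thesis by simp
      qed
      also have "\<dots> = (\<integral>\<^sup>+x. (\<bar>R\<bar>^DIM('a) * ennreal (R powr d)) * (h x * indicator (ball 0 1) x) \<partial>lborel)"
        using R by (intro nn_integral_cong) (auto simp: hom indicator_def mult_ac)
      also have "\<dots> = (\<bar>R\<bar>^DIM('a) * ennreal (R powr d)) * ennreal H"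
        by (subst nn_integral_cmult) (measurable, simp add: H)
      also have "ennreal (\<bar>R\<bar>^DIM('a)) * ennreal (R powr d) = ennreal (R powr (DIM('a) + d))"
        using R by (simp add: powr_add powr_realpow ennreal_mult)
      also have "R powr (DIM('a) + d) = r powr c"
        using pos by (simp add: R_def powr_powr c_def)
      finally show ?thesis using * True by simp
    qed
  qed
  have e2: "emeasure M2 {..<r} = (if r > 0 then ennreal (r powr c) * ennreal H else 0)" for r
  proof -
    have *: "emeasure M2 {..<r} = ennreal H * (\<integral>\<^sup>+y. ennreal (c * y powr (c - 1)) * indicator {0<..} y * indicator {..<r} y \<partial>lborel)"
      unfolding M2_def by (subst emeasure_density, simp, simp)
        (simp add: mult.assoc nn_integral_cmult[symmetric])
    show ?thesis
    proof (cases "r > 0")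
      case False
      then have "(\<integral>\<^sup>+y. ennreal (c * y powr (c - 1)) * indicator {0<..} y * indicator {..<r} y \<partial>lborel) = (\<integral>\<^sup>+y. 0 \<partial>(lborel::real measure))"
        by (intro nn_integral_cong) (auto simp: indicator_def)
      then show ?thesis using False * by simp
    next
      case True
      have "((\<lambda>y. y powr (c - 1)) has_integral (r powr (c - 1 + 1) / (c - 1 + 1))) {0..r}"
        using True c by (intro has_integral_powr_from_0) auto
      then have "((\<lambda>y. c * y powr (c - 1)) has_integral (c * (r powr c / c))) {0..r}"
        by (intro has_integral_mult_right) simp
      then have "((\<lambda>y. c * y powr (c - 1)) has_integral r powr c) {0..r}"
        using c by simp
      then have "(\<integral>\<^sup>+y. ennreal (c * y powr (c - 1)) * indicator {0..r} y \<partial>lborel) = ennreal (r powr c)"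
        using c by (intro nn_integral_has_integral_lebesgue') auto
      moreover have "(\<integral>\<^sup>+y. ennreal (c * y powr (c - 1)) * indicator {0..r} y \<partial>lborel) =
        (\<integral>\<^sup>+y. ennreal (c * y powr (c - 1)) * indicator {0<..} y * indicator {..<r} y \<partial>lborel)"
        using AE_lborel_singleton[of 0] AE_lborel_singleton[of r]
        by (intro nn_integral_cong_AE, eventually_elim) (auto simp: indicator_def)
      ultimately show ?thesis using True * by (simp add: mult.commute)
    qed
  qed
  have eq: "M1 = M2"
  proof (rule measure_eqI_generator_eq[where E = "range lessThan" and A = "\<lambda>i. {..<real i}" and \<Omega> = UNIV])
    show "Int_stable (range (lessThan :: real \<Rightarrow> _))"
    proof -
      have "{..<a} \<inter> {..<b} = {..<min a b}" for a b :: real by auto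
      then show ?thesis by (auto simp: Int_stable_def)
    qed
    show "sets M1 = sigma_sets UNIV (range lessThan)" "sets M2 = sigma_sets UNIV (range lessThan)"
      unfolding M1_def M2_def by (simp_all add: borel_Iio)
    show "emeasure M1 X = emeasure M2 X" if "X \<in> range lessThan" for X
      using that e1 e2 by auto
    show "(\<Union>i. {..<real i}) = UNIV" by (auto intro: reals_Archimedean2)
    show "emeasure M1 {..<real i} \<noteq> \<infinity>" for i
      by (simp add: e1 ennreal_mult_eq_top_iff)
  qed auto
  have "(\<integral>\<^sup>+x. h x * \<phi> (norm x powr \<kappa>) \<partial>lborel) = (\<integral>\<^sup>+y. \<phi> y \<partial>M1)"
    unfolding M1_def by (subst nn_integral_distr, simp, simp, subst nn_integral_density) auto
  also have "\<dots> = (\<integral>\<^sup>+y. ennreal H * (ennreal (c * y powr (c - 1)) * \<phi> y * indicator {0<..} y) \<partial>lborel)"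
    unfolding eq M2_def by (subst nn_integral_density) (auto intro!: nn_integral_cong simp: mult_ac)
  also have "\<dots> = ennreal H * (\<integral>\<^sup>+y. ennreal (c * y powr (c - 1)) * \<phi> y * indicator {0<..} y \<partial>lborel)"
    by (rule nn_integral_cmult) simp
  finally show ?thesis by (simp add: c_def)
qed

section \<open>Lebesgue measure on vectors as a product, Gaussian moments\<close>

lemma vec_lambda_measurable_PiM:
  "(\<lambda>f. \<chi> i. f i :: 'a::euclidean_space ^ 'n::finite) \<in> measurable (Pi\<^sub>M UNIV (\<lambda>_. lborel)) borel"
proof (rule borel_measurableI)
  fix S :: "('a ^ 'n) set" assume "open S"
  have "continuous_on UNIV (\<lambda>f. \<chi> i. f i :: 'a ^ 'n)"
    by (intro continuous_on_vec_lambda continuous_on_product_coordinates)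
  then have "open ((\<lambda>f. \<chi> i. f i :: 'a ^ 'n) -` S)"
    using \<open>open S\<close> by (simp add: open_vimage)
  then have "(\<lambda>f. \<chi> i. f i :: 'a ^ 'n) -` S \<in> sets (borel :: ('n \<Rightarrow> 'a) measure)" by simp
  also have "sets (borel :: ('n \<Rightarrow> 'a) measure) = sets (Pi\<^sub>M UNIV (\<lambda>_. borel))"
    by (rule sets_PiM_equal_borel[symmetric])
  also have "\<dots> = sets (Pi\<^sub>M UNIV (\<lambda>_. lborel :: 'a measure))"
    by (intro sets_PiM_cong) auto
  finally show "(\<lambda>f. \<chi> i. f i :: 'a ^ 'n) -` S \<inter> space (Pi\<^sub>M UNIV (\<lambda>_. lborel :: 'a measure)) \<in> sets (Pi\<^sub>M UNIV (\<lambda>_. lborel :: 'a measure))"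
    by (simp add: space_PiM)
qed

text \<open>Gaussian integrals are to be split over the coordinates of a vector. A measure with the
  right value on every box is Lebesgue measure, and a box in the vector space is a product of
  boxes.\<close>

lemma lborel_vec_eq_PiM:
  "distr (Pi\<^sub>M (UNIV::'n::finite set) (\<lambda>_. lborel :: 'a::euclidean_space measure)) borel (\<lambda>f. \<chi> i. f i)
    = (lborel :: ('a ^ 'n) measure)"
proof (rule lborel_eqI[symmetric])
  interpret product_sigma_finite "\<lambda>_::'n. lborel :: 'a measure" ..
  show "sets (distr (Pi\<^sub>M (UNIV::'n set) (\<lambda>_. lborel :: 'a measure)) borel (\<lambda>f. \<chi> i. f i)) = sets borel"
    by simp
  fix L U :: "'a ^ 'n"
  assume le: "\<And>b. b \<in> Basis \<Longrightarrow> L \<bullet> b \<le> U \<bullet> b"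
  have le': "(L $ i) \<bullet> b \<le> (U $ i) \<bullet> b" if "b \<in> Basis" for i b
    using le[of "axis i b"] that by (simp add: inner_axis axis_in_Basis_iff)
  have box: "(\<lambda>f. \<chi> i. f i) -` box L U \<inter> space (Pi\<^sub>M UNIV (\<lambda>_. lborel :: 'a measure)) =
      Pi\<^sub>E UNIV (\<lambda>i. box (L $ i) (U $ i))"
    by (auto simp: space_PiM box_def Basis_vec_def inner_axis)
  have "emeasure (distr (Pi\<^sub>M UNIV (\<lambda>_. lborel :: 'a measure)) borel (\<lambda>f. \<chi> i. f i)) (box L U)
      = emeasure (Pi\<^sub>M UNIV (\<lambda>_. lborel :: 'a measure)) (Pi\<^sub>E UNIV (\<lambda>i. box (L $ i) (U $ i)))"
    by (subst emeasure_distr[OF vec_lambda_measurable_PiM]) (simp_all add: box)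
  also have "\<dots> = (\<Prod>i\<in>UNIV. emeasure lborel (box (L $ i) (U $ i)))"
    by (rule emeasure_PiM) auto
  also have "\<dots> = (\<Prod>i\<in>UNIV. ennreal (\<Prod>b\<in>Basis. (U $ i - L $ i) \<bullet> b))"
    using le' by (intro prod.cong refl) (simp add: emeasure_lborel_box)
  also have "\<dots> = ennreal (\<Prod>i\<in>UNIV. \<Prod>b\<in>Basis. (U $ i - L $ i) \<bullet> b)"
    using le' by (intro prod_ennreal prod_nonneg) (auto simp: inner_diff_left)
  also have "(\<Prod>i\<in>UNIV. \<Prod>b\<in>Basis. (U $ i - L $ i) \<bullet> b) = (\<Prod>b\<in>Basis. (U - L) \<bullet> b)"
  proof -
    have "(\<Prod>i\<in>UNIV. \<Prod>b\<in>Basis. (U $ i - L $ i) \<bullet> b) = (\<Prod>(i,b)\<in>UNIV \<times> Basis. (U $ i - L $ i) \<bullet> b)"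
      by (rule prod.cartesian_product)
    also have "\<dots> = (\<Prod>b\<in>Basis. (U - L) \<bullet> b)"
      by (rule prod.reindex_bij_betw[symmetric, where h = "\<lambda>(i,b). axis i b", THEN trans, OF _ refl, symmetric] |
          rule prod.reindex_cong[symmetric, where l = "\<lambda>(i,b). axis i b"])
         (auto simp: inj_on_def axis_eq_axis Basis_vec_def inner_axis nonzero_Basis)
    finally show ?thesis .
  qed
  finally show "emeasure (distr (Pi\<^sub>M UNIV (\<lambda>_. lborel :: 'a measure)) borel (\<lambda>f. \<chi> i. f i)) (box L U)
    = ennreal (\<Prod>b\<in>Basis. (U - L) \<bullet> b)" .
qed

lemma vec_nth_measurable [measurable (raw)]:
  fixes f :: "'b \<Rightarrow> 'a::euclidean_space ^ 'n::finite"
  assumes "f \<in> borel_measurable M"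
  shows "(\<lambda>x. f x $ i) \<in> borel_measurable M"
proof -
  have "(\<lambda>x :: 'a ^ 'n. x $ i) \<in> borel_measurable borel"
    by (intro borel_measurable_continuous_onI continuous_intros)
  from measurable_compose[OF assms this] show ?thesis .
qed

lemma nn_integral_vec_prod:
  fixes f :: "'n::finite \<Rightarrow> 'a::euclidean_space \<Rightarrow> ennreal"
  assumes [measurable]: "\<And>i. f i \<in> borel_measurable borel"
  shows "(\<integral>\<^sup>+x. (\<Prod>i\<in>UNIV. f i (x $ i)) \<partial>lborel) = (\<Prod>i\<in>UNIV. \<integral>\<^sup>+x. f i x \<partial>lborel)"
proof -
  interpret product_sigma_finite "\<lambda>_::'n. lborel :: 'a measure" ..
  have "(\<integral>\<^sup>+x. (\<Prod>i\<in>UNIV. f i (x $ i)) \<partial>lborel) =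
      (\<integral>\<^sup>+x. (\<Prod>i\<in>UNIV. f i (x $ i)) \<partial>(distr (Pi\<^sub>M (UNIV::'n set) (\<lambda>_. lborel)) borel (\<lambda>f. \<chi> i. f i)))"
    by (simp add: lborel_vec_eq_PiM)
  also have "\<dots> = (\<integral>\<^sup>+x. (\<Prod>i\<in>UNIV. f i (x i)) \<partial>(Pi\<^sub>M (UNIV::'n set) (\<lambda>_. lborel)))"
    by (subst nn_integral_distr[OF vec_lambda_measurable_PiM]) auto
  also have "\<dots> = (\<Prod>i\<in>UNIV. \<integral>\<^sup>+x. f i x \<partial>lborel)"
    by (rule product_nn_integral_prod) auto
  finally show ?thesis .
qed

lemma nn_integral_power_exp:
  "(\<integral>\<^sup>+y\<in>{0<..}. ennreal (y powr real k) * ennreal (exp (- y)) \<partial>lborel) = ennreal (fact k)"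
proof -
  have "ennreal (fact k) = (\<integral>\<^sup>+ t. ennreal (indicator {0..} t * t powr (real (Suc k) - 1) / exp t) \<partial>lborel)"
    using Gamma_conv_nn_integral_real[of "real (Suc k)"] Gamma_fact[of k, where 'a = real] by (simp add: add.commute)
  also have "\<dots> = (\<integral>\<^sup>+y\<in>{0<..}. ennreal (y powr real k) * ennreal (exp (- y)) \<partial>lborel)"
    using AE_lborel_singleton[of 0]
    by (intro nn_integral_cong_AE, eventually_elim)
       (auto simp: indicator_def exp_minus field_simps ennreal_mult[symmetric])
  finally show ?thesis by simp
qed

lemma emeasure_unit_disc: "emeasure lborel (ball (0::complex) 1) = ennreal pi"
  using unit_ball_vol_2 by (simp add: emeasure_ball)

lemma nn_integral_complex_radial:
  assumes [measurable]: "\<phi> \<in> borel_measurable borel" and "\<kappa> > 0"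
  shows "(\<integral>\<^sup>+w. \<phi> (norm (w::complex) powr \<kappa>) \<partial>lborel) =
    ennreal (2 * pi / \<kappa>) * (\<integral>\<^sup>+y\<in>{0<..}. ennreal (y powr (2 / \<kappa> - 1)) * \<phi> y \<partial>lborel)"
proof -
  have "(\<integral>\<^sup>+w. 1 * \<phi> (norm (w::complex) powr \<kappa>) \<partial>lborel) =
    ennreal pi * (\<integral>\<^sup>+y\<in>{0<..}. ennreal ((real DIM(complex) + 0) / \<kappa> * y powr ((real DIM(complex) + 0) / \<kappa> - 1)) * \<phi> y \<partial>lborel)"
    using assms emeasure_unit_disc by (intro nn_integral_radial) auto
  also have "\<dots> = ennreal pi * (\<integral>\<^sup>+y. ennreal (2 / \<kappa>) * (ennreal (y powr (2 / \<kappa> - 1)) * \<phi> y * indicator {0<..} y) \<partial>lborel)"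
  proof (rule arg_cong2[where f = "(*)", OF refl], rule nn_integral_cong)
    fix y :: real
    have "ennreal ((real DIM(complex) + 0) / \<kappa> * y powr ((real DIM(complex) + 0) / \<kappa> - 1)) = ennreal (2 / \<kappa>) * ennreal (y powr (2 / \<kappa> - 1))"
      using assms(2) by (subst ennreal_mult[symmetric]) auto
    then show "ennreal ((real DIM(complex) + 0) / \<kappa> * y powr ((real DIM(complex) + 0) / \<kappa> - 1)) * \<phi> y * indicator {0<..} y =
      ennreal (2 / \<kappa>) * (ennreal (y powr (2 / \<kappa> - 1)) * \<phi> y * indicator {0<..} y)"
      by (simp only: mult.assoc)
  qed
  also have "\<dots> = ennreal (2 * pi / \<kappa>) * (\<integral>\<^sup>+y\<in>{0<..}. ennreal (y powr (2 / \<kappa> - 1)) * \<phi> y \<partial>lborel)"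
  proof -
    have "ennreal (2 * pi / \<kappa>) = ennreal pi * ennreal (2 / \<kappa>)"
      using assms(2) by (subst ennreal_mult[symmetric]) auto
    then show ?thesis
      by (simp only: mult.assoc, subst nn_integral_cmult) simp_all
  qed
  finally show ?thesis by simp
qed

lemma gaussian_moment_complex:
  "(\<integral>\<^sup>+w. ennreal (norm (w::complex) ^ (2 * k) * exp (- (norm w)\<^sup>2)) \<partial>lborel) = ennreal (pi * fact k)"
proof -
  have "(\<integral>\<^sup>+w. ennreal (norm (w::complex) ^ (2 * k) * exp (- (norm w)\<^sup>2)) \<partial>lborel) =
     (\<integral>\<^sup>+w. (\<lambda>y. ennreal (y ^ k * exp (- y))) (norm (w::complex) powr 2) \<partial>lborel)"
    by (simp add: power_mult)
  also have "\<dots> = ennreal pi * (\<integral>\<^sup>+y\<in>{0<..}. ennreal (y powr 0) * ennreal (y ^ k * exp (- y)) \<partial>lborel)"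
    by (subst nn_integral_complex_radial) auto
  also have "(\<integral>\<^sup>+y\<in>{0<..}. ennreal (y powr 0) * ennreal (y ^ k * exp (- y)) \<partial>lborel) =
     (\<integral>\<^sup>+y\<in>{0<..}. ennreal (y powr real k) * ennreal (exp (- y)) \<partial>lborel)"
    by (intro nn_integral_cong) (auto simp: indicator_def powr_realpow ennreal_mult)
  finally show ?thesis by (simp add: nn_integral_power_exp ennreal_mult')
qed

lemma norm_vec_complex_sq: "(norm (z :: complex ^ 'n))\<^sup>2 = (\<Sum>i\<in>UNIV. (norm (z $ i))\<^sup>2)"
  unfolding norm_vec_def L2_set_def by (simp add: sum_nonneg)

lemma gaussian_moment_vec:
  fixes i0 :: "'n::finite"
  shows "(\<integral>\<^sup>+z. ennreal (norm ((z :: complex ^ 'n) $ i0) ^ (2 * k) * exp (- (norm z)\<^sup>2)) \<partial>lborel)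
    = ennreal (pi ^ CARD('n) * fact k)"
proof -
  define f where "f = (\<lambda>i (w::complex). ennreal ((if i = i0 then norm w ^ (2 * k) else 1) * exp (- (norm w)\<^sup>2)))"
  have "ennreal (norm ((z :: complex ^ 'n) $ i0) ^ (2 * k) * exp (- (norm z)\<^sup>2)) = (\<Prod>i\<in>UNIV. f i (z $ i))" for z
  proof -
    have "(\<Prod>i\<in>UNIV. f i (z $ i)) = ennreal (\<Prod>i\<in>UNIV. (if i = i0 then norm (z $ i) ^ (2 * k) else 1) * exp (- (norm (z $ i))\<^sup>2))"
      unfolding f_def by (intro prod_ennreal) auto
    also have "(\<Prod>i\<in>UNIV. (if i = i0 then norm (z $ i) ^ (2 * k) else 1) * exp (- (norm (z $ i))\<^sup>2)) =
       norm (z $ i0) ^ (2 * k) * exp (- (norm z)\<^sup>2)"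
      by (simp add: prod.distrib norm_vec_complex_sq exp_sum sum_negf[symmetric])
    finally show ?thesis by simp
  qed
  then have "(\<integral>\<^sup>+z. ennreal (norm ((z :: complex ^ 'n) $ i0) ^ (2 * k) * exp (- (norm z)\<^sup>2)) \<partial>lborel) =
     (\<Prod>i\<in>UNIV. \<integral>\<^sup>+w. f i w \<partial>lborel)"
    by (simp, subst nn_integral_vec_prod) (auto simp: f_def)
  also have "\<dots> = (\<Prod>i\<in>UNIV. ennreal (pi * (if i = i0 then fact k else 1)))"
    using gaussian_moment_complex[of k] gaussian_moment_complex[of 0]
    by (intro prod.cong refl) (auto simp: f_def)
  also have "\<dots> = ennreal (\<Prod>i\<in>UNIV. pi * (if i = i0 then fact k else 1))"
    by (intro prod_ennreal) auto
  also have "(\<Prod>i\<in>UNIV. pi * (if i = i0 then fact k else 1)) = pi ^ CARD('n) * fact k"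
    by (simp add: prod.distrib)
  finally show ?thesis .
qed

text \<open>Radial integration gives the formula up to the unknown constant \<open>H\<close>, the
  integral of \<open>h\<close> over the unit ball. Since \<open>H\<close> does not depend on
  \<open>\<phi>\<close>, it can be read off from the single choice \<open>exp (- y)\<close>, for
  which the left side splits over the coordinates.\<close>

lemma nn_integral_coordinate_power:
  fixes i0 :: "'n::finite"
  assumes [measurable]: "\<phi> \<in> borel_measurable borel"
  shows "(\<integral>\<^sup>+z. ennreal (norm ((z :: complex ^ 'n) $ i0) ^ (2 * k)) * \<phi> ((norm z)\<^sup>2) \<partial>lborel)
    = ennreal (pi ^ CARD('n) * fact k / fact (CARD('n) + k - 1)) *
      (\<integral>\<^sup>+y\<in>{0<..}. ennreal (y ^ (CARD('n) + k - 1)) * \<phi> y \<partial>lborel)"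
proof -
  define n where "n = CARD('n)"
  have n: "n > 0" by (simp add: n_def)
  define h where "h = (\<lambda>z :: complex ^ 'n. ennreal (norm (z $ i0) ^ (2 * k)))"
  have [measurable]: "h \<in> borel_measurable borel" unfolding h_def by measurable
  have hom: "h (c *\<^sub>R z) = ennreal (c powr (real (2 * k))) * h z" if "c > 0" for c z
    using that by (simp add: h_def power_mult_distrib ennreal_mult'[symmetric] powr_realpow del: of_nat_mult)
  have "(\<integral>\<^sup>+x\<in>ball 0 1. h x \<partial>lborel) \<le> (\<integral>\<^sup>+x. indicator (ball (0 :: complex ^ 'n) 1) x \<partial>lborel)"
  proof (rule nn_integral_mono)
    fix x :: "complex ^ 'n"
    show "h x * indicator (ball 0 1) x \<le> indicator (ball 0 1) x"
    proof (cases "x \<in> ball 0 1")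
      case True
      then have "norm (x $ i0) \<le> 1" using component_le_norm_cart Finite_Cartesian_Product.norm_nth_le[of x i0] by simp
      then show ?thesis by (auto simp: h_def power_le_one indicator_def)
    qed auto
  qed
  also have "\<dots> < \<infinity>" using emeasure_lborel_ball_finite by simp
  finally obtain H where H: "(\<integral>\<^sup>+x\<in>ball 0 1. h x \<partial>lborel) = ennreal H" "H \<ge> 0"
    by (cases "(\<integral>\<^sup>+x\<in>ball 0 1. h x \<partial>lborel)") auto
  have rad: "(\<integral>\<^sup>+z. h z * \<psi> ((norm z)\<^sup>2) \<partial>lborel) = ennreal (H * real (n + k)) *
      (\<integral>\<^sup>+y\<in>{0<..}. ennreal (y ^ (n + k - 1)) * \<psi> y \<partial>lborel)"
    if [measurable]: "\<psi> \<in> borel_measurable borel" for \<psi> :: "real \<Rightarrow> ennreal"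
  proof -
    have dim: "(real DIM(complex ^ 'n) + real (2 * k)) / 2 = real (n + k)" by (simp add: n_def)
    have "(\<integral>\<^sup>+z. h z * \<psi> ((norm z)\<^sup>2) \<partial>lborel) = (\<integral>\<^sup>+z. h z * \<psi> (norm z powr 2) \<partial>lborel)"
      by simp
    also have "\<dots> = ennreal H * (\<integral>\<^sup>+y\<in>{0<..}. ennreal ((real DIM(complex ^ 'n) + real (2 * k)) / 2 * y powr ((real DIM(complex ^ 'n) + real (2 * k)) / 2 - 1)) * \<psi> y \<partial>lborel)"
      using hom H n by (intro nn_integral_radial) (auto simp: n_def add_pos_nonneg)
    also have "\<dots> = ennreal H * (\<integral>\<^sup>+y. ennreal (real (n + k)) * (ennreal (y ^ (n + k - 1)) * \<psi> y * indicator {0<..} y) \<partial>lborel)"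
      unfolding dim
    proof (rule arg_cong2[where f = "(*)", OF refl], rule nn_integral_cong)
      fix y :: real
      have "ennreal (real (n + k) * y powr (real (n + k) - 1)) = ennreal (real (n + k)) * ennreal (y ^ (n + k - 1))" if "y > 0"
        using that n by (subst ennreal_mult[symmetric]) (auto simp: powr_realpow[symmetric] of_nat_diff)
      then show "ennreal (real (n + k) * y powr (real (n + k) - 1)) * \<psi> y * indicator {0<..} y =
         ennreal (real (n + k)) * (ennreal (y ^ (n + k - 1)) * \<psi> y * indicator {0<..} y)"
        by (cases "y > 0") (simp_all add: mult.assoc)
    qed
    also have "\<dots> = ennreal (H * real (n + k)) * (\<integral>\<^sup>+y\<in>{0<..}. ennreal (y ^ (n + k - 1)) * \<psi> y \<partial>lborel)"
      using H(2) by (subst nn_integral_cmult) (simp_all add: mult.assoc ennreal_mult)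
    finally show ?thesis .
  qed
  have "ennreal (pi ^ n * fact k) = (\<integral>\<^sup>+z. h z * ennreal (exp (- (norm z)\<^sup>2)) \<partial>lborel)"
    unfolding n_def h_def by (subst gaussian_moment_vec[of i0 k, symmetric]) (simp add: ennreal_mult)
  also have "\<dots> = ennreal (H * real (n + k)) * (\<integral>\<^sup>+y\<in>{0<..}. ennreal (y ^ (n + k - 1)) * ennreal (exp (- y)) \<partial>lborel)"
    by (rule rad) simp
  also have "(\<integral>\<^sup>+y\<in>{0<..}. ennreal (y ^ (n + k - 1)) * ennreal (exp (- y)) \<partial>lborel) = ennreal (fact (n + k - 1))"
    by (subst nn_integral_power_exp[symmetric])
       (intro nn_integral_cong, auto simp: indicator_def powr_realpow)
  finally have "ennreal (pi ^ n * fact k) = ennreal (H * real (n + k) * fact (n + k - 1))"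
    using H(2) by (simp add: ennreal_mult)
  then have "pi ^ n * fact k = H * real (n + k) * fact (n + k - 1)"
    using H(2) by (subst (asm) ennreal_inj) auto
  then have "H * real (n + k) = pi ^ n * fact k / fact (n + k - 1)"
    by (simp add: field_simps)
  then show ?thesis using rad[of \<phi>] by (simp add: h_def n_def)
qed

section \<open>The Hermitian inner product and unitary invariance\<close>

definition herm :: "complex ^ 'n \<Rightarrow> complex ^ 'n \<Rightarrow> complex" where
  "herm x y = (\<Sum>i\<in>UNIV. x $ i * cnj (y $ i))"

lemma herm_add_left: "herm (x + y) z = herm x z + herm y z"
  and herm_diff_left: "herm (x - y) z = herm x z - herm y z"
  and herm_scale_left: "herm (c *s x) z = c * herm x z"
  and herm_add_right: "herm z (x + y) = herm z x + herm z y"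
  and herm_diff_right: "herm z (x - y) = herm z x - herm z y"
  and herm_scale_right: "herm z (c *s x) = cnj c * herm z x"
  by (simp_all add: herm_def algebra_simps sum.distrib sum_subtractf sum_distrib_left)

lemma scaleR_eq_scale_vec: "r *\<^sub>R (x :: complex ^ 'n) = complex_of_real r *s x"
  by (simp add: vec_eq_iff scaleR_conv_of_real[where 'a = complex])

lemma herm_zero [simp]: "herm 0 z = 0" "herm z 0 = 0"
  by (simp_all add: herm_def)

lemma cnj_herm: "cnj (herm x y) = herm y x"
  by (simp add: herm_def mult.commute)

lemma herm_self: "herm x x = complex_of_real ((norm x)\<^sup>2)"
  by (simp add: herm_def norm_vec_complex_sq complex_norm_square[symmetric])

lemma norm_scale_vec: "norm (c *s (x :: complex ^ 'n)) = norm c * norm x"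
proof -
  have "(norm (c *s x))\<^sup>2 = (norm c * norm x)\<^sup>2"
    by (simp add: norm_vec_complex_sq norm_mult power_mult_distrib sum_distrib_left)
  then show ?thesis by (simp add: power2_eq_iff_nonneg)
qed

lemma continuous_on_herm [continuous_intros]:
  "continuous_on S f \<Longrightarrow> continuous_on S g \<Longrightarrow> continuous_on S (\<lambda>x. herm (f x) (g x))"
  unfolding herm_def by (intro continuous_intros)

lemma norm_herm_le: "norm (herm x y) \<le> norm x * norm y"
proof (cases "y = 0")
  case False
  define c where "c = herm x y / herm y y"
  have h: "herm y y \<noteq> 0" using False by (simp add: herm_self)
  have "herm (x - c *s y) (x - c *s y) = herm x x - herm x y * cnj (herm x y) / herm y y"
    using h by (simp add: herm_diff_left herm_diff_right herm_scale_left herm_scale_right c_def cnj_herm field_simps)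
  then have "complex_of_real ((norm (x - c *s y))\<^sup>2) = complex_of_real ((norm x)\<^sup>2 - (norm (herm x y))\<^sup>2 / (norm y)\<^sup>2)"
    by (simp only: herm_self complex_norm_square[symmetric] of_real_diff of_real_divide)
  then have "(norm x)\<^sup>2 - (norm (herm x y))\<^sup>2 / (norm y)\<^sup>2 \<ge> 0"
    by (metis of_real_eq_iff zero_le_power2)
  then have "(norm (herm x y))\<^sup>2 \<le> (norm x * norm y)\<^sup>2"
    using False by (simp add: field_simps power_mult_distrib)
  then show ?thesis by (rule power2_le_imp_le) simp
qed simp

lemma linear_borel_measurable:
  fixes T :: "'a::euclidean_space \<Rightarrow> 'b::euclidean_space"
  assumes "linear T"
  shows "T \<in> borel_measurable borel"
proof -
  have "continuous_on UNIV T" using assms by (simp add: linear_continuous_on linear_linear)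
  then show ?thesis by (rule borel_measurable_continuous_onI)
qed

text \<open>\<open>U\<close> is the Householder reflection in \<open>v = a - f\<close>, with
  \<open>a\<close> a coordinate vector and \<open>f\<close> a unimodular multiple of
  \<open>e\<close>. The phase \<open>c\<close> makes the inner product of \<open>a\<close> and
  \<open>f\<close> real; only then does the reflection exchange the two. If \<open>a = f\<close>,
  then \<open>N = 0\<close>, the quotient in \<open>U\<close> is 0 by convention and
  \<open>U\<close> is the identity.\<close>

lemma exists_unitary:
  fixes e :: "complex ^ 'n" and i0 :: 'n
  assumes "norm e = 1"
  obtains U :: "complex ^ 'n \<Rightarrow> complex ^ 'n" where "linear U" "\<And>z. norm (U z) = norm z" "\<And>z. norm (herm (U z) e) = norm (z $ i0)"
proof -
  define c where "c = (if e $ i0 = 0 then 1 else cnj (e $ i0) / norm (e $ i0))"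
  have c: "norm c = 1" by (simp add: c_def norm_divide)
  define f where "f = c *s e"
  define a :: "complex ^ 'n" where "a = axis i0 1"
  have herm_a: "herm z a = z $ i0" for z
    by (simp add: herm_def a_def axis_def if_distrib cong: if_cong)
  have fr: "f $ i0 = complex_of_real (norm (e $ i0))"
    by (simp add: f_def c_def complex_norm_square[symmetric] power2_eq_square mult.commute[of "cnj _"])
  have ff: "herm f f = 1" using assms c by (simp add: herm_self f_def norm_scale_vec)
  have aa: "herm a a = 1" by (simp add: herm_a) (simp add: a_def)
  have fa: "herm f a = herm a f" "herm a f = complex_of_real (norm (e $ i0))"
  proof -
    have "herm f a = complex_of_real (norm (e $ i0))" by (simp add: herm_a fr)
    moreover have "herm a f = cnj (herm f a)" by (simp add: cnj_herm)
    ultimately show "herm f a = herm a f" "herm a f = complex_of_real (norm (e $ i0))" by simp_all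
  qed
  define v where "v = a - f"
  define N where "N = herm v v"
  have N: "N = 2 - 2 * herm a f"
    using ff aa fa(1) by (simp add: N_def v_def herm_diff_left herm_diff_right)
  define U where "U z = z - (2 * herm z v / N) *s v" for z
  have cN: "cnj N = N" by (simp add: N_def cnj_herm)
  have herm_U: "herm (U z) x = herm z (U x)" for z x
    by (simp add: U_def herm_diff_left herm_diff_right herm_scale_left herm_scale_right cnj_herm cN)
  have UU: "U (U z) = z" for z
  proof (cases "N = 0")
    case False
    then have "herm (U z) v = - herm z v"
      by (simp add: U_def herm_diff_left herm_scale_left flip: N_def)
    then have "U (U z) = U z + (2 * herm z v / N) *s v"
      unfolding U_def[of "U z"] by (simp add: vec_eq_iff)
    then show ?thesis by (simp add: U_def)
  qed (simp add: U_def)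
  have Uf: "U f = a"
  proof (cases "N = 0")
    case True
    then have "v = 0" by (simp add: N_def herm_self)
    then show ?thesis using True by (simp add: U_def v_def)
  next
    case False
    have "herm f v = - N / 2" using ff fa by (simp add: v_def herm_diff_right N)
    then have "U f = f + v" using False by (simp add: U_def vec_eq_iff)
    then show ?thesis by (simp add: v_def)
  qed
  have "linear U"
  proof (rule linearI)
    show "U (x + y) = U x + U y" for x y
      by (simp add: U_def herm_add_left vec_eq_iff algebra_simps add_divide_distrib)
    show "U (r *\<^sub>R x) = r *\<^sub>R U x" for r x
      by (simp add: scaleR_eq_scale_vec U_def herm_scale_left vec_eq_iff algebra_simps)
  qed
  moreover have "norm (U z) = norm z" for z
  proof -
    have "complex_of_real ((norm (U z))\<^sup>2) = complex_of_real ((norm z)\<^sup>2)"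
      unfolding herm_self[symmetric] by (simp add: herm_U UU)
    then have "(norm (U z))\<^sup>2 = (norm z)\<^sup>2" by (simp only: of_real_eq_iff)
    then show ?thesis by (simp add: power2_eq_iff_nonneg)
  qed
  moreover have "norm (herm (U z) e) = norm (z $ i0)" for z
  proof -
    have "herm (U z) f = z $ i0" by (simp add: herm_U Uf herm_a)
    then show ?thesis using c by (simp add: f_def herm_scale_right norm_mult) (metis complex_mod_cnj mult_1 norm_mult)
  qed
  ultimately show ?thesis by (rule that)
qed

lemma herm_measurable [measurable]:
  "f \<in> borel_measurable M \<Longrightarrow> g \<in> borel_measurable M \<Longrightarrow> (\<lambda>x. herm (f x) (g x)) \<in> borel_measurable M"
  by (rule borel_measurable_continuous_Pair) (auto intro!: continuous_intros)

lemma nn_integral_herm_power: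
  fixes e :: "complex ^ 'n"
  assumes [measurable]: "\<phi> \<in> borel_measurable borel" and e: "norm e = 1"
  shows "(\<integral>\<^sup>+z. ennreal (norm (herm z e) ^ (2 * k)) * \<phi> ((norm z)\<^sup>2) \<partial>lborel)
    = ennreal (pi ^ CARD('n) * fact k / fact (CARD('n) + k - 1)) *
      (\<integral>\<^sup>+y\<in>{0<..}. ennreal (y ^ (CARD('n) + k - 1)) * \<phi> y \<partial>lborel)"
proof -
  \<comment> \<open>This only fixes an arbitrary coordinate onto which \<open>e\<close> is
    rotated.\<close>
  obtain i0 :: 'n where True by simp
  obtain U :: "complex ^ 'n \<Rightarrow> complex ^ 'n" where U: "linear U" "\<And>z. norm (U z) = norm z" "\<And>z. norm (herm (U z) e) = norm (z $ i0)"
    using exists_unitary[OF e] by metis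
  have [measurable]: "U \<in> borel_measurable borel" using U(1) by (rule linear_borel_measurable)
  have "(\<integral>\<^sup>+z. ennreal (norm (herm z e) ^ (2 * k)) * \<phi> ((norm z)\<^sup>2) \<partial>lborel) =
    (\<integral>\<^sup>+z. ennreal (norm (herm z e) ^ (2 * k)) * \<phi> ((norm z)\<^sup>2) \<partial>(distr lborel borel U))"
    by (simp add: lborel_distr_isometry U)
  also have "\<dots> = (\<integral>\<^sup>+z. ennreal (norm ((z :: complex ^ 'n) $ i0) ^ (2 * k)) * \<phi> ((norm z)\<^sup>2) \<partial>lborel)"
    by (subst nn_integral_distr) (auto simp: U)
  finally show ?thesis by (simp add: nn_integral_coordinate_power)
qed

section \<open>Moments on the generalized Hartogs triangle\<close>

definition hX :: "nat \<Rightarrow> nat \<Rightarrow> (complex ^ 'n) \<times> complex \<Rightarrow> real" where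
  "hX m l y = (norm (fst y))\<^sup>2 / (norm (snd y) powr (2 / real m)) ^ l"

definition hY :: "nat \<Rightarrow> (complex ^ 'n) \<times> complex \<Rightarrow> real" where
  "hY m y = norm (snd y) powr (2 / real m)"

lemma hX_nonneg: "hX m l y \<ge> 0" and hY_nonneg: "hY m y \<ge> 0"
  by (simp_all add: hX_def hY_def)

lemma hX_measurable [measurable]: "hX m l \<in> borel_measurable borel"
  and hY_measurable [measurable]: "hY m \<in> borel_measurable borel"
proof -
  have [measurable]: "fst \<in> borel_measurable (borel :: ((complex ^ 'n) \<times> complex) measure)"
    "snd \<in> borel_measurable (borel :: ((complex ^ 'n) \<times> complex) measure)"
    by (intro borel_measurable_continuous_onI continuous_intros)+
  show "hX m l \<in> borel_measurable (borel :: ((complex ^ 'n) \<times> complex) measure)"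
    unfolding hX_def[abs_def] by measurable
  show "hY m \<in> borel_measurable (borel :: ((complex ^ 'n) \<times> complex) measure)"
    unfolding hY_def[abs_def] by measurable
qed

lemma powr_two_over_power:
  assumes "m > 0"
  shows "(norm w powr (2 / real m)) ^ m = (norm w)\<^sup>2"
proof (cases "norm w = 0")
  case False
  then have "(norm w powr (2 / real m)) ^ m = (norm w powr (2 / real m)) powr real m"
    by (simp add: powr_realpow)
  also have "\<dots> = (norm w)\<^sup>2" using assms False by (simp add: powr_powr)
  finally show ?thesis .
qed (use assms in simp)

lemma mem_hartogs_iff:
  assumes "m > 0" "l > 0"
  shows "y \<in> hartogs m l \<longleftrightarrow> 0 < hY m y \<and> hY m y < 1 \<and> hX m l y < 1"
proof -
  obtain z w where y: "y = (z, w)" by (cases y)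
  define Y where "Y = norm w powr (2 / real m)"
  have Ym: "Y ^ m = (norm w)\<^sup>2" using powr_two_over_power[OF assms(1)] by (simp add: Y_def)
  show ?thesis
  proof (cases "w = 0")
    case True
    then show ?thesis using assms by (auto simp: y hartogs_def hY_def zero_power not_less)
  next
    case False
    then have Y: "Y > 0" by (simp add: Y_def)
    have 1: "Y < 1 \<longleftrightarrow> norm w < 1"
      using Ym power_less_one_iff[of Y m] power_less_one_iff[of "norm w" 2] Y assms(1) by simp
    have 2: "norm w ^ l < 1 \<longleftrightarrow> norm w < 1"
      using assms by (simp add: power_less_one_iff)
    \<comment> \<open>Squaring turns both sides into \<open>m\<close>-th powers, of the square of
      \<open>norm z\<close> and of \<open>Y ^ l\<close>, because \<open>Y ^ m\<close> is the square
      of \<open>norm w\<close>.\<close>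
    have 3: "norm z ^ m < norm w ^ l \<longleftrightarrow> (norm z)\<^sup>2 < Y ^ l"
    proof -
      have "norm z ^ m < norm w ^ l \<longleftrightarrow> (norm z ^ m)\<^sup>2 < (norm w ^ l)\<^sup>2"
        using power_mono_iff[of "norm w ^ l" "norm z ^ m" 2] by (metis not_le norm_ge_zero zero_le_power zero_less_numeral)
      also have "(norm z ^ m)\<^sup>2 = ((norm z)\<^sup>2) ^ m" by (simp add: power_mult[symmetric] mult.commute)
      also have "(norm w ^ l)\<^sup>2 = (Y ^ l) ^ m"
        using Ym by (metis power_mult mult.commute)
      also have "((norm z)\<^sup>2) ^ m < (Y ^ l) ^ m \<longleftrightarrow> (norm z)\<^sup>2 < Y ^ l"
        using assms Y power_mono_iff[of "Y ^ l" "(norm z)\<^sup>2" m] by (metis not_le less_imp_le zero_le_power zero_le_power2)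
      finally show ?thesis .
    qed
    show ?thesis using Y 1 2 3
      by (auto simp: y hartogs_def hX_def hY_def simp flip: Y_def)
  qed
qed

lemma hartogs_measurable [measurable]: "m > 0 \<Longrightarrow> l > 0 \<Longrightarrow> hartogs m l \<in> sets borel"
proof -
  assume "m > 0" "l > 0"
  then have "hartogs m l = {y. 0 < hY m y \<and> hY m y < 1 \<and> hX m l y < 1}"
    by (auto simp: mem_hartogs_iff)
  also have "\<dots> \<in> sets borel" by measurable
  finally show ?thesis .
qed

lemma open_hartogs: "open (hartogs m l)"
proof -
  have "hartogs m l = {y :: (complex ^ 'n) \<times> complex. norm (fst y) ^ m < norm (snd y) ^ l \<and> norm (snd y) ^ l < 1}"
    by (auto simp: hartogs_def)
  also have "open \<dots>"
    by (intro open_Collect_conj open_Collect_less continuous_intros)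
  finally show ?thesis .
qed

lemma fst_borel [measurable]: "(fst :: 'a::euclidean_space \<times> 'b::euclidean_space \<Rightarrow> 'a) \<in> borel_measurable borel"
  and snd_borel [measurable]: "(snd :: 'a::euclidean_space \<times> 'b::euclidean_space \<Rightarrow> 'b) \<in> borel_measurable borel"
  by (intro borel_measurable_continuous_onI continuous_intros)+

text \<open>The variable \<open>z\<close> is integrated first, over the ball of squared radius
  \<open>c = Y ^ l\<close>. Rescaling that ball to the unit interval in \<open>X\<close> produces
  \<open>c ^ (n + k)\<close>, that is \<open>Y ^ (l * (n + k))\<close>. The radial integral over
  \<open>w\<close> with exponent \<open>2 / m\<close> contributes \<open>Y ^ (m - 1)\<close>, and
  the two add up to the exponent \<open>l * k + (m + l * n - 1)\<close>.\<close>

lemma hartogs_moment: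
  fixes e :: "complex ^ 'n" and m l k :: nat
  assumes [measurable]: "\<phi> \<in> borel_measurable borel" "\<psi> \<in> borel_measurable borel"
    and e: "norm e = 1" and m: "m > 0" and l: "l > 0"
  shows "(\<integral>\<^sup>+y\<in>hartogs m l. ennreal (norm (herm (fst y) e) ^ (2 * k)) * \<phi> (hX m l y) * \<psi> (hY m y) \<partial>lborel)
    = ennreal (real m * pi ^ (CARD('n) + 1) * fact k / fact (CARD('n) + k - 1)) *
      (\<integral>\<^sup>+x\<in>{0<..<1}. ennreal (x ^ (CARD('n) + k - 1)) * \<phi> x \<partial>lborel) *
      (\<integral>\<^sup>+y\<in>{0<..<1}. ennreal (y ^ (l * k + (m + l * CARD('n) - 1))) * \<psi> y \<partial>lborel)"
proof -
  define n where "n = CARD('n)"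
  have n: "n > 0" by (simp add: n_def)
  note [measurable] = hartogs_measurable[OF m l]
  define Q where "Q = ennreal (pi ^ n * fact k / fact (n + k - 1))"
  define \<Phi> where "\<Phi> = (\<integral>\<^sup>+x\<in>{0<..<1}. ennreal (x ^ (n + k - 1)) * \<phi> x \<partial>lborel)"
  define G where "G = (\<lambda>Y :: real. Q * \<Phi> * (ennreal (Y ^ (l * (n + k))) * \<psi> Y * indicator {0<..<1} Y))"
  have inner: "(\<integral>\<^sup>+z. ennreal (norm (herm z e) ^ (2 * k)) * \<phi> (hX m l (z, w)) * \<psi> (hY m (z, w)) * indicator (hartogs m l) (z, w) \<partial>lborel)
    = G (norm w powr (2 / m))" for w
  proof (cases "0 < norm w powr (2 / m) \<and> norm w powr (2 / m) < 1")
    case False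
    then have "(z, w) \<notin> hartogs m l" for z :: "complex ^ 'n"
      using m l by (auto simp: mem_hartogs_iff hY_def)
    then show ?thesis using False by (auto simp: G_def indicator_def)
  next
    case True
    define Y where "Y = norm w powr (2 / m)"
    define c where "c = Y ^ l"
    have Y: "0 < Y" "Y < 1" using True by (auto simp: Y_def)
    then have c: "c > 0" by (simp add: c_def)
    define \<phi>' where "\<phi>' = (\<lambda>v. \<phi> (v / c) * indicator {..<c} v)"
    have [measurable]: "\<phi>' \<in> borel_measurable borel" unfolding \<phi>'_def by measurable
    have "(\<integral>\<^sup>+z. ennreal (norm (herm z e) ^ (2 * k)) * \<phi> (hX m l (z, w)) * \<psi> (hY m (z, w)) * indicator (hartogs m l) (z, w) \<partial>lborel)
      = (\<integral>\<^sup>+z. \<psi> Y * (ennreal (norm (herm z e) ^ (2 * k)) * \<phi>' ((norm z)\<^sup>2)) \<partial>lborel)"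
    proof (rule nn_integral_cong)
      fix z :: "complex ^ 'n"
      have "(z, w) \<in> hartogs m l \<longleftrightarrow> (norm z)\<^sup>2 < c"
        using m l Y c by (simp add: mem_hartogs_iff hX_def hY_def c_def flip: Y_def)
      then show "ennreal (norm (herm z e) ^ (2 * k)) * \<phi> (hX m l (z, w)) * \<psi> (hY m (z, w)) * indicator (hartogs m l) (z, w)
          = \<psi> Y * (ennreal (norm (herm z e) ^ (2 * k)) * \<phi>' ((norm z)\<^sup>2))"
        by (simp add: \<phi>'_def hX_def hY_def c_def indicator_def mult_ac flip: Y_def)
    qed
    also have "\<dots> = \<psi> Y * (Q * (\<integral>\<^sup>+v\<in>{0<..}. ennreal (v ^ (n + k - 1)) * \<phi>' v \<partial>lborel))"
      by (subst nn_integral_cmult) (simp_all add: nn_integral_herm_power[OF _ e] Q_def n_def)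
    also have "(\<integral>\<^sup>+v\<in>{0<..}. ennreal (v ^ (n + k - 1)) * \<phi>' v \<partial>lborel) =
       ennreal \<bar>c\<bar> * (\<integral>\<^sup>+x. ennreal ((0 + c * x) ^ (n + k - 1)) * \<phi>' (0 + c * x) * indicator {0<..} (0 + c * x) \<partial>lborel)"
      using c by (intro nn_integral_real_affine) auto
    also have "(\<integral>\<^sup>+x. ennreal ((0 + c * x) ^ (n + k - 1)) * \<phi>' (0 + c * x) * indicator {0<..} (0 + c * x) \<partial>lborel)
       = (\<integral>\<^sup>+x. ennreal (c ^ (n + k - 1)) * (ennreal (x ^ (n + k - 1)) * \<phi> x * indicator {0<..<1} x) \<partial>lborel)"
    proof (rule nn_integral_cong)
      fix x :: real
      show "ennreal ((0 + c * x) ^ (n + k - 1)) * \<phi>' (0 + c * x) * indicator {0<..} (0 + c * x) =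
        ennreal (c ^ (n + k - 1)) * (ennreal (x ^ (n + k - 1)) * \<phi> x * indicator {0<..<1} x)"
        using c by (cases "0 < x \<and> x < 1")
          (auto simp: \<phi>'_def indicator_def power_mult_distrib ennreal_mult zero_less_mult_iff mult_ac)
    qed
    also have "\<dots> = ennreal (c ^ (n + k - 1)) * \<Phi>"
      by (simp add: nn_integral_cmult \<Phi>_def)
    also have "ennreal \<bar>c\<bar> * (ennreal (c ^ (n + k - 1)) * \<Phi>) = ennreal (c ^ (n + k)) * \<Phi>"
    proof -
      have "c ^ (n + k) = c * c ^ (n + k - 1)" using n by (simp flip: power_Suc)
      then show ?thesis using c by (simp add: ennreal_mult mult.assoc)
    qed
    finally show ?thesis using Y by (simp add: G_def c_def power_mult mult_ac flip: Y_def)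
  qed
  have "(\<integral>\<^sup>+y\<in>hartogs m l. ennreal (norm (herm (fst y) e) ^ (2 * k)) * \<phi> (hX m l y) * \<psi> (hY m y) \<partial>lborel)
    = (\<integral>\<^sup>+y. ennreal (norm (herm (fst y) e) ^ (2 * k)) * \<phi> (hX m l y) * \<psi> (hY m y) * indicator (hartogs m l) y \<partial>(lborel \<Otimes>\<^sub>M lborel))"
    by (simp add: lborel_prod)
  also have "\<dots> = (\<integral>\<^sup>+w. (\<integral>\<^sup>+z. ennreal (norm (herm z e) ^ (2 * k)) * \<phi> (hX m l (z, w)) * \<psi> (hY m (z, w)) * indicator (hartogs m l) (z, w) \<partial>lborel) \<partial>lborel)"
    by (subst lborel_pair.nn_integral_snd[symmetric]) (simp_all add: lborel_prod)
  also have "\<dots> = (\<integral>\<^sup>+w. G (norm (w::complex) powr (2 / m)) \<partial>lborel)"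
    by (simp only: inner)
  also have "\<dots> = ennreal (2 * pi / (2 / m)) * (\<integral>\<^sup>+y\<in>{0<..}. ennreal (y powr (2 / (2 / m) - 1)) * G y \<partial>lborel)"
    using m by (intro nn_integral_complex_radial) (auto simp: G_def)
  also have "(\<integral>\<^sup>+y\<in>{0<..}. ennreal (y powr (2 / (2 / m) - 1)) * G y \<partial>lborel) =
     (\<integral>\<^sup>+y. Q * \<Phi> * (ennreal (y ^ (l * k + (m + l * n - 1))) * \<psi> y * indicator {0<..<1} y) \<partial>lborel)"
  proof (rule nn_integral_cong)
    fix y :: real
    have *: "ennreal (y powr (2 / (2 / m) - 1)) * ennreal (y ^ (l * (n + k))) = ennreal (y ^ (l * k + (m + l * n - 1)))" if "0 < y"
    proof -
      have "y powr (2 / (2 / m) - 1) = y ^ (m - 1)" using m that by (simp add: powr_realpow[symmetric] of_nat_diff)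
      moreover have "(m - 1) + l * (n + k) = l * k + (m + l * n - 1)" using m by (simp add: algebra_simps)
      ultimately show ?thesis using that by (simp add: ennreal_mult[symmetric] power_add[symmetric])
    qed
    show "ennreal (y powr (2 / (2 / m) - 1)) * G y * indicator {0<..} y =
        Q * \<Phi> * (ennreal (y ^ (l * k + (m + l * n - 1))) * \<psi> y * indicator {0<..<1} y)"
    proof (cases "0 < y \<and> y < 1")
      case True
      have "ennreal (y powr (2 / (2 / m) - 1)) * (Q * \<Phi> * (ennreal (y ^ (l * (n + k))) * \<psi> y)) =
         Q * \<Phi> * ((ennreal (y powr (2 / (2 / m) - 1)) * ennreal (y ^ (l * (n + k)))) * \<psi> y)"
        by (simp only: mult_ac)
      then show ?thesis using True * by (simp add: G_def)
    qed (auto simp: G_def indicator_def)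
  qed
  also have "\<dots> = Q * \<Phi> * (\<integral>\<^sup>+y\<in>{0<..<1}. ennreal (y ^ (l * k + (m + l * n - 1))) * \<psi> y \<partial>lborel)"
    by (rule nn_integral_cmult) simp
  also have "ennreal (2 * pi / (2 / m)) * (Q * \<Phi> * (\<integral>\<^sup>+y\<in>{0<..<1}. ennreal (y ^ (l * k + (m + l * n - 1))) * \<psi> y \<partial>lborel)) =
     (ennreal (2 * pi / (2 / m)) * Q) * \<Phi> * (\<integral>\<^sup>+y\<in>{0<..<1}. ennreal (y ^ (l * k + (m + l * n - 1))) * \<psi> y \<partial>lborel)"
    by (simp only: mult.assoc)
  also have "ennreal (2 * pi / (2 / m)) * Q = ennreal (real m * pi ^ (n + 1) * fact k / fact (n + k - 1))"
    unfolding Q_def by (subst ennreal_mult[symmetric]) (auto simp: mult_ac)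
  finally show ?thesis by (simp only: \<Phi>_def n_def)
qed

section \<open>Circle means and averages over rotations\<close>

abbreviation unit_interval :: "real measure" where
  "unit_interval \<equiv> restrict_space lborel {0..1}"

definition cmean :: "(complex \<Rightarrow> complex) \<Rightarrow> complex" where
  "cmean g = (LINT \<theta>|unit_interval. g (cis (2 * pi * \<theta>)))"

text \<open>Each \<open>T \<theta>\<close> preserves the integral, so its mean over
  \<open>\<theta>\<close> does too; Fubini moves the mean inside. Later \<open>T\<close> is a
  rotation, and the inner mean is a Taylor coefficient that isolates one term of an
  expansion.\<close>

lemma integral_average:
  fixes F :: "'a::euclidean_space \<Rightarrow> complex" and T :: "real \<Rightarrow> 'a \<Rightarrow> 'a"
  assumes F: "integrable lborel F"
    and T: "continuous_on UNIV (\<lambda>x. T (fst x) (snd x))"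
    and inv: "\<And>\<theta>. distr lborel borel (T \<theta>) = lborel"
  shows "(LINT y|lborel. F y) = (LINT y|lborel. LINT \<theta>|unit_interval. F (T \<theta> y))"
    and "integrable lborel (\<lambda>y. LINT \<theta>|unit_interval. F (T \<theta> y))"
proof -
  have e: "emeasure (lborel::real measure) {0..1} = 1" by simp
  interpret U: finite_measure unit_interval
    by standard (simp add: space_restrict_space emeasure_restrict_space)
  interpret P: pair_sigma_finite unit_interval "lborel :: 'a measure" ..
  have [measurable]: "F \<in> borel_measurable borel" using F by auto
  have sets_eq: "sets (unit_interval \<Otimes>\<^sub>M (lborel :: 'a measure)) = sets (restrict_space borel {0..1} \<Otimes>\<^sub>M borel)"
    by (intro sets_pair_measure_cong sets_restrict_space_cong) simp_all
  have Tm: "(\<lambda>x. T (fst x) (snd x)) \<in> borel_measurable (unit_interval \<Otimes>\<^sub>M lborel)"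
  proof -
    have f1: "fst \<in> borel_measurable (unit_interval \<Otimes>\<^sub>M (lborel :: 'a measure))"
      by (rule measurable_compose[OF measurable_fst]) (simp add: measurable_restrict_space1)
    have f2: "snd \<in> borel_measurable (unit_interval \<Otimes>\<^sub>M (lborel :: 'a measure))"
      using measurable_snd[of unit_interval "lborel :: 'a measure"] by (simp cong: measurable_cong_sets)
    show ?thesis by (rule borel_measurable_continuous_Pair[OF f1 f2 T])
  qed
  have FT: "(\<lambda>(\<theta>, y). F (T \<theta> y)) \<in> borel_measurable (unit_interval \<Otimes>\<^sub>M lborel)"
    using measurable_compose[OF Tm, of F borel] by (simp add: case_prod_beta')
  have T1: "T \<theta> \<in> borel_measurable borel" for \<theta>
  proof -
    have "continuous_on UNIV (\<lambda>y. (\<lambda>x. T (fst x) (snd x)) (\<theta>, y))"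
      by (rule continuous_on_compose2[OF T]) (auto intro!: continuous_intros)
    then show ?thesis by (intro borel_measurable_continuous_onI) simp
  qed
  have nn: "(\<integral>\<^sup>+y. norm (F (T \<theta> y)) \<partial>lborel) = (\<integral>\<^sup>+y. norm (F y) \<partial>lborel)" for \<theta>
  proof -
    have "(\<integral>\<^sup>+y. norm (F y) \<partial>lborel) = (\<integral>\<^sup>+y. norm (F y) \<partial>(distr lborel borel (T \<theta>)))" by (simp add: inv)
    also have "\<dots> = (\<integral>\<^sup>+y. norm (F (T \<theta> y)) \<partial>lborel)"
      using T1[of \<theta>] by (subst nn_integral_distr) auto
    finally show ?thesis by simp
  qed
  have int: "(LINT y|lborel. F (T \<theta> y)) = (LINT y|lborel. F y)" for \<theta>
  proof -
    have "(LINT y|lborel. F y) = (LINT y|distr lborel borel (T \<theta>). F y)" by (simp add: inv)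
    also have "\<dots> = (LINT y|lborel. F (T \<theta> y))"
      using T1[of \<theta>] by (subst integral_distr) auto
    finally show ?thesis by simp
  qed
  have I: "integrable (unit_interval \<Otimes>\<^sub>M lborel) (\<lambda>(\<theta>, y). F (T \<theta> y))"
  proof (rule integrableI_bounded)
    have "(\<integral>\<^sup>+x. norm (case x of (\<theta>, y) \<Rightarrow> F (T \<theta> y)) \<partial>(unit_interval \<Otimes>\<^sub>M lborel)) =
       (\<integral>\<^sup>+\<theta>. (\<integral>\<^sup>+y. norm (F (T \<theta> y)) \<partial>lborel) \<partial>unit_interval)"
      using FT by (subst lborel.nn_integral_fst[symmetric]) (auto simp: case_prod_beta')
    also have "\<dots> = (\<integral>\<^sup>+y. norm (F y) \<partial>lborel)"
      by (simp add: nn nn_integral_const emeasure_restrict_space space_restrict_space e)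
    also have "\<dots> < \<infinity>" using F by (simp add: integrable_iff_bounded)
    finally show "(\<integral>\<^sup>+x. norm (case x of (\<theta>, y) \<Rightarrow> F (T \<theta> y)) \<partial>(unit_interval \<Otimes>\<^sub>M lborel)) < \<infinity>" .
  qed (rule FT)
  have "(LINT y|lborel. LINT \<theta>|unit_interval. F (T \<theta> y)) = (LINT \<theta>|unit_interval. LINT y|lborel. F (T \<theta> y))"
    by (rule P.Fubini_integral[OF I])
  also have "\<dots> = (LINT y|lborel. F y)"
    by (simp add: int measure_def emeasure_restrict_space space_restrict_space e)
  finally show "(LINT y|lborel. F y) = (LINT y|lborel. LINT \<theta>|unit_interval. F (T \<theta> y))" ..
  show "integrable lborel (\<lambda>y. LINT \<theta>|unit_interval. F (T \<theta> y))"
    using P.integrable_snd[OF I] by simp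
qed

text \<open>Cauchy's formula for the derivatives: on the unit circle \<open>1 / u = cnj u\<close>,
  and the factor \<open>2 * pi * \<i> * u\<close> of the parametrization cancels one power of
  \<open>u\<close>. Continuity up to the circle suffices.\<close>

lemma cmean_coefficient:
  assumes cont: "continuous_on (cball 0 1) g" and hol: "g holomorphic_on ball 0 1"
  shows "cmean (\<lambda>\<zeta>. g \<zeta> * cnj \<zeta> ^ k) = (deriv ^^ k) g 0 / fact k"
proof -
  have "((\<lambda>u. g u / (u - 0) ^ Suc k) has_contour_integral ((2 * pi * \<i>) / fact k * (deriv ^^ k) g 0)) (circlepath 0 1)"
    by (rule Cauchy_has_contour_integral_higher_derivative_circlepath[OF cont hol]) simp
  then have "((\<lambda>x. g (circlepath 0 1 x) / (circlepath 0 1 x) ^ Suc k * vector_derivative (circlepath 0 1) (at x within {0..1}))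
      has_integral ((2 * pi * \<i>) / fact k * (deriv ^^ k) g 0)) {0..1}"
    by (simp add: has_contour_integral_def)
  then have "((\<lambda>x. (2 * pi * \<i>) * (g (cis (2 * pi * x)) * cnj (cis (2 * pi * x)) ^ k))
      has_integral ((2 * pi * \<i>) / fact k * (deriv ^^ k) g 0)) {0..1}"
  proof (rule has_integral_eq[rotated])
    fix x :: real assume x: "x \<in> {0..1}"
    have c: "circlepath 0 1 x = cis (2 * pi * x)"
      by (simp add: circlepath cis_conv_exp mult_ac)
    have inv: "cnj (cis t) = 1 / cis t" for t by (simp add: cis_cnj cis_inverse divide_inverse)
    show "g (circlepath 0 1 x) / (circlepath 0 1 x) ^ Suc k * vector_derivative (circlepath 0 1) (at x within {0..1})
      = (2 * pi * \<i>) * (g (cis (2 * pi * x)) * cnj (cis (2 * pi * x)) ^ k)"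
      using x unfolding c inv
      by (subst vector_derivative_circlepath01)
         (auto simp: power_one_over field_simps cis_conv_exp)
  qed
  from has_integral_mult_right[OF this, of "1 / (2 * pi * \<i>)"]
  have *: "((\<lambda>x. g (cis (2 * pi * x)) * cnj (cis (2 * pi * x)) ^ k) has_integral (deriv ^^ k) g 0 / fact k) {0..1}"
    by simp
  have "continuous_on {0..1} (\<lambda>x. g (cis (2 * pi * x)) * cnj (cis (2 * pi * x)) ^ k)"
    by (intro continuous_intros continuous_on_compose2[OF cont]) (auto simp: cis_conv_exp intro!: continuous_intros)
  then have "set_integrable lborel {0..1} (\<lambda>x. g (cis (2 * pi * x)) * cnj (cis (2 * pi * x)) ^ k)"
    unfolding set_integrable_def by (rule borel_integrable_compact[OF compact_Icc])
  then have "(LINT x:{0..1}|lborel. g (cis (2 * pi * x)) * cnj (cis (2 * pi * x)) ^ k) = integral {0..1} (\<lambda>x. g (cis (2 * pi * x)) * cnj (cis (2 * pi * x)) ^ k)"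
    by (rule set_borel_integral_eq_integral)
  also have "\<dots> = (deriv ^^ k) g 0 / fact k" using * by (rule integral_unique)
  finally show ?thesis
    unfolding cmean_def set_lebesgue_integral_def by (subst integral_restrict_space) simp_all
qed

section \<open>Expansion of square integrable holomorphic functions\<close>

lemma holomorphic_several_continuous:
  "holomorphic_several f S \<Longrightarrow> continuous_on S f"
  unfolding holomorphic_several_def
  by (metis continuous_at_imp_continuous_on has_derivative_continuous)

text \<open>The chain rule along a complex affine line; commutation of \<open>D\<close> with complex
  scalars gives the complex derivative \<open>D (b, d)\<close>. Besides continuity, this is the form
  in which holomorphy of a given function is exploited.\<close>

lemma holomorphic_several_line:
  fixes f :: "(complex ^ 'n) \<times> complex \<Rightarrow> complex"
  assumes f: "holomorphic_several f S" and U: "open U"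
    and sub: "\<And>\<mu>. \<mu> \<in> U \<Longrightarrow> (a + \<mu> *s b, c + \<mu> * d) \<in> S"
  shows "(\<lambda>\<mu>. f (a + \<mu> *s b, c + \<mu> * d)) holomorphic_on U"
proof -
  have "(\<lambda>\<mu>. f (a + \<mu> *s b, c + \<mu> * d)) field_differentiable (at \<mu>)" if "\<mu> \<in> U" for \<mu>
  proof -
    note mem = sub[OF that]
    obtain D where D: "(f has_derivative D) (at (a + \<mu> *s b, c + \<mu> * d))"
      and lin: "\<And>c z w. D (c *s z, c * w) = c * D (z, w)"
      using bspec[OF f[unfolded holomorphic_several_def] mem] by blast
    have "bounded_linear (\<lambda>h. (h *s b :: complex ^ 'n))"
    proof (rule bounded_linear_intro[where K = "norm b"])
      show "(x + y) *s b = x *s b + y *s b" for x y :: complex by (simp add: vec_eq_iff algebra_simps)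
      show "(r *\<^sub>R x) *s b = r *\<^sub>R (x *s b)" for r and x :: complex by (simp add: vec_eq_iff)
      show "norm (x *s b) \<le> norm x * norm b" for x by (simp add: norm_scale_vec)
    qed
    then have 1: "((\<lambda>h. h *s b) has_derivative (\<lambda>h. h *s b)) (at \<mu>)"
      by (rule bounded_linear_imp_has_derivative)
    have "((\<lambda>h. (a + h *s b, c + h * d)) has_derivative (\<lambda>h. (0 + h *s b, 0 + h * d))) (at \<mu>)"
      by (intro has_derivative_Pair has_derivative_add has_derivative_const 1 has_derivative_mult_left has_derivative_ident)
    from has_derivative_compose[OF this D]
    have "((\<lambda>h. f (a + h *s b, c + h * d)) has_derivative (\<lambda>h. D (b, d) * h)) (at \<mu>)"
      using lin by (simp add: mult.commute)
    then show ?thesis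
      unfolding field_differentiable_def has_field_derivative_def by blast
  qed
  then show ?thesis using U by (simp add: holomorphic_on_def field_differentiable_at_within)
qed

lemma continuous_on_scale_vec [continuous_intros]:
  "continuous_on S f \<Longrightarrow> continuous_on S g \<Longrightarrow> continuous_on S (\<lambda>x. f x *s (g x :: complex ^ 'n))"
  unfolding vector_scalar_mult_def by (intro continuous_intros)

lemma distr_isometry_pair:
  fixes U :: "complex ^ 'n \<Rightarrow> complex ^ 'n" and b :: complex
  assumes "linear U" "\<And>z. norm (U z) = norm z" "norm b = 1"
  shows "distr lborel borel (\<lambda>y. (U (fst y), b * snd y)) = lborel"
proof (rule lborel_distr_isometry)
  show "linear (\<lambda>y. (U (fst y), b * snd y))"
    using assms(1) by (intro linearI) (auto simp: linear_add linear_scale ring_distribs)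
  show "norm (U (fst y), b * snd y) = norm y" for y
    by (cases y) (simp add: norm_Pair norm_mult assms)
qed

lemma linear_scale_vec: "linear (\<lambda>z :: complex ^ 'n. c *s z)"
  by (intro linearI) (simp_all add: vec_eq_iff algebra_simps)

text \<open>Rotating \<open>y - x\<close> by unimodular scalars preserves the ball and Lebesgue
  measure. Averaging over these rotations replaces \<open>f y\<close> by the circle mean of
  \<open>f\<close> on the complex line through \<open>x\<close> and \<open>y\<close>, which is
  \<open>f x\<close>.\<close>

lemma mean_value_ball:
  fixes f :: "(complex ^ 'n) \<times> complex \<Rightarrow> complex"
  assumes f: "holomorphic_several f S" and S: "open S" and sub: "ball x r \<subseteq> S"
    and I: "integrable lborel (\<lambda>y. indicator (ball x r) y *\<^sub>R f y)"
  shows "(LINT y|lborel. indicator (ball x r) y *\<^sub>R f y) = measure lborel (ball x r) *\<^sub>R f x"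
proof -
  define T where "T = (\<lambda>(\<theta>::real) (y :: (complex ^ 'n) \<times> complex).
     (fst x + cis (2 * pi * \<theta>) *s (fst y - fst x), snd x + cis (2 * pi * \<theta>) * (snd y - snd x)))"
  have dT: "dist x (T \<theta> y) = dist x y" for \<theta> y
  proof -
    have "dist x (T \<theta> y) = norm (T \<theta> y - x)" by (simp add: dist_norm norm_minus_commute)
    also have "\<dots> = norm (cis (2 * pi * \<theta>) *s (fst y - fst x), cis (2 * pi * \<theta>) * (snd y - snd x))"
      by (cases x) (simp add: T_def)
    also have "\<dots> = norm (y - x)"
      by (cases x; cases y) (simp only: norm_Pair fst_conv snd_conv norm_scale_vec norm_mult norm_cis mult_1 diff_Pair)
    finally show ?thesis by (simp add: dist_norm norm_minus_commute)
  qed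
  have inv: "distr lborel borel (T \<theta>) = lborel" for \<theta>
  proof -
    define R where "R = (\<lambda>y :: (complex ^ 'n) \<times> complex. (cis (2 * pi * \<theta>) *s fst y, cis (2 * pi * \<theta>) * snd y))"
    have R: "distr lborel borel R = lborel"
      unfolding R_def by (rule distr_isometry_pair) (auto simp: linear_scale_vec norm_scale_vec)
    have [measurable]: "R \<in> borel_measurable borel"
      unfolding R_def by (intro borel_measurable_continuous_onI continuous_intros)
    have "T \<theta> = (+) x \<circ> (R \<circ> (+) (- x))"
      by (rule ext, cases x) (simp add: T_def R_def)
    then have "distr lborel borel (T \<theta>) = distr (distr (distr lborel borel ((+) (- x))) borel R) borel ((+) x)"
      by (simp add: distr_distr comp_assoc)
    then show ?thesis by (simp add: lborel_distr_plus R)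
  qed
  have cT: "continuous_on UNIV (\<lambda>z. T (fst z) (snd z))"
    unfolding T_def by (intro continuous_intros)
  have "(LINT y|lborel. indicator (ball x r) y *\<^sub>R f y) =
     (LINT y|lborel. LINT \<theta>|unit_interval. indicator (ball x r) (T \<theta> y) *\<^sub>R f (T \<theta> y))"
    by (rule integral_average(1)[OF I cT inv])
  also have "(\<lambda>y. LINT \<theta>|unit_interval. indicator (ball x r) (T \<theta> y) *\<^sub>R f (T \<theta> y)) =
     (\<lambda>y. indicator (ball x r) y *\<^sub>R f x)"
  proof
    fix y
    show "(LINT \<theta>|unit_interval. indicator (ball x r) (T \<theta> y) *\<^sub>R f (T \<theta> y)) = indicator (ball x r) y *\<^sub>R f x"
    proof (cases "y \<in> ball x r")
      case False
      then show ?thesis by (simp add: dT)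
    next
      case True
      define g where "g = (\<lambda>\<mu>. f (fst x + \<mu> *s (fst y - fst x), snd x + \<mu> * (snd y - snd x)))"
      define V where "V = (\<lambda>\<mu>. (fst x + \<mu> *s (fst y - fst x), snd x + \<mu> * (snd y - snd x))) -` S"
      have "open V" unfolding V_def by (intro open_vimage S continuous_intros)
      have cV: "cball 0 1 \<subseteq> V"
      proof
        fix \<mu> :: complex assume "\<mu> \<in> cball 0 1"
        then have \<mu>: "norm \<mu> \<le> 1" by simp
        have "norm (\<mu> *s (fst y - fst x), \<mu> * (snd y - snd x)) = norm \<mu> * norm (y - x)"
          by (cases x; cases y)
             (simp only: norm_Pair fst_conv snd_conv norm_scale_vec norm_mult power_mult_distrib diff_Pair
               distrib_left[symmetric] real_sqrt_mult real_sqrt_abs abs_norm_cancel)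
        also have "\<dots> \<le> norm (y - x)" using \<mu> by (simp add: mult_left_le_one_le)
        also have "\<dots> < r" using True by (simp add: dist_norm norm_minus_commute)
        finally have "norm (\<mu> *s (fst y - fst x), \<mu> * (snd y - snd x)) < r" .
        then have "(fst x + \<mu> *s (fst y - fst x), snd x + \<mu> * (snd y - snd x)) \<in> ball x r"
        proof -
          assume "norm (\<mu> *s (fst y - fst x), \<mu> * (snd y - snd x)) < r"
          moreover have "(fst x + \<mu> *s (fst y - fst x), snd x + \<mu> * (snd y - snd x)) - x =
              (\<mu> *s (fst y - fst x), \<mu> * (snd y - snd x))"
            by (cases x) simp
          ultimately show ?thesis by (simp only: mem_ball dist_norm norm_minus_commute[of x])
        qed
        then show "\<mu> \<in> V" using sub by (auto simp: V_def)
      qed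
      have hol: "g holomorphic_on V" unfolding g_def
        by (rule holomorphic_several_line[OF f \<open>open V\<close>]) (auto simp: V_def)
      have "cmean (\<lambda>\<zeta>. g \<zeta> * cnj \<zeta> ^ 0) = (deriv ^^ 0) g 0 / fact 0"
        using holomorphic_on_subset[OF hol] cV ball_subset_cball[of 0 1]
        by (intro cmean_coefficient holomorphic_on_imp_continuous_on) blast+
      then have "cmean g = f x" by (simp add: g_def)
      then show ?thesis using True dT by (simp add: cmean_def g_def T_def)
    qed
  qed
  also have "(LINT y|lborel. indicator (ball x r) y *\<^sub>R f x) = measure lborel (ball x r) *\<^sub>R f x"
    using emeasure_lborel_ball_finite[of x r]
    by (subst Bochner_Integration.integral_scaleR_left) (auto simp: less_top)
  finally show ?thesis .
qed

definition L2_sq :: "'a::euclidean_space set \<Rightarrow> ('a \<Rightarrow> complex) \<Rightarrow> real" where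
  "L2_sq S f = (LINT y|lborel. indicator S y * (norm (f y))\<^sup>2)"

text \<open>The mean value property combined with \<open>t \<le> 1 + t^2\<close> for
  \<open>t = norm (f y)\<close>, in place of the Cauchy-Schwarz inequality. The bound is only used
  to show that coefficients grow at most polynomially near \<open>w = 0\<close>.\<close>

lemma norm_le_L2_ball:
  fixes f :: "(complex ^ 'n) \<times> complex \<Rightarrow> complex"
  assumes f: "holomorphic_several f S" and S: "open S" and sub: "ball x r \<subseteq> S" and r: "r > 0"
    and I: "integrable lborel (\<lambda>y. indicator S y * (norm (f y))\<^sup>2)"
  shows "norm (f x) \<le> 1 + L2_sq S f / measure lborel (ball x r)"
proof -
  have vol: "measure lborel (ball x r) > 0" using r content_ball_pos[of r x] by simp
  have bnd: "norm (indicator (ball x r) y *\<^sub>R f y) \<le> indicator (ball x r) y + indicator S y * (norm (f y))\<^sup>2" for y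
  proof -
    have "norm (f y) \<le> 1 + (norm (f y))\<^sup>2"
      using sum_squares_ge_zero[of "norm (f y) - 1" 0] zero_le_power2[of "norm (f y) - 1/2"]
      by (simp add: power2_eq_square algebra_simps)
    then show ?thesis using sub by (auto simp: indicator_def)
  qed
  have "continuous_on (ball x r) f"
    using holomorphic_several_continuous[OF f] sub continuous_on_subset by blast
  then have m: "(\<lambda>y. indicator (ball x r) y *\<^sub>R f y) \<in> borel_measurable lborel"
    using borel_measurable_continuous_on_indicator[of "ball x r" f] by simp
  have I1: "integrable lborel (indicator (ball x r) :: _ \<Rightarrow> real)"
    using emeasure_lborel_ball_finite[of x r] by (auto simp: less_top)
  then have I2: "integrable lborel (\<lambda>y. indicator (ball x r) y + indicator S y * (norm (f y))\<^sup>2)"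
    using I by (rule Bochner_Integration.integrable_add)
  have I3: "integrable lborel (\<lambda>y. indicator (ball x r) y *\<^sub>R f y)"
    using bnd by (intro Bochner_Integration.integrable_bound[OF I2 m] AE_I2) force
  have "measure lborel (ball x r) * norm (f x) = norm (LINT y|lborel. indicator (ball x r) y *\<^sub>R f y)"
    using mean_value_ball[OF f S sub I3] by simp
  also have "\<dots> \<le> (LINT y|lborel. norm (indicator (ball x r) y *\<^sub>R f y))" by (rule integral_norm_bound)
  also have "\<dots> \<le> (LINT y|lborel. indicator (ball x r) y + indicator S y * (norm (f y))\<^sup>2)"
    by (intro integral_mono I2 bnd integrable_norm I3)
  also have "\<dots> = measure lborel (ball x r) + L2_sq S f"
    unfolding L2_sq_def by (subst Bochner_Integration.integral_add[OF I1 I]) simp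
  finally show ?thesis using vol by (simp add: field_simps)
qed

text \<open>Differentiation under the integral requires the derivative to be jointly continuous.
  Near \<open>\<tau>0\<close> it is therefore written as a Cauchy integral of \<open>h t\<close>
  over a fixed circle, which inherits joint continuity from \<open>h\<close>.\<close>

lemma holomorphic_integral_param:
  fixes h :: "real \<Rightarrow> complex \<Rightarrow> complex"
  assumes h: "continuous_on ({0..1} \<times> V) (\<lambda>(t, \<tau>). h t \<tau>)" and V: "open V"
    and hol: "\<And>t. t \<in> {0..1} \<Longrightarrow> h t holomorphic_on V"
  shows "(\<lambda>\<tau>. integral {0..1} (\<lambda>t. h t \<tau>)) holomorphic_on V"
proof -
  have loc: "\<exists>r>0. (\<lambda>\<tau>. integral {0..1} (\<lambda>t. h t \<tau>)) holomorphic_on ball \<tau>0 r" if "\<tau>0 \<in> V" for \<tau>0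
  proof -
    obtain r where r: "r > 0" "cball \<tau>0 r \<subseteq> V" using V \<open>\<tau>0 \<in> V\<close> by (meson open_contains_cball)
    define c where "c = circlepath \<tau>0 r"
    define c' where "c' = (\<lambda>v. 2 * pi * \<i> * r * exp (2 * pi * \<i> * complex_of_real v))"
    define d where "d = (\<lambda>\<tau> t. 1 / (2 * pi * \<i>) * integral {0..1} (\<lambda>v. h t (c v) / (c v - \<tau>)\<^sup>2 * c' v))"
    have c_sphere: "c v \<in> sphere \<tau>0 r" if "v \<in> {0..1}" for v
    proof -
      have "c v \<in> path_image c" using that by (auto simp: path_image_def)
      then show ?thesis using r by (simp add: c_def)
    qed
    have c_V: "c v \<in> V" if "v \<in> {0..1}" for v
      using c_sphere[OF that] r(2) sphere_cball by blast
    have c_cont: "continuous_on A c" for A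
      unfolding c_def circlepath by (intro continuous_intros)
    have der: "(h t has_field_derivative d \<tau> t) (at \<tau>)" if t: "t \<in> {0..1}" and \<tau>: "\<tau> \<in> ball \<tau>0 r" for t \<tau>
    proof -
      have "contour_integral c (\<lambda>u. h t u / (u - \<tau>) ^ Suc 1) = (2 * pi * \<i>) / fact 1 * (deriv ^^ 1) (h t) \<tau>"
        unfolding c_def
        by (intro contour_integral_unique Cauchy_has_contour_integral_higher_derivative_circlepath
           holomorphic_on_imp_continuous_on holomorphic_on_subset[OF hol[OF t]] \<tau>)
           (use r ball_subset_cball in auto)
      moreover have "contour_integral c (\<lambda>u. h t u / (u - \<tau>) ^ Suc 1) = integral {0..1} (\<lambda>v. h t (c v) / (c v - \<tau>)\<^sup>2 * c' v)"
        unfolding contour_integral_integral c_def c'_def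
        by (simp add: vector_derivative_circlepath power2_eq_square)
      ultimately have "deriv (h t) \<tau> = d \<tau> t" by (simp add: d_def nonzero_eq_divide_eq mult_ac)
      moreover have "\<tau> \<in> V" using \<tau> r by auto
      ultimately show ?thesis using holomorphic_derivI[OF hol[OF t] V, of \<tau>] by simp
    qed
    have cont_d: "continuous_on (ball \<tau>0 r \<times> cbox (0::real) 1) (\<lambda>(\<tau>, t). d \<tau> t)"
    proof -
      have "continuous_on ((ball \<tau>0 r \<times> cbox (0::real) 1) \<times> cbox 0 1)
          (\<lambda>(x, v). h (snd x) (c v) / (c v - fst x)\<^sup>2 * c' v)"
      proof -
        have "continuous_on ((ball \<tau>0 r \<times> cbox (0::real) 1) \<times> cbox 0 1) (\<lambda>y. (\<lambda>(t, \<tau>). h t \<tau>) (snd (fst y), c (snd y)))"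
          by (rule continuous_on_compose2[OF h])
             (auto intro!: continuous_intros continuous_on_compose2[OF c_cont] c_V)
        moreover have "continuous_on ((ball \<tau>0 r \<times> cbox (0::real) 1) \<times> cbox 0 1) (\<lambda>y. c (snd y) - fst (fst y))"
          by (intro continuous_intros continuous_on_compose2[OF c_cont[of UNIV]]) auto
        moreover have "c v - x \<noteq> 0" if "x \<in> ball \<tau>0 r" "v \<in> cbox 0 1" for x v
          using c_sphere[of v] that by auto
        moreover have "continuous_on ((ball \<tau>0 r \<times> cbox (0::real) 1) \<times> cbox 0 1) (\<lambda>y. c' (snd y))"
          unfolding c'_def by (intro continuous_intros)
        ultimately have "continuous_on ((ball \<tau>0 r \<times> cbox (0::real) 1) \<times> cbox 0 1)
            (\<lambda>y. (\<lambda>(t, \<tau>). h t \<tau>) (snd (fst y), c (snd y)) / (c (snd y) - fst (fst y))\<^sup>2 * c' (snd y))"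
          by (intro continuous_on_mult continuous_on_divide continuous_on_power) auto
        then show ?thesis by (simp add: case_prod_beta')
      qed
      then have "continuous_on (ball \<tau>0 r \<times> cbox (0::real) 1)
          (\<lambda>x. integral (cbox 0 1) (\<lambda>v. h (snd x) (c v) / (c v - fst x)\<^sup>2 * c' v))"
        by (rule integral_continuous_on_param)
      then have "continuous_on (ball \<tau>0 r \<times> cbox (0::real) 1)
          (\<lambda>x. 1 / (2 * pi * \<i>) * integral (cbox 0 1) (\<lambda>v. h (snd x) (c v) / (c v - fst x)\<^sup>2 * c' v))"
        by (rule continuous_on_mult_left)
      then show ?thesis by (simp add: d_def case_prod_beta' box_real)
    qed
    have "(\<lambda>\<tau>. integral (cbox 0 1) (\<lambda>t. h t \<tau>)) holomorphic_on ball \<tau>0 r"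
    proof (rule leibniz_rule_holomorphic[OF _ _ cont_d])
      show "((\<lambda>\<tau>. h t \<tau>) has_field_derivative d \<tau> t) (at \<tau> within ball \<tau>0 r)"
        if "\<tau> \<in> ball \<tau>0 r" "t \<in> cbox 0 1" for \<tau> t
        using der[of t \<tau>] that by (simp add: has_field_derivative_at_within box_real)
      show "(\<lambda>t. h t \<tau>) integrable_on cbox 0 1" if "\<tau> \<in> ball \<tau>0 r" for \<tau>
      proof (rule integrable_continuous)
        have "continuous_on (cbox 0 1) (\<lambda>t. (\<lambda>(t, \<tau>). h t \<tau>) (t, \<tau>))"
          by (rule continuous_on_compose2[OF h]) (use that r in \<open>auto intro!: continuous_intros simp: box_real\<close>)
        then show "continuous_on (cbox 0 1) (\<lambda>t. h t \<tau>)" by simp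
      qed
    qed simp
    then show ?thesis using r(1) by (auto simp: box_real)
  qed
  show ?thesis
  proof -
    have "(\<lambda>\<tau>. integral {0..1} (\<lambda>t. h t \<tau>)) field_differentiable (at \<tau>)" if "\<tau> \<in> V" for \<tau>
      using loc[OF that] holomorphic_on_imp_differentiable_at by fastforce
    then show ?thesis by (simp add: holomorphic_on_def field_differentiable_at_within)
  qed
qed

section \<open>Taylor coefficients along a complex line and their Laurent expansion in
  \<open>w\<close>\<close>

definition slice_coeff ::
    "((complex ^ 'n) \<times> complex \<Rightarrow> complex) \<Rightarrow> complex ^ 'n \<Rightarrow> nat \<Rightarrow> complex \<Rightarrow> complex" where
  "slice_coeff f e k \<tau> = (deriv ^^ k) (\<lambda>\<mu>. f (\<mu> *s e, \<tau>)) 0 / fact k"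

text \<open>Two natural exponents for the power of \<open>w\<close>, since all negative powers occur.\<close>

definition hmono :: "complex ^ 'n \<Rightarrow> nat \<Rightarrow> nat \<Rightarrow> nat \<Rightarrow> (complex ^ 'n) \<times> complex \<Rightarrow> complex" where
  "hmono e k i N y = herm (fst y) e ^ k * snd y ^ i / snd y ^ N"

lemma cmean_eq_integral:
  assumes "continuous_on {0..1} (\<lambda>\<theta>. g (cis (2 * pi * \<theta>)))"
  shows "cmean g = integral {0..1} (\<lambda>\<theta>. g (cis (2 * pi * \<theta>)))"
proof -
  have "set_integrable lborel {0..1} (\<lambda>\<theta>. g (cis (2 * pi * \<theta>)))"
    unfolding set_integrable_def by (rule borel_integrable_compact[OF compact_Icc assms])
  then have "(LINT \<theta>:{0..1}|lborel. g (cis (2 * pi * \<theta>))) = integral {0..1} (\<lambda>\<theta>. g (cis (2 * pi * \<theta>)))"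
    by (rule set_borel_integral_eq_integral)
  then show ?thesis
    unfolding cmean_def set_lebesgue_integral_def by (subst integral_restrict_space) simp_all
qed

lemma norm_cmean_le:
  assumes "\<And>\<zeta>. norm \<zeta> = 1 \<Longrightarrow> norm (g \<zeta>) \<le> C"
  shows "norm (cmean g) \<le> C"
proof -
  have C: "C \<ge> 0" using order_trans[OF norm_ge_zero assms[of 1]] by simp
  show ?thesis
  proof (cases "integrable unit_interval (\<lambda>\<theta>. g (cis (2 * pi * \<theta>)))")
    case True
    have "norm (cmean g) \<le> (LINT \<theta>|unit_interval. norm (g (cis (2 * pi * \<theta>))))"
      unfolding cmean_def by (rule integral_norm_bound)
    also have "\<dots> \<le> (LINT \<theta>|unit_interval. C)"
    proof (intro integral_mono)
      interpret finite_measure unit_interval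
        by standard (simp add: space_restrict_space emeasure_restrict_space)
      show "integrable unit_interval (\<lambda>\<theta>. C)" by simp
    qed (use True assms in auto)
    also have "\<dots> = C" by (simp add: measure_def space_restrict_space emeasure_restrict_space)
    finally show ?thesis .
  qed (use C in \<open>simp add: cmean_def not_integrable_integral_eq\<close>)
qed

context
  fixes m l :: nat and f :: "(complex ^ 'n) \<times> complex \<Rightarrow> complex" and e :: "complex ^ 'n"
  assumes m: "m > 0" and l: "l > 0" and e: "norm e = 1"
    and hol: "holomorphic_several f (hartogs m l)"
begin

lemma scaled_mem_hartogs: "(\<mu> *s e, \<tau>) \<in> hartogs m l \<longleftrightarrow> norm \<mu> ^ m < norm \<tau> ^ l \<and> norm \<tau> ^ l < 1"
  by (simp add: hartogs_def norm_scale_vec e)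

lemma mem_hartogs_mono: "(z, \<tau>) \<in> hartogs m l \<Longrightarrow> norm z' \<le> norm z \<Longrightarrow> (z', \<tau>) \<in> hartogs m l"
  by (auto simp: hartogs_def intro: le_less_trans[OF power_mono])

lemma slice_ball:
  assumes "(\<nu> *s e, \<tau>) \<in> hartogs m l"
  obtains R where "norm \<nu> < R" "\<And>\<mu>. \<mu> \<in> ball 0 R \<Longrightarrow> (\<mu> *s e, \<tau>) \<in> hartogs m l"
    "(\<lambda>\<mu>. f (\<mu> *s e, \<tau>)) holomorphic_on ball 0 R"
proof -
  define R where "R = root m (norm \<tau> ^ l)"
  have R: "norm \<mu> < R \<longleftrightarrow> norm \<mu> ^ m < norm \<tau> ^ l" for \<mu> :: complex
    using m real_root_less_iff[of m "norm \<mu> ^ m" "norm \<tau> ^ l"] by (simp add: R_def real_root_power_cancel)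
  have *: "(\<mu> *s e, \<tau>) \<in> hartogs m l" if "\<mu> \<in> ball 0 R" for \<mu>
    using that R assms by (simp add: scaled_mem_hartogs)
  have "(\<lambda>\<mu>. f (0 + \<mu> *s e, \<tau> + \<mu> * 0)) holomorphic_on ball 0 R"
    by (rule holomorphic_several_line[OF hol]) (use * in simp_all)
  with * show ?thesis using assms R by (intro that[of R]) (simp_all add: scaled_mem_hartogs)
qed

lemma slice_sums:
  assumes "(\<nu> *s e, \<tau>) \<in> hartogs m l"
  shows "(\<lambda>k. slice_coeff f e k \<tau> * \<nu> ^ k) sums f (\<nu> *s e, \<tau>)"
proof -
  obtain R where R: "norm \<nu> < R" "(\<lambda>\<mu>. f (\<mu> *s e, \<tau>)) holomorphic_on ball 0 R"
    using slice_ball[OF assms] by metis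
  from holomorphic_power_series[OF R(2), of \<nu>] R(1)
  show ?thesis by (simp add: slice_coeff_def)
qed

lemma slice_cmean:
  assumes "(\<nu> *s e, \<tau>) \<in> hartogs m l"
  shows "cmean (\<lambda>\<zeta>. f ((\<zeta> * \<nu>) *s e, \<tau>) * cnj \<zeta> ^ k) = slice_coeff f e k \<tau> * \<nu> ^ k"
proof -
  obtain R where R: "norm \<nu> < R" "(\<lambda>\<mu>. f (\<mu> *s e, \<tau>)) holomorphic_on ball 0 R"
    using slice_ball[OF assms] by metis
  define V where "V = {\<zeta>. norm (\<nu> * \<zeta>) < R}"
  have V: "open V" unfolding V_def by (intro open_Collect_less continuous_intros)
  have cV: "cball 0 1 \<subseteq> V"
  proof
    fix \<zeta> :: complex assume "\<zeta> \<in> cball 0 1"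
    then have "norm (\<nu> * \<zeta>) \<le> norm \<nu>" by (simp add: norm_mult mult_left_le)
    then show "\<zeta> \<in> V" using R by (simp add: V_def)
  qed
  have hV: "(\<lambda>\<zeta>. f ((\<nu> * \<zeta>) *s e, \<tau>)) holomorphic_on V"
  proof -
    have "(\<lambda>\<zeta>. \<nu> * \<zeta>) holomorphic_on V" "(\<lambda>\<zeta>. \<nu> * \<zeta>) ` V \<subseteq> ball 0 R"
      by (auto simp: V_def intro!: holomorphic_intros)
    from holomorphic_on_compose_gen[OF this(1) R(2) this(2)] show ?thesis by (simp add: o_def)
  qed
  have "cmean (\<lambda>\<zeta>. f ((\<nu> * \<zeta>) *s e, \<tau>) * cnj \<zeta> ^ k) = (deriv ^^ k) (\<lambda>\<zeta>. f ((\<nu> * \<zeta>) *s e, \<tau>)) 0 / fact k"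
    using holomorphic_on_subset[OF hV] cV ball_subset_cball[of 0 1]
    by (intro cmean_coefficient holomorphic_on_imp_continuous_on) blast+
  also have "(deriv ^^ k) (\<lambda>\<zeta>. f ((\<nu> * \<zeta>) *s e, \<tau>)) 0 = \<nu> ^ k * (deriv ^^ k) (\<lambda>\<mu>. f (\<mu> *s e, \<tau>)) (\<nu> * 0)"
    by (rule higher_deriv_compose_linear[OF R(2) V])
       (use norm_ge_zero[of \<nu>] R(1) in \<open>auto simp: V_def simp del: norm_ge_zero\<close>)
  finally show ?thesis by (simp add: slice_coeff_def mult.commute)
qed

text \<open>The radius of the fibre varies with \<open>\<tau>\<close>, but a circle of one fixed
  radius \<open>\<rho>\<close> lies in all fibres over a neighbourhood of \<open>\<tau>0\<close>.
  The coefficient is the Cauchy integral over that circle, whose integrand is holomorphic in the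
  parameter \<open>\<tau>\<close>.\<close>

lemma slice_coeff_holomorphic: "slice_coeff f e k holomorphic_on ball 0 1 - {0}"
proof -
  have "slice_coeff f e k field_differentiable (at \<tau>0)" if \<tau>0: "\<tau>0 \<in> ball 0 1 - {0}" for \<tau>0
  proof -
    \<comment> \<open>Half of \<open>norm \<tau>0 ^ l\<close> works for every
      \<open>m \<ge> 1\<close>, since \<open>\<rho> ^ m \<le> \<rho>\<close> for
      \<open>\<rho> \<le> 1\<close>; this avoids roots.\<close>
    define \<rho> where "\<rho> = norm \<tau>0 ^ l / 2"
    have l1: "norm \<tau>0 ^ l < 1" "norm \<tau>0 ^ l > 0" using \<tau>0 l by (auto simp: power_less_one_iff)
    have \<rho>: "\<rho> > 0" "\<rho> ^ m < norm \<tau>0 ^ l"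
    proof -
      show "\<rho> > 0" using l1 by (simp add: \<rho>_def)
      have "\<rho> ^ m \<le> \<rho> ^ 1" using m l1 by (intro power_decreasing) (auto simp: \<rho>_def)
      also have "\<dots> < norm \<tau>0 ^ l" using l1 by (simp add: \<rho>_def)
      finally show "\<rho> ^ m < norm \<tau>0 ^ l" .
    qed
    define V where "V = {\<tau> :: complex. \<rho> ^ m < norm \<tau> ^ l \<and> norm \<tau> ^ l < 1}"
    have V: "open V" unfolding V_def by (intro open_Collect_conj open_Collect_less continuous_intros)
    have memV: "((cis t * \<rho>) *s e, \<tau>) \<in> hartogs m l" if "\<tau> \<in> V" for t \<tau>
      using that \<rho> by (simp add: scaled_mem_hartogs V_def norm_mult)
    have memV': "(complex_of_real \<rho> *s e, \<tau>) \<in> hartogs m l" if "\<tau> \<in> V" for \<tau>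
      using memV[OF that, of 0] by simp
    define h where "h = (\<lambda>t \<tau>. f ((cis (2 * pi * t) * \<rho>) *s e, \<tau>) * cnj (cis (2 * pi * t)) ^ k)"
    have hc: "continuous_on ({0..1} \<times> V) (\<lambda>(t, \<tau>). h t \<tau>)"
    proof -
      have "continuous_on ({0..1} \<times> V) (\<lambda>x. f ((cis (2 * pi * fst x) * \<rho>) *s e, snd x))"
        by (rule continuous_on_compose2[OF holomorphic_several_continuous[OF hol]])
           (auto intro!: continuous_intros memV)
      then have "continuous_on ({0..1} \<times> V) (\<lambda>x. f ((cis (2 * pi * fst x) * \<rho>) *s e, snd x) * cnj (cis (2 * pi * fst x)) ^ k)"
        by (intro continuous_on_mult) (auto intro!: continuous_intros)
      then show ?thesis by (simp add: h_def case_prod_beta')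
    qed
    have hh: "h t holomorphic_on V" for t
    proof -
      have "(\<lambda>\<mu>. f ((cis (2 * pi * t) * \<rho>) *s e + \<mu> *s 0, 0 + \<mu> * 1)) holomorphic_on V"
        by (rule holomorphic_several_line[OF hol V]) (use memV in simp)
      then show ?thesis unfolding h_def by (intro holomorphic_intros) simp
    qed
    have H: "(\<lambda>\<tau>. integral {0..1} (\<lambda>t. h t \<tau>)) holomorphic_on V"
      by (rule holomorphic_integral_param[OF hc V hh])
    have eq: "slice_coeff f e k \<tau> = integral {0..1} (\<lambda>t. h t \<tau>) / \<rho> ^ k" if "\<tau> \<in> V" for \<tau>
    proof -
      have "continuous_on {0..1} (\<lambda>t. (\<lambda>(t, \<tau>). h t \<tau>) (t, \<tau>))"
        by (rule continuous_on_compose2[OF hc]) (use that in \<open>auto intro!: continuous_intros\<close>)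
      then have c: "continuous_on {0..1} (\<lambda>t. h t \<tau>)" by simp
      have "cmean (\<lambda>\<zeta>. f ((\<zeta> * \<rho>) *s e, \<tau>) * cnj \<zeta> ^ k) = integral {0..1} (\<lambda>t. h t \<tau>)"
        using cmean_eq_integral[of "\<lambda>\<zeta>. f ((\<zeta> * \<rho>) *s e, \<tau>) * cnj \<zeta> ^ k"] c by (simp add: h_def)
      then show ?thesis using slice_cmean[OF memV'[OF that], of k] \<rho> by (simp add: field_simps)
    qed
    have "(\<lambda>\<tau>. integral {0..1} (\<lambda>t. h t \<tau>) / \<rho> ^ k) holomorphic_on V"
      using \<rho> by (intro holomorphic_intros H) auto
    then have "slice_coeff f e k holomorphic_on V"
      by (rule holomorphic_transform) (simp add: eq)
    moreover have "\<tau>0 \<in> V" using \<rho> l1 by (simp add: V_def)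
    ultimately show ?thesis using V holomorphic_on_imp_differentiable_at by blast
  qed
  then show ?thesis by (simp add: holomorphic_on_def field_differentiable_at_within)
qed

text \<open>Moving \<open>\<tau>\<close> by a fraction \<open>\<kappa>\<close> of its modulus
  shrinks \<open>norm \<tau> ^ l\<close> at most by the factor
  \<open>(1 - \<kappa>) ^ l \<ge> 1 - l * \<kappa> \<ge> 3/4\<close> (Bernoulli), while
  \<open>norm z\<close> stays below \<open>(1/2 + \<kappa>) * norm \<tau> ^ l\<close>, hence below
  \<open>3/4\<close> of it. The constant \<open>\<kappa> = 1 / (4 * (l + 1))\<close> is chosen for
  these two comparisons.\<close>

lemma ball_subset_hartogs:
  assumes \<tau>: "0 < norm \<tau>" "norm \<tau> < 1/2" and \<mu>: "norm \<mu> = norm \<tau> ^ l / 2"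
  shows "ball (\<mu> *s e, \<tau>) (norm \<tau> ^ l / (4 * (real l + 1))) \<subseteq> hartogs m l"
proof
  define \<kappa> where "\<kappa> = 1 / (4 * (real l + 1))"
  have \<kappa>: "0 < \<kappa>" "\<kappa> \<le> 1/8" "real l * \<kappa> \<le> 1/4" using l by (auto simp: \<kappa>_def field_simps)
  define t where "t = norm \<tau>"
  have tl: "0 < t ^ l" "t ^ l \<le> t" using \<tau> l power_decreasing[of 1 l t] by (auto simp: t_def)
  fix y assume "y \<in> ball (\<mu> *s e, \<tau>) (norm \<tau> ^ l / (4 * (real l + 1)))"
  then have d: "norm (y - (\<mu> *s e, \<tau>)) < \<kappa> * t ^ l" by (simp add: dist_norm norm_minus_commute \<kappa>_def t_def)
  obtain z w where y: "y = (z, w)" by (cases y)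
  have dz: "norm (z - \<mu> *s e) < \<kappa> * t ^ l" and dw: "norm (w - \<tau>) < \<kappa> * t ^ l"
    using d norm_fst_le[of "z - \<mu> *s e" "w - \<tau>"] norm_snd_le[of "w - \<tau>" "z - \<mu> *s e"] by (auto simp: y)
  have "norm z \<le> norm (z - \<mu> *s e) + norm (\<mu> *s e)" using norm_triangle_sub[of z "\<mu> *s e"] by simp
  also have "\<dots> < \<kappa> * t ^ l + t ^ l / 2" using dz by (simp add: norm_scale_vec e \<mu> t_def)
  finally have z: "norm z < (\<kappa> + 1/2) * t ^ l" by (simp add: algebra_simps)
  also have "\<dots> \<le> (3/4) * t ^ l" using \<kappa> tl by (intro mult_right_mono) auto
  finally have z: "norm z < (3/4) * t ^ l" .
  have kt: "\<kappa> * t ^ l \<le> \<kappa> * t" using \<kappa> tl by simp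
  have w1: "norm w \<ge> (1 - \<kappa>) * t"
    using dw kt norm_triangle_ineq2[of \<tau> w] by (simp add: t_def norm_minus_commute algebra_simps)
  have "(3/4) * t ^ l \<le> (1 + real l * (- \<kappa>)) * t ^ l" using \<kappa> tl by (intro mult_right_mono) auto
  also have "\<dots> \<le> (1 + (- \<kappa>)) ^ l * t ^ l"
    using \<kappa> tl by (intro mult_right_mono Bernoulli_inequality) auto
  also have "\<dots> = ((1 - \<kappa>) * t) ^ l" by (simp add: power_mult_distrib)
  also have "\<dots> \<le> norm w ^ l" using w1 \<kappa> \<tau> by (intro power_mono) (auto simp: t_def)
  finally have w2: "(3/4) * t ^ l \<le> norm w ^ l" .
  have w3: "norm w < 1"
  proof -
    have "norm w \<le> norm (w - \<tau>) + norm \<tau>" using norm_triangle_sub[of w \<tau>] by simp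
    also have "\<dots> < \<kappa> * t + t" using dw kt by (simp add: t_def)
    also have "\<dots> \<le> 1/8 * (1/2) + 1/2" using \<kappa> \<tau> by (intro add_mono mult_mono) (auto simp: t_def)
    finally show ?thesis by simp
  qed
  have w4: "norm w ^ l < 1" using w3 l by (simp add: power_less_one_iff)
  have "norm z \<le> 1" using z tl \<tau> by (simp add: t_def)
  then have "norm z ^ m \<le> norm z ^ 1" using m by (intro power_decreasing) auto
  then show "y \<in> hartogs m l" using z w2 w4 by (simp add: y hartogs_def)
qed

text \<open>At \<open>w = 0\<close> the coefficient has at worst a pole. The \<open>L2\<close>
  estimate on balls of radius proportional to \<open>norm \<tau> ^ l\<close> bounds it by a power of
  \<open>1 / norm \<tau>\<close>, and after multiplication by \<open>\<tau> ^ N\<close> the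
  singularity is removable. The order \<open>N\<close> found here is far from sharp; its lower bound
  ensures that \<open>N\<close> is at least the largest admissible pole order
  \<open>eidx m l n k + 1\<close>.\<close>

lemma slice_coeff_extends:
  assumes I: "integrable lborel (\<lambda>y. indicator (hartogs m l) y * (norm (f y))\<^sup>2)"
  shows "\<exists>B N. B holomorphic_on ball 0 1 \<and> N \<ge> l * (k + CARD('n)) \<and>
    (\<forall>\<tau>\<in>ball 0 1 - {0}. slice_coeff f e k \<tau> = B \<tau> / \<tau> ^ N)"
proof -
  define D where "D = DIM((complex ^ 'n) \<times> complex)"
  define v where "v = unit_ball_vol (real D)"
  have v: "v > 0" unfolding v_def by (rule unit_ball_vol_pos) simp
  define Q where "Q = L2_sq (hartogs m l) f"
  have Q: "Q \<ge> 0" unfolding Q_def L2_sq_def by (rule Bochner_Integration.integral_nonneg) simp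
  define N where "N = l * k + l * D"
  define \<kappa> where "\<kappa> = 1 / (4 * (real l + 1))"
  have \<kappa>: "\<kappa> > 0" by (simp add: \<kappa>_def)
  define C where "C = 2 ^ k * (1 + Q / (v * \<kappa> ^ D))"
  have bound: "norm (slice_coeff f e k \<tau> * \<tau> ^ N) \<le> C" if \<tau>: "0 < norm \<tau>" "norm \<tau> < 1/2" for \<tau>
  proof -
    define t where "t = norm \<tau>"
    have t: "0 < t" "t < 1" using \<tau> by (auto simp: t_def)
    define \<rho> where "\<rho> = t ^ l / 2"
    have \<rho>: "\<rho> > 0" using t by (simp add: \<rho>_def)
    have sub: "ball ((\<zeta> * complex_of_real \<rho>) *s e, \<tau>) (\<kappa> * t ^ l) \<subseteq> hartogs m l" if "norm \<zeta> = 1" for \<zeta>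
    proof -
      have "norm (\<zeta> * complex_of_real \<rho>) = norm \<tau> ^ l / 2" using that \<rho> by (simp add: norm_mult) (simp add: \<rho>_def t_def)
      from ball_subset_hartogs[OF \<tau> this] show ?thesis by (simp add: t_def \<kappa>_def)
    qed
    have mem: "(complex_of_real \<rho> *s e, \<tau>) \<in> hartogs m l"
      using sub[of 1] \<kappa> t by auto
    have fb: "norm (f ((\<zeta> * complex_of_real \<rho>) *s e, \<tau>)) \<le> 1 + Q / (v * (\<kappa> * t ^ l) ^ D)" if "norm \<zeta> = 1" for \<zeta>
    proof -
      have "measure lborel (ball ((\<zeta> * complex_of_real \<rho>) *s e, \<tau>) (\<kappa> * t ^ l)) = v * (\<kappa> * t ^ l) ^ D"
        unfolding v_def D_def using \<kappa> t by (intro content_ball) auto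
      then show ?thesis
        using norm_le_L2_ball[OF hol open_hartogs sub[OF that] _ I] \<kappa> t by (simp add: Q_def)
    qed
    have "norm (slice_coeff f e k \<tau> * \<rho> ^ k) = norm (cmean (\<lambda>\<zeta>. f ((\<zeta> * \<rho>) *s e, \<tau>) * cnj \<zeta> ^ k))"
      using slice_cmean[OF mem] by simp
    also have "\<dots> \<le> 1 + Q / (v * (\<kappa> * t ^ l) ^ D)"
      using fb by (intro norm_cmean_le) (auto simp: norm_mult norm_power)
    finally have s: "norm (slice_coeff f e k \<tau>) * \<rho> ^ k \<le> 1 + Q / (v * (\<kappa> * t ^ l) ^ D)"
      using \<rho> by (simp add: norm_mult norm_power)
    have "norm (slice_coeff f e k \<tau> * \<tau> ^ N) = 2 ^ k * (norm (slice_coeff f e k \<tau>) * \<rho> ^ k) * t ^ (l * D)"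
      by (simp add: norm_mult norm_power N_def \<rho>_def power_add power_mult power_divide flip: t_def)
    also have "\<dots> \<le> 2 ^ k * (1 + Q / (v * (\<kappa> * t ^ l) ^ D)) * t ^ (l * D)"
      using s t by (intro mult_right_mono mult_left_mono) auto
    also have "\<dots> = 2 ^ k * (t ^ (l * D) + Q / (v * \<kappa> ^ D))"
      using t v \<kappa> by (simp add: power_mult_distrib power_mult[symmetric] field_simps)
    also have "\<dots> \<le> C"
      unfolding C_def using t by (intro mult_left_mono add_right_mono power_le_one) auto
    finally show ?thesis .
  qed
  have hN: "(\<lambda>\<tau>. slice_coeff f e k \<tau> * \<tau> ^ N) holomorphic_on ball 0 1 - {0}"
    by (intro holomorphic_intros slice_coeff_holomorphic)
  have "eventually (\<lambda>\<tau>. norm (slice_coeff f e k \<tau> * \<tau> ^ N) \<le> C) (at 0)"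
    unfolding eventually_at by (rule exI[of _ "1/2"]) (use bound in auto)
  then have "\<exists>B. eventually (\<lambda>\<tau>. norm (slice_coeff f e k \<tau> * \<tau> ^ N) \<le> B) (at 0)" ..
  then obtain B where B: "B holomorphic_on ball 0 1" "\<forall>\<tau>\<in>ball 0 1 - {0}. B \<tau> = slice_coeff f e k \<tau> * \<tau> ^ N"
    using holomorphic_on_extend_bounded[OF hN] by auto
  have "D = 2 * CARD('n) + 2" by (simp add: D_def)
  then have "N \<ge> l * (k + CARD('n))" by (simp add: N_def algebra_simps)
  then show ?thesis using B by (intro exI[of _ B] exI[of _ N]) auto
qed

text \<open>The weight depends on \<open>norm z\<close> and \<open>norm w\<close> only and survives
  three successive averages over rotations, each of which keeps one piece of the expansion of
  \<open>f\<close>. What remains is a multiple of the monomial itself. The factor is a Taylor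
  coefficient of \<open>B\<close> and hence the same for every weight \<open>W\<close>; this is used
  with truncated weights.\<close>

lemma weighted_coefficient:
  fixes W :: "real \<Rightarrow> real"
  assumes B: "B holomorphic_on ball 0 1" "\<forall>\<tau>\<in>ball 0 1 - {0}. slice_coeff f e k \<tau> = B \<tau> / \<tau> ^ N"
    and I: "integrable lborel (\<lambda>y. (indicator (hartogs m l) y * W (hY m y)) *\<^sub>R (f y * cnj (hmono e k i N y)))"
  shows "(LINT y|lborel. (indicator (hartogs m l) y * W (hY m y)) *\<^sub>R (f y * cnj (hmono e k i N y))) =
    (deriv ^^ i) B 0 / fact i * complex_of_real (LINT y|lborel. indicator (hartogs m l) y * W (hY m y) * (norm (hmono e k i N y))\<^sup>2)"
    (is "_ = ?\<beta> * _")
proof -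
  define c where "c = (\<lambda>\<theta>::real. cis (2 * pi * \<theta>))"
  have c: "norm (c \<theta>) = 1" for \<theta> by (simp add: c_def)
  have ccont: "continuous_on A c" for A unfolding c_def by (intro continuous_intros)
  define w where "w = (\<lambda>y :: (complex ^ 'n) \<times> complex. indicator (hartogs m l) y * W (hY m y))"
  have w_eq: "w y' = w y" if "norm (fst y') = norm (fst y)" "norm (snd y') = norm (snd y)" for y y'
  proof -
    have "y' \<in> hartogs m l \<longleftrightarrow> y \<in> hartogs m l"
      using that by (cases y; cases y') (simp add: hartogs_def)
    then show ?thesis using that by (simp add: w_def hY_def indicator_def)
  qed
  have w_0: "w y = 0" if "y \<notin> hartogs m l" for y using that by (simp add: w_def)
  define P where "P = (\<lambda>z. herm z e *s e)"
  have ee: "herm e e = 1" using e by (simp add: herm_self)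
  have hP: "herm (P z) e = herm z e" for z by (simp add: P_def herm_scale_left ee)
  have nP: "norm (P z) = norm (herm z e)" for z by (simp add: P_def norm_scale_vec e)
  have Pmem: "(P z, \<tau>) \<in> hartogs m l" if "(z, \<tau>) \<in> hartogs m l" for z \<tau>
    by (rule mem_hartogs_mono[OF that]) (use norm_herm_le[of z e] e in \<open>simp add: nP\<close>)
  \<comment> \<open>\<open>U \<zeta>\<close> multiplies the component of \<open>z\<close> orthogonal
    to \<open>e\<close> by \<open>\<zeta>\<close>. It does not increase the norm for
    \<open>norm \<zeta> \<le> 1\<close>, is an isometry on the unit circle, and at
    \<open>\<zeta> = 0\<close> is the projection \<open>P\<close> onto the line of
    \<open>e\<close>.\<close>
  define U where "U = (\<lambda>\<zeta> z. P z + \<zeta> *s (z - P z))"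
  have hU: "herm (U \<zeta> z) e = herm z e" for \<zeta> z
    by (simp add: U_def herm_add_left herm_scale_left herm_diff_left hP)
  have nU2: "(norm (U \<zeta> z))\<^sup>2 = (norm (P z))\<^sup>2 + (norm \<zeta>)\<^sup>2 * (norm (z - P z))\<^sup>2" for \<zeta> z
  proof -
    have 1: "herm (z - P z) (P z) = 0" by (simp add: P_def herm_scale_right herm_diff_left herm_scale_left ee)
    then have 2: "herm (P z) (z - P z) = 0" by (metis cnj_herm complex_cnj_zero)
    have "herm (p + \<zeta> *s v) (p + \<zeta> *s v) = herm p p + \<zeta> * cnj \<zeta> * herm v v" if "herm v p = 0" "herm p v = 0" for p v
      using that by (simp add: herm_add_left herm_add_right herm_scale_left herm_scale_right)
    from this[OF 1 2] have "complex_of_real ((norm (U \<zeta> z))\<^sup>2) = herm (P z) (P z) + \<zeta> * cnj \<zeta> * herm (z - P z) (z - P z)"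
      unfolding herm_self[symmetric] U_def .
    also have "\<dots> = complex_of_real ((norm (P z))\<^sup>2 + (norm \<zeta>)\<^sup>2 * (norm (z - P z))\<^sup>2)"
      by (simp only: herm_self complex_norm_square[symmetric] of_real_add of_real_mult)
    finally show ?thesis by (simp only: of_real_eq_iff)
  qed
  have nU: "norm (U \<zeta> z) \<le> norm z" if "norm \<zeta> \<le> 1" for \<zeta> z
  proof -
    have "(norm (U \<zeta> z))\<^sup>2 \<le> (norm (U 1 z))\<^sup>2"
      unfolding nU2 using that by (intro add_left_mono mult_right_mono) (auto simp: power_le_one)
    then show ?thesis by (simp add: U_def)
  qed
  have nU1: "norm (U \<zeta> z) = norm z" if "norm \<zeta> = 1" for \<zeta> z
  proof -
    have "(norm (U \<zeta> z))\<^sup>2 = (norm (U 1 z))\<^sup>2" unfolding nU2 using that by simp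
    then show ?thesis by (simp add: U_def)
  qed
  have Ucont: "continuous_on A (\<lambda>x. U (g x) (h x))" if "continuous_on A g" "continuous_on A h" for A g h
    unfolding U_def P_def by (intro continuous_intros that)
  have linU: "linear (U \<zeta>)" for \<zeta>
    by (intro linearI) (simp_all add: U_def P_def herm_add_left scaleR_eq_scale_vec herm_scale_left vec_eq_iff algebra_simps)
  define F0 where "F0 = (\<lambda>y. w y *\<^sub>R (f y * cnj (hmono e k i N y)))"
  define F1 where "F1 = (\<lambda>y. w y *\<^sub>R (f (P (fst y), snd y) * cnj (hmono e k i N y)))"
  define F2 where "F2 = (\<lambda>y. w y *\<^sub>R (slice_coeff f e k (snd y) * herm (fst y) e ^ k * cnj (hmono e k i N y)))"
  define F3 where "F3 = (\<lambda>y. w y *\<^sub>R (?\<beta> * (hmono e k i N y * cnj (hmono e k i N y))))"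
  have I0: "integrable lborel F0" using I by (simp add: F0_def w_def)

  \<comment> \<open>First average: the mean value property in \<open>\<zeta>\<close> replaces
    \<open>f\<close> by its value on the line of \<open>e\<close>, while
    \<open>herm (fst y) e\<close>, and with it the monomial, is unchanged.\<close>
  define T1 where "T1 = (\<lambda>\<theta> (y :: (complex ^ 'n) \<times> complex). (U (c \<theta>) (fst y), 1 * snd y))"
  have T1: "continuous_on UNIV (\<lambda>x. T1 (fst x) (snd x))" "\<And>\<theta>. distr lborel borel (T1 \<theta>) = lborel"
  proof -
    show "continuous_on UNIV (\<lambda>x. T1 (fst x) (snd x))"
      unfolding T1_def by (intro continuous_intros Ucont continuous_on_compose2[OF ccont[of UNIV]]) auto
    show "distr lborel borel (T1 \<theta>) = lborel" for \<theta>
      unfolding T1_def by (rule distr_isometry_pair) (simp_all add: linU nU1 c)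
  qed
  have A1: "(LINT \<theta>|unit_interval. F0 (T1 \<theta> y)) = F1 y" for y
  proof (cases "y \<in> hartogs m l")
    case False
    then show ?thesis using w_eq[of "T1 _ y" y] w_0[OF False] by (simp add: F0_def F1_def T1_def nU1 c)
  next
    case True
    define z where "z = fst y"
    define \<tau> where "\<tau> = snd y"
    have zt: "(z, \<tau>) \<in> hartogs m l" using True by (simp add: z_def \<tau>_def)
    define V where "V = (\<lambda>\<zeta>. (U \<zeta> z, \<tau>)) -` hartogs m l"
    have V: "open V" unfolding V_def by (intro open_vimage open_hartogs continuous_intros Ucont)
    have cV: "cball 0 1 \<subseteq> V" using mem_hartogs_mono[OF zt nU] by (auto simp: V_def)
    have hV: "(\<lambda>\<zeta>. f (U \<zeta> z, \<tau>)) holomorphic_on V"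
      using holomorphic_several_line[OF hol V, of "P z" "z - P z" \<tau> 0] by (simp add: V_def U_def)
    have "cmean (\<lambda>\<zeta>. f (U \<zeta> z, \<tau>) * cnj \<zeta> ^ 0) = (deriv ^^ 0) (\<lambda>\<zeta>. f (U \<zeta> z, \<tau>)) 0 / fact 0"
      using holomorphic_on_subset[OF hV] cV ball_subset_cball[of 0 1]
      by (intro cmean_coefficient holomorphic_on_imp_continuous_on) blast+
    then have cm: "cmean (\<lambda>\<zeta>. f (U \<zeta> z, \<tau>)) = f (P z, \<tau>)" by (simp add: U_def)
    have "F0 (T1 \<theta> y) = (w y *\<^sub>R cnj (hmono e k i N y)) * f (U (c \<theta>) z, \<tau>)" for \<theta>
      using w_eq[of "T1 \<theta> y" y] by (simp add: F0_def T1_def nU1 c hmono_def hU z_def \<tau>_def)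
    then have "(LINT \<theta>|unit_interval. F0 (T1 \<theta> y)) = (w y *\<^sub>R cnj (hmono e k i N y)) * cmean (\<lambda>\<zeta>. f (U \<zeta> z, \<tau>))"
      by (simp add: cmean_def c_def)
    then show ?thesis unfolding cm by (simp add: F1_def z_def \<tau>_def)
  qed
  have I1: "integrable lborel F1" "(LINT y|lborel. F0 y) = (LINT y|lborel. F1 y)"
    using integral_average[OF I0 T1] by (simp_all add: A1)

  \<comment> \<open>Second average: rotating \<open>z\<close> as a whole against the
    \<open>k\<close>-th power in the conjugated monomial leaves the \<open>k\<close>-th Taylor
    coefficient.\<close>
  define T2 where "T2 = (\<lambda>\<theta> (y :: (complex ^ 'n) \<times> complex). (c \<theta> *s fst y, 1 * snd y))"
  have T2: "continuous_on UNIV (\<lambda>x. T2 (fst x) (snd x))" "\<And>\<theta>. distr lborel borel (T2 \<theta>) = lborel"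
  proof -
    show "continuous_on UNIV (\<lambda>x. T2 (fst x) (snd x))"
      unfolding T2_def by (intro continuous_intros continuous_on_compose2[OF ccont[of UNIV]]) auto
    show "distr lborel borel (T2 \<theta>) = lborel" for \<theta>
      unfolding T2_def by (rule distr_isometry_pair) (simp_all add: linear_scale_vec norm_scale_vec c)
  qed
  have A2: "(LINT \<theta>|unit_interval. F1 (T2 \<theta> y)) = F2 y" for y
  proof (cases "y \<in> hartogs m l")
    case False
    then show ?thesis using w_eq[of "T2 _ y" y] w_0[OF False] by (simp add: F1_def F2_def T2_def norm_scale_vec c)
  next
    case True
    define \<nu> where "\<nu> = herm (fst y) e"
    have mem: "(\<nu> *s e, snd y) \<in> hartogs m l" using Pmem[of "fst y" "snd y"] True by (simp add: P_def \<nu>_def)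
    have "F1 (T2 \<theta> y) = (w y *\<^sub>R cnj (hmono e k i N y)) * (f ((c \<theta> * \<nu>) *s e, snd y) * cnj (c \<theta>) ^ k)" for \<theta>
      using w_eq[of "T2 \<theta> y" y]
      by (simp add: F1_def T2_def norm_scale_vec c hmono_def P_def herm_scale_left \<nu>_def power_mult_distrib mult_ac)
    then have "(LINT \<theta>|unit_interval. F1 (T2 \<theta> y)) = (w y *\<^sub>R cnj (hmono e k i N y)) * cmean (\<lambda>\<zeta>. f ((\<zeta> * \<nu>) *s e, snd y) * cnj \<zeta> ^ k)"
      by (simp add: cmean_def c_def)
    then show ?thesis unfolding slice_cmean[OF mem] by (simp add: F2_def \<nu>_def mult_ac)
  qed
  have I2: "integrable lborel F2" "(LINT y|lborel. F1 y) = (LINT y|lborel. F2 y)"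
    using integral_average[OF I1(1) T2] by (simp_all add: A2)

  \<comment> \<open>Third average: rotating \<open>w\<close> leaves the \<open>i\<close>-th
    coefficient of \<open>B\<close>, because the factors coming from the two powers
    \<open>\<tau> ^ N\<close> have modulus 1 and cancel.\<close>
  define T3 where "T3 = (\<lambda>\<theta> (y :: (complex ^ 'n) \<times> complex). (id (fst y), c \<theta> * snd y))"
  have T3: "continuous_on UNIV (\<lambda>x. T3 (fst x) (snd x))" "\<And>\<theta>. distr lborel borel (T3 \<theta>) = lborel"
  proof -
    show "continuous_on UNIV (\<lambda>x. T3 (fst x) (snd x))"
      unfolding T3_def id_def by (intro continuous_intros continuous_on_compose2[OF ccont[of UNIV]]) auto
    show "distr lborel borel (T3 \<theta>) = lborel" for \<theta>
      unfolding T3_def by (rule distr_isometry_pair) (auto simp: c intro: linearI)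
  qed
  have A3: "(LINT \<theta>|unit_interval. F2 (T3 \<theta> y)) = F3 y" for y
  proof (cases "y \<in> hartogs m l")
    case False
    then show ?thesis using w_eq[of "T3 _ y" y] w_0[OF False] by (simp add: F2_def F3_def T3_def norm_mult c)
  next
    case True
    define \<tau> where "\<tau> = snd y"
    define \<nu> where "\<nu> = herm (fst y) e"
    have \<tau>: "0 < norm \<tau>" "norm \<tau> < 1"
    proof -
      have "(fst y, \<tau>) \<in> hartogs m l" using True by (simp add: \<tau>_def)
      then have 1: "norm (fst y) ^ m < norm \<tau> ^ l" "norm \<tau> ^ l < 1" by (auto simp: hartogs_def)
      then show "norm \<tau> < 1" by (simp add: power_less_one_iff)
      have "0 < norm \<tau> ^ l" using 1(1) by (rule le_less_trans[rotated]) simp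
      then show "0 < norm \<tau>" using l by (cases "\<tau> = 0") (auto simp: zero_power)
    qed
    define V where "V = {\<zeta>. norm (\<tau> * \<zeta>) < 1}"
    have V: "open V" unfolding V_def by (intro open_Collect_less continuous_intros)
    have cV: "cball 0 1 \<subseteq> V"
    proof
      fix \<zeta> :: complex assume "\<zeta> \<in> cball 0 1"
      then have "norm (\<tau> * \<zeta>) \<le> norm \<tau>" by (simp add: norm_mult mult_left_le)
      then show "\<zeta> \<in> V" using \<tau> by (simp add: V_def)
    qed
    have hV: "(\<lambda>\<zeta>. B (\<tau> * \<zeta>)) holomorphic_on V"
    proof -
      have "(\<lambda>\<zeta>. \<tau> * \<zeta>) holomorphic_on V" "(\<lambda>\<zeta>. \<tau> * \<zeta>) ` V \<subseteq> ball 0 1"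
        by (auto simp: V_def intro!: holomorphic_intros)
      from holomorphic_on_compose_gen[OF this(1) B(1) this(2)] show ?thesis by (simp add: o_def)
    qed
    have "cmean (\<lambda>\<zeta>. B (\<tau> * \<zeta>) * cnj \<zeta> ^ i) = (deriv ^^ i) (\<lambda>\<zeta>. B (\<tau> * \<zeta>)) 0 / fact i"
      using holomorphic_on_subset[OF hV] cV ball_subset_cball[of 0 1]
      by (intro cmean_coefficient holomorphic_on_imp_continuous_on) blast+
    also have "(deriv ^^ i) (\<lambda>\<zeta>. B (\<tau> * \<zeta>)) 0 = \<tau> ^ i * (deriv ^^ i) B (\<tau> * 0)"
      by (rule higher_deriv_compose_linear[OF B(1) V]) (use cV in \<open>auto simp: V_def\<close>)
    finally have cm: "cmean (\<lambda>\<zeta>. B (\<tau> * \<zeta>) * cnj \<zeta> ^ i) = ?\<beta> * \<tau> ^ i" by simp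
    have "F2 (T3 \<theta> y) = (w y *\<^sub>R (\<nu> ^ k / \<tau> ^ N * cnj (hmono e k i N y))) * (B (\<tau> * c \<theta>) * cnj (c \<theta>) ^ i)" for \<theta>
    proof -
      have c1: "c \<theta> ^ N * cnj (c \<theta>) ^ N = 1"
        using c[of \<theta>] by (simp flip: power_mult_distrib add: complex_norm_square[symmetric])
      have "c \<theta> \<noteq> 0" using c[of \<theta>] by auto
      then have c0: "c \<theta> ^ N \<noteq> 0" "cnj (c \<theta>) ^ N = 1 / c \<theta> ^ N" using c1 by (simp_all add: nonzero_eq_divide_eq mult.commute)
      have "c \<theta> * \<tau> \<in> ball 0 1 - {0}" using \<tau> c[of \<theta>] by (auto simp: norm_mult)
      then have "slice_coeff f e k (c \<theta> * \<tau>) = B (c \<theta> * \<tau>) / (c \<theta> * \<tau>) ^ N" using B(2) by blast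
      then show ?thesis
        using w_eq[of "T3 \<theta> y" y] c0
        by (simp add: F2_def T3_def norm_mult c hmono_def \<nu>_def \<tau>_def power_mult_distrib mult_ac)
    qed
    then have "(LINT \<theta>|unit_interval. F2 (T3 \<theta> y)) = (w y *\<^sub>R (\<nu> ^ k / \<tau> ^ N * cnj (hmono e k i N y))) * cmean (\<lambda>\<zeta>. B (\<tau> * \<zeta>) * cnj \<zeta> ^ i)"
      by (simp add: cmean_def c_def)
    then show ?thesis unfolding cm by (simp add: F3_def \<nu>_def \<tau>_def hmono_def mult_ac)
  qed
  have I3: "(LINT y|lborel. F2 y) = (LINT y|lborel. F3 y)"
    using integral_average[OF I2(1) T3] by (simp_all add: A3)
  have "(LINT y|lborel. F3 y) = (LINT y|lborel. ?\<beta> * complex_of_real (w y * (norm (hmono e k i N y))\<^sup>2))"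
    by (rule Bochner_Integration.integral_cong)
       (simp_all add: F3_def complex_norm_square[symmetric] scaleR_conv_of_real mult_ac del: of_real_power)
  also have "\<dots> = ?\<beta> * complex_of_real (LINT y|lborel. w y * (norm (hmono e k i N y))\<^sup>2)"
    by (simp only: integral_mult_right_zero integral_complex_of_real)
  finally show ?thesis using I1(2) I2(2) I3 by (simp add: F0_def w_def)
qed

end

section \<open>The Bergman kernel\<close>

lemma pochhammer_series:
  fixes a x :: real
  assumes "\<bar>x\<bar> < 1"
  shows "(\<lambda>k. pochhammer a k / fact k * x ^ k) sums (1 - x) powr (- a)"
proof -
  have "(\<lambda>k. ((- a) gchoose k) * (- x) ^ k) sums (1 + (- x)) powr (- a)"
    using assms by (intro gen_binomial_real) simp
  moreover have "((- a) gchoose k) * (- x) ^ k = pochhammer a k / fact k * x ^ k" for k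
    by (simp add: gbinomial_pochhammer power_mult_distrib[symmetric] mult.assoc[symmetric] flip: power_minus)
  ultimately show ?thesis by simp
qed

lemma pochhammer_binomial: "pochhammer (real n + 1) k / fact k = real ((n + k) choose n)"
proof -
  have "(fact (n + k) :: real) = fact n * pochhammer (1 + real n) k"
    unfolding pochhammer_fact by (rule pochhammer_product')
  then show ?thesis by (simp add: binomial_fact add.commute)
qed

lemma binomial_series:
  fixes x :: real
  assumes "\<bar>x\<bar> < 1"
  shows "(\<lambda>k. real ((n + k) choose n) * x ^ k) sums (1 / (1 - x) ^ (n + 1))"
proof -
  have "(1 - x) powr (- (real n + 1)) = 1 / (1 - x) ^ (n + 1)"
  proof -
    have "(1 - x) powr (real n + 1) = (1 - x) ^ (n + 1)"
      using powr_realpow[of "1 - x" "n + 1"] assms by (simp add: add.commute)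
    then show ?thesis by (simp only: powr_minus divide_inverse mult_1)
  qed
  then show ?thesis using pochhammer_series[OF assms, of "real n + 1"] by (simp only: pochhammer_binomial)
qed

text \<open>The absorption identity reduces the induction step to
  \<open>(n + 1) * (n + 1 + a + b) \<le> (n + 1 + a) * (n + 1 + b)\<close>. It allows terms of
  different residues modulo \<open>m\<close> to be compared at the price of a constant.\<close>

lemma binomial_submult: "(n + (a + b)) choose n \<le> ((n + a) choose n) * ((n + b) choose n)"
proof (induction n)
  case (Suc n)
  have S: "Suc n * ((Suc n + c) choose Suc n) = (Suc n + c) * ((n + c) choose n)" for c
    using Suc_times_binomial_eq[of "n + c" n] by (simp only: add_Suc mult.commute)
  have "Suc n * Suc n * ((Suc n + (a + b)) choose Suc n) = (Suc n * (Suc n + (a + b))) * ((n + (a + b)) choose n)"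
    using S[of "a + b"] by (simp only: mult.assoc)
  also have "\<dots> \<le> ((Suc n + a) * (Suc n + b)) * (((n + a) choose n) * ((n + b) choose n))"
    by (rule mult_le_mono[OF _ Suc.IH]) (simp add: algebra_simps)
  also have "\<dots> = (Suc n * ((Suc n + a) choose Suc n)) * (Suc n * ((Suc n + b) choose Suc n))"
    by (simp only: S mult_ac)
  also have "\<dots> = Suc n * Suc n * (((Suc n + a) choose Suc n) * ((Suc n + b) choose Suc n))"
    by (simp only: mult_ac)
  finally show ?case by (simp only: mult_le_cancel1) simp
qed simp

lemma choose_add_mono: "a \<le> b \<Longrightarrow> (n + a) choose n \<le> (n + b) choose n"
  by (rule binomial_right_mono) simp

text \<open>For \<open>x = t ^ m\<close>, the product \<open>t ^ \<rho> * Sser m n \<rho> x\<close>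
  is the part of the series of \<open>1 / (1 - t) ^ (n + 1)\<close> with exponents
  \<open>\<rho> + m * q\<close>.\<close>

definition Sser :: "nat \<Rightarrow> nat \<Rightarrow> nat \<Rightarrow> complex \<Rightarrow> complex" where
  "Sser m n \<rho> x = (\<Sum>q. of_nat ((n + (\<rho> + m * q)) choose n) * x ^ q)"

context
  fixes m :: nat assumes m: "m > 0"
begin

lemma Sser_summable_real:
  fixes x :: real
  assumes "0 \<le> x" "x < 1"
  shows "summable (\<lambda>q. real ((n + (\<rho> + m * q)) choose n) * x ^ q)"
proof -
  define y where "y = root m x"
  have y: "0 \<le> y" "y < 1" "x = y ^ m"
    using assms m real_root_less_iff[of m x 1] by (auto simp: y_def real_root_pow_pos2)
  have "(\<lambda>k. real ((n + k) choose n) * y ^ k) sums (1 / (1 - y) ^ (n + 1))"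
    using binomial_series[of y n] y by simp
  from sums_group[OF this m]
  have *: "summable (\<lambda>q. \<Sum>k\<in>{q * m..<q * m + m}. real ((n + k) choose n) * y ^ k)" by (rule sums_summable)
  have "summable (\<lambda>q. real ((n + \<rho>) choose n) * (\<Sum>k\<in>{q * m..<q * m + m}. real ((n + k) choose n) * y ^ k))"
    by (rule summable_mult[OF *])
  then show ?thesis
  proof (rule summable_comparison_test'[where N = 0])
    fix q
    have "real ((n + (\<rho> + m * q)) choose n) * x ^ q \<le> real ((n + \<rho>) choose n) * (real ((n + m * q) choose n) * y ^ (m * q))"
      using binomial_submult[of n \<rho> "m * q"] assms
      by (simp only: y(3) power_mult[symmetric] mult.assoc[symmetric] of_nat_mult[symmetric])
         (intro mult_right_mono, simp_all only: of_nat_le_iff zero_le_power y(1))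
    also have "real ((n + m * q) choose n) * y ^ (m * q) \<le> (\<Sum>k\<in>{q * m..<q * m + m}. real ((n + k) choose n) * y ^ k)"
    proof -
      have "real ((n + q * m) choose n) * y ^ (q * m) \<le> (\<Sum>k\<in>{q * m..<q * m + m}. real ((n + k) choose n) * y ^ k)"
        using y m by (intro member_le_sum[where f = "\<lambda>k. real ((n + k) choose n) * y ^ k"]) auto
      then show ?thesis by (simp only: mult.commute[of m q])
    qed
    finally show "norm (real ((n + (\<rho> + m * q)) choose n) * x ^ q) \<le>
       real ((n + \<rho>) choose n) * (\<Sum>k\<in>{q * m..<q * m + m}. real ((n + k) choose n) * y ^ k)"
      using assms by (simp add: mult_left_mono)
  qed
qed

lemma Sser_summable:
  fixes x :: complex
  assumes "norm x < 1"
  shows "summable (\<lambda>q. norm (of_nat ((n + (\<rho> + m * q)) choose n) * x ^ q))"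
  using Sser_summable_real[of "norm x" n \<rho>] assms by (simp add: norm_mult norm_power)

lemma Sser_sums:
  assumes "norm x < 1"
  shows "(\<lambda>q. of_nat ((n + (\<rho> + m * q)) choose n) * x ^ q) sums Sser m n \<rho> x"
  unfolding Sser_def by (intro summable_sums summable_norm_cancel[OF Sser_summable[OF assms]])

lemma Sser_holomorphic: "Sser m n \<rho> holomorphic_on ball 0 1"
  by (rule power_series_holomorphic[where a = "\<lambda>q. of_nat ((n + (\<rho> + m * q)) choose n)"])
     (use Sser_sums in simp)

lemma Sser_cnj:
  assumes "norm x < 1"
  shows "Sser m n \<rho> (cnj x) = cnj (Sser m n \<rho> x)"
proof -
  have "(\<lambda>q. cnj (of_nat ((n + (\<rho> + m * q)) choose n) * x ^ q)) sums cnj (Sser m n \<rho> x)"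
    using Sser_sums[OF assms] by (simp only: sums_cnj)
  moreover have "(\<lambda>q. cnj (of_nat ((n + (\<rho> + m * q)) choose n) * x ^ q)) sums Sser m n \<rho> (cnj x)"
    using Sser_sums[of "cnj x" n \<rho>] assms by simp
  ultimately show ?thesis by (metis sums_unique2)
qed

text \<open>The full series of \<open>1 / (1 - x) ^ (n + 1)\<close> is grouped into blocks of
  \<open>m\<close> consecutive terms. By \<open>binomial_submult\<close> each term of block
  \<open>q\<close> is at most a constant times the \<open>q\<close>-th term of \<open>Sser\<close>,
  so a single residue class already has the full order of growth.\<close>

lemma Sser_lower:
  fixes x :: real
  assumes "0 \<le> x" "x < 1" "\<rho> < m"
  shows "\<exists>r. Sser m n \<rho> (complex_of_real (x ^ m)) = complex_of_real r \<and>
    1 / (1 - x) ^ (n + 1) \<le> real (m * ((n + m) choose n)) * r"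
proof -
  define b where "b = (\<lambda>k. real ((n + k) choose n))"
  have xm: "0 \<le> x ^ m" "x ^ m < 1" using assms m by (auto simp: power_less_one_iff)
  define r where "r = (\<Sum>q. b (\<rho> + m * q) * (x ^ m) ^ q)"
  have sm: "summable (\<lambda>q. b (\<rho> + m * q) * (x ^ m) ^ q)"
    unfolding b_def by (rule Sser_summable_real[OF xm])
  have "(\<lambda>q. complex_of_real (b (\<rho> + m * q) * (x ^ m) ^ q)) sums complex_of_real r"
    using summable_sums[OF sm] by (simp only: sums_of_real_iff r_def)
  then have r: "Sser m n \<rho> (complex_of_real (x ^ m)) = complex_of_real r"
    unfolding Sser_def b_def by (simp add: sums_iff)
  have "(\<lambda>k. b k * x ^ k) sums (1 / (1 - x) ^ (n + 1))"
    unfolding b_def using assms by (intro binomial_series) auto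
  from sums_group[OF this m]
  have g: "(\<lambda>q. \<Sum>k\<in>{q * m..<q * m + m}. b k * x ^ k) sums (1 / (1 - x) ^ (n + 1))" .
  have le: "(\<Sum>k\<in>{q * m..<q * m + m}. b k * x ^ k) \<le> real (m * ((n + m) choose n)) * (b (\<rho> + m * q) * (x ^ m) ^ q)" for q
  proof -
    have "(\<Sum>k\<in>{q * m..<q * m + m}. b k * x ^ k) \<le> (\<Sum>k\<in>{q * m..<q * m + m}. b m * b (\<rho> + m * q) * (x ^ m) ^ q)"
    proof (rule sum_mono)
      fix k assume "k \<in> {q * m..<q * m + m}"
      define i where "i = k - q * m"
      have k: "k = i + q * m" "i < m" using \<open>k \<in> _\<close> by (auto simp: i_def)
      have "b k \<le> b i * b (q * m)"
        unfolding b_def k using binomial_submult[of n i "q * m"] by (simp only: of_nat_le_iff flip: of_nat_mult)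
      also have "\<dots> \<le> b m * b (\<rho> + m * q)"
        unfolding b_def using k by (intro mult_mono) (auto intro!: choose_add_mono simp: mult.commute)
      finally have "b k \<le> b m * b (\<rho> + m * q)" .
      moreover have "x ^ k \<le> (x ^ m) ^ q"
        using assms k power_decreasing[of "q * m" k x] by (simp add: power_mult[symmetric] mult.commute)
      ultimately show "b k * x ^ k \<le> b m * b (\<rho> + m * q) * (x ^ m) ^ q"
        using assms by (intro mult_mono) (auto simp: b_def)
    qed
    then show ?thesis by (simp add: b_def mult_ac)
  qed
  have "1 / (1 - x) ^ (n + 1) \<le> (\<Sum>q. real (m * ((n + m) choose n)) * (b (\<rho> + m * q) * (x ^ m) ^ q))"
    using g by (subst sums_unique[OF g], intro suminf_le le summable_mult sm) (simp add: sums_iff)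
  also have "\<dots> = real (m * ((n + m) choose n)) * r"
    unfolding r_def by (rule suminf_mult[OF sm])
  finally show ?thesis using r by blast
qed

end

text \<open>The monomial \<open>\<langle>z, e\<rangle>\<^sup>k w\<^sup>j\<close> is square integrable exactly for \<open>j \<ge> - eidx m l n k - 1\<close>, and at the
  lowest such \<open>j\<close> its square has the density \<open>Y^(ridx m l n k)\<close> up to a constant.\<close>

definition eidx :: "nat \<Rightarrow> nat \<Rightarrow> nat \<Rightarrow> nat \<Rightarrow> nat" where "eidx m l n k = (l * (k + n) - 1) div m"
definition ridx :: "nat \<Rightarrow> nat \<Rightarrow> nat \<Rightarrow> nat \<Rightarrow> nat" where "ridx m l n k = (l * (k + n) - 1) mod m"

lemma idx_eq: "l > 0 \<Longrightarrow> n > 0 \<Longrightarrow> l * (k + n) = m * eidx m l n k + ridx m l n k + 1"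
proof -
  assume "l > 0" "n > 0"
  then have "l * (k + n) > 0" by simp
  then show ?thesis
    unfolding eidx_def ridx_def by (simp only: mult_div_mod_eq)
qed

lemma ridx_less: "m > 0 \<Longrightarrow> ridx m l n k < m"
  unfolding ridx_def by simp

lemma
  assumes "l > 0" "n > 0" "m > 0"
  shows eidx_shift: "eidx m l n (\<rho> + m * q) = eidx m l n \<rho> + l * q"
    and ridx_shift: "ridx m l n (\<rho> + m * q) = ridx m l n \<rho>"
proof -
  have "l * (\<rho> + m * q + n) - 1 = (l * (\<rho> + n) - 1) + m * (l * q)"
    using assms by (cases "l * (\<rho> + n)") (simp_all add: algebra_simps)
  then show "eidx m l n (\<rho> + m * q) = eidx m l n \<rho> + l * q" "ridx m l n (\<rho> + m * q) = ridx m l n \<rho>"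
    using assms(3) by (simp_all add: eidx_def ridx_def)
qed

text \<open>The reciprocal of the squared \<open>L2\<close> norm of the monomial
  \<open>hmono e k i (eidx m l n k + 1)\<close> for a unit vector \<open>e\<close>; this is
  established in \<open>hmono_moment_allowed\<close>.\<close>

definition kcoef :: "nat \<Rightarrow> nat \<Rightarrow> nat \<Rightarrow> nat \<Rightarrow> nat \<Rightarrow> real" where
  "kcoef m l n k i = fact (n + k) * (ridx m l n k + m * i + 1) / (m * pi ^ (n + 1) * fact k)"

definition kterm :: "nat \<Rightarrow> nat \<Rightarrow> nat \<Rightarrow> nat \<Rightarrow> nat \<Rightarrow> complex \<Rightarrow> complex \<Rightarrow> complex" where
  "kterm m l n k i s u = complex_of_real (kcoef m l n k i) * s ^ k * u ^ i / u ^ (eidx m l n k + 1)"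

text \<open>The part \<open>k \<equiv> \<rho> (mod m)\<close> of the kernel series, where \<open>eidx m l n (\<rho> + m q) = eidx m l n \<rho> + l q\<close>.\<close>

definition kpart :: "nat \<Rightarrow> nat \<Rightarrow> nat \<Rightarrow> nat \<Rightarrow> complex \<Rightarrow> complex \<Rightarrow> complex" where
  "kpart m l n \<rho> s u = s ^ \<rho> / u ^ (eidx m l n \<rho> + 1) * (Sser m n \<rho> (s ^ m / u ^ l) * Sser m 1 (ridx m l n \<rho>) u)"

section \<open>Closed form and absolute convergence of the kernel series\<close>

definition kconst :: "nat \<Rightarrow> nat \<Rightarrow> real" where
  "kconst m n = fact n / (m * pi ^ (n + 1))"

definition kfun :: "nat \<Rightarrow> nat \<Rightarrow> nat \<Rightarrow> complex \<Rightarrow> complex \<Rightarrow> complex" where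
  "kfun m l n s u = complex_of_real (kconst m n) * (\<Sum>\<rho><m. kpart m l n \<rho> s u)"

lemma kconst_pos: "m > 0 \<Longrightarrow> kconst m n > 0" by (simp add: kconst_def)

lemma kcoef_alt: "kcoef m l n k i = kconst m n * real ((n + k) choose n) * real (ridx m l n k + m * i + 1)"
proof -
  have "real ((n + k) choose n) = fact (n + k) / (fact n * fact k)" by (simp add: binomial_fact)
  moreover have "fact (n + k) * R / (M * P * fact k) = fact n / (M * P) * (fact (n + k) / (fact n * fact k)) * R" for R M P :: real
    by simp
  ultimately show ?thesis unfolding kcoef_def kconst_def by (simp only: of_nat_mult of_nat_fact)
qed

lemma kterm_shift:
  assumes "l > 0" "n > 0" "m > 0" "u \<noteq> 0"
  shows "kterm m l n (\<rho> + m * q) i s u = complex_of_real (kconst m n) * (s ^ \<rho> / u ^ (eidx m l n \<rho> + 1)) *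
    ((of_nat ((n + (\<rho> + m * q)) choose n) * (s ^ m / u ^ l) ^ q) *
     (of_nat ((1 + (ridx m l n \<rho> + m * i)) choose 1) * u ^ i))"
proof -
  have e: "eidx m l n (\<rho> + m * q) + 1 = (eidx m l n \<rho> + 1) + l * q" using assms by (simp add: eidx_shift)
  have b: "(1 + (ridx m l n \<rho> + m * i)) choose 1 = ridx m l n \<rho> + m * i + 1" by simp
  show ?thesis
    unfolding kterm_def kcoef_alt e b ridx_shift[OF assms(1-3)] power_add[of s] power_add[of u "eidx m l n \<rho> + 1"] power_mult power_divide
    by (simp only: of_real_mult of_real_of_nat_eq times_divide_eq_left times_divide_eq_right divide_divide_eq_left mult_ac)
qed

text \<open>Sums over \<open>k < N * m\<close> and \<open>i < N\<close> contain exactly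
  \<open>N\<close> full blocks of residues, so they split without remainder into products of
  one-variable partial sums. This explains the shape of the rectangles used in all limits
  below.\<close>

lemma kterm_partial_sums:
  assumes "l > 0" "n > 0" "m > 0" "u \<noteq> 0"
  shows "(\<Sum>k<N * m. \<Sum>i<N. kterm m l n k i s u) =
    complex_of_real (kconst m n) * (\<Sum>\<rho><m. s ^ \<rho> / u ^ (eidx m l n \<rho> + 1) *
      ((\<Sum>q<N. of_nat ((n + (\<rho> + m * q)) choose n) * (s ^ m / u ^ l) ^ q) *
       (\<Sum>i<N. of_nat ((1 + (ridx m l n \<rho> + m * i)) choose 1) * u ^ i)))"
proof -
  define G where "G = (\<lambda>k. \<Sum>i<N. kterm m l n k i s u)"
  have "(\<Sum>k<N * m. G k) = (\<Sum>q<N. \<Sum>k\<in>{q * m..<q * m + m}. G k)"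
    by (rule sum.nat_group[symmetric])
  also have "\<dots> = (\<Sum>q<N. \<Sum>\<rho><m. G (\<rho> + m * q))"
  proof (rule sum.cong[OF refl])
    fix q
    show "(\<Sum>k\<in>{q * m..<q * m + m}. G k) = (\<Sum>\<rho><m. G (\<rho> + m * q))"
      using sum.shift_bounds_nat_ivl[of G 0 "q * m" m] by (simp add: mult.commute add.commute atLeast0LessThan)
  qed
  also have "\<dots> = (\<Sum>\<rho><m. \<Sum>q<N. G (\<rho> + m * q))" by (rule sum.swap)
  also have "\<dots> = (\<Sum>\<rho><m. complex_of_real (kconst m n) * (s ^ \<rho> / u ^ (eidx m l n \<rho> + 1) *
      ((\<Sum>q<N. of_nat ((n + (\<rho> + m * q)) choose n) * (s ^ m / u ^ l) ^ q) *
       (\<Sum>i<N. of_nat ((1 + (ridx m l n \<rho> + m * i)) choose 1) * u ^ i))))"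
  proof (rule sum.cong[OF refl])
    fix \<rho>
    define a where "a = complex_of_real (kconst m n) * (s ^ \<rho> / u ^ (eidx m l n \<rho> + 1))"
    have "(\<Sum>q<N. G (\<rho> + m * q)) = (\<Sum>q<N. \<Sum>i<N. a * ((of_nat ((n + (\<rho> + m * q)) choose n) * (s ^ m / u ^ l) ^ q) *
     (of_nat ((1 + (ridx m l n \<rho> + m * i)) choose 1) * u ^ i)))"
      unfolding G_def a_def by (simp only: kterm_shift[OF assms])
    also have "\<dots> = a * ((\<Sum>q<N. of_nat ((n + (\<rho> + m * q)) choose n) * (s ^ m / u ^ l) ^ q) *
       (\<Sum>i<N. of_nat ((1 + (ridx m l n \<rho> + m * i)) choose 1) * u ^ i))"
      by (simp only: sum_product) (simp only: sum_distrib_left)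
    finally show "(\<Sum>q<N. G (\<rho> + m * q)) = complex_of_real (kconst m n) * (s ^ \<rho> / u ^ (eidx m l n \<rho> + 1) *
      ((\<Sum>q<N. of_nat ((n + (\<rho> + m * q)) choose n) * (s ^ m / u ^ l) ^ q) *
       (\<Sum>i<N. of_nat ((1 + (ridx m l n \<rho> + m * i)) choose 1) * u ^ i)))"
      by (simp only: a_def mult.assoc)
  qed
  also have "\<dots> = complex_of_real (kconst m n) * (\<Sum>\<rho><m. s ^ \<rho> / u ^ (eidx m l n \<rho> + 1) *
      ((\<Sum>q<N. of_nat ((n + (\<rho> + m * q)) choose n) * (s ^ m / u ^ l) ^ q) *
       (\<Sum>i<N. of_nat ((1 + (ridx m l n \<rho> + m * i)) choose 1) * u ^ i)))"
    by (rule sum_distrib_left[symmetric])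
  finally show ?thesis by (simp only: G_def)
qed

lemma kterm_partial_sums_tendsto:
  assumes "l > 0" "n > 0" "m > 0" "u \<noteq> 0" "norm u < 1" "norm (s ^ m / u ^ l) < 1"
  shows "(\<lambda>N. \<Sum>k<N * m. \<Sum>i<N. kterm m l n k i s u) \<longlonglongrightarrow> kfun m l n s u"
proof -
  have "(\<lambda>N. \<Sum>q<N. of_nat ((n' + (\<rho> + m * q)) choose n') * x ^ q) \<longlonglongrightarrow> Sser m n' \<rho> x" if "norm x < 1" for n' \<rho> x
    using Sser_sums[OF assms(3) that] by (simp only: sums_def)
  note this[OF assms(5)] this[OF assms(6)]
  then show ?thesis
    unfolding kterm_partial_sums[OF assms(1-4)] kfun_def kpart_def
    by (intro tendsto_mult tendsto_sum tendsto_const)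
qed

lemma hartogs_norms:
  assumes "y \<in> hartogs m l" "m > 0" "l > 0"
  shows "norm (fst y) = sqrt (hX m l y) * sqrt (hY m y) ^ l" "norm (snd y) = sqrt (hY m y) ^ m"
    "0 \<le> sqrt (hX m l y)" "sqrt (hX m l y) < 1" "0 < sqrt (hY m y)" "sqrt (hY m y) < 1"
proof -
  have Y: "0 < hY m y" "hY m y < 1" "hX m l y < 1" using assms by (auto simp: mem_hartogs_iff)
  have "(norm (snd y))\<^sup>2 = hY m y ^ m" using powr_two_over_power[OF assms(2), of "snd y"] by (simp add: hY_def)
  then show "norm (snd y) = sqrt (hY m y) ^ m"
    by (metis norm_ge_zero real_sqrt_power real_sqrt_unique)
  have "(norm (fst y))\<^sup>2 = hX m l y * hY m y ^ l" using Y by (simp add: hX_def flip: hY_def)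
  then show "norm (fst y) = sqrt (hX m l y) * sqrt (hY m y) ^ l"
    by (metis norm_ge_zero real_sqrt_mult real_sqrt_power real_sqrt_unique)
  show "0 \<le> sqrt (hX m l y)" "sqrt (hX m l y) < 1" "0 < sqrt (hY m y)" "sqrt (hY m y) < 1"
    using Y hX_nonneg[of m l y] by auto
qed

context
  fixes m l :: nat
  assumes m: "m > 0" and l: "l > 0"
begin

text \<open>In the roots \<open>P\<close>, \<open>T\<close>, \<open>T'\<close> of \<open>X\<close>
  and \<open>Y\<close>, all powers of \<open>T * T'\<close> combine by the identity for
  \<open>l * k + m * i + s0\<close> into the exponent \<open>r + m * i - s0\<close>. The bound is
  deliberately one-sided: powers of \<open>P'\<close> and nonnegative powers of \<open>T'\<close>
  are estimated by 1, so that \<open>y\<close> enters only through \<open>T' ^ s0\<close>,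
  independently of \<open>k\<close> and \<open>i\<close>.\<close>

lemma kterm_norm_le:
  fixes x y :: "(complex ^ 'n) \<times> complex"
  assumes x: "x \<in> hartogs m l" and y: "y \<in> hartogs m l"
  defines "P \<equiv> sqrt (hX m l x)" and "T \<equiv> sqrt (hY m x)"
  shows "norm (kterm m l CARD('n) k i (herm (fst x) (fst y)) (snd x * cnj (snd y))) \<le>
    kcoef m l CARD('n) k i * (P ^ k * T ^ (ridx m l CARD('n) k + m * i)) / T ^ (m + l * CARD('n) - 1) / sqrt (hY m y) ^ (m + l * CARD('n) - 1)"
proof -
  define n where "n = CARD('n)"
  have n: "n > 0" by (simp add: n_def)
  define s0 where "s0 = m + l * n - 1"
  define r where "r = ridx m l n k"
  define e where "e = eidx m l n k"
  define P' where "P' = sqrt (hX m l y)"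
  define T' where "T' = sqrt (hY m y)"
  note X = hartogs_norms[OF x m l, folded P_def T_def]
  note Y = hartogs_norms[OF y m l, folded P'_def T'_def]
  have kc: "kcoef m l n k i \<ge> 0" by (simp add: kcoef_def)
  have TT: "0 < T * T'" "T * T' < 1" using X Y mult_strict_mono[of T 1 T' 1] by auto
  have u: "norm (snd x * cnj (snd y)) = (T * T') ^ m" by (simp add: norm_mult X Y power_mult_distrib)
  have s: "norm (herm (fst x) (fst y)) \<le> P * (T * T') ^ l"
  proof -
    have "norm (herm (fst x) (fst y)) \<le> norm (fst x) * norm (fst y)" by (rule norm_herm_le)
    also have "\<dots> = P * P' * (T * T') ^ l" by (simp add: X Y power_mult_distrib)
    also have "\<dots> \<le> P * 1 * (T * T') ^ l" using X Y by (intro mult_right_mono mult_left_mono) auto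
    finally show ?thesis by simp
  qed
  have ex: "l * k + m * i + s0 = m * (e + 1) + (r + m * i)"
    using idx_eq[OF l n, of k m] n m l by (simp add: s0_def e_def r_def algebra_simps)
  have "norm (kterm m l n k i (herm (fst x) (fst y)) (snd x * cnj (snd y))) =
     kcoef m l n k i * norm (herm (fst x) (fst y)) ^ k * ((T * T') ^ m) ^ i / ((T * T') ^ m) ^ (e + 1)"
    unfolding kterm_def e_def[symmetric] norm_divide norm_mult norm_power u[symmetric] using kc by (simp add: norm_mult)
  also have "\<dots> \<le> kcoef m l n k i * (P * (T * T') ^ l) ^ k * ((T * T') ^ m) ^ i / ((T * T') ^ m) ^ (e + 1)"
    using TT kc s by (intro divide_right_mono mult_right_mono mult_left_mono power_mono) auto
  also have "\<dots> = kcoef m l n k i * P ^ k * ((T * T') ^ (l * k + m * i + s0) / ((T * T') ^ (m * (e + 1)) * (T * T') ^ s0))"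
  proof -
    have "kc * (P * q ^ l) ^ k * (q ^ m) ^ i / (q ^ m) ^ (e + 1) = kc * P ^ k * (q ^ (l * k + m * i + s0) / (q ^ (m * (e + 1)) * q ^ s0))"
      if "q > 0" for q kc :: real
    proof -
      have "q ^ s0 \<noteq> 0" using that by auto
      from mult_divide_mult_cancel_right[OF this, of "kc * (P ^ k * ((q ^ l) ^ k * (q ^ m) ^ i))" "(q ^ m) ^ (e + 1)", symmetric]
      show ?thesis
        by (simp only: power_add power_mult power_mult_distrib times_divide_eq_right mult.assoc)
    qed
    from this[OF TT(1)] show ?thesis .
  qed
  also have "\<dots> = kcoef m l n k i * P ^ k * ((T * T') ^ (r + m * i) / (T * T') ^ s0)"
    using TT X(5) Y(5) unfolding ex power_add[of _ "m * (e + 1)"] by simp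
  also have "\<dots> \<le> kcoef m l n k i * P ^ k * (T ^ (r + m * i) / (T * T') ^ s0)"
    using X Y kc by (intro mult_left_mono divide_right_mono power_mono mult_left_le) auto
  also have "\<dots> = kcoef m l n k i * (P ^ k * T ^ (r + m * i)) / T ^ s0 / T' ^ s0"
    by (simp add: power_mult_distrib)
  finally show ?thesis unfolding n_def s0_def r_def T'_def .
qed

definition kbound :: "(complex ^ 'n) \<times> complex \<Rightarrow> real" where
  "kbound x = kconst m CARD('n) * (1 / (1 - sqrt (hX m l x)) ^ (CARD('n) + 1)) * (1 / (1 - sqrt (hY m x)) ^ 2) / sqrt (hY m x) ^ (m + l * CARD('n) - 1)"

text \<open>Summing the termwise bounds gives binomial series in \<open>P\<close> and
  \<open>T\<close>. The bound is uniform in \<open>M\<close> and \<open>N\<close>, and as a function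
  of \<open>y\<close> it is square integrable, since its square \<open>1 / Y ^ s0\<close> cancels
  the density of \<open>Y\<close>.\<close>

lemma kterm_sum_bound:
  fixes x y :: "(complex ^ 'n) \<times> complex"
  assumes x: "x \<in> hartogs m l" and y: "y \<in> hartogs m l"
  shows "(\<Sum>k<M. \<Sum>i<N. norm (kterm m l CARD('n) k i (herm (fst x) (fst y)) (snd x * cnj (snd y)))) \<le>
    kbound x / sqrt (hY m y) ^ (m + l * CARD('n) - 1)"
proof -
  define n where "n = CARD('n)"
  define s0 where "s0 = m + l * n - 1"
  define P where "P = sqrt (hX m l x)"
  define T where "T = sqrt (hY m x)"
  define T' where "T' = sqrt (hY m y)"
  note X = hartogs_norms[OF x m l, folded P_def T_def]
  note Y = hartogs_norms[OF y m l, folded T'_def]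
  have c0: "kconst m n \<ge> 0" using kconst_pos[OF m, of n] by simp
  have g: "(\<lambda>a. real ((1 + a) choose 1) * T ^ a) sums (1 / (1 - T) ^ (1 + 1))"
    using X by (intro binomial_series) auto
  have inner: "(\<Sum>i<N. real (ridx m l n k + m * i + 1) * T ^ (ridx m l n k + m * i)) \<le> 1 / (1 - T) ^ 2" for k
  proof -
    define r where "r = ridx m l n k"
    have "(\<Sum>i<N. real (r + m * i + 1) * T ^ (r + m * i)) = (\<Sum>a\<in>(\<lambda>i. r + m * i) ` {..<N}. real ((1 + a) choose 1) * T ^ a)"
      using m by (subst sum.reindex) (auto simp: inj_on_def)
    also have "\<dots> \<le> (\<Sum>a. real ((1 + a) choose 1) * T ^ a)"
      using X by (intro sum_le_suminf sums_summable[OF g]) auto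
    also have "\<dots> = 1 / (1 - T) ^ 2" using g by (simp add: sums_iff numeral_2_eq_2)
    finally show ?thesis by (simp add: r_def)
  qed
  have outer: "(\<Sum>k<M. real ((n + k) choose n) * P ^ k) \<le> 1 / (1 - P) ^ (n + 1)"
  proof -
    have "(\<lambda>k. real ((n + k) choose n) * P ^ k) sums (1 / (1 - P) ^ (n + 1))" using X by (intro binomial_series) auto
    then show ?thesis using X by (subst sums_unique[of _ "1 / (1 - P) ^ (n + 1)"]) (auto intro!: sum_le_suminf simp: sums_iff)
  qed
  have "(\<Sum>k<M. \<Sum>i<N. norm (kterm m l n k i (herm (fst x) (fst y)) (snd x * cnj (snd y)))) \<le>
     (\<Sum>k<M. \<Sum>i<N. kcoef m l n k i * (P ^ k * T ^ (ridx m l n k + m * i)) / T ^ s0 / T' ^ s0)"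
    unfolding n_def s0_def P_def T_def T'_def by (intro sum_mono kterm_norm_le x y)
  also have "\<dots> = (\<Sum>k<M. kconst m n / T ^ s0 / T' ^ s0 * (real ((n + k) choose n) * P ^ k) *
       (\<Sum>i<N. real (ridx m l n k + m * i + 1) * T ^ (ridx m l n k + m * i)))"
    unfolding sum_distrib_left kcoef_alt by (intro sum.cong refl) (simp only: times_divide_eq_left times_divide_eq_right mult_ac)
  also have "\<dots> \<le> (\<Sum>k<M. kconst m n / T ^ s0 / T' ^ s0 * (real ((n + k) choose n) * P ^ k) * (1 / (1 - T) ^ 2))"
    using X Y c0 by (intro sum_mono mult_left_mono inner) auto
  also have "\<dots> = kconst m n / T ^ s0 / T' ^ s0 * (1 / (1 - T) ^ 2) * (\<Sum>k<M. real ((n + k) choose n) * P ^ k)"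
    unfolding sum_distrib_left by (intro sum.cong refl) (simp only: mult_ac)
  also have "\<dots> \<le> kconst m n / T ^ s0 / T' ^ s0 * (1 / (1 - T) ^ 2) * (1 / (1 - P) ^ (n + 1))"
    using X Y c0 by (intro mult_left_mono outer) auto
  also have "\<dots> = kbound x / T' ^ s0"
    by (simp add: kbound_def n_def s0_def P_def T_def)
  finally show ?thesis by (simp add: n_def s0_def T'_def)
qed

text \<open>The value 0 outside the domain matches the normalization in
  \<open>is_bergman_kernel\<close>, so that the equality with \<open>bergman_kernel\<close> holds
  for total functions.\<close>

definition hker :: "(complex ^ 'n) \<times> complex \<Rightarrow> (complex ^ 'n) \<times> complex \<Rightarrow> complex" where
  "hker x y = (if x \<in> hartogs m l \<and> y \<in> hartogs m l then
     kfun m l CARD('n) (herm (fst x) (fst y)) (snd x * cnj (snd y)) else 0)"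

text \<open>The conditions under which the closed form is meaningful: a nonzero divisor, and both
  arguments of \<open>Sser\<close> in the open unit disc. In the last one the powers of
  \<open>norm (snd x)\<close> and \<open>norm (snd y)\<close> cancel and a power of
  \<open>sqrt (X x) * sqrt (X y) < 1\<close> remains.\<close>

lemma kernel_arguments:
  fixes x y :: "(complex ^ 'n) \<times> complex"
  assumes x: "x \<in> hartogs m l" and y: "y \<in> hartogs m l"
  shows "snd x * cnj (snd y) \<noteq> 0" "norm (snd x * cnj (snd y)) < 1"
    "norm (herm (fst x) (fst y) ^ m / (snd x * cnj (snd y)) ^ l) < 1"
proof -
  note X = hartogs_norms[OF x m l] and Y = hartogs_norms[OF y m l]
  define u where "u = norm (snd x * cnj (snd y))"
  have u: "u = sqrt (hY m x) ^ m * sqrt (hY m y) ^ m" by (simp add: u_def norm_mult X Y)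
  have "sqrt (hY m x) ^ m < 1" "sqrt (hY m y) ^ m < 1" "0 < sqrt (hY m x) ^ m" "0 < sqrt (hY m y) ^ m"
    using X Y m by (auto simp: power_less_one_iff)
  then have u01: "0 < u" "u < 1" unfolding u using mult_strict_mono[of "sqrt (hY m x) ^ m" 1 "sqrt (hY m y) ^ m" 1] by auto
  then show 1: "snd x * cnj (snd y) \<noteq> 0" and "norm (snd x * cnj (snd y)) < 1" by (auto simp: u_def)
  have "norm (herm (fst x) (fst y)) ^ m \<le> (norm (fst x) * norm (fst y)) ^ m"
    by (intro power_mono norm_herm_le) simp
  also have "\<dots> = (sqrt (hX m l x) * sqrt (hX m l y)) ^ m * u ^ l"
    by (simp add: u X(1) Y(1) power_mult_distrib power_mult[symmetric] mult_ac)
  also have "\<dots> < 1 * u ^ l"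
  proof (intro mult_strict_right_mono)
    have "sqrt (hX m l x) * sqrt (hX m l y) < 1"
      using X Y mult_le_one[of "sqrt (hX m l x)" "sqrt (hX m l y)"]
      by (metis mult_left_le less_eq_real_def order_le_less_trans)
    then show "(sqrt (hX m l x) * sqrt (hX m l y)) ^ m < 1"
      using X Y m by (simp add: power_less_one_iff)
  qed (use u01 in simp)
  finally show "norm (herm (fst x) (fst y) ^ m / (snd x * cnj (snd y)) ^ l) < 1"
    using u01 by (simp only: norm_divide norm_power u_def[symmetric]) simp
qed

lemma hker_tendsto:
  fixes x y :: "(complex ^ 'n) \<times> complex"
  assumes x: "x \<in> hartogs m l" and y: "y \<in> hartogs m l"
  shows "(\<lambda>N. \<Sum>k<N * m. \<Sum>i<N. kterm m l CARD('n) k i (herm (fst x) (fst y)) (snd x * cnj (snd y))) \<longlonglongrightarrow> hker x y"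
  using kterm_partial_sums_tendsto[OF l _ m kernel_arguments[OF x y], of "CARD('n)"] x y by (simp add: hker_def)

lemma hker_bound:
  fixes x y :: "(complex ^ 'n) \<times> complex"
  assumes x: "x \<in> hartogs m l" and y: "y \<in> hartogs m l"
  shows "norm (hker x y) \<le> kbound x / sqrt (hY m y) ^ (m + l * CARD('n) - 1)"
proof (rule LIMSEQ_le_const2[OF tendsto_norm[OF hker_tendsto[OF x y]]], intro exI allI impI)
  fix N
  show "norm (\<Sum>k<N * m. \<Sum>i<N. kterm m l CARD('n) k i (herm (fst x) (fst y)) (snd x * cnj (snd y)))
     \<le> kbound x / sqrt (hY m y) ^ (m + l * CARD('n) - 1)"
    by (rule order_trans[OF order_trans[OF norm_sum sum_mono[OF norm_sum]] kterm_sum_bound[OF x y]])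
qed

lemma kterm_cnj: "kterm m l n k i (cnj s) (cnj u) = cnj (kterm m l n k i s u)"
  by (simp add: kterm_def)

lemma hker_hermitian: "hker y x = cnj (hker x y)"
proof (cases "x \<in> hartogs m l \<and> y \<in> hartogs m l")
  case True
  then have x: "x \<in> hartogs m l" and y: "y \<in> hartogs m l" by auto
  have "(\<lambda>N. \<Sum>k<N * m. \<Sum>i<N. kterm m l CARD('a) k i (herm (fst y) (fst x)) (snd y * cnj (snd x))) \<longlonglongrightarrow> hker y x"
    by (rule hker_tendsto[OF y x])
  moreover have "kterm m l CARD('a) k i (herm (fst y) (fst x)) (snd y * cnj (snd x)) =
     cnj (kterm m l CARD('a) k i (herm (fst x) (fst y)) (snd x * cnj (snd y)))" for k i
    unfolding kterm_cnj[symmetric] by (simp add: cnj_herm mult.commute)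
  ultimately have "(\<lambda>N. cnj (\<Sum>k<N * m. \<Sum>i<N. kterm m l CARD('a) k i (herm (fst x) (fst y)) (snd x * cnj (snd y)))) \<longlonglongrightarrow> hker y x"
    by simp
  moreover have "(\<lambda>N. cnj (\<Sum>k<N * m. \<Sum>i<N. kterm m l CARD('a) k i (herm (fst x) (fst y)) (snd x * cnj (snd y)))) \<longlonglongrightarrow> cnj (hker x y)"
    by (intro tendsto_cnj hker_tendsto x y)
  ultimately show ?thesis by (rule LIMSEQ_unique)
qed (auto simp: hker_def)

end

section \<open>Holomorphy of the kernel\<close>

definition hol_at :: "((complex ^ 'n) \<times> complex \<Rightarrow> complex) \<Rightarrow> (complex ^ 'n) \<times> complex \<Rightarrow> bool" where
  "hol_at f x \<longleftrightarrow> (\<exists>D. (f has_derivative D) (at x) \<and> (\<forall>c z w. D (c *s z, c * w) = c * D (z, w)))"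

lemma holomorphic_several_iff: "holomorphic_several f S \<longleftrightarrow> (\<forall>x\<in>S. hol_at f x)"
  by (simp add: holomorphic_several_def hol_at_def)

lemma hol_at_const: "hol_at (\<lambda>x. c) x"
  unfolding hol_at_def by (rule exI[of _ "\<lambda>_. 0"]) auto

lemma hol_at_herm: "hol_at (\<lambda>x. herm (fst x) b) x"
proof -
  have "bounded_linear (\<lambda>x :: (complex ^ 'a) \<times> complex. herm (fst x) b)"
    unfolding herm_def
    by (intro bounded_linear_sum bounded_linear_mult_const bounded_linear_compose[OF bounded_linear_vec_nth bounded_linear_fst])
  then show ?thesis
    unfolding hol_at_def by (intro exI[of _ "\<lambda>x. herm (fst x) b"]) (auto intro: bounded_linear_imp_has_derivative simp: herm_scale_left)
qed

lemma hol_at_snd: "hol_at (\<lambda>x. snd x * b) x"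
proof -
  have "bounded_linear (\<lambda>x :: (complex ^ 'a) \<times> complex. snd x * b)"
    by (intro bounded_linear_mult_const bounded_linear_snd)
  then show ?thesis
    unfolding hol_at_def by (intro exI[of _ "\<lambda>x. snd x * b"]) (auto intro: bounded_linear_imp_has_derivative)
qed

lemma hol_at_mult: "hol_at f x \<Longrightarrow> hol_at g x \<Longrightarrow> hol_at (\<lambda>x. f x * g x) x"
  unfolding hol_at_def
  by (elim exE conjE, rule exI, rule conjI, rule has_derivative_mult, assumption, assumption) (auto simp: algebra_simps)

lemma hol_at_add: "hol_at f x \<Longrightarrow> hol_at g x \<Longrightarrow> hol_at (\<lambda>x. f x + g x) x"
  unfolding hol_at_def
  by (elim exE conjE, rule exI, rule conjI, rule has_derivative_add, assumption, assumption) (auto simp: algebra_simps)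

lemma hol_at_sum: "finite A \<Longrightarrow> (\<And>i. i \<in> A \<Longrightarrow> hol_at (f i) x) \<Longrightarrow> hol_at (\<lambda>x. \<Sum>i\<in>A. f i x) x"
  by (induction A rule: finite_induct) (simp_all add: hol_at_const hol_at_add)

lemma hol_at_compose:
  assumes f: "hol_at f x" and g: "g holomorphic_on T" "open T" "f x \<in> T"
  shows "hol_at (\<lambda>x. g (f x)) x"
proof -
  obtain D where D: "(f has_derivative D) (at x)" "\<And>c z w. D (c *s z, c * w) = c * D (z, w)"
    using f unfolding hol_at_def by blast
  have "(g has_derivative (\<lambda>h. deriv g (f x) * h)) (at (f x))"
    using holomorphic_derivI[OF g] by (simp add: has_field_derivative_def)
  from has_derivative_compose[OF D(1) this]
  show ?thesis unfolding hol_at_def by (intro exI conjI) (auto simp: D(2))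
qed

lemma hol_at_power: "hol_at f x \<Longrightarrow> hol_at (\<lambda>x. f x ^ k) x"
  by (rule hol_at_compose[where T = UNIV]) (auto intro!: holomorphic_intros)

lemma hol_at_inverse: "hol_at f x \<Longrightarrow> f x \<noteq> 0 \<Longrightarrow> hol_at (\<lambda>x. inverse (f x)) x"
  by (rule hol_at_compose[where T = "- {0}"]) (auto intro!: holomorphic_intros)

text \<open>The closed form is a finite sum of products of one-variable holomorphic functions
  composed with linear maps and quotients. The rules for \<open>hol_at\<close> therefore suffice,
  and no limit of functions of several variables has to be differentiated.\<close>

lemma hker_holomorphic:
  fixes y :: "(complex ^ 'n) \<times> complex"
  assumes m: "m > 0" and l: "l > 0" and y: "y \<in> hartogs m l"
  shows "holomorphic_several (\<lambda>x. hker m l x y) (hartogs m l)"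
  unfolding holomorphic_several_iff
proof
  fix x :: "(complex ^ 'n) \<times> complex" assume x: "x \<in> hartogs m l"
  let ?s = "\<lambda>x. herm (fst x) (fst y)" and ?u = "\<lambda>x. snd x * cnj (snd y)"
  note a = kernel_arguments[OF m l x y]
  have S: "Sser m n' \<rho> holomorphic_on ball 0 1" for n' \<rho> by (rule Sser_holomorphic[OF m])
  have "hol_at (\<lambda>x. kfun m l CARD('n) (?s x) (?u x)) x"
    unfolding kfun_def kpart_def divide_inverse
    by (intro hol_at_mult hol_at_const hol_at_sum hol_at_power hol_at_inverse hol_at_herm hol_at_snd
        hol_at_compose[OF _ S]) (use a in \<open>auto simp: divide_inverse\<close>)
  then obtain D where D: "((\<lambda>x. kfun m l CARD('n) (?s x) (?u x)) has_derivative D) (at x)"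
     "\<forall>c z w. D (c *s z, c * w) = c * D (z, w)"
    unfolding hol_at_def by blast
  have "((\<lambda>x. hker m l x y) has_derivative D) (at x)"
    by (rule has_derivative_transform_within_open[OF D(1) open_hartogs x]) (use y in \<open>simp add: hker_def[OF m l]\<close>)
  then show "hol_at (\<lambda>x. hker m l x y) x" using D(2) unfolding hol_at_def by blast
qed

section \<open>Norms of monomials, vanishing coefficients and the reproducing property\<close>

lemma nn_integral_power_unit:
  "(\<integral>\<^sup>+x\<in>{0<..<1}. ennreal (x ^ p) \<partial>lborel) = ennreal (1 / (real p + 1))"
proof -
  have "((\<lambda>x. x ^ p) has_integral (1 ^ Suc p / real (Suc p) - 0 ^ Suc p / real (Suc p))) {0..1}"
  proof (rule fundamental_theorem_of_calculus)
    fix x :: real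
    show "((\<lambda>x. x ^ Suc p / real (Suc p)) has_vector_derivative x ^ p) (at x within {0..1})"
      unfolding has_real_derivative_iff_has_vector_derivative[symmetric]
      by (rule derivative_eq_intros refl | simp del: power_Suc of_nat_Suc)+
  qed simp
  then have "(\<integral>\<^sup>+x. ennreal (x ^ p) * indicator {0..1} x \<partial>lborel) = ennreal (1 / (real p + 1))"
    using nn_integral_has_integral_lebesgue'[of "{0..1}" "\<lambda>x. x ^ p"] by (simp add: add.commute)
  moreover have "(\<integral>\<^sup>+x. ennreal (x ^ p) * indicator {0..1} x \<partial>lborel) = (\<integral>\<^sup>+x\<in>{0<..<1}. ennreal (x ^ p) \<partial>lborel)"
    using AE_lborel_singleton[of 0] AE_lborel_singleton[of 1]
    by (intro nn_integral_cong_AE, eventually_elim) (auto simp: indicator_def)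
  ultimately show ?thesis by simp
qed

text \<open>The uniform bound makes the double series absolutely convergent; Tannery's theorem with
  majorant \<open>b k\<close> then turns the iterated sum into the limit over the rectangles on
  which the kernel series splits.\<close>

lemma double_series_square:
  fixes a :: "nat \<Rightarrow> nat \<Rightarrow> complex"
  assumes g: "\<And>k. (\<lambda>i. a k i) sums g k" and S: "g sums S" and m: "m > 0"
    and bound: "\<And>M N. (\<Sum>k<M. \<Sum>i<N. norm (a k i)) \<le> Q"
  shows "(\<lambda>N. \<Sum>k<N * m. \<Sum>i<N. a k i) \<longlonglongrightarrow> S"
proof -
  have sk: "summable (\<lambda>i. norm (a k i))" for k
  proof (rule bounded_imp_summable)
    fix N
    have "(\<Sum>i<Suc N. norm (a k i)) \<le> (\<Sum>k<Suc k. \<Sum>i<Suc N. norm (a k i))"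
      by (intro member_le_sum[where f = "\<lambda>k. \<Sum>i<Suc N. norm (a k i)"] sum_nonneg norm_ge_zero) auto
    also have "\<dots> \<le> Q" by (rule bound)
    finally show "(\<Sum>i\<le>N. norm (a k i)) \<le> Q" by (simp only: lessThan_Suc_atMost)
  qed simp
  define b where "b k = (\<Sum>i. norm (a k i))" for k
  have bs: "summable b"
  proof (rule bounded_imp_summable)
    show "b k \<ge> 0" for k unfolding b_def by (intro suminf_nonneg sk) simp
    fix M
    have "(\<lambda>N. \<Sum>k<Suc M. \<Sum>i<N. norm (a k i)) \<longlonglongrightarrow> (\<Sum>k<Suc M. b k)"
      unfolding b_def by (intro tendsto_sum summable_LIMSEQ sk)
    then have "(\<Sum>k<Suc M. b k) \<le> Q"
      by (rule LIMSEQ_le_const2) (use bound in blast)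
    then show "(\<Sum>k\<le>M. b k) \<le> Q" by (simp only: lessThan_Suc_atMost)
  qed
  define h where "h k N = (if k < N * m then \<Sum>i<N. a k i else 0)" for k N
  have "(\<lambda>N. \<Sum>k. h k N) \<longlonglongrightarrow> (\<Sum>k. g k)"
  proof (rule tannerys_theorem[THEN conjunct2, THEN conjunct2])
    show "(\<lambda>N. h k N) \<longlonglongrightarrow> g k" for k
    proof (rule Lim_transform_eventually)
      show "(\<lambda>N. \<Sum>i<N. a k i) \<longlonglongrightarrow> g k" using g by (simp add: sums_def)
      show "\<forall>\<^sub>F N in sequentially. (\<Sum>i<N. a k i) = h k N"
        using eventually_gt_at_top[of k]
      proof eventually_elim
        case (elim N)
        have "N \<le> N * m" using m by simp
        with elim have "k < N * m" by linarith
        then show ?case by (simp add: h_def)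
      qed
    qed
    have "norm (h k N) \<le> b k" for k N
    proof -
      have "norm (\<Sum>i<N. a k i) \<le> (\<Sum>i<N. norm (a k i))" by (rule norm_sum)
      also have "\<dots> \<le> b k" unfolding b_def by (intro sum_le_suminf sk) auto
      finally show ?thesis unfolding h_def b_def using suminf_nonneg[OF sk] by auto
    qed
    then show "\<forall>\<^sub>F (k, N) in at_top \<times>\<^sub>F sequentially. norm (h k N) \<le> b k"
      by (intro always_eventually) auto
  qed (use bs in auto)
  moreover have "(\<Sum>k. h k N) = (\<Sum>k<N * m. \<Sum>i<N. a k i)" for N
  proof -
    have "(\<Sum>k. h k N) = (\<Sum>k<N * m. h k N)" by (rule suminf_finite) (auto simp: h_def)
    then show ?thesis by (simp add: h_def)
  qed
  ultimately show ?thesis using S by (simp add: sums_iff)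
qed

lemma sum_of_squares_bound_complex:
  fixes a b :: complex
  shows "norm (a * b) \<le> ((norm a)\<^sup>2 + (norm b)\<^sup>2)"
proof -
  have "0 \<le> (norm a - norm b)\<^sup>2" by simp
  then have "2 * (norm a * norm b) \<le> (norm a)\<^sup>2 + (norm b)\<^sup>2" by (simp add: power2_diff mult.assoc)
  moreover have "0 \<le> norm a * norm b" by simp
  ultimately show ?thesis unfolding norm_mult by linarith
qed

lemma borel_measurable_indicator_continuous:
  fixes f :: "'a::euclidean_space \<Rightarrow> 'b::{banach, second_countable_topology}"
  assumes "continuous_on S f" "S \<in> sets borel"
  shows "(\<lambda>y. indicator S y *\<^sub>R f y) \<in> borel_measurable borel"
  using borel_measurable_continuous_on_indicator[of S f] assms by simp

lemma integrable_mult_L2: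
  fixes f g :: "'a::euclidean_space \<Rightarrow> complex"
  assumes "continuous_on S f" "continuous_on S g" and [measurable]: "S \<in> sets borel"
    and "integrable lborel (\<lambda>y. indicator S y * (norm (f y))\<^sup>2)" "integrable lborel (\<lambda>y. indicator S y * (norm (g y))\<^sup>2)"
  shows "integrable lborel (\<lambda>y. indicator S y *\<^sub>R (f y * g y))"
proof (rule Bochner_Integration.integrable_bound[OF Bochner_Integration.integrable_add[OF assms(4,5)]])
  show "(\<lambda>y. indicator S y *\<^sub>R (f y * g y)) \<in> borel_measurable lborel"
    using borel_measurable_indicator_continuous[of S "\<lambda>y. f y * g y"] assms by (auto intro!: continuous_intros)
  show "AE y in lborel. norm (indicator S y *\<^sub>R (f y * g y)) \<le> norm (indicator S y * (norm (f y))\<^sup>2 + indicator S y * (norm (g y))\<^sup>2)"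
  proof (intro AE_I2)
    fix y
    show "norm (indicator S y *\<^sub>R (f y * g y)) \<le> norm (indicator S y * (norm (f y))\<^sup>2 + indicator S y * (norm (g y))\<^sup>2)"
      using sum_of_squares_bound_complex[of "f y" "g y"] by (cases "y \<in> S") auto
  qed
qed

lemma hmono_measurable [measurable]: "hmono e k i N \<in> borel_measurable borel"
  unfolding hmono_def[abs_def] by measurable

lemma hmono_continuous: "l > 0 \<Longrightarrow> continuous_on (hartogs m l) (hmono e k i N)"
  unfolding hmono_def[abs_def]
  by (intro continuous_intros) (auto simp: hartogs_def zero_power dest: le_less_trans[rotated])

lemma hmono_norm_sq:
  assumes "m > 0"
  shows "(norm (hmono e k i N y))\<^sup>2 = norm (herm (fst y) e) ^ (2 * k) * (hY m y ^ (m * i) / hY m y ^ (m * N))"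
proof -
  have "(norm (snd y))\<^sup>2 = hY m y ^ m" using powr_two_over_power[OF assms, of "snd y"] by (simp add: hY_def)
  then have "(norm (snd y) ^ j)\<^sup>2 = hY m y ^ (m * j)" for j
    by (metis power_commutes power_mult mult.commute)
  then show ?thesis
    by (simp add: hmono_def norm_mult norm_divide norm_power power_mult_distrib power_divide power_mult[symmetric] mult.commute[of k])
qed

lemma hmono_moment:
  fixes e :: "complex ^ 'n" and m l k :: nat
  assumes [measurable]: "W \<in> borel_measurable borel"
    and e: "norm e = 1" and m: "m > 0" and l: "l > 0"
  shows "(\<integral>\<^sup>+y\<in>hartogs m l. ennreal ((norm (hmono e k i N y))\<^sup>2) * W (hY m y) \<partial>lborel)
    = ennreal (real m * pi ^ (CARD('n) + 1) * fact k / fact (CARD('n) + k)) *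
      (\<integral>\<^sup>+y\<in>{0<..<1}. ennreal (y ^ (l * k + (m + l * CARD('n) - 1) + m * i) / y ^ (m * N)) * W y \<partial>lborel)"
proof -
  define n where "n = CARD('n)"
  have n: "n > 0" by (simp add: n_def)
  define \<psi> where "\<psi> = (\<lambda>y. ennreal (y ^ (m * i) / y ^ (m * N)) * W y)"
  have [measurable]: "\<psi> \<in> borel_measurable borel" unfolding \<psi>_def by measurable
  have "(\<integral>\<^sup>+y\<in>hartogs m l. ennreal ((norm (hmono e k i N y))\<^sup>2) * W (hY m y) \<partial>lborel) =
     (\<integral>\<^sup>+y\<in>hartogs m l. ennreal (norm (herm (fst y) e) ^ (2 * k)) * (\<lambda>_. 1) (hX m l y) * \<psi> (hY m y) \<partial>lborel)"
    by (simp only: hmono_norm_sq[OF m] \<psi>_def mult_1_right mult.assoc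
       ennreal_mult[OF zero_le_power[OF norm_ge_zero] divide_nonneg_nonneg[OF zero_le_power[OF hY_nonneg] zero_le_power[OF hY_nonneg]]])
  also have "\<dots> = ennreal (real m * pi ^ (n + 1) * fact k / fact (n + k - 1)) *
      (\<integral>\<^sup>+x\<in>{0<..<1}. ennreal (x ^ (n + k - 1)) * 1 \<partial>lborel) *
      (\<integral>\<^sup>+y\<in>{0<..<1}. ennreal (y ^ (l * k + (m + l * n - 1))) * \<psi> y \<partial>lborel)"
    unfolding n_def by (rule hartogs_moment) (use assms in auto)
  also have "(\<integral>\<^sup>+x\<in>{0<..<1}. ennreal (x ^ (n + k - 1)) * 1 \<partial>lborel) = ennreal (1 / real (n + k))"
    using n by (simp only: mult_1_right nn_integral_power_unit) (simp add: of_nat_diff)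
  also have "ennreal (real m * pi ^ (n + 1) * fact k / fact (n + k - 1)) * ennreal (1 / real (n + k)) =
     ennreal (real m * pi ^ (n + 1) * fact k / fact (n + k))"
  proof -
    have "(fact (n + k) :: real) = real (n + k) * fact (n + k - 1)" using n by (intro fact_reduce) simp
    then show ?thesis by (subst ennreal_mult[symmetric]) (auto simp: mult_ac)
  qed
  also have "(\<integral>\<^sup>+y\<in>{0<..<1}. ennreal (y ^ (l * k + (m + l * n - 1))) * \<psi> y \<partial>lborel) =
     (\<integral>\<^sup>+y\<in>{0<..<1}. ennreal (y ^ (l * k + (m + l * n - 1) + m * i) / y ^ (m * N)) * W y \<partial>lborel)"
  proof (rule nn_integral_cong)
    fix y :: real
    show "ennreal (y ^ (l * k + (m + l * n - 1))) * \<psi> y * indicator {0<..<1} y =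
       ennreal (y ^ (l * k + (m + l * n - 1) + m * i) / y ^ (m * N)) * W y * indicator {0<..<1} y"
      unfolding \<psi>_def power_add[of y "l * k + (m + l * n - 1)"] times_divide_eq_right[symmetric]
      by (cases "0 < y") (simp_all only: mult.assoc ennreal_mult zero_le_power zero_le_divide_iff less_imp_le indicator_simps simp_thms
          greaterThanLessThan_iff mult_zero_right)
  qed
  finally show ?thesis by (simp only: n_def)
qed

context
  fixes m l :: nat
  assumes m: "m > 0" and l: "l > 0"
begin

text \<open>With pole order \<open>eidx m l n k + 1\<close>, the definition of the indices by
  division with remainder turns the density of the squared monomial into
  \<open>Y ^ (r + m * i)\<close>, which is integrable for every \<open>i\<close>.\<close>

lemma hmono_moment_allowed:
  fixes e :: "complex ^ 'n"
  assumes e: "norm e = 1"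
  shows "integrable lborel (\<lambda>y. indicator (hartogs m l) y * (norm (hmono e k i (eidx m l CARD('n) k + 1) y))\<^sup>2)"
    and "(LINT y|lborel. indicator (hartogs m l) y * (norm (hmono e k i (eidx m l CARD('n) k + 1) y))\<^sup>2) = 1 / kcoef m l CARD('n) k i"
proof -
  define n where "n = CARD('n)"
  have n: "n > 0" by (simp add: n_def)
  note [measurable] = hartogs_measurable[OF m l]
  define N where "N = eidx m l n k + 1"
  define r where "r = ridx m l n k"
  have ex: "l * k + (m + l * n - 1) + m * i = (r + m * i) + m * N"
    using idx_eq[OF l n, of k m] n m l by (simp add: N_def r_def algebra_simps)
  have "(\<integral>\<^sup>+y. ennreal (indicator (hartogs m l) y * (norm (hmono e k i N y))\<^sup>2) \<partial>lborel) =
    (\<integral>\<^sup>+y\<in>hartogs m l. ennreal ((norm (hmono e k i N y))\<^sup>2) * (\<lambda>_. 1) (hY m y) \<partial>lborel)"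
    by (intro nn_integral_cong) (auto simp: indicator_def)
  also have "\<dots> = ennreal (real m * pi ^ (n + 1) * fact k / fact (n + k)) *
      (\<integral>\<^sup>+y\<in>{0<..<1}. ennreal (y ^ (l * k + (m + l * n - 1) + m * i) / y ^ (m * N)) * 1 \<partial>lborel)"
    unfolding n_def by (rule hmono_moment[OF _ e m l]) simp
  also have "(\<integral>\<^sup>+y\<in>{0<..<1}. ennreal (y ^ (l * k + (m + l * n - 1) + m * i) / y ^ (m * N)) * 1 \<partial>lborel) =
     (\<integral>\<^sup>+y\<in>{0<..<1}. ennreal (y ^ (r + m * i)) \<partial>lborel)"
    unfolding ex by (intro nn_integral_cong) (auto simp: indicator_def power_add)
  also have "\<dots> = ennreal (1 / (real (r + m * i) + 1))" by (rule nn_integral_power_unit)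
  also have "ennreal (real m * pi ^ (n + 1) * fact k / fact (n + k)) * ennreal (1 / (real (r + m * i) + 1)) = ennreal (1 / kcoef m l n k i)"
  proof -
    have "kcoef m l n k i = fact (n + k) * (real (r + m * i) + 1) / (real m * pi ^ (n + 1) * fact k)"
      by (simp add: kcoef_def r_def ring_distribs)
    then have "real m * pi ^ (n + 1) * fact k / fact (n + k) * (1 / (real (r + m * i) + 1)) = 1 / kcoef m l n k i"
      by (simp only: divide_divide_eq_right times_divide_times_eq mult_1 mult_1_right)
    then show ?thesis by (subst ennreal_mult[symmetric]) auto
  qed
  finally have *: "(\<integral>\<^sup>+y. ennreal (indicator (hartogs m l) y * (norm (hmono e k i N y))\<^sup>2) \<partial>lborel) = ennreal (1 / kcoef m l n k i)" .
  have kc: "1 / kcoef m l n k i \<ge> 0" by (simp add: kcoef_def)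
  show "integrable lborel (\<lambda>y. indicator (hartogs m l) y * (norm (hmono e k i (eidx m l CARD('n) k + 1) y))\<^sup>2)"
    using * by (intro integrableI_nonneg) (auto simp: N_def n_def)
  show "(LINT y|lborel. indicator (hartogs m l) y * (norm (hmono e k i (eidx m l CARD('n) k + 1) y))\<^sup>2) = 1 / kcoef m l CARD('n) k i"
    using * kc by (subst integral_eq_nn_integral) (auto simp: N_def n_def)
qed

context
  fixes f :: "(complex ^ 'n) \<times> complex \<Rightarrow> complex"
  assumes hol: "holomorphic_several f (hartogs m l)"
    and I: "integrable lborel (\<lambda>y. indicator (hartogs m l) y * (norm (f y))\<^sup>2)"
begin

text \<open>The hypothesis on \<open>i\<close> says that the squared monomial has density
  \<open>Y ^ (A - m * N)\<close> with exponent at most -1, so its norm over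
  \<open>Y > \<delta>\<close> grows at least like \<open>- ln \<delta>\<close>. By
  \<open>weighted_coefficient\<close> the component of \<open>f\<close> along the truncated monomial
  has the same factor \<open>\<beta>\<close> for every \<open>\<delta>\<close>; a nonzero
  \<open>\<beta>\<close> would make the norm of \<open>f\<close> infinite.\<close>

lemma nonallowed_coefficient_zero:
  assumes e: "norm e = 1"
    and B: "B holomorphic_on ball 0 1" "\<forall>\<tau>\<in>ball 0 1 - {0}. slice_coeff f e k \<tau> = B \<tau> / \<tau> ^ N"
    and i: "l * k + (m + l * CARD('n) - 1) + m * i < m * N"
  shows "(deriv ^^ i) B 0 / fact i = 0"
proof (rule ccontr)
  define n where "n = CARD('n)"
  define \<beta> where "\<beta> = (deriv ^^ i) B 0 / fact i"
  assume "\<not> (deriv ^^ i) B 0 / fact i = 0"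
  then have b: "norm \<beta> > 0" by (simp add: \<beta>_def)
  define b where "b = norm \<beta>"
  have b: "b > 0" using b by (simp add: b_def)
  note [measurable] = hartogs_measurable[OF m l]
  define A where "A = l * k + (m + l * n - 1) + m * i"
  have A: "A < m * N" using i by (simp add: A_def n_def)
  define C where "C = real m * pi ^ (n + 1) * fact k / fact (n + k)"
  have C: "C > 0" using m by (simp add: C_def)
  have fm: "(\<lambda>y. indicator (hartogs m l) y *\<^sub>R f y) \<in> borel_measurable borel"
    by (rule borel_measurable_indicator_continuous[OF holomorphic_several_continuous[OF hol]]) measurable
  define Q where "Q = L2_sq (hartogs m l) f"
  have bnd: "C * (- ln \<delta>) \<le> Q / b\<^sup>2" if \<delta>: "0 < \<delta>" "\<delta> < 1" for \<delta>
  proof -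
    \<comment> \<open>Truncating to \<open>Y > \<delta>\<close> makes the monomial square integrable
      and keeps the rotation invariance.\<close>
    define W where "W = (indicator {\<delta><..} :: real \<Rightarrow> real)"
    have [measurable]: "W \<in> borel_measurable borel" by (simp add: W_def)
    have W: "W x * W x = W x" "0 \<le> W x" "W x \<le> 1" for x by (auto simp: W_def indicator_def)
    define g where "g = (\<lambda>y. indicator (hartogs m l) y * W (hY m y) * (norm (hmono e k i N y))\<^sup>2)"
    have [measurable]: "g \<in> borel_measurable borel" unfolding g_def by measurable
    have nn: "(\<integral>\<^sup>+y. ennreal (g y) \<partial>lborel) = ennreal C * (\<integral>\<^sup>+y\<in>{0<..<1}. ennreal (y ^ A / y ^ (m * N)) * ennreal (W y) \<partial>lborel)"
    proof -
      have "(\<integral>\<^sup>+y. ennreal (g y) \<partial>lborel) = (\<integral>\<^sup>+y\<in>hartogs m l. ennreal ((norm (hmono e k i N y))\<^sup>2) * ennreal (W (hY m y)) \<partial>lborel)"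
        by (intro nn_integral_cong) (auto simp: g_def indicator_def ennreal_mult W mult.commute)
      also have "\<dots> = ennreal C * (\<integral>\<^sup>+y\<in>{0<..<1}. ennreal (y ^ A / y ^ (m * N)) * ennreal (W y) \<partial>lborel)"
        unfolding C_def A_def n_def by (rule hmono_moment[OF _ e m l]) simp
      finally show ?thesis .
    qed
    have "(\<integral>\<^sup>+y\<in>{0<..<1}. ennreal (y ^ A / y ^ (m * N)) * ennreal (W y) \<partial>lborel) \<le> (\<integral>\<^sup>+y. ennreal (1 / \<delta> ^ (m * N)) * indicator {0..1::real} y \<partial>lborel)"
    proof (rule nn_integral_mono)
      fix y :: real
      have "y ^ A / y ^ (m * N) \<le> 1 / \<delta> ^ (m * N)" if "\<delta> < y" "y < 1"
        using that \<delta> by (intro frac_le power_mono power_le_one) auto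
      then show "ennreal (y ^ A / y ^ (m * N)) * ennreal (W y) * indicator {0<..<1} y \<le> ennreal (1 / \<delta> ^ (m * N)) * indicator {0..1::real} y"
        by (auto simp: W_def indicator_def intro!: ennreal_leI)
    qed
    also have "\<dots> < \<infinity>" by (simp add: nn_integral_cmult_indicator ennreal_mult_less_top)
    finally have "(\<integral>\<^sup>+y. ennreal (g y) \<partial>lborel) < \<infinity>" unfolding nn by (simp add: ennreal_mult_less_top)
    then have gI: "integrable lborel g" by (intro integrableI_nonneg) (auto simp: g_def W)
    define M where "M = (LINT y|lborel. g y)"
    have M: "(\<integral>\<^sup>+y. ennreal (g y) \<partial>lborel) = ennreal M"
      unfolding M_def by (rule nn_integral_eq_integral[OF gI]) (auto simp: g_def W)
    have M0: "M \<ge> 0" unfolding M_def by (rule Bochner_Integration.integral_nonneg) (auto simp: g_def W)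
    define F where "F = (\<lambda>y. (indicator (hartogs m l) y * W (hY m y)) *\<^sub>R (f y * cnj (hmono e k i N y)))"
    have Fm: "F \<in> borel_measurable borel"
    proof -
      have "F = (\<lambda>y. W (hY m y) *\<^sub>R ((indicator (hartogs m l) y *\<^sub>R f y) * cnj (hmono e k i N y)))"
        by (auto simp: F_def indicator_def)
      moreover have [measurable]: "(\<lambda>y. cnj (hmono e k i N y)) \<in> borel_measurable borel"
        by (rule measurable_compose[OF hmono_measurable]) (intro borel_measurable_continuous_onI continuous_intros)
      moreover note fm[measurable]
      ultimately show ?thesis by (simp only:) measurable
    qed
    \<comment> \<open>The weights \<open>1 / b\<close> and \<open>b\<close>, with
      \<open>b = norm \<beta>\<close>, are chosen so that half of \<open>b * M\<close> is absorbed
      in the left side below, leaving \<open>M \<le> Q / b^2\<close>.\<close>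
    have nF: "norm (F y) \<le> (indicator (hartogs m l) y * (norm (f y))\<^sup>2 / b + b * g y) / 2" for y
    proof (cases "y \<in> hartogs m l \<and> W (hY m y) = 1")
      case True
      have "0 \<le> (norm (f y) - b * norm (hmono e k i N y))\<^sup>2" by simp
      then have "2 * b * (norm (f y) * norm (hmono e k i N y)) \<le> (norm (f y))\<^sup>2 + b\<^sup>2 * (norm (hmono e k i N y))\<^sup>2"
        by (simp add: power2_diff power_mult_distrib algebra_simps)
      then have "norm (f y) * norm (hmono e k i N y) \<le> ((norm (f y))\<^sup>2 / b + b * (norm (hmono e k i N y))\<^sup>2) / 2"
        using b by (simp add: field_simps power2_eq_square)
      then show ?thesis using True by (simp add: F_def g_def norm_mult)
    next
      case False
      then have "F y = 0" by (auto simp: F_def W_def indicator_def)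
      then show ?thesis using b by (simp add: g_def W)
    qed
    have I2: "integrable lborel (\<lambda>y. (indicator (hartogs m l) y * (norm (f y))\<^sup>2 / b + b * g y) / 2)"
      using I gI by simp
    have FI: "integrable lborel F"
      using Fm nF by (intro Bochner_Integration.integrable_bound[OF I2] AE_I2) (auto intro: order_trans[OF _ abs_ge_self])
    have "(LINT y|lborel. F y) = \<beta> * complex_of_real M"
      using weighted_coefficient[OF m l e hol B FI[unfolded F_def]] by (simp add: F_def M_def g_def \<beta>_def)
    then have "b * M = norm (LINT y|lborel. F y)" using M0 by (simp add: norm_mult b_def)
    also have "\<dots> \<le> (LINT y|lborel. norm (F y))" by (rule integral_norm_bound)
    also have "\<dots> \<le> (LINT y|lborel. (indicator (hartogs m l) y * (norm (f y))\<^sup>2 / b + b * g y) / 2)"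
      by (intro integral_mono I2 nF integrable_norm FI)
    also have "\<dots> = (Q / b + b * M) / 2" using I gI by (simp add: Q_def L2_sq_def M_def)
    finally have "b * M \<le> (Q / b + b * M) / 2" .
    moreover have "p \<le> (q + p) / 2 \<Longrightarrow> p \<le> q" for p q :: real by simp
    ultimately have "b * M \<le> Q / b" by blast
    then have "M \<le> Q / b\<^sup>2" using b by (simp add: field_simps power2_eq_square)
    moreover have "C * (- ln \<delta>) \<le> M"
    proof -
      have "((\<lambda>y. 1 / y) has_integral (ln 1 - ln \<delta>)) {\<delta>..1}"
        using \<delta> by (intro fundamental_theorem_of_calculus)
          (auto intro!: derivative_eq_intros simp: has_real_derivative_iff_has_vector_derivative[symmetric])
      then have "(\<integral>\<^sup>+y. ennreal (1 / y) * indicator {\<delta>..1} y \<partial>lborel) = ennreal (- ln \<delta>)"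
        using \<delta> nn_integral_has_integral_lebesgue'[of "{\<delta>..1}" "\<lambda>y. 1 / y" "ln 1 - ln \<delta>"] by simp
      moreover have "(\<integral>\<^sup>+y. ennreal (1 / y) * indicator {\<delta>..1} y \<partial>lborel) \<le>
         (\<integral>\<^sup>+y\<in>{0<..<1}. ennreal (y ^ A / y ^ (m * N)) * ennreal (W y) \<partial>lborel)"
      proof (rule nn_integral_mono_AE)
        show "AE y in lborel. ennreal (1 / y) * indicator {\<delta>..1} y \<le> ennreal (y ^ A / y ^ (m * N)) * ennreal (W y) * indicator {0<..<1} y"
          using AE_lborel_singleton[of \<delta>] AE_lborel_singleton[of 1]
        proof eventually_elim
          fix y :: real assume y: "y \<noteq> \<delta>" "y \<noteq> 1"
          have "1 / y \<le> y ^ A / y ^ (m * N)" if "\<delta> < y" "y < 1"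
          proof -
            have "y ^ (m * N) \<le> y ^ (A + 1)" using that \<delta> A by (intro power_decreasing) auto
            then show ?thesis using that \<delta> by (simp add: field_simps)
          qed
          then show "ennreal (1 / y) * indicator {\<delta>..1} y \<le> ennreal (y ^ A / y ^ (m * N)) * ennreal (W y) * indicator {0<..<1} y"
            using y \<delta> by (auto simp: W_def indicator_def intro!: ennreal_leI)
        qed
      qed
      ultimately have "ennreal C * ennreal (- ln \<delta>) \<le> ennreal M"
        unfolding M[symmetric] nn by (intro mult_left_mono) auto
      then show ?thesis using C M0 \<delta> by (simp add: ennreal_mult'[symmetric])
    qed
    ultimately show ?thesis by linarith
  qed
  have Q: "Q \<ge> 0" unfolding Q_def L2_sq_def by (rule Bochner_Integration.integral_nonneg) simp
  \<comment> \<open>With \<open>\<delta> = exp (- x)\<close> the left side of \<open>bnd\<close> is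
    \<open>C * x\<close>, which exceeds \<open>Q / b^2\<close> by exactly \<open>C\<close>.\<close>
  define x where "x = Q / b\<^sup>2 / C + 1"
  have x: "x > 0" using Q b C by (simp add: x_def add_nonneg_pos)
  have "C * x \<le> Q / b\<^sup>2" using bnd[of "exp (- x)"] x by simp
  moreover have "C * x = Q / b\<^sup>2 + C" using C by (simp add: x_def field_simps)
  ultimately show False using C by simp
qed

end

end

lemma lebesgue_on_integral:
  fixes g :: "'a::euclidean_space \<Rightarrow> 'b::{banach, second_countable_topology}"
  assumes S: "S \<in> sets borel" and g: "(\<lambda>y. indicator S y *\<^sub>R g y) \<in> borel_measurable borel"
  shows "integrable (lebesgue_on S) g \<longleftrightarrow> integrable lborel (\<lambda>y. indicator S y *\<^sub>R g y)"
    and "(LINT y|lebesgue_on S. g y) = (LINT y|lborel. indicator S y *\<^sub>R g y)"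
proof -
  have S': "S \<inter> space lebesgue \<in> sets lebesgue" using S by simp
  have g': "(\<lambda>y. indicator S y *\<^sub>R g y) \<in> borel_measurable lborel" using g by simp
  show "integrable (lebesgue_on S) g \<longleftrightarrow> integrable lborel (\<lambda>y. indicator S y *\<^sub>R g y)"
    unfolding integrable_restrict_space[OF S'] by (rule integrable_completion[OF g'])
  show "(LINT y|lebesgue_on S. g y) = (LINT y|lborel. indicator S y *\<^sub>R g y)"
    unfolding integral_restrict_space[OF S'] by (rule integral_completion[OF g'])
qed

context
  fixes m l :: nat
  assumes m: "m > 0" and l: "l > 0"
begin

lemma bergman_space_iff:
  fixes f :: "(complex ^ 'n) \<times> complex \<Rightarrow> complex"
  shows "f \<in> bergman_space (hartogs m l) \<longleftrightarrow>
    holomorphic_several f (hartogs m l) \<and> integrable lborel (\<lambda>y. indicator (hartogs m l) y * (norm (f y))\<^sup>2)"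
proof (cases "holomorphic_several f (hartogs m l)")
  case True
  note [measurable] = hartogs_measurable[OF m l]
  have c: "continuous_on (hartogs m l) f" by (rule holomorphic_several_continuous[OF True])
  have "f \<in> borel_measurable (lebesgue_on (hartogs m l))"
    by (rule continuous_imp_measurable_on_sets_lebesgue[OF c]) simp
  moreover have "(\<lambda>y. indicator (hartogs m l) y *\<^sub>R (norm (f y))\<^sup>2) \<in> borel_measurable borel"
    by (rule borel_measurable_indicator_continuous) (auto intro!: continuous_intros c)
  ultimately show ?thesis
    using True lebesgue_on_integral(1)[of "hartogs m l" "\<lambda>y. (norm (f y))\<^sup>2"]
    by (simp add: bergman_space_def Lp_space_def)
qed (simp add: bergman_space_def)

context
  fixes f :: "(complex ^ 'n) \<times> complex \<Rightarrow> complex"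
  assumes hol: "holomorphic_several f (hartogs m l)"
    and I: "integrable lborel (\<lambda>y. indicator (hartogs m l) y * (norm (f y))\<^sup>2)"
begin

text \<open>The Laurent series of a coefficient of a square integrable function starts at the first
  admissible power, and each of its terms is an inner product of \<open>f\<close> with a monomial
  divided by the squared norm of that monomial.\<close>

lemma slice_coeff_sums:
  assumes e: "norm e = 1" and \<tau>: "\<tau> \<in> ball 0 1 - {0}"
  shows "(\<lambda>i. complex_of_real (kcoef m l CARD('n) k i) *
     (LINT y|lborel. indicator (hartogs m l) y *\<^sub>R (f y * cnj (hmono e k i (eidx m l CARD('n) k + 1) y))) *
     (\<tau> ^ i / \<tau> ^ (eidx m l CARD('n) k + 1))) sums slice_coeff f e k \<tau>"
proof -
  define n where "n = CARD('n)"
  have n: "n > 0" by (simp add: n_def)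
  obtain B N where B: "B holomorphic_on ball 0 1" "\<forall>\<tau>\<in>ball 0 1 - {0}. slice_coeff f e k \<tau> = B \<tau> / \<tau> ^ N"
    and N: "N \<ge> l * (k + n)"
    using slice_coeff_extends[OF m l e hol I] unfolding n_def by blast
  define E where "E = eidx m l n k + 1"
  have idx: "l * (k + n) = m * (E - 1) + ridx m l n k + 1" using idx_eq[OF l n, of k m] by (simp add: E_def)
  have r: "ridx m l n k < m" by (rule ridx_less[OF m])
  have EN: "E \<le> N"
  proof -
    have "E - 1 \<le> m * (E - 1)" using m by simp
    then show ?thesis using N idx by linarith
  qed
  define d where "d = N - E"
  define \<beta> where "\<beta> = (\<lambda>i. (deriv ^^ i) B 0 / fact i)"
  \<comment> \<open>The order \<open>N\<close> may exceed the admissible order \<open>E\<close> by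
    \<open>d\<close>. The first \<open>d\<close> coefficients of \<open>B\<close> belong to
    monomials that are not square integrable and vanish, so the index can be shifted by
    \<open>d\<close>.\<close>
  have \<beta>0: "\<beta> j = 0" if "j < d" for j
  proof -
    have "m * (E + j + 1) \<le> m * N" using that by (intro mult_le_mono2) (simp add: d_def)
    moreover have "l * k + (m + l * n - 1) + m * j < m * (E + j + 1)"
      using idx r m by (simp add: algebra_simps E_def)
    ultimately have "l * k + (m + l * CARD('n) - 1) + m * j < m * N" by (simp add: n_def)
    from nonallowed_coefficient_zero[OF m l hol I e B this] show ?thesis by (simp add: \<beta>_def)
  qed
  have hm: "hmono e k (i + d) N y = hmono e k i E y" if "y \<in> hartogs m l" for i y
  proof -
    have "snd y \<noteq> 0" using that l by (auto simp: hartogs_def zero_power dest: le_less_trans[rotated])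
    moreover have "N = E + d" using EN by (simp add: d_def)
    ultimately show ?thesis by (simp add: hmono_def power_add)
  qed
  have coef: "complex_of_real (kcoef m l n k i) * (LINT y|lborel. indicator (hartogs m l) y *\<^sub>R (f y * cnj (hmono e k i E y))) = \<beta> (i + d)" for i
  proof -
    have kc: "kcoef m l n k i > 0" using m by (simp add: kcoef_def del: of_nat_Suc of_nat_add)
    have Fint: "integrable lborel (\<lambda>y. indicator (hartogs m l) y *\<^sub>R (f y * cnj (hmono e k i E y)))"
      using hmono_moment_allowed(1)[OF m l e, of k i] I hartogs_measurable[OF m l] hmono_continuous[OF l]
      by (intro integrable_mult_L2 holomorphic_several_continuous[OF hol] continuous_intros) (simp_all add: E_def n_def)
    have eq1: "(\<lambda>y. (indicator (hartogs m l) y * (\<lambda>_. 1) (hY m y)) *\<^sub>R (f y * cnj (hmono e k (i + d) N y))) =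
        (\<lambda>y. indicator (hartogs m l) y *\<^sub>R (f y * cnj (hmono e k i E y)))"
      by (rule ext) (auto simp: indicator_def hm)
    have eq2: "(\<lambda>y. indicator (hartogs m l) y * (\<lambda>_. 1) (hY m y) * (norm (hmono e k (i + d) N y))\<^sup>2) =
        (\<lambda>y. indicator (hartogs m l) y * (norm (hmono e k i E y))\<^sup>2)"
      by (rule ext) (auto simp: indicator_def hm)
    have "(LINT y|lborel. indicator (hartogs m l) y *\<^sub>R (f y * cnj (hmono e k i E y))) = \<beta> (i + d) * complex_of_real (1 / kcoef m l n k i)"
      using weighted_coefficient[OF m l e hol B, where W = "\<lambda>_. 1" and i = "i + d", unfolded eq1 eq2, OF Fint]
        hmono_moment_allowed(2)[OF m l e, of k i]
      by (simp add: \<beta>_def E_def n_def)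
    then show ?thesis using kc by simp
  qed
  have "(\<lambda>j. \<beta> j * \<tau> ^ j) sums B \<tau>"
    using holomorphic_power_series[OF B(1), of \<tau>] \<tau> by (simp add: \<beta>_def)
  then have "(\<lambda>i. \<beta> (i + d) * \<tau> ^ (i + d)) sums B \<tau>"
    by (subst sums_zero_iff_shift) (auto simp: \<beta>0)
  then have "(\<lambda>i. \<beta> (i + d) * \<tau> ^ (i + d) / \<tau> ^ N) sums (B \<tau> / \<tau> ^ N)"
    by (rule sums_divide)
  moreover have "\<beta> (i + d) * \<tau> ^ (i + d) / \<tau> ^ N = \<beta> (i + d) * (\<tau> ^ i / \<tau> ^ E)" for i
  proof -
    have "N = E + d" using EN by (simp add: d_def)
    then show ?thesis using \<tau> by (simp add: power_add)
  qed
  moreover have "B \<tau> / \<tau> ^ N = slice_coeff f e k \<tau>" using B(2) \<tau> by simp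
  ultimately have "(\<lambda>i. \<beta> (i + d) * (\<tau> ^ i / \<tau> ^ E)) sums slice_coeff f e k \<tau>" by simp
  then show ?thesis by (simp only: coef[symmetric] E_def n_def)
qed

end

text \<open>The square is \<open>1 / Y ^ s0\<close> on the domain, and \<open>Y ^ s0\<close> is the
  density of \<open>Y\<close> for \<open>k = 0\<close>; what remains is the integral of 1 over the
  unit interval.\<close>

lemma inverse_sqrt_power_integrable:
  "integrable lborel (\<lambda>y. indicator (hartogs m l :: ((complex ^ 'n) \<times> complex) set) y * (1 / sqrt (hY m y) ^ (m + l * CARD('n) - 1))\<^sup>2)"
proof (rule integrableI_nonneg)
  define s0 where "s0 = m + l * CARD('n) - 1"
  note [measurable] = hartogs_measurable[OF m l]
  obtain i0 :: 'n where True by simp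
  define e :: "complex ^ 'n" where "e = axis i0 1"
  have e: "norm e = 1" by (simp add: e_def)
  show "(\<lambda>y. indicator (hartogs m l :: ((complex ^ 'n) \<times> complex) set) y * (1 / sqrt (hY m y) ^ (m + l * CARD('n) - 1))\<^sup>2) \<in> borel_measurable lborel"
    by measurable
  have "(\<integral>\<^sup>+y. ennreal (indicator (hartogs m l :: ((complex ^ 'n) \<times> complex) set) y * (1 / sqrt (hY m y) ^ s0)\<^sup>2) \<partial>lborel) =
    (\<integral>\<^sup>+y\<in>hartogs m l. ennreal (norm (herm (fst y) e) ^ (2 * 0)) * (\<lambda>_. 1) (hX m l y) * (\<lambda>y. ennreal (1 / y ^ s0)) (hY m y) \<partial>lborel)"
  proof (rule nn_integral_cong)
    fix y :: "(complex ^ 'n) \<times> complex"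
    have "(1 / sqrt (hY m y) ^ s0)\<^sup>2 = 1 / hY m y ^ s0"
      using hY_nonneg[of m y] by (simp add: power_divide power_mult[symmetric] mult.commute[of s0]) (simp add: power_mult)
    then show "ennreal (indicator (hartogs m l) y * (1 / sqrt (hY m y) ^ s0)\<^sup>2) =
       ennreal (norm (herm (fst y) e) ^ (2 * 0)) * (\<lambda>_. 1) (hX m l y) * (\<lambda>y. ennreal (1 / y ^ s0)) (hY m y) * indicator (hartogs m l) y"
      by (auto simp: indicator_def)
  qed
  also have "\<dots> = ennreal (real m * pi ^ (CARD('n) + 1) * fact 0 / fact (CARD('n) + 0 - 1)) *
      (\<integral>\<^sup>+x\<in>{0<..<1}. ennreal (x ^ (CARD('n) + 0 - 1)) * 1 \<partial>lborel) *
      (\<integral>\<^sup>+y\<in>{0<..<1}. ennreal (y ^ (l * 0 + (m + l * CARD('n) - 1))) * ennreal (1 / y ^ s0) \<partial>lborel)"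
    by (rule hartogs_moment[OF _ _ e m l]) measurable
  also have "(\<integral>\<^sup>+y\<in>{0<..<1}. ennreal (y ^ (l * 0 + (m + l * CARD('n) - 1))) * ennreal (1 / y ^ s0) \<partial>lborel) = (\<integral>\<^sup>+y\<in>{0<..<1}. ennreal (y ^ 0) \<partial>lborel)"
    by (intro nn_integral_cong) (auto simp: indicator_def s0_def ennreal_mult[symmetric])
  also have "ennreal (real m * pi ^ (CARD('n) + 1) * fact 0 / fact (CARD('n) + 0 - 1)) *
      (\<integral>\<^sup>+x\<in>{0<..<1}. ennreal (x ^ (CARD('n) + 0 - 1)) * 1 \<partial>lborel) * \<dots> < \<infinity>"
    by (simp only: mult_1_right nn_integral_power_unit) (simp add: ennreal_mult_less_top)
  finally show "(\<integral>\<^sup>+y. ennreal (indicator (hartogs m l :: ((complex ^ 'n) \<times> complex) set) y * (1 / sqrt (hY m y) ^ (m + l * CARD('n) - 1))\<^sup>2) \<partial>lborel) < \<infinity>"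
    by (simp add: s0_def)
qed (auto simp: indicator_def)

lemma integral_double_sum:
  fixes G :: "nat \<Rightarrow> nat \<Rightarrow> 'a \<Rightarrow> 'b::{banach, second_countable_topology}"
  assumes "\<And>k i. integrable M (G k i)"
  shows "(LINT y|M. (\<Sum>k<A. \<Sum>i<B. G k i y)) = (\<Sum>k<A. \<Sum>i<B. LINT y|M. G k i y)"
  using assms by simp

text \<open>Both sides are limits of the same rectangular sums of \<open>a k i\<close>. Summed as an
  iterated series they give \<open>f x\<close>, by the Taylor expansion along \<open>e\<close>
  followed by the Laurent expansion in \<open>w\<close>; taken under the integral they give the
  kernel, by dominated convergence.\<close>

lemma reproducing_formula:
  fixes f :: "(complex ^ 'n) \<times> complex \<Rightarrow> complex"
  assumes hol: "holomorphic_several f (hartogs m l)"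
    and I: "integrable lborel (\<lambda>y. indicator (hartogs m l) y * (norm (f y))\<^sup>2)"
    and x: "x \<in> hartogs m l"
  shows "f x = (LINT y|lborel. indicator (hartogs m l) y *\<^sub>R (f y * hker m l x y))"
proof -
  define n where "n = CARD('n)"
  define s0 where "s0 = m + l * n - 1"
  note [measurable] = hartogs_measurable[OF m l]
  obtain z w where xzw: "x = (z, w)" by (cases x)
  \<comment> \<open>The unit vector depends on \<open>x\<close>: it points along the
    \<open>z\<close>-component of \<open>x\<close>, so that \<open>x\<close> lies on the line where
    \<open>f\<close> is expanded and each kernel term is a constant times a conjugated monomial in
    \<open>y\<close>. If that component is 0, any unit vector will do.\<close>
  obtain e :: "complex ^ 'n" where e: "norm e = 1" and z: "z = complex_of_real (norm z) *s e"
  proof (cases "z = 0")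
    case True
    obtain i0 :: 'n where True by simp
    show ?thesis by (rule that[of "axis i0 1"]) (use True in auto)
  next
    case False
    show ?thesis
      by (rule that[of "complex_of_real (1 / norm z) *s z"])
         (use False in \<open>auto simp: norm_scale_vec vector_smult_assoc norm_divide\<close>)
  qed
  define \<nu> where "\<nu> = complex_of_real (norm z)"
  have xe: "x = (\<nu> *s e, w)" using xzw z by (simp add: \<nu>_def)
  have w: "w \<in> ball 0 1 - {0}"
  proof -
    have "norm w ^ l < 1" "norm z ^ m < norm w ^ l" using x by (auto simp: xzw hartogs_def)
    then show ?thesis using l by (auto simp: power_less_one_iff zero_power dest: le_less_trans[rotated])
  qed
  define kt where "kt = (\<lambda>k i y. kterm m l n k i (herm (fst x) (fst y)) (snd x * cnj (snd y)))"
  define a where "a = (\<lambda>k i. LINT y|lborel. indicator (hartogs m l) y *\<^sub>R (f y * kt k i y))"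
  have kt_eq: "kt k i y = complex_of_real (kcoef m l n k i) * (\<nu> ^ k * (w ^ i / w ^ (eidx m l n k + 1))) * cnj (hmono e k i (eidx m l n k + 1) y)" for k i y
    unfolding kt_def kterm_def xe hmono_def
    by (simp add: herm_scale_left power_mult_distrib cnj_herm mult_ac)
  have a_eq: "a k i = complex_of_real (kcoef m l n k i) *
     (LINT y|lborel. indicator (hartogs m l) y *\<^sub>R (f y * cnj (hmono e k i (eidx m l n k + 1) y))) *
     (w ^ i / w ^ (eidx m l n k + 1)) * \<nu> ^ k" for k i
  proof -
    define c where "c = complex_of_real (kcoef m l n k i) * (\<nu> ^ k * (w ^ i / w ^ (eidx m l n k + 1)))"
    have "a k i = (LINT y|lborel. c * (indicator (hartogs m l) y *\<^sub>R (f y * cnj (hmono e k i (eidx m l n k + 1) y))))"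
      unfolding a_def kt_eq c_def[symmetric] by (rule Bochner_Integration.integral_cong) (simp_all add: mult_ac)
    also have "\<dots> = c * (LINT y|lborel. indicator (hartogs m l) y *\<^sub>R (f y * cnj (hmono e k i (eidx m l n k + 1) y)))"
      by (rule integral_mult_right_zero)
    finally show ?thesis by (simp add: c_def mult_ac)
  qed
  have g: "(\<lambda>i. a k i) sums (slice_coeff f e k w * \<nu> ^ k)" for k
    unfolding a_eq n_def by (intro sums_mult2 slice_coeff_sums[OF hol I] e w)
  have S: "(\<lambda>k. slice_coeff f e k w * \<nu> ^ k) sums f x"
    unfolding xe by (rule slice_sums[OF m l e hol]) (use x xe in simp)
  define D where "D = (\<lambda>y :: (complex ^ 'n) \<times> complex. kbound m l x * (1 / sqrt (hY m y) ^ s0))"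
  have kb: "kbound m l x \<ge> 0"
    using hartogs_norms[OF x m l] kconst_pos[OF m, of "CARD('n)"] by (simp add: kbound_def[OF m l])
  have fm: "(\<lambda>y. indicator (hartogs m l) y *\<^sub>R f y) \<in> borel_measurable borel"
    by (rule borel_measurable_indicator_continuous[OF holomorphic_several_continuous[OF hol]]) measurable
  have ktm: "kt k i \<in> borel_measurable borel" for k i
    unfolding kt_eq[abs_def]
    by (intro borel_measurable_times borel_measurable_const measurable_compose[OF hmono_measurable]
         borel_measurable_continuous_onI[where f = cnj] continuous_intros)
  \<comment> \<open>The majorant for all partial sums: \<open>norm (f y)\<close> times the bound of
    \<open>kterm_sum_bound\<close>. Both factors are square integrable on the domain, so
    \<open>dom\<close> is integrable.\<close>
  define dom where "dom = (\<lambda>y. indicator (hartogs m l) y * (norm (f y) * D y))"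
  have dom_int: "integrable lborel dom"
  proof (rule Bochner_Integration.integrable_bound)
    show "integrable lborel (\<lambda>y. indicator (hartogs m l) y * (norm (f y))\<^sup>2 + (kbound m l x)\<^sup>2 * (indicator (hartogs m l) y * (1 / sqrt (hY m y) ^ s0)\<^sup>2))"
      using inverse_sqrt_power_integrable I by (intro Bochner_Integration.integrable_add integrable_mult_right) (auto simp: s0_def n_def)
    have "dom = (\<lambda>y. norm (indicator (hartogs m l) y *\<^sub>R f y) * D y)" by (auto simp: dom_def indicator_def)
    moreover have [measurable]: "D \<in> borel_measurable borel" unfolding D_def by measurable
    moreover note fm[measurable]
    ultimately show "dom \<in> borel_measurable lborel" by (simp only:) measurable
    show "AE y in lborel. norm (dom y) \<le> norm (indicator (hartogs m l) y * (norm (f y))\<^sup>2 + (kbound m l x)\<^sup>2 * (indicator (hartogs m l) y * (1 / sqrt (hY m y) ^ s0)\<^sup>2))"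
    proof (intro AE_I2)
      fix y
      have "\<bar>p * q\<bar> \<le> p\<^sup>2 + q\<^sup>2" for p q :: real
        using sum_of_squares_bound_complex[of "complex_of_real p" "complex_of_real q"] by (simp add: norm_mult abs_mult)
      from this[of "norm (f y)" "D y"]
      have "\<bar>norm (f y) * D y\<bar> \<le> (norm (f y))\<^sup>2 + (kbound m l x)\<^sup>2 * (1 / sqrt (hY m y) ^ s0)\<^sup>2"
        by (simp only: D_def power_mult_distrib)
      then show "norm (dom y) \<le> norm (indicator (hartogs m l) y * (norm (f y))\<^sup>2 + (kbound m l x)\<^sup>2 * (indicator (hartogs m l) y * (1 / sqrt (hY m y) ^ s0)\<^sup>2))"
        by (auto simp: dom_def indicator_def)
    qed
  qed
  have fkm: "(\<lambda>y. indicator (hartogs m l) y *\<^sub>R (f y * kt k i y)) \<in> borel_measurable lborel" for k i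
  proof -
    have eq: "(\<lambda>y. indicator (hartogs m l) y *\<^sub>R (f y * kt k i y)) = (\<lambda>y. (indicator (hartogs m l) y *\<^sub>R f y) * kt k i y)" by auto
    show ?thesis unfolding eq by (intro borel_measurable_times) (use fm ktm in simp_all)
  qed
  have sum_le: "(\<Sum>k<M. \<Sum>i<N. norm (indicator (hartogs m l) y *\<^sub>R (f y * kt k i y))) \<le> dom y" for M N y
  proof (cases "y \<in> hartogs m l")
    case True
    have "(\<Sum>k<M. \<Sum>i<N. norm (kt k i y)) \<le> D y"
      using kterm_sum_bound[OF m l x True] by (simp add: kt_def D_def n_def s0_def)
    then have "norm (f y) * (\<Sum>k<M. \<Sum>i<N. norm (kt k i y)) \<le> norm (f y) * D y" by (intro mult_left_mono) auto
    then show ?thesis using True by (simp add: dom_def norm_mult sum_distrib_left)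
  qed (simp add: dom_def)
  have fk_int: "integrable lborel (\<lambda>y. indicator (hartogs m l) y *\<^sub>R (f y * kt k i y))" for k i
  proof (rule Bochner_Integration.integrable_bound[OF dom_int fkm], rule AE_I2)
    fix y
    have "norm (indicator (hartogs m l) y *\<^sub>R (f y * kt k i y)) \<le> (\<Sum>i<Suc i. norm (indicator (hartogs m l) y *\<^sub>R (f y * kt k i y)))"
      by (rule member_le_sum[where f = "\<lambda>i. norm (indicator (hartogs m l) y *\<^sub>R (f y * kt k i y))"]) auto
    also have "\<dots> \<le> (\<Sum>k<Suc k. \<Sum>i<Suc i. norm (indicator (hartogs m l) y *\<^sub>R (f y * kt k i y)))"
      by (intro member_le_sum[where f = "\<lambda>k. \<Sum>i<Suc i. norm (indicator (hartogs m l) y *\<^sub>R (f y * kt k i y))"] sum_nonneg norm_ge_zero) auto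
    also have "\<dots> \<le> dom y" by (rule sum_le)
    finally show "norm (indicator (hartogs m l) y *\<^sub>R (f y * kt k i y)) \<le> norm (dom y)" by simp
  qed
  have bound: "(\<Sum>k<M. \<Sum>i<N. norm (a k i)) \<le> (LINT y|lborel. dom y)" for M N
  proof -
    have "(\<Sum>k<M. \<Sum>i<N. norm (a k i)) \<le> (\<Sum>k<M. \<Sum>i<N. LINT y|lborel. norm (indicator (hartogs m l) y *\<^sub>R (f y * kt k i y)))"
      unfolding a_def by (intro sum_mono integral_norm_bound)
    also have "\<dots> = (LINT y|lborel. (\<Sum>k<M. \<Sum>i<N. norm (indicator (hartogs m l) y *\<^sub>R (f y * kt k i y))))"
      by (rule integral_double_sum[symmetric]) (rule integrable_norm[OF fk_int])
    also have "\<dots> \<le> (LINT y|lborel. dom y)"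
      using fk_int by (intro integral_mono dom_int sum_le Bochner_Integration.integrable_sum integrable_norm)
    finally show ?thesis .
  qed
  have lim1: "(\<lambda>N. \<Sum>k<N * m. \<Sum>i<N. a k i) \<longlonglongrightarrow> f x"
    by (rule double_series_square[OF g S m bound])
  define FN where "FN = (\<lambda>N y. \<Sum>k<N * m. \<Sum>i<N. indicator (hartogs m l) y *\<^sub>R (f y * kt k i y))"
  have FN_int: "(LINT y|lborel. FN N y) = (\<Sum>k<N * m. \<Sum>i<N. a k i)" for N
    unfolding FN_def a_def by (rule integral_double_sum[OF fk_int])
  have lim2: "(\<lambda>N. LINT y|lborel. FN N y) \<longlonglongrightarrow> (LINT y|lborel. indicator (hartogs m l) y *\<^sub>R (f y * hker m l x y))"
  proof (rule integral_dominated_convergence[where w = dom])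
    have FN_lim: "(\<lambda>N. FN N y) \<longlonglongrightarrow> indicator (hartogs m l) y *\<^sub>R (f y * hker m l x y)" for y
    proof (cases "y \<in> hartogs m l")
      case True
      have "(\<lambda>N. f y * (\<Sum>k<N * m. \<Sum>i<N. kt k i y)) \<longlonglongrightarrow> f y * hker m l x y"
        unfolding kt_def n_def by (intro tendsto_mult_left hker_tendsto m l x True)
      moreover have "indicator (hartogs m l) y = (1::real)" using True by simp
      ultimately show ?thesis by (simp only: FN_def scaleR_one sum_distrib_left)
    qed (simp add: FN_def)
    show FNm: "FN N \<in> borel_measurable lborel" for N
      unfolding FN_def by (intro borel_measurable_sum fkm)
    show "(\<lambda>y. indicator (hartogs m l) y *\<^sub>R (f y * hker m l x y)) \<in> borel_measurable lborel"
      by (rule borel_measurable_LIMSEQ_metric[OF FNm FN_lim])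
    show "AE y in lborel. (\<lambda>N. FN N y) \<longlonglongrightarrow> indicator (hartogs m l) y *\<^sub>R (f y * hker m l x y)"
      using FN_lim by simp
    show "AE y in lborel. norm (FN N y) \<le> dom y" for N
      unfolding FN_def by (intro AE_I2 order_trans[OF order_trans[OF norm_sum sum_mono[OF norm_sum]] sum_le])
  qed (rule dom_int)
  show ?thesis using LIMSEQ_unique[OF lim1 lim2[unfolded FN_int]] .
qed

text \<open>\<open>hker_bound\<close> controls the second variable; Hermitian symmetry transfers it
  to the first.\<close>

lemma hker_square_integrable:
  fixes y :: "(complex ^ 'n) \<times> complex"
  assumes y: "y \<in> hartogs m l"
  shows "integrable lborel (\<lambda>x. indicator (hartogs m l) x * (norm (hker m l x y))\<^sup>2)"
proof (rule Bochner_Integration.integrable_bound)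
  note [measurable] = hartogs_measurable[OF m l]
  have hol: "holomorphic_several (\<lambda>x. hker m l x y) (hartogs m l)" by (rule hker_holomorphic[OF m l y])
  show "integrable lborel (\<lambda>x. (kbound m l y)\<^sup>2 * (indicator (hartogs m l :: ((complex ^ 'n) \<times> complex) set) x * (1 / sqrt (hY m x) ^ (m + l * CARD('n) - 1))\<^sup>2))"
    using inverse_sqrt_power_integrable by (intro integrable_mult_right)
  have "(\<lambda>x. indicator (hartogs m l :: ((complex ^ 'n) \<times> complex) set) x *\<^sub>R (norm (hker m l x y))\<^sup>2) \<in> borel_measurable borel"
    by (rule borel_measurable_indicator_continuous) (auto intro!: continuous_intros holomorphic_several_continuous[OF hol])
  then show "(\<lambda>x. indicator (hartogs m l :: ((complex ^ 'n) \<times> complex) set) x * (norm (hker m l x y))\<^sup>2) \<in> borel_measurable lborel" by simp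
  show "AE x in lborel. norm (indicator (hartogs m l :: ((complex ^ 'n) \<times> complex) set) x * (norm (hker m l x y))\<^sup>2) \<le>
     norm ((kbound m l y)\<^sup>2 * (indicator (hartogs m l :: ((complex ^ 'n) \<times> complex) set) x * (1 / sqrt (hY m x) ^ (m + l * CARD('n) - 1))\<^sup>2))"
  proof (rule AE_I2)
    fix x :: "(complex ^ 'n) \<times> complex"
    show "norm (indicator (hartogs m l :: ((complex ^ 'n) \<times> complex) set) x * (norm (hker m l x y))\<^sup>2) \<le>
     norm ((kbound m l y)\<^sup>2 * (indicator (hartogs m l :: ((complex ^ 'n) \<times> complex) set) x * (1 / sqrt (hY m x) ^ (m + l * CARD('n) - 1))\<^sup>2))"
    proof (cases "x \<in> (hartogs m l :: ((complex ^ 'n) \<times> complex) set)")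
      case True
      have "norm (hker m l x y) \<le> kbound m l y / sqrt (hY m x) ^ (m + l * CARD('n) - 1)"
        using hker_bound[OF m l y True] hker_hermitian[OF m l, of y x] by simp
      then have "(norm (hker m l x y))\<^sup>2 \<le> (kbound m l y / sqrt (hY m x) ^ (m + l * CARD('n) - 1))\<^sup>2"
        by (rule power_mono) simp
      then show ?thesis using True by (simp add: power_divide)
    qed simp
  qed
qed

theorem bergman_kernel_hartogs: "bergman_kernel (hartogs m l :: ((complex ^ 'n) \<times> complex) set) = hker m l"
proof -
  let ?S = "hartogs m l :: ((complex ^ 'n) \<times> complex) set"
  note [measurable] = hartogs_measurable[OF m l]
  have A2: "(\<lambda>x. hker m l x y) \<in> bergman_space ?S" if y: "y \<in> ?S" for y
  proof -
    have hol: "holomorphic_several (\<lambda>x. hker m l x y) ?S" by (rule hker_holomorphic[OF m l y])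
    with hker_square_integrable[OF y] show ?thesis by (simp add: bergman_space_iff)
  qed
  have "is_bergman_kernel ?S (hker m l)"
    unfolding is_bergman_kernel_def
  proof (intro conjI ballI allI impI)
    fix f :: "(complex ^ 'n) \<times> complex \<Rightarrow> complex" and x
    assume f: "f \<in> bergman_space ?S" and x: "x \<in> ?S"
    have hol: "holomorphic_several f ?S" and I: "integrable lborel (\<lambda>y. indicator ?S y * (norm (f y))\<^sup>2)"
      using f by (auto simp: bergman_space_iff)
    have hk: "cnj (hker m l y x) = hker m l x y" for y using hker_hermitian[OF m l, of x y] by simp
    have "continuous_on ?S (\<lambda>y. f y * cnj (hker m l y x))"
      by (intro continuous_intros holomorphic_several_continuous hol hker_holomorphic m l x)
    then have "(\<lambda>y. indicator ?S y *\<^sub>R (f y * cnj (hker m l y x))) \<in> borel_measurable borel"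
      by (rule borel_measurable_indicator_continuous) measurable
    then have "(LINT y|lebesgue_on ?S. f y * cnj (hker m l y x)) = (LINT y|lborel. indicator ?S y *\<^sub>R (f y * cnj (hker m l y x)))"
      by (rule lebesgue_on_integral(2)[OF hartogs_measurable[OF m l]])
    then show "f x = (LINT y|lebesgue_on ?S. f y * cnj (hker m l y x))"
      using reproducing_formula[OF hol I x] by (simp add: hk)
  qed (rule A2, assumption, auto simp: hker_def[OF m l])
  then show ?thesis
    unfolding bergman_kernel_def
    using the_equality[of "is_bergman_kernel ?S" "hker m l"] is_bergman_kernel_unique by blast
qed

end

section \<open>Estimates for the Berezin kernel\<close>

lemma integral_rotation:
  fixes F :: "(complex ^ 'n) \<times> complex \<Rightarrow> complex"
  assumes [measurable]: "F \<in> borel_measurable borel" and "norm a = 1" "norm b = 1"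
  shows "(LINT y|lborel. F (a *s fst y, b * snd y)) = (LINT y|lborel. F y)"
proof -
  have d: "distr lborel borel (\<lambda>y. (a *s fst y :: complex ^ 'n, b * snd y)) = lborel"
    using assms by (intro distr_isometry_pair linear_scale_vec) (simp_all add: norm_scale_vec)
  have [measurable]: "(\<lambda>y. (a *s fst y :: complex ^ 'n, b * snd y)) \<in> borel_measurable borel"
    by (intro borel_measurable_continuous_onI continuous_intros)
  have "(LINT y|lborel. F y) = (LINT y|distr lborel borel (\<lambda>y. (a *s fst y, b * snd y)). F y)" by (simp add: d)
  also have "\<dots> = (LINT y|lborel. F (a *s fst y, b * snd y))"
    by (rule integral_distr) simp_all
  finally show ?thesis by simp
qed

lemma hX_rotation: "norm a = 1 \<Longrightarrow> norm b = 1 \<Longrightarrow> hX m l (a *s z, b * w) = hX m l (z, w)"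
  and hY_rotation: "norm b = 1 \<Longrightarrow> hY m (a *s z, b * w) = hY m (z, w)"
  and hartogs_rotation: "norm a = 1 \<Longrightarrow> norm b = 1 \<Longrightarrow> (a *s z, b * w) \<in> hartogs m l \<longleftrightarrow> (z, w) \<in> hartogs m l"
  by (simp_all add: hX_def hY_def hartogs_def norm_scale_vec norm_mult)

text \<open>A suitable rotation of \<open>z\<close> (if the powers of \<open>z\<close> differ) or of
  \<open>w\<close> (otherwise) changes the sign of the integrand, so the integral equals its own
  negative. The weight may depend on both \<open>X\<close> and \<open>Y\<close>.\<close>

lemma hmono_orthogonal:
  fixes e :: "complex ^ 'n"
  assumes [measurable]: "\<phi> \<in> borel_measurable borel" "\<psi> \<in> borel_measurable borel" "hartogs m l \<in> sets (borel :: ((complex ^ 'n) \<times> complex) measure)"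
    and ne: "k \<noteq> k' \<or> (i \<noteq> i' \<and> N = N')"
  shows "(LINT y|lborel. (indicator (hartogs m l) y * (\<phi> (hX m l y) * \<psi> (hY m y))) *\<^sub>R (hmono e k i N y * cnj (hmono e k' i' N' y))) = 0"
proof -
  define F where "F = (\<lambda>y. (indicator (hartogs m l) y * (\<phi> (hX m l y) * \<psi> (hY m y))) *\<^sub>R (hmono e k i N y * cnj (hmono e k' i' N' y)))"
  have [measurable]: "cnj \<in> borel_measurable borel" by (intro borel_measurable_continuous_onI continuous_intros)
  have Fm: "F \<in> borel_measurable borel" unfolding F_def by measurable
  have cisp: "cis t ^ a * cnj (cis t) ^ a' = cis (t * (real a - real a'))" for t a a'
    by (simp only: Complex.DeMoivre cis_cnj cis_mult mult_minus_right mult.commute[of t] left_diff_distrib diff_conv_add_uminus distrib_right mult_minus_left)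
  have cisn: "cis t ^ N \<noteq> 0" for t by simp
  obtain a b where ab: "norm a = 1" "norm b = 1" "\<And>y. F (a *s fst y, b * snd y) = - F y"
  proof (cases "k = k'")
    case False
    \<comment> \<open>This angle makes the factor \<open>cis (t * (k - k'))\<close> equal to
      -1.\<close>
    define t where "t = pi / (real k - real k')"
    have t: "cis t ^ k * cnj (cis t) ^ k' = -1" using False by (simp add: cisp t_def)
    show ?thesis
    proof (rule that[of "cis t" 1])
      fix y
      have "F (cis t *s fst y, 1 * snd y) = (cis t ^ k * cnj (cis t) ^ k') * F y"
        using hX_rotation[of "cis t" 1 m l "fst y" "snd y"] hY_rotation[of 1 m "cis t" "fst y" "snd y"] hartogs_rotation[of "cis t" 1 "fst y" "snd y" m l]
        by (simp add: F_def hmono_def herm_scale_left power_mult_distrib indicator_def mult_ac)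
      then show "F (cis t *s fst y, 1 * snd y) = - F y" by (simp add: t)
    qed auto
  next
    case True
    then have ii: "i \<noteq> i'" "N = N'" using ne by auto
    define t where "t = pi / (real i - real i')"
    have t: "cis t ^ i * cnj (cis t) ^ i' = -1" using ii by (simp add: cisp t_def)
    have tN: "cis t ^ N * cnj (cis t) ^ N = 1" by (simp add: cisp)
    show ?thesis
    proof (rule that[of 1 "cis t"])
      fix y
      have "F (1 *s fst y, cis t * snd y) = (cis t ^ i * cnj (cis t) ^ i') / (cis t ^ N * cnj (cis t) ^ N) * F y"
        using hX_rotation[of 1 "cis t" m l "fst y" "snd y"] hY_rotation[of "cis t" m 1 "fst y" "snd y"] hartogs_rotation[of 1 "cis t" "fst y" "snd y" m l]
        by (simp add: F_def hmono_def power_mult_distrib indicator_def ii(2) mult_ac)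
      then show "F (1 *s fst y, cis t * snd y) = - F y" by (simp only: t tN) simp
    qed auto
  qed
  have "(LINT y|lborel. F y) = (LINT y|lborel. F (a *s fst y, b * snd y))" by (rule integral_rotation[symmetric, OF Fm ab(1,2)])
  also have "\<dots> = - (LINT y|lborel. F y)" by (simp add: ab(3))
  finally have "(LINT y|lborel. F y) = 0" by simp
  then show ?thesis by (simp add: F_def)
qed

lemma finite_parseval:
  fixes h :: "'j \<Rightarrow> 'a::euclidean_space \<Rightarrow> complex" and w :: "'a \<Rightarrow> real"
  assumes J: "finite J" and [measurable]: "w \<in> borel_measurable borel" "\<And>j. h j \<in> borel_measurable borel"
    and w: "\<And>y. w y \<ge> 0"
    and I: "\<And>j. j \<in> J \<Longrightarrow> (\<integral>\<^sup>+y. ennreal (w y * (norm (h j y))\<^sup>2) \<partial>lborel) = ennreal (M j)" "\<And>j. M j \<ge> 0"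
    and orth: "\<And>j j'. j \<in> J \<Longrightarrow> j' \<in> J \<Longrightarrow> j \<noteq> j' \<Longrightarrow> (LINT y|lborel. w y *\<^sub>R (h j y * cnj (h j' y))) = 0"
  shows "(\<integral>\<^sup>+y. ennreal (w y * (norm (\<Sum>j\<in>J. a j * h j y))\<^sup>2) \<partial>lborel) = ennreal (\<Sum>j\<in>J. (norm (a j))\<^sup>2 * M j)"
proof -
  have [measurable]: "cnj \<in> borel_measurable borel" by (intro borel_measurable_continuous_onI continuous_intros)
  have I1: "integrable lborel (\<lambda>y. w y * (norm (h j y))\<^sup>2)" if "j \<in> J" for j
    using I(1)[OF that] by (intro integrableI_nonneg) (auto simp: w)
  have I1': "(LINT y|lborel. w y * (norm (h j y))\<^sup>2) = M j" if "j \<in> J" for j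
    using I(1)[OF that] I(2) by (subst integral_eq_nn_integral) (auto simp: w)
  have I2: "integrable lborel (\<lambda>y. w y *\<^sub>R (h j y * cnj (h j' y)))" if "j \<in> J" "j' \<in> J" for j j'
  proof (rule Bochner_Integration.integrable_bound[OF Bochner_Integration.integrable_add[OF I1[OF that(1)] I1[OF that(2)]]])
    show "(\<lambda>y. w y *\<^sub>R (h j y * cnj (h j' y))) \<in> borel_measurable lborel" by measurable
    show "AE y in lborel. norm (w y *\<^sub>R (h j y * cnj (h j' y))) \<le> norm (w y * (norm (h j y))\<^sup>2 + w y * (norm (h j' y))\<^sup>2)"
    proof (rule AE_I2)
      fix y
      have "w y * norm (h j y * cnj (h j' y)) \<le> w y * ((norm (h j y))\<^sup>2 + (norm (cnj (h j' y)))\<^sup>2)"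
        by (intro mult_left_mono sum_of_squares_bound_complex w)
      then show "norm (w y *\<^sub>R (h j y * cnj (h j' y))) \<le> norm (w y * (norm (h j y))\<^sup>2 + w y * (norm (h j' y))\<^sup>2)"
        using w[of y] by (simp add: distrib_left)
    qed
  qed
  have sq: "complex_of_real (w y * (norm (\<Sum>j\<in>J. a j * h j y))\<^sup>2) = (\<Sum>j\<in>J. \<Sum>j'\<in>J. (a j * cnj (a j')) * (w y *\<^sub>R (h j y * cnj (h j' y))))" for y
  proof -
    have "complex_of_real (w y * (norm (\<Sum>j\<in>J. a j * h j y))\<^sup>2) = complex_of_real (w y) * ((\<Sum>j\<in>J. a j * h j y) * cnj (\<Sum>j\<in>J. a j * h j y))"
      by (simp only: of_real_mult complex_norm_square)
    also have "\<dots> = complex_of_real (w y) * (\<Sum>j\<in>J. \<Sum>j'\<in>J. (a j * h j y) * cnj (a j' * h j' y))"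
      by (simp only: cnj_sum sum_product)
    also have "\<dots> = (\<Sum>j\<in>J. \<Sum>j'\<in>J. (a j * cnj (a j')) * (w y *\<^sub>R (h j y * cnj (h j' y))))"
      unfolding sum_distrib_left by (intro sum.cong refl) (simp add: scaleR_conv_of_real mult_ac)
    finally show ?thesis .
  qed
  have int: "integrable lborel (\<lambda>y. complex_of_real (w y * (norm (\<Sum>j\<in>J. a j * h j y))\<^sup>2))"
    unfolding sq by (intro Bochner_Integration.integrable_sum integrable_mult_right I2)
  have "complex_of_real (LINT y|lborel. w y * (norm (\<Sum>j\<in>J. a j * h j y))\<^sup>2) =
     (LINT y|lborel. complex_of_real (w y * (norm (\<Sum>j\<in>J. a j * h j y))\<^sup>2))" by (rule integral_complex_of_real[symmetric])
  also have "\<dots> = (\<Sum>j\<in>J. \<Sum>j'\<in>J. (a j * cnj (a j')) * (LINT y|lborel. w y *\<^sub>R (h j y * cnj (h j' y))))"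
  proof -
    have "(LINT y|lborel. (\<Sum>j\<in>J. \<Sum>j'\<in>J. (a j * cnj (a j')) * (w y *\<^sub>R (h j y * cnj (h j' y))))) =
      (\<Sum>j\<in>J. LINT y|lborel. (\<Sum>j'\<in>J. (a j * cnj (a j')) * (w y *\<^sub>R (h j y * cnj (h j' y)))))"
      by (intro Bochner_Integration.integral_sum Bochner_Integration.integrable_sum integrable_mult_right I2)
    also have "\<dots> = (\<Sum>j\<in>J. \<Sum>j'\<in>J. LINT y|lborel. (a j * cnj (a j')) * (w y *\<^sub>R (h j y * cnj (h j' y))))"
      by (intro sum.cong refl Bochner_Integration.integral_sum integrable_mult_right I2)
    finally show ?thesis by (simp only: sq integral_mult_right_zero)
  qed
  also have "\<dots> = (\<Sum>j\<in>J. (a j * cnj (a j)) * (LINT y|lborel. w y *\<^sub>R (h j y * cnj (h j y))))"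
  proof (rule sum.cong[OF refl])
    fix j assume j: "j \<in> J"
    show "(\<Sum>j'\<in>J. (a j * cnj (a j')) * (LINT y|lborel. w y *\<^sub>R (h j y * cnj (h j' y)))) =
        (a j * cnj (a j)) * (LINT y|lborel. w y *\<^sub>R (h j y * cnj (h j y)))"
      by (subst sum.remove[OF J j], subst sum.neutral) (auto simp: orth j)
  qed
  also have "\<dots> = (\<Sum>j\<in>J. complex_of_real ((norm (a j))\<^sup>2 * M j))"
  proof (rule sum.cong[OF refl])
    fix j assume j: "j \<in> J"
    have "(LINT y|lborel. w y *\<^sub>R (h j y * cnj (h j y))) = (LINT y|lborel. complex_of_real (w y * (norm (h j y))\<^sup>2))"
      by (simp only: complex_norm_square of_real_mult scaleR_conv_of_real)
    also have "\<dots> = complex_of_real (M j)" by (simp only: integral_complex_of_real I1'[OF j])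
    finally show "(a j * cnj (a j)) * (LINT y|lborel. w y *\<^sub>R (h j y * cnj (h j y))) = complex_of_real ((norm (a j))\<^sup>2 * M j)"
      by (simp only: complex_norm_square of_real_mult)
  qed
  also have "\<dots> = complex_of_real (\<Sum>j\<in>J. (norm (a j))\<^sup>2 * M j)" by simp
  finally have eq: "(LINT y|lborel. w y * (norm (\<Sum>j\<in>J. a j * h j y))\<^sup>2) = (\<Sum>j\<in>J. (norm (a j))\<^sup>2 * M j)"
    by (simp only: of_real_eq_iff)
  have "integrable lborel (\<lambda>y. w y * (norm (\<Sum>j\<in>J. a j * h j y))\<^sup>2)"
    using int by (simp only: complex_of_real_integrable_eq)
  then show ?thesis unfolding eq[symmetric]
    by (intro nn_integral_eq_integral) (auto simp: w)
qed

section \<open>Beta integrals and weighted norms of the parts of the kernel\<close>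

lemma nn_integral_Beta:
  assumes "a > 0" "b > 0"
  shows "(\<integral>\<^sup>+x\<in>{0<..<1}. ennreal (x powr (a - 1) * (1 - x) powr (b - 1)) \<partial>lborel) = ennreal (Beta a b)"
proof -
  have "(\<integral>\<^sup>+x. ennreal (x powr (a - 1) * (1 - x) powr (b - 1)) * indicator {0..1} x \<partial>lborel) = ennreal (Beta a b)"
    by (rule nn_integral_has_integral_lebesgue'[OF _ has_integral_Beta_real[OF assms]]) auto
  moreover have "(\<integral>\<^sup>+x. ennreal (x powr (a - 1) * (1 - x) powr (b - 1)) * indicator {0..1} x \<partial>lborel) =
     (\<integral>\<^sup>+x\<in>{0<..<1}. ennreal (x powr (a - 1) * (1 - x) powr (b - 1)) \<partial>lborel)"
    using AE_lborel_singleton[of 0] AE_lborel_singleton[of 1]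
    by (intro nn_integral_cong_AE, eventually_elim) (auto simp: indicator_def)
  ultimately show ?thesis by simp
qed

lemma Gamma_log_convex_sq:
  fixes N \<epsilon> :: real
  assumes "\<bar>\<epsilon>\<bar> < N"
  shows "(Gamma N)\<^sup>2 \<le> Gamma (N - \<epsilon>) * Gamma (N + \<epsilon>)"
proof -
  have pos: "N > 0" "N - \<epsilon> > 0" "N + \<epsilon> > 0" using assms by auto
  have "(ln \<circ> Gamma) ((1 - 1/2) *\<^sub>R (N - \<epsilon>) + (1/2) *\<^sub>R (N + \<epsilon>)) \<le> (1 - 1/2) * (ln \<circ> Gamma) (N - \<epsilon>) + (1/2) * (ln \<circ> Gamma) (N + \<epsilon>)"
    using pos by (intro convex_onD[OF log_convex_Gamma_real]) auto
  then have "2 * ln (Gamma N) \<le> ln (Gamma (N - \<epsilon>)) + ln (Gamma (N + \<epsilon>))" by (simp add: field_simps)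
  then have "ln ((Gamma N)\<^sup>2) \<le> ln (Gamma (N - \<epsilon>) * Gamma (N + \<epsilon>))"
    by (simp only: ln_mult_pos[OF Gamma_real_pos[OF pos(2)] Gamma_real_pos[OF pos(3)]] ln_realpow of_nat_numeral)
  moreover have "0 < (Gamma N)\<^sup>2" "0 < Gamma (N - \<epsilon>) * Gamma (N + \<epsilon>)"
    using Gamma_real_pos[OF pos(1)] Gamma_real_pos[OF pos(2)] Gamma_real_pos[OF pos(3)]
    by (simp_all only: zero_less_power mult_pos_pos)
  ultimately show ?thesis by (simp only: ln_le_cancel_iff)
qed

text \<open>With \<open>N = n + k + 1\<close> the left side is, up to constants and
  \<open>1 / fact k\<close>, the quotient of the square of \<open>Gamma N\<close> by
  \<open>Gamma (N - \<epsilon>)\<close>. Log-convexity bounds this by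
  \<open>Gamma (N + \<epsilon>)\<close>, which gives the coefficients of
  \<open>(1 - x) powr (- (n + 1 + \<epsilon>))\<close>.\<close>

lemma Beta_coefficient_bound:
  fixes \<epsilon> :: real
  assumes \<epsilon>: "0 < \<epsilon>" "\<epsilon> < 1" and n: "n > 0"
  shows "(real ((n + k) choose n))\<^sup>2 * (fact k / fact (n + k - 1)) * Beta (real (n + k)) (1 - \<epsilon>) \<le>
    Gamma (1 - \<epsilon>) * Gamma (real n + 1 + \<epsilon>) / (fact n)\<^sup>2 * (pochhammer (real n + 1 + \<epsilon>) k / fact k)"
proof -
  define N where "N = real (n + k) + 1"
  have GN: "Gamma N = fact (n + k)" using Gamma_fact[of "n + k", where 'a = real] by (simp add: N_def add_ac)
  have Gk: "Gamma (real (n + k)) = fact (n + k - 1)"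
    using Gamma_fact[of "n + k - 1", where 'a = real] n by (simp add: of_nat_diff)
  have G1: "Gamma (1 - \<epsilon>) > 0" "Gamma (N - \<epsilon>) > 0" "Gamma (real n + 1 + \<epsilon>) > 0"
    using \<epsilon> by (auto intro!: Gamma_real_pos simp: N_def)
  have poch: "Gamma (N + \<epsilon>) = pochhammer (real n + 1 + \<epsilon>) k * Gamma (real n + 1 + \<epsilon>)"
  proof -
    have "real n + 1 + \<epsilon> \<notin> \<int>\<^sub>\<le>\<^sub>0" using \<epsilon> by (auto elim!: nonpos_Ints_cases)
    then have "pochhammer (real n + 1 + \<epsilon>) k = Gamma (real n + 1 + \<epsilon> + real k) / Gamma (real n + 1 + \<epsilon>)"
      by (rule pochhammer_Gamma)
    then show ?thesis using G1 by (simp add: N_def add_ac)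
  qed
  have "(real ((n + k) choose n))\<^sup>2 * (fact k / fact (n + k - 1)) * Beta (real (n + k)) (1 - \<epsilon>)
     = (fact (n + k))\<^sup>2 * Gamma (1 - \<epsilon>) / ((fact n)\<^sup>2 * fact k * Gamma (N - \<epsilon>))"
    unfolding Beta_def Gk
    by (simp add: binomial_fact N_def power_divide power_mult_distrib power2_eq_square[of "fact k"] algebra_simps)
  also have "\<dots> \<le> (Gamma (N - \<epsilon>) * Gamma (N + \<epsilon>)) * Gamma (1 - \<epsilon>) / ((fact n)\<^sup>2 * fact k * Gamma (N - \<epsilon>))"
    using Gamma_log_convex_sq[of \<epsilon> N] \<epsilon> n G1 unfolding GN
    by (intro divide_right_mono mult_right_mono) (auto simp: N_def)
  also have "\<dots> = Gamma (1 - \<epsilon>) * Gamma (real n + 1 + \<epsilon>) / (fact n)\<^sup>2 * (pochhammer (real n + 1 + \<epsilon>) k / fact k)"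
    using G1 by (simp add: poch)
  finally show ?thesis .
qed

lemma pochhammer_subseries_le:
  fixes a x :: real
  assumes "a > 0" "0 \<le> x" "x < 1" "m > 0"
  shows "(\<Sum>q<N. pochhammer a (m * q) / fact (m * q) * x ^ (m * q)) \<le> (1 - x) powr (- a)"
proof -
  have s: "(\<lambda>k. pochhammer a k / fact k * x ^ k) sums (1 - x) powr (- a)" using assms by (intro pochhammer_series) auto
  have "(\<Sum>q<N. pochhammer a (m * q) / fact (m * q) * x ^ (m * q)) = (\<Sum>k\<in>(\<lambda>q. m * q) ` {..<N}. pochhammer a k / fact k * x ^ k)"
    using assms(4) by (subst sum.reindex) (auto simp: inj_on_def)
  also have "\<dots> \<le> (\<Sum>k. pochhammer a k / fact k * x ^ k)"
    using assms by (intro sum_le_suminf sums_summable[OF s]) (auto intro!: mult_nonneg_nonneg divide_nonneg_nonneg pochhammer_nonneg)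
  finally show ?thesis using s by (simp add: sums_iff)
qed

lemma geometric_subseries_le:
  fixes x :: real
  assumes "0 \<le> x" "x < 1" "m > 0"
  shows "(\<Sum>q<N. x ^ (m * q)) \<le> 1 / (1 - x)"
  using pochhammer_subseries_le[of 1 x m N] assms by (simp add: pochhammer_fact[symmetric] powr_minus divide_inverse)

lemma binomial_shift_le: "\<rho> < m \<Longrightarrow> real ((n + (\<rho> + k)) choose n) \<le> real ((n + m) choose n) * real ((n + k) choose n)"
proof -
  assume "\<rho> < m"
  have "((n + (\<rho> + k)) choose n) \<le> ((n + \<rho>) choose n) * ((n + k) choose n)" by (rule binomial_submult)
  also have "\<dots> \<le> ((n + m) choose n) * ((n + k) choose n)" using \<open>\<rho> < m\<close> by (intro mult_right_mono choose_add_mono) auto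
  finally show ?thesis by (simp only: of_nat_mult[symmetric] of_nat_le_iff)
qed

text \<open>\<open>kpart\<close> at the arguments of the kernel, without the monomial factor
  \<open>s ^ \<rho> / u ^ (eidx m l n \<rho> + 1)\<close>. That factor is estimated separately,
  against the diagonal.\<close>

definition hpart :: "nat \<Rightarrow> nat \<Rightarrow> nat \<Rightarrow> (complex ^ 'n) \<times> complex \<Rightarrow> (complex ^ 'n) \<times> complex \<Rightarrow> complex" where
  "hpart m l \<rho> x y = Sser m CARD('n) \<rho> (herm (fst x) (fst y) ^ m / (snd x * cnj (snd y)) ^ l) *
     Sser m 1 (ridx m l CARD('n) \<rho>) (snd x * cnj (snd y))"

lemma ennreal_mult3: "a \<ge> 0 \<Longrightarrow> b \<ge> 0 \<Longrightarrow> c \<ge> 0 \<Longrightarrow> ennreal (a * b * c) = ennreal a * ennreal b * ennreal c"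
  by (simp add: ennreal_mult)

context
  fixes m l :: nat
  assumes m: "m > 0" and l: "l > 0"
begin

text \<open>For fixed \<open>x\<close> the double series of \<open>hpart\<close> consists of
  constants times conjugated monomials in \<open>y\<close>, orthogonal for every weight in
  \<open>X\<close> and \<open>Y\<close>. The squared norm of a partial sum splits into a sum over
  \<open>q\<close> with moments \<open>F\<close> and a sum over \<open>i\<close> with moments
  \<open>G\<close>; \<open>A\<close> and \<open>B\<close> bound these uniformly.\<close>

lemma hpart_parseval:
  fixes x :: "(complex ^ 'n) \<times> complex" and \<phi> \<psi> F G :: "_ \<Rightarrow> real"
  assumes x: "x \<in> hartogs m l"
    and [measurable]: "\<phi> \<in> borel_measurable borel" "\<psi> \<in> borel_measurable borel"
    and nonneg: "\<And>t. \<phi> t \<ge> 0" "\<And>t. \<psi> t \<ge> 0"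
    and F: "\<And>q. (\<integral>\<^sup>+t\<in>{0<..<1}. ennreal (t ^ (CARD('n) + m * q - 1)) * ennreal (\<phi> t) \<partial>lborel) = ennreal (F q)" "\<And>q. F q \<ge> 0"
    and G: "\<And>i. (\<integral>\<^sup>+t\<in>{0<..<1}. ennreal (t ^ (m + l * CARD('n) - 1 + m * i)) * ennreal (\<psi> t) \<partial>lborel) = ennreal (G i)" "\<And>i. G i \<ge> 0"
    and A: "\<And>N. (\<Sum>q<N. (real ((CARD('n) + (\<rho> + m * q)) choose CARD('n)))\<^sup>2 * hX m l x ^ (m * q) * (fact (m * q) / fact (CARD('n) + m * q - 1) * F q)) \<le> A"
    and B: "\<And>N. (\<Sum>i<N. (real ((1 + (ridx m l CARD('n) \<rho> + m * i)) choose 1))\<^sup>2 * hY m x ^ (m * i) * G i) \<le> B"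
  shows "(\<integral>\<^sup>+y\<in>hartogs m l. ennreal ((norm (hpart m l \<rho> x y))\<^sup>2 * (\<phi> (hX m l y) * \<psi> (hY m y))) \<partial>lborel)
    \<le> ennreal (real m * pi ^ (CARD('n) + 1) * (A * B))"
proof -
  define n where "n = CARD('n)"
  have n: "n > 0" by (simp add: n_def)
  define s0 where "s0 = m + l * n - 1"
  define r where "r = ridx m l n \<rho>"
  note [measurable] = hartogs_measurable[OF m l]
  have [measurable]: "cnj \<in> borel_measurable borel" by (intro borel_measurable_continuous_onI continuous_intros)
  obtain z w where xzw: "x = (z, w)" by (cases x)
  obtain e :: "complex ^ 'n" where e: "norm e = 1" and z: "z = complex_of_real (norm z) *s e"
  proof (cases "z = 0")
    case True
    obtain i0 :: 'n where True by simp
    show ?thesis by (rule that[of "axis i0 1"]) (use True in auto)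
  next
    case False
    show ?thesis
      by (rule that[of "complex_of_real (1 / norm z) *s z"])
         (use False in \<open>auto simp: norm_scale_vec vector_smult_assoc norm_divide\<close>)
  qed
  define \<nu> where "\<nu> = complex_of_real (norm z)"
  have xe: "x = (\<nu> *s e, w)" using xzw z by (simp add: \<nu>_def)
  define b where "b = (\<lambda>q. real ((n + (\<rho> + m * q)) choose n))"
  define c where "c = (\<lambda>i. real ((1 + (r + m * i)) choose 1))"
  define coef where "coef = (\<lambda>(q, i). complex_of_real (b q * c i) * (\<nu> ^ (m * q) * (w ^ i / w ^ (l * q))))"
  define h where "h = (\<lambda>(q, i) y. cnj (hmono e (m * q) i (l * q) y))"
  define W where "W = (\<lambda>y :: (complex ^ 'n) \<times> complex. indicator (hartogs m l) y * (\<phi> (hX m l y) * \<psi> (hY m y)))"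
  have [measurable]: "W \<in> borel_measurable borel" unfolding W_def by measurable
  have W: "W y \<ge> 0" for y using nonneg by (simp add: W_def)
  define HN where "HN = (\<lambda>N y. \<Sum>j\<in>{..<N} \<times> {..<N}. coef j * h j y)"
  have hm: "h j \<in> borel_measurable borel" for j unfolding h_def by (cases j) (simp, measurable)
  have HN_eq: "HN N y = (\<Sum>q<N. of_nat ((n + (\<rho> + m * q)) choose n) * (herm (fst x) (fst y) ^ m / (snd x * cnj (snd y)) ^ l) ^ q) *
      (\<Sum>i<N. of_nat ((1 + (r + m * i)) choose 1) * (snd x * cnj (snd y)) ^ i)" for N y
  proof -
    have "of_nat ((n + (\<rho> + m * q)) choose n) * (herm (fst x) (fst y) ^ m / (snd x * cnj (snd y)) ^ l) ^ q *
      (of_nat ((1 + (r + m * i)) choose 1) * (snd x * cnj (snd y)) ^ i) = coef (q, i) * h (q, i) y" for q i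
      unfolding coef_def h_def b_def c_def xe hmono_def
      by (simp only: herm_scale_left cnj_herm complex_cnj_mult complex_cnj_power complex_cnj_divide power_mult_distrib power_divide power_mult
            of_real_mult of_real_of_nat_eq fst_conv snd_conv prod.case)
         (simp only: times_divide_eq_left times_divide_eq_right divide_divide_eq_left divide_divide_eq_right mult_ac)
    moreover have "HN N y = (\<Sum>q<N. \<Sum>i<N. coef (q, i) * h (q, i) y)"
      unfolding HN_def sum.cartesian_product by (rule sum.cong) auto
    ultimately show ?thesis
      by (simp only: sum_product)
  qed
  have lim: "(\<lambda>N. HN N y) \<longlonglongrightarrow> hpart m l \<rho> x y" if y: "y \<in> hartogs m l" for y
  proof -
    note a = kernel_arguments[OF m l x y]
    have "(\<lambda>N. \<Sum>q<N. of_nat ((n' + (\<rho>' + m * q)) choose n') * t ^ q) \<longlonglongrightarrow> Sser m n' \<rho>' t" if "norm t < 1" for n' \<rho>' t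
      using Sser_sums[OF m that] by (simp only: sums_def)
    from tendsto_mult[OF this[OF a(3), of n \<rho>] this[OF a(2), of 1 r]]
    show ?thesis unfolding HN_eq hpart_def n_def r_def .
  qed
  define M where "M = (\<lambda>(q, i). real m * pi ^ (n + 1) * fact (m * q) / fact (n + m * q - 1) * F q * G i)"
  have M: "M j \<ge> 0" for j using F(2) G(2) by (cases j) (simp add: M_def)
  have hM: "(\<integral>\<^sup>+y. ennreal (W y * (norm (h j y))\<^sup>2) \<partial>lborel) = ennreal (M j)" for j
  proof -
    obtain q i where j: "j = (q, i)" by (cases j)
    have "(\<integral>\<^sup>+y. ennreal (W y * (norm (h j y))\<^sup>2) \<partial>lborel) =
      (\<integral>\<^sup>+y\<in>hartogs m l. ennreal (norm (herm (fst y) e) ^ (2 * (m * q))) * (\<lambda>t. ennreal (\<phi> t)) (hX m l y) *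
         (\<lambda>t. ennreal (t ^ (m * i) / t ^ (m * (l * q)) * \<psi> t)) (hY m y) \<partial>lborel)"
    proof (rule nn_integral_cong)
      fix y :: "(complex ^ 'n) \<times> complex"
      have "W y * (norm (h j y))\<^sup>2 = indicator (hartogs m l) y * (norm (herm (fst y) e) ^ (2 * (m * q)) * \<phi> (hX m l y) *
          (hY m y ^ (m * i) / hY m y ^ (m * (l * q)) * \<psi> (hY m y)))"
        unfolding W_def h_def j by (simp add: hmono_norm_sq[OF m])
      moreover from ennreal_mult3[OF zero_le_power[OF norm_ge_zero] nonneg(1) mult_nonneg_nonneg[OF divide_nonneg_nonneg[OF zero_le_power zero_le_power] nonneg(2)], OF hY_nonneg hY_nonneg]
      have "ennreal (norm (herm (fst y) e) ^ (2 * (m * q)) * \<phi> (hX m l y) * (hY m y ^ (m * i) / hY m y ^ (m * (l * q)) * \<psi> (hY m y))) =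
        ennreal (norm (herm (fst y) e) ^ (2 * (m * q))) * ennreal (\<phi> (hX m l y)) * ennreal (hY m y ^ (m * i) / hY m y ^ (m * (l * q)) * \<psi> (hY m y))" .
      ultimately show "ennreal (W y * (norm (h j y))\<^sup>2) = ennreal (norm (herm (fst y) e) ^ (2 * (m * q))) * (\<lambda>t. ennreal (\<phi> t)) (hX m l y) *
         (\<lambda>t. ennreal (t ^ (m * i) / t ^ (m * (l * q)) * \<psi> t)) (hY m y) * indicator (hartogs m l) y"
        by (cases "y \<in> hartogs m l") (simp_all only: indicator_simps mult_1 mult_1_right mult_zero_left mult_zero_right ennreal_0 simp_thms)
    qed
    also have "\<dots> = ennreal (real m * pi ^ (n + 1) * fact (m * q) / fact (n + m * q - 1)) *
      (\<integral>\<^sup>+t\<in>{0<..<1}. ennreal (t ^ (n + m * q - 1)) * ennreal (\<phi> t) \<partial>lborel) *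
      (\<integral>\<^sup>+t\<in>{0<..<1}. ennreal (t ^ (l * (m * q) + (m + l * n - 1))) * ennreal (t ^ (m * i) / t ^ (m * (l * q)) * \<psi> t) \<partial>lborel)"
      unfolding n_def by (rule hartogs_moment[OF _ _ e m l]) measurable
    also have "(\<integral>\<^sup>+t\<in>{0<..<1}. ennreal (t ^ (l * (m * q) + (m + l * n - 1))) * ennreal (t ^ (m * i) / t ^ (m * (l * q)) * \<psi> t) \<partial>lborel) = ennreal (G i)"
    proof -
      have "t ^ (l * (m * q) + (m + l * n - 1)) * (t ^ (m * i) / t ^ (m * (l * q)) * \<psi> t) = t ^ (m + l * n - 1 + m * i) * \<psi> t" if "0 < t" for t :: real
        using that by (simp add: power_add mult.left_commute[of l])
      then have "(\<integral>\<^sup>+t\<in>{0<..<1}. ennreal (t ^ (l * (m * q) + (m + l * n - 1))) * ennreal (t ^ (m * i) / t ^ (m * (l * q)) * \<psi> t) \<partial>lborel) =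
        (\<integral>\<^sup>+t\<in>{0<..<1}. ennreal (t ^ (m + l * n - 1 + m * i)) * ennreal (\<psi> t) \<partial>lborel)"
        using nonneg by (intro nn_integral_cong) (auto simp: indicator_def ennreal_mult[symmetric])
      then show ?thesis using G(1)[of i] by (simp add: n_def)
    qed
    also have "(\<integral>\<^sup>+t\<in>{0<..<1}. ennreal (t ^ (n + m * q - 1)) * ennreal (\<phi> t) \<partial>lborel) = ennreal (F q)"
      using F(1)[of q] by (simp add: n_def)
    also have "ennreal (real m * pi ^ (n + 1) * fact (m * q) / fact (n + m * q - 1)) * ennreal (F q) * ennreal (G i) = ennreal (M j)"
      unfolding M_def j prod.case by (rule ennreal_mult3[symmetric]) (simp_all add: F(2) G(2))
    finally show ?thesis .
  qed
  have orth: "(LINT y|lborel. W y *\<^sub>R (h j y * cnj (h j' y))) = 0" if ne: "j \<noteq> j'" for j j'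
  proof -
    obtain q i q' i' where j: "j = (q, i)" "j' = (q', i')" by (cases j; cases j')
    have "m * q' \<noteq> m * q \<or> (i' \<noteq> i \<and> l * q' = l * q)" using ne m by (auto simp: j)
    then have "(LINT y|lborel. (indicator (hartogs m l) y * (\<phi> (hX m l y) * \<psi> (hY m y))) *\<^sub>R (hmono e (m * q') i' (l * q') y * cnj (hmono e (m * q) i (l * q) y))) = 0"
      by (intro hmono_orthogonal) measurable
    then show ?thesis by (simp add: W_def h_def j mult.commute)
  qed
  have coef_sq: "(norm (coef (q, i)))\<^sup>2 = (b q)\<^sup>2 * (c i)\<^sup>2 * (hX m l x ^ (m * q) * hY m x ^ (m * i))" for q i
  proof -
    have Y: "hY m x > 0" using x m l by (simp add: mem_hartogs_iff)
    have w2: "(norm w)\<^sup>2 = hY m x ^ m" using powr_two_over_power[OF m, of w] by (simp add: hY_def xzw)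
    have z2: "(norm z)\<^sup>2 = hX m l x * hY m x ^ l" using Y by (simp add: hX_def hY_def xzw)
    have "(norm (coef (q, i)))\<^sup>2 = (b q)\<^sup>2 * (c i)\<^sup>2 * (((norm z)\<^sup>2) ^ (m * q) * (((norm w)\<^sup>2) ^ i / ((norm w)\<^sup>2) ^ (l * q)))"
      by (simp add: coef_def \<nu>_def b_def c_def norm_mult norm_divide norm_power power_mult_distrib power_divide power_mult[symmetric] mult.commute[of 2] mult_ac
          del: of_nat_add of_nat_mult of_nat_Suc choose_one)
    also have "((norm z)\<^sup>2) ^ (m * q) * (((norm w)\<^sup>2) ^ i / ((norm w)\<^sup>2) ^ (l * q)) = hX m l x ^ (m * q) * hY m x ^ (m * i)"
      unfolding w2 z2 using Y by (simp add: power_mult_distrib power_mult[symmetric] mult_ac)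
    finally show ?thesis .
  qed
  have bound: "(\<integral>\<^sup>+y. ennreal (W y * (norm (HN N y))\<^sup>2) \<partial>lborel) \<le> ennreal (real m * pi ^ (n + 1) * (A * B))" for N
  proof -
    have e1: "(\<integral>\<^sup>+y. ennreal (W y * (norm (HN N y))\<^sup>2) \<partial>lborel) = ennreal (\<Sum>j\<in>{..<N} \<times> {..<N}. (norm (coef j))\<^sup>2 * M j)"
      unfolding HN_def
    proof (rule finite_parseval)
      show "W \<in> borel_measurable borel" by measurable
    qed (simp, rule hm, rule W, rule hM, rule M, rule orth)
    have "(\<Sum>j\<in>{..<N} \<times> {..<N}. (norm (coef j))\<^sup>2 * M j) = real m * pi ^ (n + 1) *
       ((\<Sum>q<N. (b q)\<^sup>2 * hX m l x ^ (m * q) * (fact (m * q) / fact (n + m * q - 1) * F q)) *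
        (\<Sum>i<N. (c i)\<^sup>2 * hY m x ^ (m * i) * G i))"
      unfolding sum_product unfolding sum_distrib_left unfolding sum.cartesian_product
    proof (rule sum.cong[OF refl])
      fix j assume "j \<in> {..<N} \<times> {..<N}"
      obtain q i where j: "j = (q, i)" by (cases j)
      show "(norm (coef j))\<^sup>2 * M j = (case j of (q, i) \<Rightarrow> real m * pi ^ (n + 1) *
         ((b q)\<^sup>2 * hX m l x ^ (m * q) * (fact (m * q) / fact (n + m * q - 1) * F q) * ((c i)\<^sup>2 * hY m x ^ (m * i) * G i)))"
        unfolding j by (simp only: coef_sq M_def prod.case times_divide_eq_left times_divide_eq_right mult_ac)
    qed
    also have "\<dots> \<le> real m * pi ^ (n + 1) * (A * B)"
    proof (intro mult_left_mono mult_mono)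
      show "(\<Sum>q<N. (b q)\<^sup>2 * hX m l x ^ (m * q) * (fact (m * q) / fact (n + m * q - 1) * F q)) \<le> A"
        using A[of N] by (simp add: b_def n_def)
      show "(\<Sum>i<N. (c i)\<^sup>2 * hY m x ^ (m * i) * G i) \<le> B"
        using B[of N] by (simp only: c_def n_def r_def)
      show "0 \<le> A" using A[of 0] by simp
      show "0 \<le> (\<Sum>i<N. (c i)\<^sup>2 * hY m x ^ (m * i) * G i)"
        by (intro sum_nonneg mult_nonneg_nonneg zero_le_power hY_nonneg G(2) zero_le_power2)
    qed simp
    finally show ?thesis unfolding e1 by (rule ennreal_leI)
  qed
  have "(\<integral>\<^sup>+y\<in>hartogs m l. ennreal ((norm (hpart m l \<rho> x y))\<^sup>2 * (\<phi> (hX m l y) * \<psi> (hY m y))) \<partial>lborel) =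
     (\<integral>\<^sup>+y. liminf (\<lambda>N. ennreal (W y * (norm (HN N y))\<^sup>2)) \<partial>lborel)"
  proof (rule nn_integral_cong)
    fix y :: "(complex ^ 'n) \<times> complex"
    show "ennreal ((norm (hpart m l \<rho> x y))\<^sup>2 * (\<phi> (hX m l y) * \<psi> (hY m y))) * indicator (hartogs m l) y =
       liminf (\<lambda>N. ennreal (W y * (norm (HN N y))\<^sup>2))"
    proof (cases "y \<in> hartogs m l")
      case True
      have "(\<lambda>N. ennreal (W y * (norm (HN N y))\<^sup>2)) \<longlonglongrightarrow> ennreal (W y * (norm (hpart m l \<rho> x y))\<^sup>2)"
        by (intro tendsto_ennrealI tendsto_intros lim True)
      from lim_imp_Liminf[OF _ this] show ?thesis using True by (simp add: W_def mult.commute)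
    next
      case False
      then show ?thesis by (simp add: W_def Liminf_const)
    qed
  qed
  \<comment> \<open>Fatou's lemma suffices: only an upper bound is wanted, so no convergence in
    \<open>L2\<close> has to be proved.\<close>
  also have "\<dots> \<le> liminf (\<lambda>N. \<integral>\<^sup>+y. ennreal (W y * (norm (HN N y))\<^sup>2) \<partial>lborel)"
    by (rule nn_integral_liminf) (unfold HN_def, use hm in measurable)
  also have "\<dots> \<le> ennreal (real m * pi ^ (n + 1) * (A * B))"
  proof -
    have "liminf (\<lambda>N. \<integral>\<^sup>+y. ennreal (W y * (norm (HN N y))\<^sup>2) \<partial>lborel) \<le> liminf (\<lambda>N::nat. ennreal (real m * pi ^ (n + 1) * (A * B)))"
      by (intro Liminf_mono always_eventually allI bound)
    then show ?thesis by (simp add: Liminf_const)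
  qed
  finally show ?thesis by (simp add: n_def)
qed

end

lemma Beta_pos: "a > 0 \<Longrightarrow> b > 0 \<Longrightarrow> Beta a b > (0::real)"
  unfolding Beta_def by (intro divide_pos_pos mult_pos_pos Gamma_real_pos) auto

lemma Beta_mono_left:
  assumes "0 < a" "a \<le> a'" "0 < (b::real)"
  shows "Beta a' b \<le> Beta a b"
proof -
  have le: "(\<integral>\<^sup>+x\<in>{0<..<1}. ennreal (x powr (a' - 1) * (1 - x) powr (b - 1)) \<partial>lborel)
      \<le> (\<integral>\<^sup>+x\<in>{0<..<1}. ennreal (x powr (a - 1) * (1 - x) powr (b - 1)) \<partial>lborel)"
  proof (rule nn_integral_mono)
    fix x :: real
    have "x powr (a' - 1) \<le> x powr (a - 1)" if "0 < x" "x < 1"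
      using that assms by (intro powr_mono') auto
    then show "ennreal (x powr (a' - 1) * (1 - x) powr (b - 1)) * indicator {0<..<1} x \<le>
        ennreal (x powr (a - 1) * (1 - x) powr (b - 1)) * indicator {0<..<1} x"
      by (cases "x \<in> {0<..<1}") (auto intro!: ennreal_leI mult_right_mono)
  qed
  have "0 < a'" using assms by simp
  from le[unfolded nn_integral_Beta[OF assms(1,3)] nn_integral_Beta[OF this assms(3)]]
  have "ennreal (Beta a' b) \<le> ennreal (Beta a b)" .
  then show ?thesis using Beta_pos[OF assms(1,3)] by simp
qed

lemma Beta_shift_bound:
  fixes b \<epsilon> :: real
  assumes "0 \<le> b" "b < 1" "0 < \<epsilon>" "\<epsilon> < 1"
  shows "\<exists>C>0. \<forall>k r :: nat. Beta (real (k + r) + 1 - b) (1 - \<epsilon>) \<le> C * Beta (real (1 + k)) (1 - \<epsilon>)"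
proof -
  define C where "C = max 2 (Beta (1 - b) (1 - \<epsilon>) / Beta 1 (1 - \<epsilon>))"
  have "Beta (real (k + r) + 1 - b) (1 - \<epsilon>) \<le> C * Beta (real (1 + k)) (1 - \<epsilon>)" for k r :: nat
  proof (cases "k = 0")
    case True
    have p: "Beta 1 (1 - \<epsilon>) > 0" using assms by (intro Beta_pos) auto
    have "Beta (real (k + r) + 1 - b) (1 - \<epsilon>) \<le> Beta (1 - b) (1 - \<epsilon>)" using assms by (intro Beta_mono_left) auto
    also have "\<dots> = (Beta (1 - b) (1 - \<epsilon>) / Beta 1 (1 - \<epsilon>)) * Beta 1 (1 - \<epsilon>)" using p by simp
    also have "\<dots> \<le> C * Beta 1 (1 - \<epsilon>)" using p by (intro mult_right_mono) (auto simp: C_def)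
    finally show ?thesis using True by simp
  next
    case False
    have p: "Beta (real (1 + k)) (1 - \<epsilon>) > 0" using assms by (intro Beta_pos) auto
    have "Beta (real (k + r) + 1 - b) (1 - \<epsilon>) \<le> Beta (real k) (1 - \<epsilon>)" using assms False by (intro Beta_mono_left) auto
    also have "real k * Beta (real k) (1 - \<epsilon>) = (real k + (1 - \<epsilon>)) * Beta (real k + 1) (1 - \<epsilon>)"
      by (rule Beta_plus1_left[symmetric]) (use False in \<open>auto elim!: nonpos_Ints_cases\<close>)
    then have "Beta (real k) (1 - \<epsilon>) = ((real k + (1 - \<epsilon>)) / real k) * Beta (real (1 + k)) (1 - \<epsilon>)"
      using False by (simp add: field_simps)
    also have "\<dots> \<le> 2 * Beta (real (1 + k)) (1 - \<epsilon>)"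
      using p False assms by (intro mult_right_mono) (auto simp: field_simps)
    also have "\<dots> \<le> C * Beta (real (1 + k)) (1 - \<epsilon>)" using p by (intro mult_right_mono) (auto simp: C_def)
    finally show ?thesis .
  qed
  moreover have "C > 0" by (simp add: C_def)
  ultimately show ?thesis by blast
qed

lemma fact_log_convex: "(fact (n + k) :: real)\<^sup>2 \<le> fact k * fact (2 * n + k)"
proof (induction n)
  case (Suc n)
  have "(fact (Suc n + k) :: real)\<^sup>2 = (real (n + k + 1))\<^sup>2 * (fact (n + k))\<^sup>2"
    by (simp add: power_mult_distrib)
  also have "\<dots> \<le> (real (2 * n + k + 1) * real (2 * n + k + 2)) * (fact k * fact (2 * n + k))"
    by (intro mult_mono Suc.IH) (auto simp: power2_eq_square intro!: mult_mono)
  also have "\<dots> = fact k * fact (2 * Suc n + k)" by (simp add: algebra_simps)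
  finally show ?case .
qed (simp add: power2_eq_square)

text \<open>After cancellation the claim follows from \<open>(n + k)!^2 \<le> k! (2 n + k)!\<close>.
  With the weight \<open>(1 - X)^n\<close> the coefficients of the squared norm are thus bounded,
  and the series is at most geometric.\<close>

lemma binomial_Beta_le_1:
  assumes "n > 0"
  shows "(real ((n + k) choose n))\<^sup>2 * (fact k / fact (n + k - 1)) * Beta (real (n + k)) (real (n + 1)) \<le> 1"
proof -
  have g1: "Gamma (real (n + k)) = fact (n + k - 1)"
    using Gamma_fact[of "n + k - 1", where 'a = real] assms by (simp add: of_nat_diff)
  have g2: "Gamma (real (n + 1)) = fact n" using Gamma_fact[of n, where 'a = real] by (simp add: add_ac)
  have g3: "Gamma (real (n + k) + real (n + 1)) = fact (2 * n + k)"
    using Gamma_fact[of "2 * n + k", where 'a = real] by (simp add: add_ac)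
  have "(real ((n + k) choose n))\<^sup>2 * (fact k / fact (n + k - 1)) * Beta (real (n + k)) (real (n + 1)) =
     (fact (n + k))\<^sup>2 / (fact n * (fact k * fact (2 * n + k)))"
    unfolding Beta_def g1 g2 g3
    by (simp add: binomial_fact power_divide power_mult_distrib power2_eq_square[of "fact k"] power2_eq_square[of "fact n"])
  also have "\<dots> \<le> (fact (n + k))\<^sup>2 / (1 * (fact k * fact (2 * n + k)))"
    by (intro divide_left_mono mult_right_mono mult_pos_pos) (auto simp: fact_ge_1)
  also have "\<dots> \<le> 1" using fact_log_convex[of n k] by (simp add: divide_le_eq_1)
  finally show ?thesis .
qed

context
  fixes m l :: nat
  assumes m: "m > 0" and l: "l > 0"
begin

text \<open>The estimate for the singular test function. The factor \<open>Y^r / Y^s0\<close> is the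
  one occurring in \<open>berezin_kernel_bound\<close>; after cancellation with the density it
  leaves \<open>Y powr (r - b)\<close>. The resulting exponents exceed \<open>n + 1\<close> and 2 by
  \<open>\<epsilon>\<close>, so that the diagonal factor \<open>(1 - X)^(n + 1) (1 - Y)^2\<close>
  restores the exponent \<open>- \<epsilon>\<close>.\<close>

lemma hpart_integral_singular:
  fixes b \<epsilon> :: real
  assumes b: "0 \<le> b" "b < 1" and \<epsilon>: "0 < \<epsilon>" "\<epsilon> < 1"
  shows "\<exists>C>0. \<forall>\<rho><m. \<forall>x\<in>hartogs m l.
    (\<integral>\<^sup>+y\<in>hartogs m l. ennreal ((norm (hpart m l \<rho> x (y :: (complex ^ 'n) \<times> complex)))\<^sup>2 *
       ((1 - hX m l y) powr (- \<epsilon>) *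
        (hY m y ^ ridx m l CARD('n) \<rho> / hY m y ^ (m + l * CARD('n) - 1) * hY m y powr (- b) * (1 - hY m y) powr (- \<epsilon>)))) \<partial>lborel)
    \<le> ennreal (C * ((1 - hX m l x) powr (- (real CARD('n) + 1 + \<epsilon>)) * (1 - hY m x) powr (- (2 + \<epsilon>))))"
proof -
  define n where "n = CARD('n)"
  have n: "n > 0" by (simp add: n_def)
  define s0 where "s0 = m + l * n - 1"
  obtain Cb where Cb: "Cb > 0" "\<And>k r :: nat. Beta (real (k + r) + 1 - b) (1 - \<epsilon>) \<le> Cb * Beta (real (1 + k)) (1 - \<epsilon>)"
    using Beta_shift_bound[OF b \<epsilon>] by blast
  define K where "K = (\<lambda>n::nat. Gamma (1 - \<epsilon>) * Gamma (real n + 1 + \<epsilon>) / (fact n)\<^sup>2)"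
  have K: "K n' > 0" for n' unfolding K_def using \<epsilon> by (intro divide_pos_pos mult_pos_pos Gamma_real_pos) auto
  define bb where "bb = (\<lambda>n::nat. real ((n + m) choose n))"
  have bb: "bb n' > 0" for n' by (simp add: bb_def)
  define CA where "CA = (bb n)\<^sup>2 * K n"
  define CB where "CB = (bb 1)\<^sup>2 * (Cb * K 1)"
  have CAB: "CA > 0" "CB > 0" unfolding CA_def CB_def by (intro mult_pos_pos zero_less_power bb K Cb(1))+
  define C where "C = real m * pi ^ (n + 1) * (CA * CB)"
  have "(\<integral>\<^sup>+y\<in>hartogs m l. ennreal ((norm (hpart m l \<rho> x (y :: (complex ^ 'n) \<times> complex)))\<^sup>2 *
       ((1 - hX m l y) powr (- \<epsilon>) *
        (hY m y ^ ridx m l CARD('n) \<rho> / hY m y ^ (m + l * CARD('n) - 1) * hY m y powr (- b) * (1 - hY m y) powr (- \<epsilon>)))) \<partial>lborel)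
    \<le> ennreal (C * ((1 - hX m l x) powr (- (real CARD('n) + 1 + \<epsilon>)) * (1 - hY m x) powr (- (2 + \<epsilon>))))"
    if \<rho>: "\<rho> < m" and x: "x \<in> hartogs m l" for \<rho> and x :: "(complex ^ 'n) \<times> complex"
  proof -
    define r where "r = ridx m l n \<rho>"
    have r: "r < m" using ridx_less[OF m] by (simp add: r_def)
    have X: "0 \<le> hX m l x" "hX m l x < 1" "0 < hY m x" "hY m x < 1"
      using x m l hX_nonneg[of m l x] by (auto simp: mem_hartogs_iff)
    define \<phi> where "\<phi> = (\<lambda>t::real. (1 - t) powr (- \<epsilon>))"
    \<comment> \<open>The weight must be nonnegative on the whole line, and
      \<open>t ^ r / t ^ s0\<close> can be negative for negative \<open>t\<close>.\<close>
    define \<psi> where "\<psi> = (\<lambda>t::real. if 0 < t then t ^ r / t ^ s0 * t powr (- b) * (1 - t) powr (- \<epsilon>) else 0)"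
    define F where "F = (\<lambda>q. Beta (real (n + m * q)) (1 - \<epsilon>))"
    define G where "G = (\<lambda>i. Beta (real (m * i + r) + 1 - b) (1 - \<epsilon>))"
    define A where "A = CA * (1 - hX m l x) powr (- (real n + 1 + \<epsilon>))"
    define B where "B = CB * (1 - hY m x) powr (- (2 + \<epsilon>))"
    have F0: "F q \<ge> 0" for q unfolding F_def using n \<epsilon> by (intro less_imp_le Beta_pos) (auto simp: add_pos_nonneg)
    have G0: "G i \<ge> 0" for i unfolding G_def using b \<epsilon> of_nat_0_le_iff[of "m * i + r", where 'a = real] by (intro less_imp_le Beta_pos) linarith+
    have "(\<integral>\<^sup>+y\<in>hartogs m l. ennreal ((norm (hpart m l \<rho> x (y :: (complex ^ 'n) \<times> complex)))\<^sup>2 * (\<phi> (hX m l y) * \<psi> (hY m y))) \<partial>lborel)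
      \<le> ennreal (real m * pi ^ (CARD('n) + 1) * (A * B))"
    proof (rule hpart_parseval[OF m l x, where F = F and G = G])
      show "\<phi> \<in> borel_measurable borel" "\<psi> \<in> borel_measurable borel" unfolding \<phi>_def \<psi>_def by measurable
      show "0 \<le> \<phi> t" "0 \<le> \<psi> t" for t by (auto simp: \<phi>_def \<psi>_def)
      show "0 \<le> F q" "0 \<le> G q" for q by (rule F0, rule G0)
      show "(\<integral>\<^sup>+t\<in>{0<..<1}. ennreal (t ^ (CARD('n) + m * q - 1)) * ennreal (\<phi> t) \<partial>lborel) = ennreal (F q)" for q
      proof -
        have "t ^ (n + m * q - 1) * \<phi> t = t powr (real (n + m * q) - 1) * (1 - t) powr ((1 - \<epsilon>) - 1)" if "0 < t" for t
          using that n by (simp add: \<phi>_def powr_realpow[symmetric] of_nat_diff)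
        then have "(\<integral>\<^sup>+t\<in>{0<..<1}. ennreal (t ^ (n + m * q - 1)) * ennreal (\<phi> t) \<partial>lborel) =
          (\<integral>\<^sup>+t\<in>{0<..<1}. ennreal (t powr (real (n + m * q) - 1) * (1 - t) powr ((1 - \<epsilon>) - 1)) \<partial>lborel)"
          by (intro nn_integral_cong) (auto simp: indicator_def ennreal_mult'[symmetric])
        also have "\<dots> = ennreal (F q)" unfolding F_def by (rule nn_integral_Beta) (use n \<epsilon> in \<open>auto simp: add_pos_nonneg\<close>)
        finally show ?thesis by (simp add: n_def)
      qed
      show "(\<integral>\<^sup>+t\<in>{0<..<1}. ennreal (t ^ (m + l * CARD('n) - 1 + m * i)) * ennreal (\<psi> t) \<partial>lborel) = ennreal (G i)" for i
      proof -
        have "t ^ (s0 + m * i) * \<psi> t = t powr ((real (m * i + r) + 1 - b) - 1) * (1 - t) powr ((1 - \<epsilon>) - 1)" if "0 < t" for t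
        proof -
          have "t ^ (s0 + m * i) * \<psi> t = (t ^ (m * i + r) * t powr (- b)) * (1 - t) powr (- \<epsilon>)"
            using that by (simp add: \<psi>_def power_add)
          also have "t ^ (m * i + r) * t powr (- b) = t powr ((real (m * i + r) + 1 - b) - 1)"
            using that by (simp add: powr_realpow[symmetric] powr_add[symmetric] algebra_simps)
          finally show ?thesis by simp
        qed
        then have "(\<integral>\<^sup>+t\<in>{0<..<1}. ennreal (t ^ (s0 + m * i)) * ennreal (\<psi> t) \<partial>lborel) =
          (\<integral>\<^sup>+t\<in>{0<..<1}. ennreal (t powr ((real (m * i + r) + 1 - b) - 1) * (1 - t) powr ((1 - \<epsilon>) - 1)) \<partial>lborel)"
          by (intro nn_integral_cong) (auto simp: indicator_def ennreal_mult'[symmetric])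
        also have "\<dots> = ennreal (G i)" unfolding G_def by (rule nn_integral_Beta) (use b \<epsilon> of_nat_0_le_iff[of "m * i + r", where 'a = real] in linarith)+
        finally show ?thesis by (simp add: s0_def n_def)
      qed
      show "(\<Sum>q<N. (real ((CARD('n) + (\<rho> + m * q)) choose CARD('n)))\<^sup>2 * hX m l x ^ (m * q) * (fact (m * q) / fact (CARD('n) + m * q - 1) * F q)) \<le> A" for N
      proof -
        have "(\<Sum>q<N. (real ((n + (\<rho> + m * q)) choose n))\<^sup>2 * hX m l x ^ (m * q) * (fact (m * q) / fact (n + m * q - 1) * F q)) \<le>
          (\<Sum>q<N. CA * (pochhammer (real n + 1 + \<epsilon>) (m * q) / fact (m * q) * hX m l x ^ (m * q)))"
        proof (rule sum_mono)
          fix q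
          define d where "d = fact (m * q) / fact (n + m * q - 1) * F q"
          have d: "d \<ge> 0" unfolding d_def using F0 by simp
          have "(real ((n + (\<rho> + m * q)) choose n))\<^sup>2 * d \<le> (bb n * real ((n + m * q) choose n))\<^sup>2 * d"
            unfolding bb_def using \<rho> d by (intro mult_right_mono power_mono binomial_shift_le) auto
          also have "\<dots> = (bb n)\<^sup>2 * ((real ((n + m * q) choose n))\<^sup>2 * (fact (m * q) / fact (n + m * q - 1)) * Beta (real (n + m * q)) (1 - \<epsilon>))"
            by (simp add: d_def F_def power_mult_distrib mult_ac)
          also have "\<dots> \<le> (bb n)\<^sup>2 * (K n * (pochhammer (real n + 1 + \<epsilon>) (m * q) / fact (m * q)))"
            unfolding K_def by (intro mult_left_mono Beta_coefficient_bound \<epsilon> n) simp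
          finally have "(real ((n + (\<rho> + m * q)) choose n))\<^sup>2 * d * hX m l x ^ (m * q) \<le> (bb n)\<^sup>2 * (K n * (pochhammer (real n + 1 + \<epsilon>) (m * q) / fact (m * q))) * hX m l x ^ (m * q)"
            using X by (intro mult_right_mono) auto
          then show "(real ((n + (\<rho> + m * q)) choose n))\<^sup>2 * hX m l x ^ (m * q) * (fact (m * q) / fact (n + m * q - 1) * F q) \<le>
             CA * (pochhammer (real n + 1 + \<epsilon>) (m * q) / fact (m * q) * hX m l x ^ (m * q))"
            by (simp only: CA_def d_def mult_ac)
        qed
        also have "\<dots> = CA * (\<Sum>q<N. pochhammer (real n + 1 + \<epsilon>) (m * q) / fact (m * q) * hX m l x ^ (m * q))"
          by (rule sum_distrib_left[symmetric])
        also have "\<dots> \<le> A"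
          unfolding A_def using CAB X \<epsilon> m by (intro mult_left_mono pochhammer_subseries_le) auto
        finally show ?thesis by (simp add: n_def)
      qed
      show "(\<Sum>i<N. (real ((1 + (ridx m l CARD('n) \<rho> + m * i)) choose 1))\<^sup>2 * hY m x ^ (m * i) * G i) \<le> B" for N
      proof -
        have "(\<Sum>i<N. (real ((1 + (r + m * i)) choose 1))\<^sup>2 * hY m x ^ (m * i) * G i) \<le>
          (\<Sum>i<N. CB * (pochhammer (real 1 + 1 + \<epsilon>) (m * i) / fact (m * i) * hY m x ^ (m * i)))"
        proof (rule sum_mono)
          fix i
          have "(real ((1 + (r + m * i)) choose 1))\<^sup>2 * G i \<le> (bb 1 * real ((1 + m * i) choose 1))\<^sup>2 * (Cb * Beta (real (1 + m * i)) (1 - \<epsilon>))"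
            unfolding bb_def G_def using G0[of i] r Cb(1) Cb(2)[of "m * i" r]
            by (intro mult_mono power_mono binomial_shift_le) (auto simp: G_def)
          also have "\<dots> = (bb 1)\<^sup>2 * (Cb * ((real ((1 + m * i) choose 1))\<^sup>2 * (fact (m * i) / fact (1 + m * i - 1)) * Beta (real (1 + m * i)) (1 - \<epsilon>)))"
            by (simp add: power_mult_distrib mult_ac)
          also have "\<dots> \<le> (bb 1)\<^sup>2 * (Cb * (K 1 * (pochhammer (real 1 + 1 + \<epsilon>) (m * i) / fact (m * i))))"
            unfolding K_def using Cb by (intro mult_left_mono Beta_coefficient_bound \<epsilon>) auto
          finally have "(real ((1 + (r + m * i)) choose 1))\<^sup>2 * G i * hY m x ^ (m * i) \<le> (bb 1)\<^sup>2 * (Cb * (K 1 * (pochhammer (real 1 + 1 + \<epsilon>) (m * i) / fact (m * i)))) * hY m x ^ (m * i)"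
            using X by (intro mult_right_mono) auto
          then show "(real ((1 + (r + m * i)) choose 1))\<^sup>2 * hY m x ^ (m * i) * G i \<le>
             CB * (pochhammer (real 1 + 1 + \<epsilon>) (m * i) / fact (m * i) * hY m x ^ (m * i))"
            by (simp only: CB_def mult_ac)
        qed
        also have "\<dots> = CB * (\<Sum>i<N. pochhammer (real 1 + 1 + \<epsilon>) (m * i) / fact (m * i) * hY m x ^ (m * i))"
          by (rule sum_distrib_left[symmetric])
        also have "\<dots> \<le> CB * (1 - hY m x) powr (- (real 1 + 1 + \<epsilon>))"
          using CAB X \<epsilon> m by (intro mult_left_mono pochhammer_subseries_le) auto
        finally show ?thesis by (simp add: r_def n_def B_def)
      qed
    qed
    also have c2: "real m * pi ^ (CARD('n) + 1) * (A * B) = C * ((1 - hX m l x) powr (- (real CARD('n) + 1 + \<epsilon>)) * (1 - hY m x) powr (- (2 + \<epsilon>)))"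
      by (simp only: A_def B_def C_def n_def mult_ac)
    also have "(\<integral>\<^sup>+y\<in>hartogs m l. ennreal ((norm (hpart m l \<rho> x (y :: (complex ^ 'n) \<times> complex)))\<^sup>2 * (\<phi> (hX m l y) * \<psi> (hY m y))) \<partial>lborel) =
      (\<integral>\<^sup>+y\<in>hartogs m l. ennreal ((norm (hpart m l \<rho> x (y :: (complex ^ 'n) \<times> complex)))\<^sup>2 *
       ((1 - hX m l y) powr (- \<epsilon>) *
        (hY m y ^ ridx m l CARD('n) \<rho> / hY m y ^ (m + l * CARD('n) - 1) * hY m y powr (- b) * (1 - hY m y) powr (- \<epsilon>)))) \<partial>lborel)"
      using m l by (intro nn_integral_cong) (auto simp: indicator_def mem_hartogs_iff \<phi>_def \<psi>_def r_def s0_def n_def)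
    finally show ?thesis .
  qed
  moreover have "C > 0" using m CAB by (simp add: C_def)
  ultimately show ?thesis by blast
qed

text \<open>The estimate for the other half of Schur's test. Its weight is
  \<open>(1 - X)^(n + 1) (1 - Y)^2\<close> divided by \<open>(1 - X) (1 - Y)\<close>. Here the
  integration variable carries the full density \<open>Y ^ s0\<close>, and both coefficient series
  are dominated by geometric ones.\<close>

lemma hpart_integral_vanishing:
  "\<exists>C>0. \<forall>\<rho><m. \<forall>x\<in>hartogs m l.
    (\<integral>\<^sup>+y\<in>hartogs m l. ennreal ((norm (hpart m l \<rho> x (y :: (complex ^ 'n) \<times> complex)))\<^sup>2 *
       (\<bar>1 - hX m l y\<bar> ^ CARD('n) * \<bar>1 - hY m y\<bar>)) \<partial>lborel)
    \<le> ennreal (C * (1 / (1 - hX m l x) * (1 / (1 - hY m x))))"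
proof -
  define n where "n = CARD('n)"
  have n: "n > 0" by (simp add: n_def)
  define s0 where "s0 = m + l * n - 1"
  define CA where "CA = (real ((n + m) choose n))\<^sup>2"
  have CA: "CA > 0" by (simp add: CA_def)
  define C where "C = real m * pi ^ (n + 1) * CA"
  have "(\<integral>\<^sup>+y\<in>hartogs m l. ennreal ((norm (hpart m l \<rho> x (y :: (complex ^ 'n) \<times> complex)))\<^sup>2 *
       (\<bar>1 - hX m l y\<bar> ^ CARD('n) * \<bar>1 - hY m y\<bar>)) \<partial>lborel)
    \<le> ennreal (C * (1 / (1 - hX m l x) * (1 / (1 - hY m x))))"
    if \<rho>: "\<rho> < m" and x: "x \<in> hartogs m l" for \<rho> and x :: "(complex ^ 'n) \<times> complex"
  proof -
    define r where "r = ridx m l n \<rho>"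
    have r: "r < m" using ridx_less[OF m] by (simp add: r_def)
    have X: "0 \<le> hX m l x" "hX m l x < 1" "0 < hY m x" "hY m x < 1"
      using x m l hX_nonneg[of m l x] by (auto simp: mem_hartogs_iff)
    define \<phi> where "\<phi> = (\<lambda>t::real. \<bar>1 - t\<bar> ^ n)"
    define \<psi> where "\<psi> = (\<lambda>t::real. \<bar>1 - t\<bar>)"
    define F where "F = (\<lambda>q. Beta (real (n + m * q)) (real (n + 1)))"
    define G where "G = (\<lambda>i. Beta (real (s0 + m * i) + 1) 2)"
    define A where "A = CA * (1 / (1 - hX m l x))"
    define B where "B = 1 / (1 - hY m x)"
    have F0: "F q \<ge> 0" for q unfolding F_def using n by (intro less_imp_le Beta_pos) (auto simp: add_pos_nonneg)
    have G0: "G i \<ge> 0" for i unfolding G_def by (intro less_imp_le Beta_pos) (auto simp: add_nonneg_pos)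
    have "(\<integral>\<^sup>+y\<in>hartogs m l. ennreal ((norm (hpart m l \<rho> x (y :: (complex ^ 'n) \<times> complex)))\<^sup>2 * (\<phi> (hX m l y) * \<psi> (hY m y))) \<partial>lborel)
      \<le> ennreal (real m * pi ^ (CARD('n) + 1) * (A * B))"
    proof (rule hpart_parseval[OF m l x, where F = F and G = G])
      show "\<phi> \<in> borel_measurable borel" "\<psi> \<in> borel_measurable borel" unfolding \<phi>_def \<psi>_def by measurable
      show "0 \<le> \<phi> t" "0 \<le> \<psi> t" for t by (auto simp: \<phi>_def \<psi>_def)
      show "0 \<le> F q" "0 \<le> G q" for q by (rule F0, rule G0)
      show "(\<integral>\<^sup>+t\<in>{0<..<1}. ennreal (t ^ (CARD('n) + m * q - 1)) * ennreal (\<phi> t) \<partial>lborel) = ennreal (F q)" for q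
      proof -
        have "t ^ (n + m * q - 1) * \<phi> t = t powr (real (n + m * q) - 1) * (1 - t) powr (real (n + 1) - 1)" if "0 < t" "t < 1" for t
          using that n by (simp add: \<phi>_def powr_realpow[symmetric] of_nat_diff)
        then have "(\<integral>\<^sup>+t\<in>{0<..<1}. ennreal (t ^ (n + m * q - 1)) * ennreal (\<phi> t) \<partial>lborel) =
          (\<integral>\<^sup>+t\<in>{0<..<1}. ennreal (t powr (real (n + m * q) - 1) * (1 - t) powr (real (n + 1) - 1)) \<partial>lborel)"
          by (intro nn_integral_cong) (auto simp: indicator_def ennreal_mult'[symmetric])
        also have "\<dots> = ennreal (F q)" unfolding F_def by (rule nn_integral_Beta) (use n in \<open>auto simp: add_pos_nonneg\<close>)
        finally show ?thesis by (simp add: n_def)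
      qed
      show "(\<integral>\<^sup>+t\<in>{0<..<1}. ennreal (t ^ (m + l * CARD('n) - 1 + m * i)) * ennreal (\<psi> t) \<partial>lborel) = ennreal (G i)" for i
      proof -
        have "t ^ (s0 + m * i) * \<psi> t = t powr ((real (s0 + m * i) + 1) - 1) * (1 - t) powr (2 - 1)" if "0 < t" "t < 1" for t
          using that by (simp add: \<psi>_def powr_realpow[symmetric])
        then have "(\<integral>\<^sup>+t\<in>{0<..<1}. ennreal (t ^ (s0 + m * i)) * ennreal (\<psi> t) \<partial>lborel) =
          (\<integral>\<^sup>+t\<in>{0<..<1}. ennreal (t powr ((real (s0 + m * i) + 1) - 1) * (1 - t) powr (2 - 1)) \<partial>lborel)"
          by (intro nn_integral_cong) (auto simp: indicator_def ennreal_mult'[symmetric])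
        also have "\<dots> = ennreal (G i)" unfolding G_def by (rule nn_integral_Beta) (auto simp: add_nonneg_pos)
        finally show ?thesis by (simp add: s0_def n_def)
      qed
      show "(\<Sum>q<N. (real ((CARD('n) + (\<rho> + m * q)) choose CARD('n)))\<^sup>2 * hX m l x ^ (m * q) * (fact (m * q) / fact (CARD('n) + m * q - 1) * F q)) \<le> A" for N
      proof -
        have "(\<Sum>q<N. (real ((n + (\<rho> + m * q)) choose n))\<^sup>2 * hX m l x ^ (m * q) * (fact (m * q) / fact (n + m * q - 1) * F q)) \<le>
          (\<Sum>q<N. CA * hX m l x ^ (m * q))"
        proof (rule sum_mono)
          fix q
          define d where "d = fact (m * q) / fact (n + m * q - 1) * F q"
          have d: "d \<ge> 0" unfolding d_def using F0 by simp
          have "(real ((n + (\<rho> + m * q)) choose n))\<^sup>2 * d \<le> (real ((n + m) choose n) * real ((n + m * q) choose n))\<^sup>2 * d"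
            using \<rho> d by (intro mult_right_mono power_mono binomial_shift_le) auto
          also have "\<dots> = CA * ((real ((n + m * q) choose n))\<^sup>2 * (fact (m * q) / fact (n + m * q - 1)) * Beta (real (n + m * q)) (real (n + 1)))"
            by (simp only: d_def F_def CA_def power_mult_distrib mult_ac)
          also have "\<dots> \<le> CA * 1"
            using CA by (intro mult_left_mono binomial_Beta_le_1 n) simp
          finally have "(real ((n + (\<rho> + m * q)) choose n))\<^sup>2 * d * hX m l x ^ (m * q) \<le> CA * 1 * hX m l x ^ (m * q)"
            using X by (intro mult_right_mono) auto
          then show "(real ((n + (\<rho> + m * q)) choose n))\<^sup>2 * hX m l x ^ (m * q) * (fact (m * q) / fact (n + m * q - 1) * F q) \<le> CA * hX m l x ^ (m * q)"
            by (simp only: d_def mult_ac mult_1_right)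
        qed
        also have "\<dots> = CA * (\<Sum>q<N. hX m l x ^ (m * q))" by (rule sum_distrib_left[symmetric])
        also have "\<dots> \<le> A"
          unfolding A_def using CA X m by (intro mult_left_mono geometric_subseries_le) auto
        finally show ?thesis by (simp add: n_def)
      qed
      show "(\<Sum>i<N. (real ((1 + (ridx m l CARD('n) \<rho> + m * i)) choose 1))\<^sup>2 * hY m x ^ (m * i) * G i) \<le> B" for N
      proof -
        have "(\<Sum>i<N. (real ((1 + (r + m * i)) choose 1))\<^sup>2 * hY m x ^ (m * i) * G i) \<le> (\<Sum>i<N. hY m x ^ (m * i))"
        proof (rule sum_mono)
          fix i
          \<comment> \<open>\<open>G i = Beta a 2\<close> equals \<open>1 / (a * (a + 1))\<close>,
            and \<open>r \<le> s0\<close> makes \<open>a\<close> at least the binomial coefficient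
            \<open>1 + r + m * i\<close>.\<close>
          define a where "a = real (s0 + m * i) + 1"
          have "r \<le> s0" using r by (simp add: s0_def)
          then have a: "a > 0" "1 + real r + real m * real i \<le> a" by (auto simp: a_def add_nonneg_pos)
          have "a \<notin> \<int>\<^sub>\<le>\<^sub>0" "a + 1 \<notin> \<int>\<^sub>\<le>\<^sub>0" using a by (auto elim!: nonpos_Ints_cases)
          then have "Gamma (a + 2) = (a + 1) * (a * Gamma a)"
            using Gamma_plus1[of a] Gamma_plus1[of "a + 1"] by (simp add: add.assoc)
          then have "G i = 1 / ((a + 1) * a)"
            using Gamma_real_pos[OF a(1)] Gamma_fact[of 1, where 'a = real]
            unfolding G_def Beta_def a_def[symmetric] by simp
          moreover have "(real ((1 + (r + m * i)) choose 1))\<^sup>2 \<le> (a + 1) * a"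
            unfolding power2_eq_square using a by (intro mult_mono) auto
          ultimately have "(real ((1 + (r + m * i)) choose 1))\<^sup>2 * G i \<le> 1"
            using a by (simp add: divide_le_eq_1)
          then have "((real ((1 + (r + m * i)) choose 1))\<^sup>2 * G i) * hY m x ^ (m * i) \<le> 1 * hY m x ^ (m * i)"
            using X by (intro mult_right_mono) auto
          then show "(real ((1 + (r + m * i)) choose 1))\<^sup>2 * hY m x ^ (m * i) * G i \<le> hY m x ^ (m * i)"
            by (simp only: mult_ac mult_1_right)
        qed
        also have "\<dots> \<le> B" unfolding B_def using X m by (intro geometric_subseries_le) auto
        finally show ?thesis by (simp add: r_def n_def)
      qed
    qed
    also have "real m * pi ^ (CARD('n) + 1) * (A * B) = C * (1 / (1 - hX m l x) * (1 / (1 - hY m x)))"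
      by (simp only: A_def B_def C_def n_def mult_ac)
    finally show ?thesis by (simp only: \<phi>_def \<psi>_def n_def)
  qed
  moreover have "C > 0" using m CA by (simp add: C_def)
  ultimately show ?thesis by blast
qed

end

section \<open>Comparison of the kernel with its diagonal values\<close>

context
  fixes m l :: nat
  assumes m: "m > 0" and l: "l > 0"
begin

lemma hpart_hermitian:
  assumes x: "x \<in> hartogs m l" and y: "y \<in> hartogs m l"
  shows "norm (hpart m l \<rho> x y) = norm (hpart m l \<rho> y x)"
proof -
  note a = kernel_arguments[OF m l x y]
  have "hpart m l \<rho> y x = cnj (hpart m l \<rho> x y)"
    unfolding hpart_def using Sser_cnj[OF m a(3)] Sser_cnj[OF m a(2)]
    by (simp add: cnj_herm mult.commute)
  then show ?thesis by simp
qed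

lemma scaled_binomial_pos: "0 < real (m * ((n' + m) choose n'))"
  unfolding of_nat_0_less_iff using m by simp

text \<open>On the diagonal every part is a nonnegative real number, so the kernel is at least any
  single part. By \<open>Sser_lower\<close> each part has the full singularity of order
  \<open>n + 1\<close> in \<open>1 - X\<close> and 2 in \<open>1 - Y\<close>, times its own
  monomial.\<close>

lemma hker_diagonal_lower:
  fixes x :: "(complex ^ 'n) \<times> complex"
  assumes x: "x \<in> hartogs m l" and \<rho>: "\<rho> < m"
  shows "norm (hker m l x x) \<ge> kconst m CARD('n) / (real (m * ((CARD('n) + m) choose CARD('n))) * real (m * ((1 + m) choose 1))) *
    (norm (fst x) ^ (2 * \<rho>) / norm (snd x) ^ (2 * (eidx m l CARD('n) \<rho> + 1)) *
      (1 / (1 - hX m l x) ^ (CARD('n) + 1) * (1 / (1 - hY m x) ^ 2)))"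
proof -
  define n where "n = CARD('n)"
  have X: "0 \<le> hX m l x" "hX m l x < 1" "0 < hY m x" "hY m x < 1"
    using x m l hX_nonneg[of m l x] by (auto simp: mem_hartogs_iff)
  define c1 where "c1 = real (m * ((n + m) choose n))"
  define c2 where "c2 = real (m * ((1 + m) choose 1))"
  have c12: "c1 > 0" "c2 > 0" unfolding c1_def c2_def by (rule scaled_binomial_pos)+
  define mo where "mo = (\<lambda>\<rho>. norm (fst x) ^ (2 * \<rho>) / norm (snd x) ^ (2 * (eidx m l n \<rho> + 1)))"
  have mo0: "mo \<rho> \<ge> 0" for \<rho> by (simp add: mo_def)
  have w2: "(norm (snd x))\<^sup>2 = hY m x ^ m" using powr_two_over_power[OF m, of "snd x"] by (simp add: hY_def)
  have z2: "(norm (fst x))\<^sup>2 = hX m l x * hY m x ^ l" using X by (simp add: hX_def hY_def)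
  have s: "herm (fst x) (fst x) = complex_of_real ((norm (fst x))\<^sup>2)" by (rule herm_self)
  have u: "snd x * cnj (snd x) = complex_of_real ((norm (snd x))\<^sup>2)" by (rule complex_norm_square[symmetric])
  have su: "herm (fst x) (fst x) ^ m / (snd x * cnj (snd x)) ^ l = complex_of_real (hX m l x ^ m)"
  proof -
    have "(hX m l x * hY m x ^ l) ^ m / (hY m x ^ m) ^ l = hX m l x ^ m"
      using X by (simp add: power_mult_distrib power_mult[symmetric] mult.commute)
    then show ?thesis unfolding s u z2 w2 by (metis of_real_divide of_real_power)
  qed
  have uu: "snd x * cnj (snd x) = complex_of_real (hY m x ^ m)" unfolding u w2 ..
  have ex: "\<exists>v. kpart m l n \<rho> (herm (fst x) (fst x)) (snd x * cnj (snd x)) = complex_of_real v \<and>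
      v \<ge> mo \<rho> * ((1 / (1 - hX m l x) ^ (n + 1)) / c1 * ((1 / (1 - hY m x) ^ 2) / c2)) \<and> v \<ge> 0" if "\<rho> < m" for \<rho>
  proof -
    obtain r1 where r1: "Sser m n \<rho> (complex_of_real (hX m l x ^ m)) = complex_of_real r1"
      "1 / (1 - hX m l x) ^ (n + 1) \<le> c1 * r1"
      using Sser_lower[OF m X(1,2) \<open>\<rho> < m\<close>, of n] unfolding c1_def by blast
    obtain r2 where r2: "Sser m 1 (ridx m l n \<rho>) (complex_of_real (hY m x ^ m)) = complex_of_real r2"
      "1 / (1 - hY m x) ^ (1 + 1) \<le> c2 * r2"
      using Sser_lower[OF m less_imp_le[OF X(3)] X(4) ridx_less[OF m], of 1 l n \<rho>] unfolding c2_def by blast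
    have dv: "a / c \<le> r" if "a \<le> c * r" "c > 0" for a c r :: real using that by (simp add: divide_le_eq mult.commute)
    have r1': "(1 / (1 - hX m l x) ^ (n + 1)) / c1 \<le> r1" by (rule dv[OF r1(2) c12(1)])
    have r2': "(1 / (1 - hY m x) ^ 2) / c2 \<le> r2" using dv[OF r2(2) c12(2)] by (simp only: one_add_one)
    have p1: "0 \<le> (1 / (1 - hX m l x) ^ (n + 1)) / c1" "0 \<le> (1 / (1 - hY m x) ^ 2) / c2"
      using X c12 by auto
    have mon: "herm (fst x) (fst x) ^ \<rho> / (snd x * cnj (snd x)) ^ (eidx m l n \<rho> + 1) = complex_of_real (mo \<rho>)"
      unfolding s u mo_def power_mult by (simp only: of_real_divide of_real_power)
    have "kpart m l n \<rho> (herm (fst x) (fst x)) (snd x * cnj (snd x)) = complex_of_real (mo \<rho> * (r1 * r2))"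
      unfolding kpart_def mon su uu[THEN arg_cong[where f = "Sser m 1 (ridx m l n \<rho>)"]] r1(1) r2(1) by simp
    moreover have "mo \<rho> * ((1 / (1 - hX m l x) ^ (n + 1)) / c1 * ((1 / (1 - hY m x) ^ 2) / c2)) \<le> mo \<rho> * (r1 * r2)"
      by (intro mult_left_mono mult_mono mo0 r1' r2' p1 order_trans[OF p1(1) r1'])
    moreover have "0 \<le> mo \<rho> * (r1 * r2)" by (intro mult_nonneg_nonneg mo0 order_trans[OF p1(1) r1'] order_trans[OF p1(2) r2'])
    ultimately show ?thesis by blast
  qed
  then obtain v where v: "\<And>\<rho>. \<rho> < m \<Longrightarrow> kpart m l n \<rho> (herm (fst x) (fst x)) (snd x * cnj (snd x)) = complex_of_real (v \<rho>)"
    "\<And>\<rho>. \<rho> < m \<Longrightarrow> v \<rho> \<ge> mo \<rho> * ((1 / (1 - hX m l x) ^ (n + 1)) / c1 * ((1 / (1 - hY m x) ^ 2) / c2))"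
    "\<And>\<rho>. \<rho> < m \<Longrightarrow> v \<rho> \<ge> 0"
    by metis
  have kc: "kconst m n > 0" by (rule kconst_pos[OF m])
  have "hker m l x x = complex_of_real (kconst m n * (\<Sum>\<rho><m. v \<rho>))"
    using x v(1) by (simp add: hker_def[OF m l] kfun_def n_def)
  then have "norm (hker m l x x) = kconst m n * (\<Sum>\<rho><m. v \<rho>)"
  proof -
    have "(\<Sum>\<rho><m. v \<rho>) \<ge> 0" using v(3) by (intro sum_nonneg) auto
    then have "kconst m n * (\<Sum>\<rho><m. v \<rho>) \<ge> 0" using kc by (intro mult_nonneg_nonneg) auto
    with \<open>hker m l x x = _\<close> show ?thesis by (simp only: norm_of_real abs_of_nonneg)
  qed
  also have "\<dots> \<ge> kconst m n * v \<rho>"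
    using kc v(3) \<rho> by (intro mult_left_mono member_le_sum) auto
  finally have "norm (hker m l x x) \<ge> kconst m n * v \<rho>" .
  moreover have "kconst m n * v \<rho> \<ge> kconst m n * (mo \<rho> * ((1 / (1 - hX m l x) ^ (n + 1)) / c1 * ((1 / (1 - hY m x) ^ 2) / c2)))"
    using kc v(2)[OF \<rho>] by (intro mult_left_mono) auto
  ultimately have "norm (hker m l x x) \<ge> kconst m n * (mo \<rho> * ((1 / (1 - hX m l x) ^ (n + 1)) / c1 * ((1 / (1 - hY m x) ^ 2) / c2)))"
    by linarith
  then show ?thesis
    by (simp only: mo_def c1_def c2_def n_def times_divide_eq_left times_divide_eq_right divide_divide_eq_left divide_divide_eq_right mult_ac mult_1_left mult_1_right)
qed

lemma hker_diagonal_pos: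
  fixes x :: "(complex ^ 'n) \<times> complex"
  assumes x: "x \<in> hartogs m l"
  shows "norm (hker m l x x) > 0"
proof -
  have X: "0 \<le> hX m l x" "hX m l x < 1" "0 < hY m x" "hY m x < 1"
    using x m l hX_nonneg[of m l x] by (auto simp: mem_hartogs_iff)
  have "norm (snd x) > 0" using X by (auto simp: hY_def)
  \<comment> \<open>The part \<open>\<rho> = 0\<close> is positive even at \<open>fst x = 0\<close>,
    since \<open>norm (fst x) ^ 0 = 1\<close>.\<close>
  then have "kconst m CARD('n) / (real (m * ((CARD('n) + m) choose CARD('n))) * real (m * ((1 + m) choose 1))) *
    (norm (fst x) ^ (2 * 0) / norm (snd x) ^ (2 * (eidx m l CARD('n) 0 + 1)) *
      (1 / (1 - hX m l x) ^ (CARD('n) + 1) * (1 / (1 - hY m x) ^ 2))) > 0"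
    using X m kconst_pos[OF m, of "CARD('n)"]
    by (intro mult_pos_pos[of "_ / _"] divide_pos_pos[of "kconst _ _"] mult_pos_pos[OF scaled_binomial_pos scaled_binomial_pos] mult_pos_pos divide_pos_pos) auto
  then show ?thesis using hker_diagonal_lower[OF x m] by linarith
qed

text \<open>The square of the sum of \<open>m\<close> parts costs a factor \<open>m\<close>, and
  each part is compared with the diagonal bound for the same residue \<open>\<rho>\<close>. Thus
  possible zeros of the kernel play no part in the estimate.\<close>

lemma berezin_kernel_bound:
  "\<exists>C>0. \<forall>x\<in>hartogs m l. \<forall>y\<in>hartogs m l.
     (norm (hker m l x y))\<^sup>2 / norm (hker m l x (x :: (complex ^ 'n) \<times> complex)) \<le>
     C * ((1 - hX m l x) ^ (CARD('n) + 1) * (1 - hY m x) ^ 2) *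
       (\<Sum>\<rho><m. hY m y ^ ridx m l CARD('n) \<rho> / hY m y ^ (m + l * CARD('n) - 1) * (norm (hpart m l \<rho> x y))\<^sup>2)"
proof -
  define n where "n = CARD('n)"
  have n: "n > 0" by (simp add: n_def)
  define s0 where "s0 = m + l * n - 1"
  define cc where "cc = real (m * ((n + m) choose n)) * real (m * ((1 + m) choose 1))"
  have cc: "cc > 0" unfolding cc_def by (intro mult_pos_pos scaled_binomial_pos)
  define kc where "kc = kconst m n"
  have kc: "kc > 0" unfolding kc_def by (rule kconst_pos[OF m])
  define C where "C = kc\<^sup>2 * real m * (cc / kc)"
  have "(norm (hker m l x y))\<^sup>2 / norm (hker m l x x) \<le>
     C * ((1 - hX m l x) ^ (n + 1) * (1 - hY m x) ^ 2) *
       (\<Sum>\<rho><m. hY m y ^ ridx m l n \<rho> / hY m y ^ s0 * (norm (hpart m l \<rho> x y))\<^sup>2)"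
    if x: "x \<in> hartogs m l" and y: "y \<in> hartogs m l" for x y :: "(complex ^ 'n) \<times> complex"
  proof -
    have X: "0 \<le> hX m l x" "hX m l x < 1" "0 < hY m x" "hY m x < 1"
      using x m l hX_nonneg[of m l x] by (auto simp: mem_hartogs_iff)
    have Y: "0 \<le> hX m l y" "hX m l y < 1" "0 < hY m y" "hY m y < 1"
      using y m l hX_nonneg[of m l y] by (auto simp: mem_hartogs_iff)
    define D where "D = norm (hker m l x x)"
    have D: "D > 0" unfolding D_def by (rule hker_diagonal_pos[OF x])
    define s where "s = herm (fst x) (fst y)"
    define u where "u = snd x * cnj (snd y)"
    define d where "d = (1 - hX m l x) ^ (n + 1) * (1 - hY m x) ^ 2"
    have d: "d > 0" using X by (simp add: d_def)
    have snz: "norm (snd x) > 0" "norm (snd y) > 0" using X Y by (auto simp: hY_def)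
    have kp: "(norm (kpart m l n \<rho> s u))\<^sup>2 / D \<le> cc / kc * d * (hY m y ^ ridx m l n \<rho> / hY m y ^ s0 * (norm (hpart m l \<rho> x y))\<^sup>2)"
      if \<rho>: "\<rho> < m" for \<rho>
    proof -
      define E where "E = eidx m l n \<rho> + 1"
      define H where "H = (norm (hpart m l \<rho> x y))\<^sup>2"
      have H: "H \<ge> 0" by (simp add: H_def)
      define a where "a = norm (fst x) ^ (2 * \<rho>) / norm (snd x) ^ (2 * E)"
      define b where "b = norm (fst y) ^ (2 * \<rho>) / norm (snd y) ^ (2 * E)"
      have a: "a \<ge> 0" and b: "b \<ge> 0" by (auto simp: a_def b_def)
      have "(norm (kpart m l n \<rho> s u))\<^sup>2 = (norm s ^ \<rho>)\<^sup>2 / (norm u ^ E)\<^sup>2 * H"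
        by (simp add: kpart_def hpart_def H_def E_def s_def u_def n_def norm_mult norm_divide norm_power power_mult_distrib power_divide)
      also have "\<dots> \<le> ((norm (fst x) * norm (fst y)) ^ \<rho>)\<^sup>2 / (norm u ^ E)\<^sup>2 * H"
        unfolding s_def using H by (intro mult_right_mono divide_right_mono power_mono norm_herm_le) auto
      also have "\<dots> = a * b * H"
        by (simp add: a_def b_def u_def norm_mult power_mult_distrib power_mult[symmetric] mult.commute[of _ 2])
      finally have k1: "(norm (kpart m l n \<rho> s u))\<^sup>2 \<le> a * b * H" .
      have k2: "kc / cc * (a / d) \<le> D"
        using hker_diagonal_lower[OF x \<rho>] by (simp add: D_def kc_def cc_def a_def d_def E_def n_def)
      \<comment> \<open>The monomial factor \<open>a\<close> in \<open>x\<close> is the one in the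
        diagonal lower bound, so after division by \<open>D\<close> no power of
        \<open>norm (fst x)\<close> or \<open>norm (snd x)\<close> remains.\<close>
      then have "a \<le> cc / kc * d * D" using kc cc d by (simp add: field_simps)
      then have "a * b * H \<le> (cc / kc * d * D) * b * H" using b H by (intro mult_right_mono) auto
      with k1 have k3: "(norm (kpart m l n \<rho> s u))\<^sup>2 / D \<le> cc / kc * d * (b * H)"
        using D by (simp add: divide_le_eq mult_ac)
      \<comment> \<open>The monomial factor in \<open>y\<close> has no counterpart on the diagonal
        at \<open>x\<close>. In terms of \<open>X\<close> and \<open>Y\<close> it is
        \<open>X ^ \<rho> * Y ^ (r - s0)\<close>, and this negative power of \<open>Y\<close> is the
        source of the restriction on \<open>p\<close>.\<close>
      have "b \<le> hY m y ^ ridx m l n \<rho> / hY m y ^ s0"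
      proof -
        have w2: "(norm (snd y))\<^sup>2 = hY m y ^ m" using powr_two_over_power[OF m, of "snd y"] by (simp add: hY_def)
        have z2: "(norm (fst y))\<^sup>2 = hX m l y * hY m y ^ l" using Y by (simp add: hX_def hY_def)
        have idx: "l * \<rho> + s0 = m * E + ridx m l n \<rho>"
          using idx_eq[OF l n, of \<rho> m] n m l by (simp add: s0_def E_def algebra_simps)
        have "b = hX m l y ^ \<rho> * (hY m y ^ (l * \<rho>) / hY m y ^ (m * E))"
          unfolding b_def power_mult w2 z2 by (simp add: power_mult_distrib power_mult)
        also have "\<dots> \<le> 1 * (hY m y ^ (l * \<rho>) / hY m y ^ (m * E))"
          using Y by (intro mult_right_mono power_le_one) auto
        also have "hY m y ^ (l * \<rho>) / hY m y ^ (m * E) = hY m y ^ (l * \<rho> + s0) / (hY m y ^ (m * E) * hY m y ^ s0)"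
          using Y by (simp add: power_add)
        also have "1 * \<dots> = hY m y ^ ridx m l n \<rho> / hY m y ^ s0"
          unfolding idx using Y by (simp add: power_add)
        finally show ?thesis .
      qed
      then have "cc / kc * d * (b * H) \<le> cc / kc * d * (hY m y ^ ridx m l n \<rho> / hY m y ^ s0 * H)"
        using cc kc d H by (intro mult_left_mono mult_right_mono) auto
      with k3 show ?thesis by (simp add: H_def)
    qed
    have "norm (hker m l x y) = kc * norm (\<Sum>\<rho><m. kpart m l n \<rho> s u)"
      using x y kc by (simp add: hker_def[OF m l] kfun_def norm_mult s_def u_def n_def kc_def)
    also have "\<dots> \<le> kc * (\<Sum>\<rho><m. norm (kpart m l n \<rho> s u))"
      using kc by (intro mult_left_mono norm_sum) auto
    finally have "(norm (hker m l x y))\<^sup>2 \<le> (kc * (\<Sum>\<rho><m. norm (kpart m l n \<rho> s u)))\<^sup>2"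
      by (rule power_mono) simp
    also have "\<dots> = kc\<^sup>2 * (\<Sum>\<rho><m. norm (kpart m l n \<rho> s u))\<^sup>2" by (rule power_mult_distrib)
    also have "\<dots> \<le> kc\<^sup>2 * (real m * (\<Sum>\<rho><m. (norm (kpart m l n \<rho> s u))\<^sup>2))"
      using sum_squared_le_sum_of_squares[of "\<lambda>\<rho>. norm (kpart m l n \<rho> s u)" "{..<m}"] by (intro mult_left_mono) (auto simp: mult.commute)
    finally have "(norm (hker m l x y))\<^sup>2 / D \<le> kc\<^sup>2 * (real m * (\<Sum>\<rho><m. (norm (kpart m l n \<rho> s u))\<^sup>2)) / D"
      using D by (intro divide_right_mono) auto
    also have "\<dots> = kc\<^sup>2 * real m * (\<Sum>\<rho><m. (norm (kpart m l n \<rho> s u))\<^sup>2 / D)"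
      by (simp only: sum_divide_distrib[symmetric] times_divide_eq_right mult.assoc)
    also have "\<dots> \<le> kc\<^sup>2 * real m * (\<Sum>\<rho><m. cc / kc * d * (hY m y ^ ridx m l n \<rho> / hY m y ^ s0 * (norm (hpart m l \<rho> x y))\<^sup>2))"
      by (intro mult_left_mono sum_mono kp) auto
    also have "\<dots> = C * d * (\<Sum>\<rho><m. hY m y ^ ridx m l n \<rho> / hY m y ^ s0 * (norm (hpart m l \<rho> x y))\<^sup>2)"
      by (simp only: sum_distrib_left[symmetric] C_def mult.assoc)
    finally show ?thesis by (simp only: D_def d_def)
  qed
  moreover have "C > 0" using kc cc m by (simp add: C_def)
  ultimately show ?thesis unfolding n_def s0_def by blast
qed

end

text \<open>One half of Schur's test. The inequality \<open>G \<le> t + G\<^sup>p t powr (1 - p)\<close>, with the best \<open>t\<close>, replaces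
  Hoelder's.\<close>

lemma weighted_power_bound:
  fixes \<kappa> V g :: "'a \<Rightarrow> real" and p A j :: real
  assumes [measurable]: "\<kappa> \<in> borel_measurable M" "V \<in> borel_measurable M" "g \<in> borel_measurable M"
    and nonneg: "\<And>y. \<kappa> y \<ge> 0" "\<And>y. V y \<ge> 0" "\<And>y. g y \<ge> 0"
    and V: "\<And>y. \<kappa> y \<noteq> 0 \<Longrightarrow> V y > 0"
    and p: "p > 1" and A: "A > 0" "(\<integral>\<^sup>+y. ennreal (\<kappa> y * V y) \<partial>M) \<le> ennreal A"
    and j: "j \<ge> 0" "(\<integral>\<^sup>+y. ennreal (\<kappa> y * (V y powr (1 - p) * g y powr p)) \<partial>M) = ennreal j"
  shows "(\<integral>\<^sup>+y. ennreal (\<kappa> y * g y) \<partial>M) \<le> ennreal (2 * (A powr (1 - 1 / p) * j powr (1 / p)))"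
proof -
  have young: "G \<le> t + G powr p * t powr (1 - p)" if "G \<ge> 0" "t > 0" for G t :: real
  proof (cases "G \<le> t")
    case False
    then have "G > 0" using that by simp
    have "t powr (1 - p) \<ge> G powr (1 - p)" using False that p by (intro powr_mono2') auto
    then have "G powr p * t powr (1 - p) \<ge> G powr p * G powr (1 - p)" by (intro mult_left_mono) auto
    also have "G powr p * G powr (1 - p) = G" using \<open>G > 0\<close> by (simp add: powr_add[symmetric])
    finally show ?thesis using that by simp
  next
    case True
    have "0 \<le> G powr p * t powr (1 - p)" by simp
    with True show ?thesis by linarith
  qed
  have main: "(\<integral>\<^sup>+y. ennreal (\<kappa> y * g y) \<partial>M) \<le> ennreal (t * A + t powr (1 - p) * j)" if t: "t > 0" for t
  proof -
    have "(\<integral>\<^sup>+y. ennreal (\<kappa> y * g y) \<partial>M) \<le>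
      (\<integral>\<^sup>+y. ennreal t * ennreal (\<kappa> y * V y) + ennreal (t powr (1 - p)) * ennreal (\<kappa> y * (V y powr (1 - p) * g y powr p)) \<partial>M)"
    proof (rule nn_integral_mono)
      fix y
      have "\<kappa> y * g y \<le> t * (\<kappa> y * V y) + t powr (1 - p) * (\<kappa> y * (V y powr (1 - p) * g y powr p))"
      proof (cases "\<kappa> y = 0")
        case False
        then have Vy: "V y > 0" by (rule V)
        have "g y / V y \<le> t + (g y / V y) powr p * t powr (1 - p)" using nonneg Vy t by (intro young) auto
        then have "g y \<le> (t + (g y / V y) powr p * t powr (1 - p)) * V y" using Vy by (simp add: divide_le_eq)
        also have "\<dots> = t * V y + t powr (1 - p) * (V y powr (1 - p) * g y powr p)"
          using Vy nonneg by (simp add: powr_divide powr_diff field_simps)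
        finally have "\<kappa> y * g y \<le> \<kappa> y * (t * V y + t powr (1 - p) * (V y powr (1 - p) * g y powr p))"
          using nonneg by (intro mult_left_mono) auto
        then show ?thesis by (simp add: algebra_simps)
      qed simp
      then have "ennreal (\<kappa> y * g y) \<le> ennreal (t * (\<kappa> y * V y) + t powr (1 - p) * (\<kappa> y * (V y powr (1 - p) * g y powr p)))"
        by (rule ennreal_leI)
      also have "\<dots> = ennreal t * ennreal (\<kappa> y * V y) + ennreal (t powr (1 - p)) * ennreal (\<kappa> y * (V y powr (1 - p) * g y powr p))"
        using nonneg t by (simp add: ennreal_mult)
      finally show "ennreal (\<kappa> y * g y) \<le> ennreal t * ennreal (\<kappa> y * V y) + ennreal (t powr (1 - p)) * ennreal (\<kappa> y * (V y powr (1 - p) * g y powr p))" .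
    qed
    also have "\<dots> = ennreal t * (\<integral>\<^sup>+y. ennreal (\<kappa> y * V y) \<partial>M) + ennreal (t powr (1 - p)) * (\<integral>\<^sup>+y. ennreal (\<kappa> y * (V y powr (1 - p) * g y powr p)) \<partial>M)"
      by (simp add: nn_integral_add nn_integral_cmult)
    also have "\<dots> \<le> ennreal t * ennreal A + ennreal (t powr (1 - p)) * ennreal j"
      unfolding j(2) by (intro add_mono mult_left_mono A) auto
    also have "\<dots> = ennreal (t * A + t powr (1 - p) * j)"
      using t A j by (simp add: ennreal_mult)
    finally show ?thesis .
  qed
  show ?thesis
  proof (cases "j = 0")
    \<comment> \<open>For \<open>j = 0\<close> there is no best \<open>t\<close>; the bound
      \<open>t * A\<close> with \<open>t = e / A\<close> becomes arbitrarily small.\<close>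
    case True
    have "(\<integral>\<^sup>+y. ennreal (\<kappa> y * g y) \<partial>M) \<le> 0"
    proof (rule ennreal_le_epsilon)
      fix e :: real assume e: "e > 0"
      have "(\<integral>\<^sup>+y. ennreal (\<kappa> y * g y) \<partial>M) \<le> ennreal ((e / A) * A + (e / A) powr (1 - p) * j)"
        using e A by (intro main) auto
      then show "(\<integral>\<^sup>+y. ennreal (\<kappa> y * g y) \<partial>M) \<le> 0 + ennreal e" using A True by simp
    qed
    then show ?thesis by simp
  next
    case False
    then have j0: "j > 0" using j by simp
    \<comment> \<open>This \<open>t\<close> makes the two terms \<open>t * A\<close> and
      \<open>t powr (1 - p) * j\<close> equal, whence the factor 2.\<close>
    define t where "t = (j / A) powr (1 / p)"
    have t: "t > 0" using j0 A by (simp add: t_def)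
    have "t * A = A powr (1 - 1 / p) * j powr (1 / p)"
      using j0 A by (simp add: t_def powr_divide powr_diff)
    moreover have "t powr (1 - p) * j = A powr (1 - 1 / p) * j powr (1 / p)"
    proof -
      have "t powr (1 - p) = (j / A) powr (1 / p - 1)" using p by (simp add: t_def powr_powr diff_divide_distrib)
      also have "\<dots> = j powr (1 / p - 1) * A powr (1 - 1 / p)"
        using j0 A by (simp add: powr_divide powr_diff)
      finally have "t powr (1 - p) * j = A powr (1 - 1 / p) * (j powr (1 / p - 1) * j powr 1)" using j0 by simp
      also have "j powr (1 / p - 1) * j powr 1 = j powr (1 / p)" by (simp only: powr_add[symmetric]) simp
      finally show ?thesis .
    qed
    ultimately have "t * A + t powr (1 - p) * j = 2 * (A powr (1 - 1 / p) * j powr (1 / p))" by (simp only: mult_2)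
    then show ?thesis using main[OF t] by (simp only:)
  qed
qed

section \<open>The Berezin kernel and its two test integrals\<close>

context
  fixes m l :: nat
  assumes m: "m > 0" and l: "l > 0"
begin

lemma hker_measurable:
  "(\<lambda>z. hker m l (fst z) (snd z)) \<in> borel_measurable (borel :: (((complex ^ 'n) \<times> complex) \<times> ((complex ^ 'n) \<times> complex)) measure)"
proof -
  let ?S = "hartogs m l :: ((complex ^ 'n) \<times> complex) set"
  note [measurable] = hartogs_measurable[OF m l]
  have [measurable]: "cnj \<in> borel_measurable borel" by (intro borel_measurable_continuous_onI continuous_intros)
  have [measurable]: "?S \<times> ?S \<in> sets borel"
    by (intro borel_open open_Times open_hartogs)
  define F where "F = (\<lambda>N (z :: ((complex ^ 'n) \<times> complex) \<times> ((complex ^ 'n) \<times> complex)). indicator (?S \<times> ?S) z *\<^sub>R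
     (\<Sum>k<N * m. \<Sum>i<N. kterm m l CARD('n) k i (herm (fst (fst z)) (fst (snd z))) (snd (fst z) * cnj (snd (snd z)))))"
  show ?thesis
  proof (rule borel_measurable_LIMSEQ_metric)
    have [measurable]: "(\<lambda>z :: ((complex ^ 'n) \<times> complex) \<times> ((complex ^ 'n) \<times> complex). kterm m l CARD('n) k i (herm (fst (fst z)) (fst (snd z))) (snd (fst z) * cnj (snd (snd z)))) \<in> borel_measurable borel" for k i
      unfolding kterm_def by measurable
    show "F N \<in> borel_measurable borel" for N
      unfolding F_def by measurable
    show "(\<lambda>N. F N z) \<longlonglongrightarrow> hker m l (fst z) (snd z)" for z
    proof (cases "fst z \<in> ?S \<and> snd z \<in> ?S")
      case True
      then have "indicator (?S \<times> ?S) z = (1::real)" by (auto simp: indicator_def mem_Times_iff)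
      then show ?thesis unfolding F_def using hker_tendsto[OF m l, of "fst z" "snd z"] True by (simp only: scaleR_one)
    next
      case False
      then have "indicator (?S \<times> ?S) z = (0::real)" by (auto simp: indicator_def mem_Times_iff)
      then show ?thesis unfolding F_def using False by (auto simp: hker_def[OF m l])
    qed
  qed
qed

definition bker :: "(complex ^ 'n) \<times> complex \<Rightarrow> (complex ^ 'n) \<times> complex \<Rightarrow> real" where
  "bker x y = (norm (hker m l x y))\<^sup>2 / norm (hker m l x x)"

lemma bker_nonneg: "bker x y \<ge> 0" by (simp add: bker_def)

lemma bker_outside: "x \<notin> hartogs m l \<or> y \<notin> hartogs m l \<Longrightarrow> bker x y = 0"
  by (auto simp: bker_def hker_def[OF m l])

lemma bker_measurable:
  "(\<lambda>z. bker (fst z) (snd z)) \<in> borel_measurable (borel :: (((complex ^ 'n) \<times> complex) \<times> ((complex ^ 'n) \<times> complex)) measure)"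
proof -
  note [measurable] = hker_measurable
  have "(\<lambda>z :: ((complex ^ 'n) \<times> complex) \<times> ((complex ^ 'n) \<times> complex). (fst z, fst z)) \<in> borel_measurable borel"
    by (intro borel_measurable_continuous_onI continuous_intros)
  from measurable_compose[OF this hker_measurable]
  have [measurable]: "(\<lambda>z :: ((complex ^ 'n) \<times> complex) \<times> ((complex ^ 'n) \<times> complex). hker m l (fst z) (fst z)) \<in> borel_measurable borel" by simp
  show ?thesis unfolding bker_def by measurable
qed

lemma bker_measurable2:
  fixes x :: "(complex ^ 'n) \<times> complex"
  shows "bker x \<in> borel_measurable borel" "(\<lambda>y. bker y x) \<in> borel_measurable borel"
proof -
  have "(\<lambda>y. (x, y)) \<in> borel_measurable (borel :: ((complex ^ 'n) \<times> complex) measure)"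
    "(\<lambda>y. (y, x)) \<in> borel_measurable (borel :: ((complex ^ 'n) \<times> complex) measure)"
    by (intro borel_measurable_continuous_onI continuous_intros)+
  from this[THEN measurable_compose[OF _ bker_measurable]]
  show "bker x \<in> borel_measurable borel" "(\<lambda>y. bker y x) \<in> borel_measurable borel" by simp_all
qed

text \<open>On the domain these are \<open>1 - X\<close> and \<open>1 - Y\<close>; the absolute
  values keep the test functions nonnegative on the whole space.\<close>

definition wX :: "(complex ^ 'n) \<times> complex \<Rightarrow> real" where "wX y = \<bar>1 - hX m l y\<bar>"
definition wY :: "(complex ^ 'n) \<times> complex \<Rightarrow> real" where "wY y = \<bar>1 - hY m y\<bar>"

lemma w_eq: "y \<in> hartogs m l \<Longrightarrow> wX y = 1 - hX m l y" "y \<in> hartogs m l \<Longrightarrow> wY y = 1 - hY m y"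
  and w_pos: "y \<in> hartogs m l \<Longrightarrow> wX y > 0" "y \<in> hartogs m l \<Longrightarrow> wY y > 0"
  using m l by (auto simp: wX_def wY_def mem_hartogs_iff)

lemma w_measurable [measurable]: "wX \<in> borel_measurable borel" "wY \<in> borel_measurable borel"
  unfolding wX_def[abs_def] wY_def[abs_def] by measurable

lemma bker_bound:
  obtains C where "C > 0"
    "\<And>x y :: (complex ^ 'n) \<times> complex. x \<in> hartogs m l \<Longrightarrow> y \<in> hartogs m l \<Longrightarrow> bker x y \<le>
     C * (wX x ^ (CARD('n) + 1) * wY x ^ 2) *
       (\<Sum>\<rho><m. hY m y ^ ridx m l CARD('n) \<rho> / hY m y ^ (m + l * CARD('n) - 1) * (norm (hpart m l \<rho> x y))\<^sup>2)"
  using berezin_kernel_bound[OF m l, where 'n = 'n] unfolding bker_def by (auto simp: w_eq)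

lemma hpart_borel:
  fixes x :: "(complex ^ 'n) \<times> complex"
  assumes x: "x \<in> hartogs m l"
  shows "(\<lambda>y. indicator (hartogs m l) y *\<^sub>R hpart m l \<rho> x y) \<in> borel_measurable borel"
proof (rule borel_measurable_indicator_continuous)
  have S: "continuous_on (ball 0 1) (Sser m n' \<rho>')" for n' \<rho>'
    by (rule holomorphic_on_imp_continuous_on[OF Sser_holomorphic[OF m]])
  have "continuous_on (hartogs m l) (\<lambda>y. herm (fst x) (fst y) ^ m / (snd x * cnj (snd y)) ^ l)"
    using kernel_arguments(1)[OF m l x] by (intro continuous_intros) auto
  then have "continuous_on (hartogs m l) (\<lambda>y. Sser m CARD('n) \<rho> (herm (fst x) (fst y) ^ m / (snd x * cnj (snd y)) ^ l))"
    by (rule continuous_on_compose2[OF S]) (use kernel_arguments(3)[OF m l x] in auto)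
  moreover have "continuous_on (hartogs m l) (\<lambda>y :: (complex ^ 'n) \<times> complex. Sser m 1 (ridx m l CARD('n) \<rho>) (snd x * cnj (snd y)))"
    by (rule continuous_on_compose2[OF S]) (use kernel_arguments(2)[OF m l x] in \<open>auto intro!: continuous_intros\<close>)
  ultimately show "continuous_on (hartogs m l) (hpart m l \<rho> x)"
    unfolding hpart_def[abs_def] by (rule continuous_on_mult)
qed (rule hartogs_measurable[OF m l])

text \<open>The kernel bound is integrated part by part with \<open>hpart_integral_singular\<close>;
  the powers \<open>n + 1\<close> and 2 of the diagonal factor lower the exponents there to
  \<open>- \<epsilon>\<close>. The factor \<open>Y powr (- b)\<close> of the test function does not
  reappear on the right.\<close>

lemma bker_test_singular:
  fixes b \<epsilon> :: real
  assumes b: "0 \<le> b" "b < 1" and \<epsilon>: "0 < \<epsilon>" "\<epsilon> < 1"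
  obtains C where "C > 0" "\<And>x :: (complex ^ 'n) \<times> complex. x \<in> hartogs m l \<Longrightarrow>
    (\<integral>\<^sup>+y. ennreal (bker x y * (hY m y powr (- b) * (wX y powr (- \<epsilon>) * wY y powr (- \<epsilon>)))) \<partial>lborel)
     \<le> ennreal (C * (wX x powr (- \<epsilon>) * wY x powr (- \<epsilon>)))"
proof -
  define n where "n = CARD('n)"
  define s0 where "s0 = m + l * n - 1"
  have const: "ennreal d * (\<Sum>\<rho><m. ennreal c) = ennreal (d * (real m * c))" if "d \<ge> 0" "c \<ge> 0" for c d :: real
    using that by (simp add: ennreal_mult ennreal_of_nat_eq_real_of_nat)
  note [measurable] = hartogs_measurable[OF m l]
  obtain C1 where C1: "C1 > 0"
    "\<And>x y :: (complex ^ 'n) \<times> complex. x \<in> hartogs m l \<Longrightarrow> y \<in> hartogs m l \<Longrightarrow> bker x y \<le>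
     C1 * (wX x ^ (n + 1) * wY x ^ 2) * (\<Sum>\<rho><m. hY m y ^ ridx m l n \<rho> / hY m y ^ s0 * (norm (hpart m l \<rho> x y))\<^sup>2)"
    using bker_bound[where 'n = 'n] unfolding n_def s0_def by blast
  obtain C2 where C2: "C2 > 0" "\<And>\<rho> x. \<rho> < m \<Longrightarrow> x \<in> hartogs m l \<Longrightarrow>
    (\<integral>\<^sup>+y\<in>hartogs m l. ennreal ((norm (hpart m l \<rho> x (y :: (complex ^ 'n) \<times> complex)))\<^sup>2 *
       ((1 - hX m l y) powr (- \<epsilon>) *
        (hY m y ^ ridx m l n \<rho> / hY m y ^ s0 * hY m y powr (- b) * (1 - hY m y) powr (- \<epsilon>)))) \<partial>lborel)
    \<le> ennreal (C2 * ((1 - hX m l x) powr (- (real n + 1 + \<epsilon>)) * (1 - hY m x) powr (- (2 + \<epsilon>))))"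
    using hpart_integral_singular[OF m l b \<epsilon>, where 'n = 'n] unfolding n_def s0_def by blast
  have "(\<integral>\<^sup>+y. ennreal (bker x y * (hY m y powr (- b) * (wX y powr (- \<epsilon>) * wY y powr (- \<epsilon>)))) \<partial>lborel)
     \<le> ennreal ((C1 * C2 * real m) * (wX x powr (- \<epsilon>) * wY x powr (- \<epsilon>)))" if x: "x \<in> hartogs m l" for x :: "(complex ^ 'n) \<times> complex"
  proof -
    define d where "d = C1 * (wX x ^ (n + 1) * wY x ^ 2)"
    have d: "d \<ge> 0" using C1 w_pos[OF x] by (simp add: d_def)
    define T where "T = (\<lambda>\<rho> y. (norm (hpart m l \<rho> x y))\<^sup>2 * ((1 - hX m l y) powr (- \<epsilon>) *
        (hY m y ^ ridx m l n \<rho> / hY m y ^ s0 * hY m y powr (- b) * (1 - hY m y) powr (- \<epsilon>))))"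
    have T: "T \<rho> y \<ge> 0" for \<rho> y by (simp add: T_def hY_nonneg)
    have hm: "(\<lambda>y. ennreal (T \<rho> y) * indicator (hartogs m l) y) \<in> borel_measurable lborel" for \<rho>
    proof -
      note hpart_borel[OF x, of \<rho>, measurable]
      have eq: "(\<lambda>y. ennreal (T \<rho> y) * indicator (hartogs m l) y) = (\<lambda>y. ennreal ((norm (indicator (hartogs m l) y *\<^sub>R hpart m l \<rho> x y))\<^sup>2 * ((1 - hX m l y) powr (- \<epsilon>) *
        (hY m y ^ ridx m l n \<rho> / hY m y ^ s0 * hY m y powr (- b) * (1 - hY m y) powr (- \<epsilon>)))))"
        by (rule ext) (simp add: T_def indicator_def)
      show ?thesis unfolding eq by measurable
    qed
    have "(\<integral>\<^sup>+y. ennreal (bker x y * (hY m y powr (- b) * (wX y powr (- \<epsilon>) * wY y powr (- \<epsilon>)))) \<partial>lborel) \<le>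
      (\<integral>\<^sup>+y. ennreal d * (\<Sum>\<rho><m. ennreal (T \<rho> y) * indicator (hartogs m l) y) \<partial>lborel)"
    proof (rule nn_integral_mono)
      fix y :: "(complex ^ 'n) \<times> complex"
      show "ennreal (bker x y * (hY m y powr (- b) * (wX y powr (- \<epsilon>) * wY y powr (- \<epsilon>)))) \<le> ennreal d * (\<Sum>\<rho><m. ennreal (T \<rho> y) * indicator (hartogs m l) y)"
      proof (cases "y \<in> hartogs m l")
        case True
        have "bker x y * (hY m y powr (- b) * (wX y powr (- \<epsilon>) * wY y powr (- \<epsilon>))) \<le>
           (d * (\<Sum>\<rho><m. hY m y ^ ridx m l n \<rho> / hY m y ^ s0 * (norm (hpart m l \<rho> x y))\<^sup>2)) * (hY m y powr (- b) * (wX y powr (- \<epsilon>) * wY y powr (- \<epsilon>)))"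
          unfolding d_def by (intro mult_right_mono C1(2) x True) auto
        also have "\<dots> = d * (\<Sum>\<rho><m. T \<rho> y)"
          unfolding T_def sum_distrib_left sum_distrib_right w_eq[OF True] by (intro sum.cong refl) (simp only: mult_ac)
        finally have "ennreal (bker x y * (hY m y powr (- b) * (wX y powr (- \<epsilon>) * wY y powr (- \<epsilon>)))) \<le> ennreal (d * (\<Sum>\<rho><m. T \<rho> y))"
          by (rule ennreal_leI)
        also have "ennreal (d * (\<Sum>\<rho><m. T \<rho> y)) = ennreal d * (\<Sum>\<rho><m. ennreal (T \<rho> y) * indicator (hartogs m l) y)"
          using True d T by (simp add: ennreal_mult sum_nonneg sum_ennreal)
        finally show ?thesis .
      qed (simp add: bker_outside)
    qed
    also have "\<dots> = ennreal d * (\<Sum>\<rho><m. \<integral>\<^sup>+y. ennreal (T \<rho> y) * indicator (hartogs m l) y \<partial>lborel)"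
      by (subst nn_integral_cmult, intro borel_measurable_sum hm, subst nn_integral_sum, rule hm, rule refl)
    also have "\<dots> \<le> ennreal d * (\<Sum>\<rho><m. ennreal (C2 * (wX x powr (- (real n + 1 + \<epsilon>)) * wY x powr (- (2 + \<epsilon>)))))"
      unfolding T_def w_eq[OF x] by (intro mult_left_mono sum_mono C2(2) x) auto
    also have "\<dots> = ennreal (d * (real m * (C2 * (wX x powr (- (real n + 1 + \<epsilon>)) * wY x powr (- (2 + \<epsilon>))))))"
      by (rule const) (use d C2(1) in simp_all)
    also have "d * (real m * (C2 * (wX x powr (- (real n + 1 + \<epsilon>)) * wY x powr (- (2 + \<epsilon>))))) = (C1 * C2 * real m) * (wX x powr (- \<epsilon>) * wY x powr (- \<epsilon>))"
    proof -
      have "wX x ^ (n + 1) * wX x powr (- (real n + 1 + \<epsilon>)) = wX x powr (- \<epsilon>)"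
        using w_pos[OF x] powr_realpow[of "wX x" "n + 1"] by (simp only: powr_add[symmetric] flip: powr_realpow) simp
      moreover have "wY x ^ 2 * wY x powr (- (2 + \<epsilon>)) = wY x powr (- \<epsilon>)"
        using w_pos[OF x] powr_realpow[of "wY x" 2] by (simp only: powr_add[symmetric] flip: powr_realpow) simp
      moreover have "C1 * (a * b) * (real m * (C2 * (P * Q))) = C1 * C2 * real m * ((a * P) * (b * Q))" for a b P Q by simp
      ultimately show ?thesis unfolding d_def by (simp only:)
    qed
    finally show ?thesis .
  qed
  then show ?thesis using C1 C2 m by (intro that[of "C1 * C2 * real m"]) auto
qed

text \<open>The integration runs over the first variable, in which the diagonal value also stands.
  \<open>berezin_kernel_bound\<close> has turned that value into explicit factors, and
  \<open>hpart_hermitian\<close> exchanges the arguments of the parts so that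
  \<open>hpart_integral_vanishing\<close> applies at the fixed point \<open>y\<close>.\<close>

lemma bker_test_vanishing:
  obtains C where "C > 0" "\<And>y :: (complex ^ 'n) \<times> complex. y \<in> hartogs m l \<Longrightarrow>
    (\<integral>\<^sup>+x. ennreal (bker x y * (1 / wX x * (1 / wY x))) \<partial>lborel)
     \<le> ennreal (C * (1 / hY m y ^ (m + l * CARD('n) - 1) * (1 / wX y * (1 / wY y))))"
proof -
  define n where "n = CARD('n)"
  define s0 where "s0 = m + l * n - 1"
  have const: "ennreal d * (\<Sum>\<rho><m. ennreal c) = ennreal (d * (real m * c))" if "d \<ge> 0" "c \<ge> 0" for c d :: real
    using that by (simp add: ennreal_mult ennreal_of_nat_eq_real_of_nat)
  note [measurable] = hartogs_measurable[OF m l]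
  obtain C1 where C1: "C1 > 0"
    "\<And>x y :: (complex ^ 'n) \<times> complex. x \<in> hartogs m l \<Longrightarrow> y \<in> hartogs m l \<Longrightarrow> bker x y \<le>
     C1 * (wX x ^ (n + 1) * wY x ^ 2) * (\<Sum>\<rho><m. hY m y ^ ridx m l n \<rho> / hY m y ^ s0 * (norm (hpart m l \<rho> x y))\<^sup>2)"
    using bker_bound[where 'n = 'n] unfolding n_def s0_def by blast
  obtain C2 where C2: "C2 > 0" "\<And>\<rho> x. \<rho> < m \<Longrightarrow> x \<in> hartogs m l \<Longrightarrow>
    (\<integral>\<^sup>+y\<in>hartogs m l. ennreal ((norm (hpart m l \<rho> x (y :: (complex ^ 'n) \<times> complex)))\<^sup>2 * (wX y ^ n * wY y)) \<partial>lborel)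
    \<le> ennreal (C2 * (1 / (1 - hX m l x) * (1 / (1 - hY m x))))"
    using hpart_integral_vanishing[OF m l, where 'n = 'n] unfolding n_def wX_def wY_def by blast
  have "(\<integral>\<^sup>+x. ennreal (bker x y * (1 / wX x * (1 / wY x))) \<partial>lborel)
     \<le> ennreal ((C1 * C2 * real m) * (1 / hY m y ^ s0 * (1 / wX y * (1 / wY y))))" if y: "y \<in> hartogs m l" for y :: "(complex ^ 'n) \<times> complex"
  proof -
    have Y: "0 < hY m y" "hY m y < 1" using y m l by (auto simp: mem_hartogs_iff)
    define d where "d = C1 * (1 / hY m y ^ s0)"
    have d: "d \<ge> 0" using C1 Y by (simp add: d_def)
    define T where "T = (\<lambda>\<rho> x. (norm (hpart m l \<rho> y x))\<^sup>2 * (wX x ^ n * wY x))"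
    have T: "T \<rho> x \<ge> 0" for \<rho> x by (simp add: T_def wX_def wY_def)
    have hm: "(\<lambda>x. ennreal (T \<rho> x) * indicator (hartogs m l) x) \<in> borel_measurable lborel" for \<rho>
    proof -
      note hpart_borel[OF y, of \<rho>, measurable]
      have eq: "(\<lambda>x. ennreal (T \<rho> x) * indicator (hartogs m l) x) = (\<lambda>x. ennreal ((norm (indicator (hartogs m l) x *\<^sub>R hpart m l \<rho> y x))\<^sup>2 * (wX x ^ n * wY x)))"
        by (rule ext) (simp add: T_def indicator_def)
      show ?thesis unfolding eq by measurable
    qed
    have "(\<integral>\<^sup>+x. ennreal (bker x y * (1 / wX x * (1 / wY x))) \<partial>lborel) \<le>
      (\<integral>\<^sup>+x. ennreal d * (\<Sum>\<rho><m. ennreal (T \<rho> x) * indicator (hartogs m l) x) \<partial>lborel)"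
    proof (rule nn_integral_mono)
      fix x :: "(complex ^ 'n) \<times> complex"
      show "ennreal (bker x y * (1 / wX x * (1 / wY x))) \<le> ennreal d * (\<Sum>\<rho><m. ennreal (T \<rho> x) * indicator (hartogs m l) x)"
      proof (cases "x \<in> hartogs m l")
        case True
        note w = w_pos[OF True]
        have "bker x y * (1 / wX x * (1 / wY x)) \<le>
           (C1 * (wX x ^ (n + 1) * wY x ^ 2) * (\<Sum>\<rho><m. hY m y ^ ridx m l n \<rho> / hY m y ^ s0 * (norm (hpart m l \<rho> x y))\<^sup>2)) * (1 / wX x * (1 / wY x))"
          using w by (intro mult_right_mono C1(2) y True) auto
        also have "\<dots> = C1 * (wX x ^ n * wY x) * (\<Sum>\<rho><m. hY m y ^ ridx m l n \<rho> / hY m y ^ s0 * (norm (hpart m l \<rho> x y))\<^sup>2)"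
          using w by (simp add: power2_eq_square)
        \<comment> \<open>\<open>Y ^ r \<le> 1\<close> is used so that one power serves all
          residues; the loss \<open>1 / Y ^ s0\<close> remains.\<close>
        also have "\<dots> \<le> C1 * (wX x ^ n * wY x) * (\<Sum>\<rho><m. 1 / hY m y ^ s0 * (norm (hpart m l \<rho> x y))\<^sup>2)"
          using w C1 Y by (intro mult_left_mono sum_mono mult_right_mono divide_right_mono power_le_one) auto
        also have "\<dots> = d * (\<Sum>\<rho><m. T \<rho> x)"
          unfolding T_def d_def hpart_hermitian[OF m l True y] sum_distrib_left by (intro sum.cong refl) (simp only: mult_ac)
        finally have "ennreal (bker x y * (1 / wX x * (1 / wY x))) \<le> ennreal (d * (\<Sum>\<rho><m. T \<rho> x))"
          by (rule ennreal_leI)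
        also have "ennreal (d * (\<Sum>\<rho><m. T \<rho> x)) = ennreal d * (\<Sum>\<rho><m. ennreal (T \<rho> x) * indicator (hartogs m l) x)"
          using True d T by (simp add: ennreal_mult sum_nonneg sum_ennreal)
        finally show ?thesis .
      qed (simp add: bker_outside)
    qed
    also have "\<dots> = ennreal d * (\<Sum>\<rho><m. \<integral>\<^sup>+x. ennreal (T \<rho> x) * indicator (hartogs m l) x \<partial>lborel)"
      by (subst nn_integral_cmult, intro borel_measurable_sum hm, subst nn_integral_sum, rule hm, rule refl)
    also have "\<dots> \<le> ennreal d * (\<Sum>\<rho><m. ennreal (C2 * (1 / wX y * (1 / wY y))))"
      unfolding T_def w_eq[OF y] by (intro mult_left_mono sum_mono C2(2) y) auto
    also have "\<dots> = ennreal (d * (real m * (C2 * (1 / wX y * (1 / wY y)))))"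
      by (rule const) (use d C2(1) w_pos[OF y] in simp_all)
    also have "d * (real m * (C2 * (1 / wX y * (1 / wY y)))) = (C1 * C2 * real m) * (1 / hY m y ^ s0 * (1 / wX y * (1 / wY y)))"
      by (simp only: d_def mult_ac)
    finally show ?thesis .
  qed
  then show ?thesis using C1 C2 m unfolding n_def s0_def by (intro that[of "C1 * C2 * real m"]) auto
qed

end

section \<open>Boundedness\<close>

context
  fixes m l :: nat
  assumes m: "m > 0" and l: "l > 0"
begin

text \<open>Schur's test: \<open>weighted_power_bound\<close> with test function \<open>V\<close> at
  each \<open>x\<close>, followed by integration over \<open>x\<close> against \<open>u\<close>. The
  function \<open>u\<close> is what the bound for the integral of the kernel against
  \<open>V\<close> becomes in the power \<open>p - 1\<close>, up to a constant.\<close>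

lemma bker_power_bound:
  fixes p :: real
  assumes p: "p > real (m + l * CARD('n))"
  obtains C where "C > 0" "\<And>g :: (complex ^ 'n) \<times> complex \<Rightarrow> real. g \<in> borel_measurable borel \<Longrightarrow> (\<And>y. g y \<ge> 0) \<Longrightarrow>
    (\<integral>\<^sup>+y. ennreal (g y powr p) \<partial>lborel) < \<infinity> \<Longrightarrow>
    (AE x in lborel. (\<integral>\<^sup>+y. ennreal (bker m l x y * g y) \<partial>lborel) < \<infinity>) \<and>
    (\<integral>\<^sup>+x. ennreal (enn2real (\<integral>\<^sup>+y. ennreal (bker m l x y * g y) \<partial>lborel) powr p) \<partial>lborel)
      \<le> ennreal C * (\<integral>\<^sup>+y. ennreal (g y powr p) \<partial>lborel)"
proof -
  define s0 where "s0 = m + l * CARD('n) - 1"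
  have "0 < l * CARD('n)" using l by simp
  then have s0: "s0 \<ge> 1" "real (m + l * CARD('n)) = real s0 + 1"
    unfolding s0_def using m by linarith+
  \<comment> \<open>The choices give \<open>V powr (1 - p) = Y ^ s0 * (1 - X) * (1 - Y)\<close>, the
    reciprocal of the bound in \<open>bker_test_vanishing\<close> up to a constant. The assumption
    on \<open>p\<close> is \<open>p - 1 > s0\<close>, that is \<open>b < 1\<close>; with
    \<open>s0 \<ge> 1\<close> it also gives \<open>\<epsilon> < 1\<close>.\<close>
  define \<epsilon> where "\<epsilon> = 1 / (p - 1)"
  define b where "b = real s0 / (p - 1)"
  have p1: "p - 1 > real s0" "p - 1 > 1" "p > 1" using p s0 by auto
  have \<epsilon>: "0 < \<epsilon>" "\<epsilon> < 1" and b: "0 \<le> b" "b < 1" using p1 by (auto simp: \<epsilon>_def b_def)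
  have \<epsilon>p: "\<epsilon> * (p - 1) = 1" and bp: "b * (p - 1) = real s0" using p1 by (auto simp: \<epsilon>_def b_def)
  obtain C1 where C1: "C1 > 0" "\<And>x :: (complex ^ 'n) \<times> complex. x \<in> hartogs m l \<Longrightarrow>
    (\<integral>\<^sup>+y. ennreal (bker m l x y * (hY m y powr (- b) * (wX m l y powr (- \<epsilon>) * wY m y powr (- \<epsilon>)))) \<partial>lborel)
     \<le> ennreal (C1 * (wX m l x powr (- \<epsilon>) * wY m x powr (- \<epsilon>)))"
    using bker_test_singular[OF m l b \<epsilon>, where 'n = 'n] by blast
  obtain C2 where C2: "C2 > 0" "\<And>y :: (complex ^ 'n) \<times> complex. y \<in> hartogs m l \<Longrightarrow>
    (\<integral>\<^sup>+x. ennreal (bker m l x y * (1 / wX m l x * (1 / wY m x))) \<partial>lborel)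
     \<le> ennreal (C2 * (1 / hY m y ^ s0 * (1 / wX m l y * (1 / wY m y))))"
    using bker_test_vanishing[OF m l, where 'n = 'n] unfolding s0_def by blast
  define V where "V = (\<lambda>y :: (complex ^ 'n) \<times> complex. hY m y powr (- b) * (wX m l y powr (- \<epsilon>) * wY m y powr (- \<epsilon>)))"
  define u where "u = (\<lambda>x :: (complex ^ 'n) \<times> complex. 1 / wX m l x * (1 / wY m x))"
  note [measurable] = w_measurable[OF m l]
  have [measurable]: "V \<in> borel_measurable borel" "u \<in> borel_measurable borel"
    unfolding V_def u_def by measurable
  have u0: "u x \<ge> 0" for x by (simp add: u_def wX_def[OF m l] wY_def[OF m l])
  have Ypos: "hY m y > 0" if "y \<in> hartogs m l" for y :: "(complex ^ 'n) \<times> complex"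
    using that m l by (simp add: mem_hartogs_iff)
  have Vpos: "V y > 0" if "y \<in> hartogs m l" for y
    using Ypos[OF that] w_pos[OF m l that] by (simp add: V_def)
  have Vp: "V y powr (1 - p) = hY m y ^ s0 * (wX m l y * wY m y)" if "y \<in> hartogs m l" for y
  proof -
    note pos = Ypos[OF that] w_pos[OF m l that]
    have "- b * (1 - p) = real s0" "- \<epsilon> * (1 - p) = 1" using bp \<epsilon>p by (simp_all add: algebra_simps)
    then show ?thesis using pos unfolding V_def by (simp add: powr_mult powr_powr powr_realpow)
  qed
  \<comment> \<open>The \<open>p\<close>-th power of
    \<open>2 * (A powr (1 - 1 / p) * j powr (1 / p))\<close> is
    \<open>2 powr p * A powr (p - 1) * j\<close>, and
    \<open>A powr (p - 1) = C1 powr (p - 1) * u x\<close>.\<close>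
  define D where "D = 2 powr p * C1 powr (p - 1)"
  have D: "D > 0" using C1 by (simp add: D_def)
  show ?thesis
  proof (rule that[of "D * C2"], use D C2(1) in simp)
    fix g :: "(complex ^ 'n) \<times> complex \<Rightarrow> real"
    assume g [measurable]: "g \<in> borel_measurable borel" and g0: "\<And>y. g y \<ge> 0"
      and fin: "(\<integral>\<^sup>+y. ennreal (g y powr p) \<partial>lborel) < \<infinity>"
    note [measurable] = bker_measurable2[OF m l] bker_measurable[OF m l]
    define N where "N = (\<lambda>x. \<integral>\<^sup>+y. ennreal (bker m l x y * g y) \<partial>lborel)"
    define J where "J = (\<lambda>x. \<integral>\<^sup>+y. ennreal (bker m l x y * (V y powr (1 - p) * g y powr p)) \<partial>lborel)"
    have b0: "bker m l x y \<ge> 0" for x y :: "(complex ^ 'n) \<times> complex" by (rule bker_nonneg[OF m l])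
    \<comment> \<open>By Tonelli the integral over \<open>x\<close> is done first. Its bound
      \<open>C2 / (Y ^ s0 * (1 - X) * (1 - Y))\<close> cancels \<open>V powr (1 - p)\<close> and
      leaves \<open>C2 * g y powr p\<close>.\<close>
    define F where "F = (\<lambda>x y. ennreal (u x * (bker m l x y * (V y powr (1 - p) * g y powr p))))"
    have F: "case_prod F \<in> borel_measurable (lborel \<Otimes>\<^sub>M lborel)"
      unfolding F_def lborel_prod case_prod_beta by measurable
    have uJ: "ennreal (u x) * J x = (\<integral>\<^sup>+y. F x y \<partial>lborel)" for x
      unfolding J_def F_def using u0[of x] b0
      by (subst nn_integral_cmult[symmetric]) (auto simp: ennreal_mult)
    have "(\<integral>\<^sup>+x. ennreal (u x) * J x \<partial>lborel) = (\<integral>\<^sup>+y. \<integral>\<^sup>+x. F x y \<partial>lborel \<partial>lborel)"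
      unfolding uJ by (rule lborel_pair.Fubini'[OF F, symmetric])
    also have "\<dots> \<le> (\<integral>\<^sup>+y. ennreal C2 * ennreal (g y powr p) \<partial>lborel)"
    proof (rule nn_integral_mono)
      fix y :: "(complex ^ 'n) \<times> complex"
      show "(\<integral>\<^sup>+x. F x y \<partial>lborel) \<le> ennreal C2 * ennreal (g y powr p)"
      proof (cases "y \<in> hartogs m l")
        case True
        define v where "v = V y powr (1 - p) * g y powr p"
        have v0: "v \<ge> 0" by (simp add: v_def)
        have "(\<integral>\<^sup>+x. F x y \<partial>lborel) = (\<integral>\<^sup>+x. ennreal v * ennreal (bker m l x y * u x) \<partial>lborel)"
          unfolding F_def v_def[symmetric] using v0 by (simp add: ennreal_mult'[symmetric] mult_ac)
        also have "\<dots> = ennreal v * (\<integral>\<^sup>+x. ennreal (bker m l x y * u x) \<partial>lborel)"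
          by (rule nn_integral_cmult) measurable
        also have "\<dots> \<le> ennreal v * ennreal (C2 * (1 / hY m y ^ s0 * (1 / wX m l y * (1 / wY m y))))"
          unfolding u_def by (intro mult_left_mono C2(2) True) auto
        also have "\<dots> = ennreal (v * (C2 * (1 / hY m y ^ s0 * (1 / wX m l y * (1 / wY m y)))))"
          by (rule ennreal_mult'[symmetric, OF v0])
        also have "v * (C2 * (1 / hY m y ^ s0 * (1 / wX m l y * (1 / wY m y)))) = C2 * g y powr p"
          unfolding v_def Vp[OF True] using Ypos[OF True] w_pos[OF m l True] by simp
        finally show ?thesis using C2(1) by (simp add: ennreal_mult)
      qed (simp add: F_def bker_outside[OF m l])
    qed
    also have "\<dots> = ennreal C2 * (\<integral>\<^sup>+y. ennreal (g y powr p) \<partial>lborel)"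
      by (rule nn_integral_cmult) measurable
    finally have J_le: "(\<integral>\<^sup>+x. ennreal (u x) * J x \<partial>lborel) \<le> ennreal C2 * (\<integral>\<^sup>+y. ennreal (g y powr p) \<partial>lborel)" .
    have uJm [measurable]: "(\<lambda>x. ennreal (u x) * J x) \<in> borel_measurable lborel"
      unfolding uJ using lborel.borel_measurable_nn_integral_fst[OF F] by simp
    have "(\<integral>\<^sup>+x. ennreal (u x) * J x \<partial>lborel) \<noteq> \<infinity>"
      using J_le fin by (auto simp: ennreal_mult_less_top top_unique ennreal_mult_eq_top_iff)
    then have AEJ: "AE x in lborel. ennreal (u x) * J x \<noteq> \<infinity>" by (intro nn_integral_PInf_AE uJm) auto
    have bound: "N x < \<infinity> \<and> ennreal (enn2real (N x) powr p) \<le> ennreal D * (ennreal (u x) * J x)"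
      if fx: "ennreal (u x) * J x \<noteq> \<infinity>" for x
    proof (cases "x \<in> hartogs m l")
      case True
      note w = w_pos[OF m l True]
      have "u x > 0" using w by (simp add: u_def)
      then have "J x \<noteq> \<infinity>" using fx by (auto simp: ennreal_mult_eq_top_iff)
      then obtain j where j: "j \<ge> 0" "J x = ennreal j" by (cases "J x") auto
      define A where "A = C1 * (wX m l x powr (- \<epsilon>) * wY m x powr (- \<epsilon>))"
      have A: "A > 0" using w C1 by (simp add: A_def)
      have Nle: "N x \<le> ennreal (2 * (A powr (1 - 1 / p) * j powr (1 / p)))"
        unfolding N_def
      proof (rule weighted_power_bound[where V = V])
        show "(\<integral>\<^sup>+y. ennreal (bker m l x y * V y) \<partial>lborel) \<le> ennreal A"
          unfolding V_def A_def by (rule C1(2)[OF True])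
        show "(\<integral>\<^sup>+y. ennreal (bker m l x y * (V y powr (1 - p) * g y powr p)) \<partial>lborel) = ennreal j"
          using j(2) unfolding J_def .
        show "V y > 0" if "bker m l x y \<noteq> 0" for y
          using that bker_outside[OF m l] by (intro Vpos) blast
        show "V y \<ge> 0" for y by (simp add: V_def)
      qed (use g0 b0 p1 A j in \<open>auto intro: bker_measurable2[OF m l]\<close>)
      have "enn2real (N x) \<le> 2 * (A powr (1 - 1 / p) * j powr (1 / p))"
        by (rule enn2real_leI[OF _ Nle]) simp
      then have "enn2real (N x) powr p \<le> (2 * (A powr (1 - 1 / p) * j powr (1 / p))) powr p"
        using p1 by (intro powr_mono2) auto
      also have "\<dots> = 2 powr p * (A powr ((1 - 1 / p) * p) * j powr (1 / p * p))"
        by (simp only: powr_mult powr_powr)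
      also have "(1 - 1 / p) * p = p - 1" using p1 by (simp add: algebra_simps)
      also have "j powr (1 / p * p) = j" using p1 j by simp
      also have "A powr (p - 1) = C1 powr (p - 1) * u x"
      proof -
        have "- \<epsilon> * (p - 1) = - 1" using \<epsilon>p by simp
        then show ?thesis using w C1 unfolding A_def u_def
          by (simp only: powr_mult powr_powr) (simp add: powr_minus_divide)
      qed
      finally have "enn2real (N x) powr p \<le> D * (u x * j)" by (simp add: D_def mult_ac)
      then have "ennreal (enn2real (N x) powr p) \<le> ennreal (D * (u x * j))" by (rule ennreal_leI)
      also have "\<dots> = ennreal D * (ennreal (u x) * J x)" using D u0 j by (simp add: ennreal_mult)
      finally show ?thesis using Nle by (auto simp: less_top[symmetric] top_unique)
    next
      case False
      then show ?thesis using p1 by (simp add: N_def bker_outside[OF m l])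
    qed
    have "(\<integral>\<^sup>+x. ennreal (enn2real (N x) powr p) \<partial>lborel) \<le> (\<integral>\<^sup>+x. ennreal D * (ennreal (u x) * J x) \<partial>lborel)"
      by (rule nn_integral_mono_AE) (use AEJ bound in auto)
    also have "\<dots> = ennreal D * (\<integral>\<^sup>+x. ennreal (u x) * J x \<partial>lborel)"
      by (rule nn_integral_cmult) measurable
    also have "\<dots> \<le> ennreal D * (ennreal C2 * (\<integral>\<^sup>+y. ennreal (g y powr p) \<partial>lborel))"
      by (intro mult_left_mono J_le) simp
    finally have "(\<integral>\<^sup>+x. ennreal (enn2real (N x) powr p) \<partial>lborel) \<le> ennreal (D * C2) * (\<integral>\<^sup>+y. ennreal (g y powr p) \<partial>lborel)"
      using D C2(1) by (simp add: ennreal_mult mult.assoc)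
    moreover have "AE x in lborel. N x < \<infinity>" using AEJ bound by auto
    ultimately show "(AE x in lborel. (\<integral>\<^sup>+y. ennreal (bker m l x y * g y) \<partial>lborel) < \<infinity>) \<and>
      (\<integral>\<^sup>+x. ennreal (enn2real (\<integral>\<^sup>+y. ennreal (bker m l x y * g y) \<partial>lborel) powr p) \<partial>lborel)
      \<le> ennreal (D * C2) * (\<integral>\<^sup>+y. ennreal (g y powr p) \<partial>lborel)"
      unfolding N_def by blast
  qed
qed

end

section \<open>Borel representatives and the boundedness statement\<close>

lemma lebesgue_on_borel_representative:
  fixes f :: "'a :: euclidean_space \<Rightarrow> complex"
  assumes S [measurable]: "S \<in> sets borel" and f: "f \<in> borel_measurable (lebesgue_on S)"
  obtains f' where "f' \<in> borel_measurable borel" "\<And>x. x \<notin> S \<Longrightarrow> f' x = 0" "AE x in lebesgue_on S. f x = f' x"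
proof -
  have "(\<lambda>x. indicator S x *\<^sub>R f x) \<in> borel_measurable lebesgue"
    using f S by (subst (asm) borel_measurable_restrict_space_iff) auto
  then have "(\<lambda>x. Re (indicator S x *\<^sub>R f x)) \<in> borel_measurable (completion lborel)"
    "(\<lambda>x. Im (indicator S x *\<^sub>R f x)) \<in> borel_measurable (completion lborel)"
    by measurable
  from this[THEN completion_ex_borel_measurable_real]
  obtain u v where [measurable]: "u \<in> borel_measurable lborel" "v \<in> borel_measurable lborel" and
    uv: "AE x in lborel. Re (indicator S x *\<^sub>R f x) = u x" "AE x in lborel. Im (indicator S x *\<^sub>R f x) = v x"
    by auto
  show ?thesis
  proof
    show "(\<lambda>x. indicator S x *\<^sub>R Complex (u x) (v x)) \<in> borel_measurable borel"
    proof -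
      have "(\<lambda>x. indicator S x *\<^sub>R Complex (u x) (v x)) = (\<lambda>x. indicator S x *\<^sub>R (complex_of_real (u x) + \<i> * complex_of_real (v x)))"
        by (simp add: complex_eq fun_eq_iff complex_eq_iff)
      also have "\<dots> \<in> borel_measurable borel" by measurable
      finally show ?thesis .
    qed
    have "AE x in lborel. x \<in> S \<longrightarrow> f x = indicator S x *\<^sub>R Complex (u x) (v x)"
      using uv by eventually_elim (auto simp: complex_eq_iff)
    then have "AE x in lebesgue. x \<in> S \<longrightarrow> f x = indicator S x *\<^sub>R Complex (u x) (v x)"
      by (rule AE_completion)
    then show "AE x in lebesgue_on S. f x = indicator S x *\<^sub>R Complex (u x) (v x)"
      by (subst AE_restrict_space_iff) auto
  qed simp
qed

lemma Lp_space_borel_representative: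
  fixes f :: "'a :: euclidean_space \<Rightarrow> complex"
  assumes S [measurable]: "S \<in> sets borel" and f: "f \<in> Lp_space p S"
  obtains f' where "f' \<in> borel_measurable borel" "\<And>x. x \<notin> S \<Longrightarrow> f' x = 0" "AE x in lebesgue_on S. f x = f' x"
    "(\<integral>\<^sup>+x. ennreal (norm (f' x) powr p) \<partial>lborel) = ennreal (LINT x|lebesgue_on S. norm (f x) powr p)"
proof -
  have fm [measurable]: "f \<in> borel_measurable (lebesgue_on S)" and fi: "integrable (lebesgue_on S) (\<lambda>x. norm (f x) powr p)"
    using f by (auto simp: Lp_space_def)
  obtain f' where f' [measurable]: "f' \<in> borel_measurable borel" and f'0: "\<And>x. x \<notin> S \<Longrightarrow> f' x = 0"
    and ae: "AE x in lebesgue_on S. f x = f' x"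
    using lebesgue_on_borel_representative[OF S fm] by blast
  have f'm [measurable]: "f' \<in> borel_measurable (lebesgue_on S)"
    by (intro measurable_restrict_space1 measurable_completion) simp
  have ind: "(\<lambda>x. indicator S x *\<^sub>R (norm (f' x) powr p)) = (\<lambda>x. norm (f' x) powr p)"
    by (rule ext) (auto simp: indicator_def f'0)
  have eq: "(LINT x|lebesgue_on S. norm (f x) powr p) = (LINT x|lebesgue_on S. norm (f' x) powr p)"
    by (rule integral_cong_AE) (use ae in \<open>auto elim!: eventually_mono\<close>)
  have "integrable (lebesgue_on S) (\<lambda>x. norm (f' x) powr p)"
    by (rule integrable_cong_AE_imp[OF fi]) (use ae in \<open>auto elim!: eventually_mono\<close>)
  moreover have bm: "(\<lambda>x. indicator S x *\<^sub>R (norm (f' x) powr p)) \<in> borel_measurable borel" by measurable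
  ultimately have "integrable lborel (\<lambda>x. norm (f' x) powr p)"
    using lebesgue_on_integral(1)[OF S bm] unfolding ind by blast
  then have "(\<integral>\<^sup>+x. ennreal (norm (f' x) powr p) \<partial>lborel) = ennreal (LINT x|lborel. norm (f' x) powr p)"
    by (intro nn_integral_eq_integral) auto
  also have "(LINT x|lborel. norm (f' x) powr p) = (LINT x|lebesgue_on S. norm (f x) powr p)"
    using lebesgue_on_integral(2)[OF S bm] by (simp only: ind eq)
  finally have "(\<integral>\<^sup>+x. ennreal (norm (f' x) powr p) \<partial>lborel) = ennreal (LINT x|lebesgue_on S. norm (f x) powr p)" .
  then show ?thesis by (intro that[of f'] f' f'0 ae)
qed

text \<open>The transform is dominated pointwise by the positive operator with kernel
  \<open>bker\<close> applied to the modulus of a Borel representative of \<open>f\<close>.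
  Finiteness of that integral almost everywhere gives the absolute convergence demanded in the
  definition, and \<open>bker_power_bound\<close> gives the norm estimate.\<close>

lemma berezin_bounded_hartogs:
  fixes m l :: nat and p :: real
  assumes m: "m > 0" and l: "l > 0" and p: "p > real (m + l * CARD('n))"
  shows "berezin_bounded_on_Lp p (hartogs m l :: ((complex ^ 'n) \<times> complex) set)"
proof -
  let ?S = "hartogs m l :: ((complex ^ 'n) \<times> complex) set"
  have S [measurable]: "?S \<in> sets borel" by (rule hartogs_measurable[OF m l])
  have p0: "p > 0" using p by linarith
  define c where "c = (\<lambda>x y :: (complex ^ 'n) \<times> complex. complex_of_real ((norm (hker m l x y))\<^sup>2) / hker m l x x)"
  have c_norm: "norm (c x y) = bker m l x y" for x y
    by (simp add: c_def bker_def[OF m l] norm_divide norm_power)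
  have integrand: "berezin_integrand ?S f x y = c x y * f y" for f x y
    by (simp add: berezin_integrand_def c_def bergman_kernel_hartogs[OF m l])
  have cm: "(\<lambda>z. c (fst z) (snd z)) \<in> borel_measurable borel"
  proof -
    note [measurable] = hker_measurable[OF m l]
    have "(\<lambda>z :: ((complex ^ 'n) \<times> complex) \<times> ((complex ^ 'n) \<times> complex). (fst z, fst z)) \<in> borel_measurable borel"
      by (intro borel_measurable_continuous_onI continuous_intros)
    from measurable_compose[OF this hker_measurable[OF m l]]
    have [measurable]: "(\<lambda>z :: ((complex ^ 'n) \<times> complex) \<times> ((complex ^ 'n) \<times> complex). hker m l (fst z) (fst z)) \<in> borel_measurable borel" by simp
    show ?thesis unfolding c_def by measurable
  qed
  have cm2: "c x \<in> borel_measurable borel" for x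
  proof -
    have "(\<lambda>y. (x, y)) \<in> borel_measurable (borel :: ((complex ^ 'n) \<times> complex) measure)"
      by (intro borel_measurable_continuous_onI continuous_intros)
    from measurable_compose[OF this cm] show ?thesis by simp
  qed
  obtain C where C: "C > 0" "\<And>g :: (complex ^ 'n) \<times> complex \<Rightarrow> real. g \<in> borel_measurable borel \<Longrightarrow> (\<And>y. g y \<ge> 0) \<Longrightarrow>
    (\<integral>\<^sup>+y. ennreal (g y powr p) \<partial>lborel) < \<infinity> \<Longrightarrow>
    (AE x in lborel. (\<integral>\<^sup>+y. ennreal (bker m l x y * g y) \<partial>lborel) < \<infinity>) \<and>
    (\<integral>\<^sup>+x. ennreal (enn2real (\<integral>\<^sup>+y. ennreal (bker m l x y * g y) \<partial>lborel) powr p) \<partial>lborel)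
      \<le> ennreal C * (\<integral>\<^sup>+y. ennreal (g y powr p) \<partial>lborel)"
    using bker_power_bound[OF m l p] by blast
  have main: "(AE x in lebesgue_on ?S. integrable (lebesgue_on ?S) (berezin_integrand ?S f x)) \<and>
      berezin ?S f \<in> Lp_space p ?S \<and> Lp_norm p ?S (berezin ?S f) \<le> C powr (1 / p) * Lp_norm p ?S f"
    if f: "f \<in> Lp_space p ?S" for f
  proof -
    define G where "G = (LINT x|lebesgue_on ?S. norm (f x) powr p)"
    have G0: "G \<ge> 0" unfolding G_def by (intro Bochner_Integration.integral_nonneg) simp
    have fm [measurable]: "f \<in> borel_measurable (lebesgue_on ?S)" using f by (simp add: Lp_space_def)
    obtain f' where f' [measurable]: "f' \<in> borel_measurable borel" and f'0: "\<And>x. x \<notin> ?S \<Longrightarrow> f' x = 0"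
      and ae: "AE x in lebesgue_on ?S. f x = f' x"
      and G: "(\<integral>\<^sup>+x. ennreal (norm (f' x) powr p) \<partial>lborel) = ennreal G"
      using Lp_space_borel_representative[OF S f] unfolding G_def by blast
    define N where "N = (\<lambda>x. \<integral>\<^sup>+y. ennreal (bker m l x y * norm (f' y)) \<partial>lborel)"
    have "(\<lambda>y. norm (f' y)) \<in> borel_measurable borel" by measurable
    from C(2)[OF this norm_ge_zero]
    have N: "AE x in lborel. N x < \<infinity>" "(\<integral>\<^sup>+x. ennreal (enn2real (N x) powr p) \<partial>lborel) \<le> ennreal C * ennreal G"
      unfolding N_def G by auto
    define h where "h = (\<lambda>x. LINT y|lborel. c x y * f' y)"
    note [measurable] = cm cm2
    have h [measurable]: "h \<in> borel_measurable borel"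
    proof -
      have "(\<lambda>(x, y). c x y * f' y) \<in> borel_measurable (lborel \<Otimes>\<^sub>M lborel)"
        unfolding lborel_prod case_prod_beta by measurable
      from lborel.borel_measurable_lebesgue_integral[OF this]
      show ?thesis unfolding h_def by simp
    qed
    have ind: "(\<lambda>y. indicator ?S y *\<^sub>R (c x y * f' y)) = (\<lambda>y. c x y * f' y)" for x
      by (rule ext) (auto simp: indicator_def f'0)
    have bm: "(\<lambda>y. indicator ?S y *\<^sub>R (c x y * f' y)) \<in> borel_measurable borel" for x
      by measurable
    have lm: "u \<in> borel_measurable (lebesgue_on ?S)" if "u \<in> borel_measurable borel" for u :: "(complex ^ 'n) \<times> complex \<Rightarrow> complex"
      using that by (intro measurable_restrict_space1 measurable_completion) simp
    note [measurable] = lm[OF f'] lm[OF cm2]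
    have ber: "berezin ?S f x = h x" for x
    proof -
      have "berezin ?S f x = (LINT y|lebesgue_on ?S. c x y * f' y)"
        unfolding berezin_def integrand by (rule integral_cong_AE) (use ae in \<open>auto elim!: eventually_mono\<close>)
      also have "\<dots> = h x" using lebesgue_on_integral(2)[OF S bm] unfolding ind h_def .
      finally show ?thesis .
    qed
    have int: "integrable (lebesgue_on ?S) (berezin_integrand ?S f x)" if "N x < \<infinity>" for x
    proof -
      have "integrable lborel (\<lambda>y. c x y * f' y)"
        using that unfolding N_def by (intro integrableI_bounded) (auto simp: norm_mult c_norm)
      then have "integrable (lebesgue_on ?S) (\<lambda>y. c x y * f' y)"
        using lebesgue_on_integral(1)[OF S bm] unfolding ind by blast
      moreover have "berezin_integrand ?S f x = (\<lambda>y. c x y * f y)" by (rule ext) (rule integrand)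
      ultimately show ?thesis
        by (simp only:) (erule integrable_cong_AE_imp, use ae in \<open>auto elim!: eventually_mono\<close>)
    qed
    have "AE x in lebesgue. N x < \<infinity>" using N(1) by (rule AE_completion)
    then have AE: "AE x in lebesgue_on ?S. integrable (lebesgue_on ?S) (berezin_integrand ?S f x)"
      using S by (subst AE_restrict_space_iff) (auto elim!: eventually_mono intro: int)
    have hN: "norm (h x) \<le> enn2real (N x)" for x
    proof -
      have "norm (h x) \<le> (LINT y|lborel. norm (c x y * f' y))" unfolding h_def by (rule integral_norm_bound)
      also have "\<dots> = enn2real (N x)" unfolding N_def
        using bker_measurable2(1)[OF m l, of x] bker_nonneg[OF m l, of x]
        by (subst integral_eq_nn_integral) (auto simp: norm_mult c_norm)
      finally show ?thesis .
    qed
    have h0: "h x = 0" if "x \<notin> ?S" for x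
      using that unfolding h_def by (simp add: c_def hker_def[OF m l])
    have hb: "(\<integral>\<^sup>+x. ennreal (norm (h x) powr p) \<partial>lborel) \<le> ennreal (C * G)"
    proof -
      have "(\<integral>\<^sup>+x. ennreal (norm (h x) powr p) \<partial>lborel) \<le> (\<integral>\<^sup>+x. ennreal (enn2real (N x) powr p) \<partial>lborel)"
        using p0 by (intro nn_integral_mono ennreal_leI powr_mono2 hN) auto
      then show ?thesis using N(2) C(1) G0 by (simp add: ennreal_mult)
    qed
    have hi: "integrable lborel (\<lambda>x. norm (h x) powr p)"
      using hb by (intro integrableI_bounded) (auto simp: less_top[symmetric] top_unique)
    have indh: "(\<lambda>x. indicator ?S x *\<^sub>R (norm (h x) powr p)) = (\<lambda>x. norm (h x) powr p)"
      by (rule ext) (auto simp: indicator_def h0)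
    have bmh: "(\<lambda>x. indicator ?S x *\<^sub>R (norm (h x) powr p)) \<in> borel_measurable borel" by measurable
    have hL: "integrable (lebesgue_on ?S) (\<lambda>x. norm (h x) powr p)"
      "(LINT x|lebesgue_on ?S. norm (h x) powr p) = (LINT x|lborel. norm (h x) powr p)"
      using lebesgue_on_integral[OF S bmh] hi unfolding indh by auto
    have bereq: "berezin ?S f = h" by (rule ext) (rule ber)
    have "(LINT x|lborel. norm (h x) powr p) \<le> C * G"
      using hb C(1) G0 nn_integral_eq_integral[OF hi] by (simp add: ennreal_le_iff)
    then have "Lp_norm p ?S h \<le> (C * G) powr (1 / p)"
      unfolding Lp_norm_def hL(2) using p0 by (intro powr_mono2 Bochner_Integration.integral_nonneg) auto
    also have "\<dots> = C powr (1 / p) * Lp_norm p ?S f"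
      unfolding Lp_norm_def G_def[symmetric] using C(1) G0 by (simp add: powr_mult)
    finally show ?thesis using AE lm[OF h] hL(1) unfolding bereq Lp_space_def by blast
  qed
  then show ?thesis unfolding berezin_bounded_on_Lp_def by blast
qed

section \<open>Unboundedness\<close>

context
  fixes m l :: nat
  assumes m: "m > 0" and l: "l > 0"
begin

lemma hmono_holomorphic:
  fixes e :: "complex ^ 'n"
  shows "holomorphic_several (hmono e k i N) (hartogs m l)"
  unfolding holomorphic_several_iff
proof
  fix x :: "(complex ^ 'n) \<times> complex" assume x: "x \<in> hartogs m l"
  have "snd x \<noteq> 0" using x l by (auto simp: hartogs_def zero_power dest: le_less_trans[rotated])
  then have "hol_at (\<lambda>y. herm (fst y) e ^ k * (snd y * 1) ^ i * inverse ((snd y * 1) ^ N)) x"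
    by (intro hol_at_mult hol_at_power hol_at_inverse hol_at_herm hol_at_snd) simp
  then show "hol_at (hmono e k i N) x" by (simp add: hmono_def[abs_def] field_class.field_divide_inverse)
qed

text \<open>The coefficient \<open>\<beta>\<close> of the kernel along the monomial \<open>h\<close> is the same for every weight \<open>W\<close>; for \<open>W = 1\<close>
  the reproducing formula shows that it does not vanish.\<close>

lemma kernel_weight_lower:
  fixes x :: "(complex ^ 'n) \<times> complex"
  assumes x: "x \<in> hartogs m l" and x0: "fst x \<noteq> 0" and r: "ridx m l CARD('n) k = 0"
  obtains a where "a > 0" "\<And>W :: real \<Rightarrow> real. \<And>c. W \<in> borel_measurable borel \<Longrightarrow> (\<And>y. 0 \<le> W y) \<Longrightarrow> (\<And>y. W y \<le> c) \<Longrightarrow>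
     a * (LINT y|lborel. indicator {0<..<1} y * W y) \<le>
       (LINT y|lborel. indicator (hartogs m l) y * W (hY m y) * (norm (hker m l x y))\<^sup>2)"
proof -
  define n where "n = CARD('n)"
  have n: "n > 0" by (simp add: n_def)
  let ?S = "hartogs m l :: ((complex ^ 'n) \<times> complex) set"
  have S [measurable]: "?S \<in> sets borel" by (rule hartogs_measurable[OF m l])
  \<comment> \<open>The monomial is taken in the direction of \<open>fst x\<close> itself, so that
    it does not vanish at \<open>x\<close>.\<close>
  define e where "e = complex_of_real (1 / norm (fst x)) *s fst x"
  have e: "norm e = 1" using x0 by (simp add: e_def norm_scale_vec norm_divide)
  have xe: "fst x = complex_of_real (norm (fst x)) *s e" using x0 by (simp add: e_def vector_smult_assoc)
  define E where "E = eidx m l n k + 1"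
  have lk: "l * (k + n) = m * eidx m l n k + 1" using idx_eq[OF l n, of k m] r by (simp add: n_def)
  define h where "h = hmono e k 0 E"
  have snd0: "snd y \<noteq> 0" if "y \<in> ?S" for y :: "(complex ^ 'n) \<times> complex"
    using that l by (auto simp: hartogs_def zero_power dest: le_less_trans[rotated])
  have hol_h: "holomorphic_several h ?S" unfolding h_def by (rule hmono_holomorphic)
  define f where "f = (\<lambda>y. hker m l y x)"
  have hol: "holomorphic_several f ?S" unfolding f_def by (rule hker_holomorphic[OF m l x])
  have If: "integrable lborel (\<lambda>y. indicator ?S y * (norm (f y))\<^sup>2)"
    unfolding f_def by (rule hker_square_integrable[OF m l x])
  have Ih: "integrable lborel (\<lambda>y. indicator ?S y * (norm (h y))\<^sup>2)"
    unfolding h_def E_def n_def by (rule hmono_moment_allowed(1)[OF m l e])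
  have ch: "continuous_on ?S h" by (rule holomorphic_several_continuous[OF hol_h])
  have cf: "continuous_on ?S f" by (rule holomorphic_several_continuous[OF hol])
  have fnorm: "norm (f y) = norm (hker m l x y)" for y
    unfolding f_def using hker_hermitian[OF m l, of y x] by (metis complex_mod_cnj)
  obtain B N where B: "B holomorphic_on ball 0 1" "\<forall>\<tau>\<in>ball 0 1 - {0}. slice_coeff f e k \<tau> = B \<tau> / \<tau> ^ N"
    and N: "N \<ge> l * (k + n)"
    using slice_coeff_extends[OF m l e hol If] unfolding n_def by blast
  have "eidx m l n k \<le> m * eidx m l n k" using m by simp
  then have EN: "E \<le> N" unfolding E_def using N lk by linarith
  have heq: "hmono e k (N - E) N y = h y" if "y \<in> ?S" for y
    using snd0[OF that] EN by (simp add: h_def hmono_def power_diff)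
  define \<beta> where "\<beta> = (deriv ^^ (N - E)) B 0 / fact (N - E)"
  have I3: "integrable lborel (\<lambda>y. indicator ?S y *\<^sub>R (f y * cnj (h y)))"
    by (rule integrable_mult_L2) (use cf ch If Ih in \<open>auto intro!: continuous_intros\<close>)
  have hbm: "(\<lambda>y. indicator ?S y *\<^sub>R h y) \<in> borel_measurable borel" "(\<lambda>y. indicator ?S y *\<^sub>R f y) \<in> borel_measurable borel"
    by (rule borel_measurable_indicator_continuous[OF ch S], rule borel_measurable_indicator_continuous[OF cf S])
  have coeff: "(LINT y|lborel. (indicator ?S y * W (hY m y)) *\<^sub>R (f y * cnj (h y))) =
      \<beta> * complex_of_real (LINT y|lborel. indicator ?S y * W (hY m y) * (norm (h y))\<^sup>2)"
    and coeff_int: "integrable lborel (\<lambda>y. (indicator ?S y * W (hY m y)) *\<^sub>R (f y * cnj (h y)))"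
    if W [measurable]: "W \<in> borel_measurable borel" and W0: "\<And>y. 0 \<le> W y" and Wc: "\<And>y. W y \<le> c" for W :: "real \<Rightarrow> real" and c
  proof -
    have eq1: "(indicator ?S y * W (hY m y)) *\<^sub>R (f y * cnj (hmono e k (N - E) N y)) = (indicator ?S y * W (hY m y)) *\<^sub>R (f y * cnj (h y))" for y
      by (cases "y \<in> ?S") (simp_all add: heq)
    have eq2: "indicator ?S y * W (hY m y) * (norm (hmono e k (N - E) N y))\<^sup>2 = indicator ?S y * W (hY m y) * (norm (h y))\<^sup>2" for y
      by (cases "y \<in> ?S") (simp_all add: heq)
    show I: "integrable lborel (\<lambda>y. (indicator ?S y * W (hY m y)) *\<^sub>R (f y * cnj (h y)))"
    proof (rule Bochner_Integration.integrable_bound)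
      show "integrable lborel (\<lambda>y. c *\<^sub>R (indicator ?S y *\<^sub>R (f y * cnj (h y))))"
        by (rule integrable_scaleR_right[OF I3])
      have eq: "(indicator ?S y * W (hY m y)) *\<^sub>R (f y * cnj (h y)) = W (hY m y) *\<^sub>R (indicator ?S y *\<^sub>R (f y * cnj (h y)))" for y
        by simp
      show "(\<lambda>y. (indicator ?S y * W (hY m y)) *\<^sub>R (f y * cnj (h y))) \<in> borel_measurable lborel"
        unfolding eq using borel_measurable_integrable[OF I3] by measurable
      show "AE y in lborel. norm ((indicator ?S y * W (hY m y)) *\<^sub>R (f y * cnj (h y))) \<le> norm (c *\<^sub>R (indicator ?S y *\<^sub>R (f y * cnj (h y))))"
      proof (rule AE_I2)
        fix y :: "(complex ^ 'n) \<times> complex"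
        have "\<bar>W (hY m y)\<bar> \<le> \<bar>c\<bar>" using W0[of "hY m y"] Wc[of "hY m y"] by linarith
        then have "\<bar>W (hY m y)\<bar> * norm (indicator ?S y *\<^sub>R (f y * cnj (h y))) \<le> \<bar>c\<bar> * norm (indicator ?S y *\<^sub>R (f y * cnj (h y)))"
          by (rule mult_right_mono) simp
        then show "norm ((indicator ?S y * W (hY m y)) *\<^sub>R (f y * cnj (h y))) \<le> norm (c *\<^sub>R (indicator ?S y *\<^sub>R (f y * cnj (h y))))"
          unfolding eq norm_scaleR .
      qed
    qed
    show "(LINT y|lborel. (indicator ?S y * W (hY m y)) *\<^sub>R (f y * cnj (h y))) =
      \<beta> * complex_of_real (LINT y|lborel. indicator ?S y * W (hY m y) * (norm (h y))\<^sup>2)"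
      using weighted_coefficient[OF m l e hol B, of W "N - E"] I unfolding eq1 eq2 \<beta>_def by blast
  qed
  \<comment> \<open>A vanishing \<open>\<beta>\<close> would make the kernel at \<open>x\<close>
    orthogonal to \<open>h\<close>; the reproducing formula would then give \<open>h x = 0\<close>,
    against the choice of \<open>e\<close>.\<close>
  have \<beta>: "\<beta> \<noteq> 0"
  proof
    assume "\<beta> = 0"
    then have "(LINT y|lborel. indicator ?S y *\<^sub>R (f y * cnj (h y))) = 0" using coeff[of "\<lambda>_. 1" 1] by simp
    moreover have "indicator ?S y *\<^sub>R (f y * cnj (h y)) = cnj (indicator ?S y *\<^sub>R (h y * hker m l x y))" for y
      unfolding f_def using hker_hermitian[OF m l, of y x] hker_hermitian[OF m l, of x y] by simp
    ultimately have "cnj (LINT y|lborel. indicator ?S y *\<^sub>R (h y * hker m l x y)) = 0"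
      by (simp only: Bochner_Integration.integral_cnj)
    then have "h x = 0" using reproducing_formula[OF m l hol_h Ih x] by simp
    moreover have "herm (fst x) e = complex_of_real (norm (fst x))"
      by (subst xe) (simp add: herm_scale_left herm_self e)
    ultimately show False using snd0[OF x] x0 by (simp add: h_def hmono_def)
  qed
  define M where "M = real m * pi ^ (n + 1) * fact k / fact (n + k)"
  have M: "M > 0" using m by (simp add: M_def)
  have hW: "(LINT y|lborel. indicator ?S y * W (hY m y) * (norm (h y))\<^sup>2) = M * (LINT y|lborel. indicator {0<..<1} y * W y)"
    and hW_int: "integrable lborel (\<lambda>y. indicator ?S y * W (hY m y) * (norm (h y))\<^sup>2)"
    and fW_int: "integrable lborel (\<lambda>y. indicator ?S y * W (hY m y) * (norm (f y))\<^sup>2)"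
    if W [measurable]: "W \<in> borel_measurable borel" and W0: "\<And>y. 0 \<le> W y" and Wc: "\<And>y. W y \<le> c" for W :: "real \<Rightarrow> real" and c
  proof -
    have int: "integrable lborel (\<lambda>y. indicator ?S y * W (hY m y) * (norm (u y))\<^sup>2)"
      if I: "integrable lborel (\<lambda>y. indicator ?S y * (norm (u y))\<^sup>2)" for u :: "(complex ^ 'n) \<times> complex \<Rightarrow> complex"
    proof (rule Bochner_Integration.integrable_bound)
      show "integrable lborel (\<lambda>y. c * (indicator ?S y * (norm (u y))\<^sup>2))" by (rule integrable_mult_right[OF I])
      have eq: "indicator ?S y * W (hY m y) * (norm (u y))\<^sup>2 = W (hY m y) * (indicator ?S y * (norm (u y))\<^sup>2)" for y
        by simp
      show "(\<lambda>y. indicator ?S y * W (hY m y) * (norm (u y))\<^sup>2) \<in> borel_measurable lborel"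
        unfolding eq using borel_measurable_integrable[OF I] by measurable
      show "AE y in lborel. norm (indicator ?S y * W (hY m y) * (norm (u y))\<^sup>2) \<le> norm (c * (indicator ?S y * (norm (u y))\<^sup>2))"
      proof (rule AE_I2)
        fix y :: "(complex ^ 'n) \<times> complex"
        have "\<bar>W (hY m y)\<bar> \<le> \<bar>c\<bar>" using W0[of "hY m y"] Wc[of "hY m y"] by linarith
        then have "\<bar>W (hY m y)\<bar> * norm (indicator ?S y * (norm (u y))\<^sup>2) \<le> \<bar>c\<bar> * norm (indicator ?S y * (norm (u y))\<^sup>2)"
          by (rule mult_right_mono) simp
        then show "norm (indicator ?S y * W (hY m y) * (norm (u y))\<^sup>2) \<le> norm (c * (indicator ?S y * (norm (u y))\<^sup>2))"
          by (simp only: eq real_norm_def abs_mult)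
      qed
    qed
    show "integrable lborel (\<lambda>y. indicator ?S y * W (hY m y) * (norm (f y))\<^sup>2)" by (rule int[OF If])
    show Ihw: "integrable lborel (\<lambda>y. indicator ?S y * W (hY m y) * (norm (h y))\<^sup>2)" by (rule int[OF Ih])
    \<comment> \<open>Here the residue 0 is used: the density of \<open>h\<close> in
      \<open>Y\<close> is constant, so the weight is integrated against plain Lebesgue
      measure.\<close>
    have ex: "y ^ (l * k + (m + l * n - 1) + m * 0) / y ^ (m * E) = 1" if "y > 0" for y :: real
    proof -
      have "l * k + (m + l * n - 1) + m * 0 = m * E"
        using lk m by (simp add: E_def algebra_simps)
      then show ?thesis using that by simp
    qed
    have "ennreal (LINT y|lborel. indicator ?S y * W (hY m y) * (norm (h y))\<^sup>2) = (\<integral>\<^sup>+y. ennreal (indicator ?S y * W (hY m y) * (norm (h y))\<^sup>2) \<partial>lborel)"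
      using W0 by (intro nn_integral_eq_integral[symmetric] Ihw AE_I2) simp
    also have "\<dots> = (\<integral>\<^sup>+y\<in>?S. ennreal ((norm (h y))\<^sup>2) * (\<lambda>y. ennreal (W y)) (hY m y) \<partial>lborel)"
      using W0 by (intro nn_integral_cong) (simp add: indicator_def ennreal_mult'' mult.commute)
    also have "\<dots> = ennreal M * (\<integral>\<^sup>+y\<in>{0<..<1}. ennreal (y ^ (l * k + (m + l * n - 1) + m * 0) / y ^ (m * E)) * ennreal (W y) \<partial>lborel)"
      unfolding h_def M_def n_def by (rule hmono_moment[OF _ e m l]) measurable
    also have "(\<integral>\<^sup>+y\<in>{0<..<1}. ennreal (y ^ (l * k + (m + l * n - 1) + m * 0) / y ^ (m * E)) * ennreal (W y) \<partial>lborel) = (\<integral>\<^sup>+y. ennreal (indicator {0<..<1} y * W y) \<partial>lborel)"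
    proof (rule nn_integral_cong)
      fix y :: real
      show "ennreal (y ^ (l * k + (m + l * n - 1) + m * 0) / y ^ (m * E)) * ennreal (W y) * indicator {0<..<1} y = ennreal (indicator {0<..<1} y * W y)"
      proof (cases "y \<in> {0<..<1}")
        case True
        then have "y > 0" by simp
        from ex[OF this] True show ?thesis by (simp only: indicator_simps) simp
      qed simp
    qed
    also have "\<dots> = ennreal (LINT y|lborel. indicator {0<..<1} y * W y)"
    proof (rule nn_integral_eq_integral)
      have "integrable lborel (\<lambda>y::real. c * indicator {0<..<1} y)" by (intro integrable_mult_right integrable_real_indicator) simp_all
      then show "integrable lborel (\<lambda>y. indicator {0<..<1} y * W y)"
      proof (rule Bochner_Integration.integrable_bound)
        show "AE y in lborel. norm (indicator {0<..<1} y * W y) \<le> norm (c * indicator {0<..<1} y)"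
        proof (rule AE_I2)
          fix y
          have "\<bar>W y\<bar> \<le> \<bar>c\<bar>" using W0[of y] Wc[of y] by linarith
          then show "norm (indicator {0<..<1} y * W y) \<le> norm (c * indicator {0<..<1} y)" by (simp add: indicator_def)
        qed
      qed measurable
    qed (use W0 in simp)
    finally have "ennreal (LINT y|lborel. indicator ?S y * W (hY m y) * (norm (h y))\<^sup>2) = ennreal (M * (LINT y|lborel. indicator {0<..<1} y * W y))"
      using M by (simp add: ennreal_mult')
    then show "(LINT y|lborel. indicator ?S y * W (hY m y) * (norm (h y))\<^sup>2) = M * (LINT y|lborel. indicator {0<..<1} y * W y)"
      using M W0 by (subst (asm) ennreal_inj) (auto intro!: Bochner_Integration.integral_nonneg mult_nonneg_nonneg)
  qed
  define t where "t = norm \<beta>"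
  have t: "t > 0" using \<beta> by (simp add: t_def)
  show ?thesis
  proof (rule that[of "t\<^sup>2 * M"])
    show "t\<^sup>2 * M > 0" using t M by simp
    fix W :: "real \<Rightarrow> real" and c :: real
    assume W: "W \<in> borel_measurable borel" and W0: "\<And>y. 0 \<le> W y" and Wc: "\<And>y. W y \<le> c"
    define Hh where "Hh = (LINT y|lborel. indicator ?S y * W (hY m y) * (norm (h y))\<^sup>2)"
    define Ff where "Ff = (LINT y|lborel. indicator ?S y * W (hY m y) * (norm (f y))\<^sup>2)"
    note ints = hW_int[OF W W0 Wc] fW_int[OF W W0 Wc]
    have Hh0: "Hh \<ge> 0" unfolding Hh_def using W0 by (intro Bochner_Integration.integral_nonneg) simp
    have "t * Hh = norm (LINT y|lborel. (indicator ?S y * W (hY m y)) *\<^sub>R (f y * cnj (h y)))"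
      unfolding coeff[OF W W0 Wc] Hh_def[symmetric] t_def norm_mult using Hh0 by simp
    also have "\<dots> \<le> (LINT y|lborel. norm ((indicator ?S y * W (hY m y)) *\<^sub>R (f y * cnj (h y))))"
      by (rule integral_norm_bound)
    also have "\<dots> \<le> (LINT y|lborel. 1 / (2 * t) * (indicator ?S y * W (hY m y) * (norm (f y))\<^sup>2) + t / 2 * (indicator ?S y * W (hY m y) * (norm (h y))\<^sup>2))"
    proof (rule integral_mono)
      show "integrable lborel (\<lambda>y. norm ((indicator ?S y * W (hY m y)) *\<^sub>R (f y * cnj (h y))))"
        by (rule integrable_norm[OF coeff_int[OF W W0 Wc]])
      show "integrable lborel (\<lambda>y. 1 / (2 * t) * (indicator ?S y * W (hY m y) * (norm (f y))\<^sup>2) + t / 2 * (indicator ?S y * W (hY m y) * (norm (h y))\<^sup>2))"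
        by (intro Bochner_Integration.integrable_add integrable_mult_right ints)
      fix y :: "(complex ^ 'n) \<times> complex"
      \<comment> \<open>The weights are adapted to \<open>t = norm \<beta>\<close>: the term
        \<open>t / 2 * Hh\<close> takes half of the left side \<open>t * Hh\<close>, which leaves
        \<open>t^2 * Hh \<le> Ff\<close>, the inequality of Bessel type that is wanted.\<close>
      have "p * q \<le> 1 / (2 * t) * p\<^sup>2 + t / 2 * q\<^sup>2" for p q :: real
      proof -
        have "0 \<le> (p - t * q)\<^sup>2 / (2 * t)" using t by simp
        also have "(p - t * q)\<^sup>2 / (2 * t) = 1 / (2 * t) * p\<^sup>2 + t / 2 * q\<^sup>2 - p * q"
          using t by (simp add: power2_eq_square field_simps)
        finally show ?thesis by simp
      qed
      from mult_left_mono[OF this[of "norm (f y)" "norm (h y)"], of "indicator ?S y * W (hY m y)"]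
      have "(indicator ?S y * W (hY m y)) * (norm (f y) * norm (h y)) \<le> (indicator ?S y * W (hY m y)) * (1 / (2 * t) * (norm (f y))\<^sup>2 + t / 2 * (norm (h y))\<^sup>2)"
        using W0 by simp
      moreover have "norm ((indicator ?S y * W (hY m y)) *\<^sub>R (f y * cnj (h y))) = (indicator ?S y * W (hY m y)) * (norm (f y) * norm (h y))"
        using W0 by (simp add: norm_mult)
      moreover have "w * (1 / (2 * t) * p + t / 2 * q) = 1 / (2 * t) * (w * p) + t / 2 * (w * q)" for w p q :: real
        by (simp add: algebra_simps)
      ultimately show "norm ((indicator ?S y * W (hY m y)) *\<^sub>R (f y * cnj (h y))) \<le> 1 / (2 * t) * (indicator ?S y * W (hY m y) * (norm (f y))\<^sup>2) + t / 2 * (indicator ?S y * W (hY m y) * (norm (h y))\<^sup>2)"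
        by (simp only:)
    qed
    also have "\<dots> = 1 / (2 * t) * Ff + t / 2 * Hh"
      unfolding Ff_def Hh_def using ints by (subst Bochner_Integration.integral_add) auto
    finally have "t / 2 * Hh \<le> 1 / (2 * t) * Ff" by simp
    then have "(2 * t) * (t / 2 * Hh) \<le> (2 * t) * (1 / (2 * t) * Ff)" using t by (intro mult_left_mono) auto
    then have "t\<^sup>2 * Hh \<le> Ff" using t by (simp add: power2_eq_square)
    then show "t\<^sup>2 * M * (LINT y|lborel. indicator {0<..<1} y * W y) \<le>
       (LINT y|lborel. indicator ?S y * W (hY m y) * (norm (hker m l x y))\<^sup>2)"
      unfolding Hh_def Ff_def hW[OF W W0 Wc] fnorm by (simp only: mult.assoc)
  qed
qed

end

section \<open>The logarithmic weight and the divergent integral\<close>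

definition log_weight :: "real \<Rightarrow> real" where "log_weight y = 1 / (y * (1 - ln y))"

lemma log_weight_measurable [measurable]: "log_weight \<in> borel_measurable borel"
  unfolding log_weight_def[abs_def] by measurable

lemma log_weight_bounds:
  assumes "0 < y" "y \<le> 1"
  shows "log_weight y \<ge> 0" "log_weight y \<le> 1 / y"
proof -
  have L: "1 - ln y \<ge> 1" using assms by simp
  have P: "0 < y * (1 - ln y)" using assms(1) L by (intro mult_pos_pos) linarith+
  then show "log_weight y \<ge> 0" unfolding log_weight_def by (intro divide_nonneg_nonneg zero_le_one less_imp_le)
  have "y * 1 \<le> y * (1 - ln y)" using assms(1) by (intro mult_left_mono[OF L]) linarith
  then have Q: "y \<le> y * (1 - ln y)" by (simp only: mult_1_right)
  show "log_weight y \<le> 1 / y" unfolding log_weight_def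
    by (rule divide_left_mono[OF Q zero_le_one mult_pos_pos[OF P assms(1)]])
qed

text \<open>An antiderivative is \<open>- ln (1 - ln y)\<close>; it is unbounded near 0, which
  produces the divergence.\<close>

lemma log_weight_mass:
  assumes "0 < \<delta>" "\<delta> \<le> 1 / 2"
  shows "(LINT y|lborel. log_weight y * indicator {\<delta>..1 / 2} y) = ln (1 - ln \<delta>) - ln (1 - ln (1 / 2))"
proof -
  have "(LINT y|lborel. log_weight y * indicator {\<delta>..1 / 2} y) = (- ln (1 - ln (1 / 2))) - (- ln (1 - ln \<delta>))"
  proof (rule integral_FTC_Icc_nonneg)
    fix y :: real assume y: "y \<in> {\<delta>..1 / 2}"
    have "ln y \<le> 0" using y assms by simp
    then have L: "1 - ln y > 0" by simp
    show "((\<lambda>y. - ln (1 - ln y)) has_real_derivative log_weight y) (at y)"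
      unfolding log_weight_def using y assms L by (auto intro!: derivative_eq_intros)
    show "0 \<le> log_weight y" using y assms by (intro log_weight_bounds) auto
  qed (use assms in auto)
  then show ?thesis by simp
qed

text \<open>The antiderivative \<open>1 / (1 - ln y)\<close> takes values between 0 and 1 on the
  unit interval. The integrals over \<open>{1 / (j + 1)..1}\<close> are thus at most 1, and monotone
  convergence does the rest.\<close>

lemma log_weight_square_moment:
  "(\<integral>\<^sup>+y\<in>{0<..<1}. ennreal (1 / (y * (1 - ln y) ^ 2)) \<partial>lborel) \<le> 1"
proof -
  define F where "F = (\<lambda>j y. ennreal (1 / (y * (1 - ln y) ^ 2)) * indicator {1 / real (Suc j)..1} y)"
  have F: "F j \<in> borel_measurable lborel" for j unfolding F_def by measurable
  have inc: "incseq F"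
  proof (rule incseq_SucI, rule le_funI)
    fix j y
    have "1 / real (Suc (Suc j)) \<le> 1 / real (Suc j)" by (simp add: frac_le)
    then show "F j y \<le> F (Suc j) y" unfolding F_def by (auto simp: indicator_def)
  qed
  have "(\<integral>\<^sup>+y\<in>{0<..<1}. ennreal (1 / (y * (1 - ln y) ^ 2)) \<partial>lborel) \<le> (\<integral>\<^sup>+y. (SUP j. F j y) \<partial>lborel)"
  proof (rule nn_integral_mono)
    fix y :: real
    show "ennreal (1 / (y * (1 - ln y) ^ 2)) * indicator {0<..<1} y \<le> (SUP j. F j y)"
    proof (cases "y \<in> {0<..<1}")
      case True
      obtain j where "inverse (real (Suc j)) < y" using reals_Archimedean[of y] True by auto
      then have "ennreal (1 / (y * (1 - ln y) ^ 2)) * indicator {0<..<1} y = F j y"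
        using True by (simp add: F_def indicator_def inverse_eq_divide)
      then show ?thesis by (simp only:) (rule SUP_upper, simp)
    qed simp
  qed
  also have "\<dots> = (SUP j. \<integral>\<^sup>+y. F j y \<partial>lborel)" by (rule nn_integral_monotone_convergence_SUP[OF inc F])
  also have "\<dots> \<le> 1"
  proof (rule SUP_least)
    fix j
    define d where "d = 1 / real (Suc j)"
    have d: "0 < d" "d \<le> 1" by (auto simp: d_def)
    have "(\<integral>\<^sup>+y. F j y \<partial>lborel) = ennreal (1 / (1 - ln 1) - 1 / (1 - ln d))"
      unfolding F_def d_def[symmetric]
    proof (rule nn_integral_FTC_Icc)
      fix y :: real assume y: "y \<in> {d..1}"
      have "ln y \<le> 0" using y d by simp
      then have L: "1 - ln y > 0" by simp
      show "((\<lambda>y. 1 / (1 - ln y)) has_real_derivative 1 / (y * (1 - ln y) ^ 2)) (at y)"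
        using y d L by (auto intro!: derivative_eq_intros simp: power2_eq_square)
      show "0 \<le> 1 / (y * (1 - ln y) ^ 2)" using y d by simp
    qed (use d in auto)
    moreover have "ln d \<le> 0" using d by simp
    then have "ennreal (1 / (1 - ln 1) - 1 / (1 - ln d)) \<le> ennreal 1" by (intro ennreal_leI) simp
    ultimately show "(\<integral>\<^sup>+y. F j y \<partial>lborel) \<le> 1" by simp
  qed
  finally show ?thesis .
qed

text \<open>The extreme exponent is \<open>s + 1\<close>: then \<open>y ^ s\<close> cancels all but
  one factor \<open>1 / y\<close>, and \<open>s \<ge> 1\<close> leaves at least the square of
  \<open>1 - ln y\<close> in the denominator. Smaller exponents are covered by
  \<open>g powr p \<le> 1 + g ^ (s + 1)\<close>.\<close>

lemma log_weight_powr_bound: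
  assumes y: "0 < y" "y \<le> 1" and s: "s \<ge> 1" and p: "1 \<le> p" "p \<le> real s + 1"
  shows "y ^ s * log_weight y powr p \<le> 1 + 1 / (y * (1 - ln y) ^ 2)"
proof -
  define L where "L = 1 - ln y"
  have L: "L \<ge> 1" using y by (simp add: L_def)
  define g where "g = log_weight y"
  have g: "g > 0" "g = 1 / (y * L)" using L y by (simp_all add: g_def log_weight_def L_def[symmetric])
  have "g powr p \<le> 1 + g ^ (s + 1)"
  proof (cases "g \<le> 1")
    case True
    then have "g powr p \<le> 1" using g p by (intro powr_le1) auto
    moreover have "g ^ (s + 1) \<ge> 0" using g by simp
    ultimately show ?thesis by linarith
  next
    case False
    then have "g powr p \<le> g powr real (s + 1)" using p by (intro powr_mono) auto
    also have "g powr real (s + 1) = g ^ (s + 1)" by (rule powr_realpow[OF g(1)])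
    finally show ?thesis by simp
  qed
  then have "y ^ s * g powr p \<le> y ^ s * (1 + g ^ (s + 1))" using y by (intro mult_left_mono) auto
  also have "\<dots> = y ^ s + 1 / (y * L ^ (s + 1))"
    using y L by (simp add: g(2) power_divide power_mult_distrib distrib_left)
  also have "\<dots> \<le> 1 + 1 / (y * L ^ 2)"
  proof (rule add_mono)
    show "y ^ s \<le> 1" using y by (intro power_le_one) auto
    have LL: "L ^ 2 \<le> L ^ (s + 1)" using L s by (intro power_increasing) auto
    have "y * L ^ 2 \<le> y * L ^ (s + 1)" using y by (intro mult_left_mono LL) simp
    then show "1 / (y * L ^ (s + 1)) \<le> 1 / (y * L ^ 2)" using y L by (intro divide_left_mono mult_pos_pos) auto
  qed
  finally show ?thesis by (simp add: g_def L_def)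
qed

text \<open>By the identity of Bezout, \<open>l * a\<close> is congruent to 1 modulo
  \<open>m\<close>. Since \<open>k + n\<close> only matters modulo \<open>m\<close>, adding
  \<open>m * n\<close> to \<open>a\<close> before subtracting \<open>n\<close> keeps
  \<open>k\<close> a natural number.\<close>

lemma ridx_zero_exists:
  assumes m: "m > 0" and l: "l > 0" and "gcd m l = 1"
  obtains k where "ridx m l n k = 0"
proof -
  obtain a b where ab: "l * a = m * b + 1"
    using bezout_nat[of l m] l assms(3) by (auto simp: gcd.commute)
  have "n \<le> m * n" using m by simp
  then have "a + m * n - n + n = a + m * n" by linarith
  then have "l * (a + m * n - n + n) - 1 = m * (b + l * n)"
    using ab by (simp only: distrib_left) (simp add: mult.left_commute)
  then have "ridx m l n (a + m * n - n) = 0" by (simp add: ridx_def)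
  then show ?thesis by (rule that)
qed

context
  fixes m l :: nat
  assumes m: "m > 0" and l: "l > 0"
begin

text \<open>Moment formula for the constant monomial \<open>hmono e 0 0 0\<close>: the density of
  \<open>Y\<close> is \<open>Y ^ s0\<close>, so the bound of \<open>log_weight_powr_bound\<close>
  applies up to and including the endpoint \<open>p = s0 + 1\<close>.\<close>

lemma log_weight_Lp_space:
  assumes p: "1 \<le> p" "p \<le> real (m + l * CARD('n))"
  shows "(\<lambda>y :: (complex ^ 'n) \<times> complex. complex_of_real (indicator (hartogs m l) y * log_weight (hY m y))) \<in> Lp_space p (hartogs m l)"
proof -
  let ?S = "hartogs m l :: ((complex ^ 'n) \<times> complex) set"
  have S [measurable]: "?S \<in> sets borel" by (rule hartogs_measurable[OF m l])
  define s0 where "s0 = m + l * CARD('n) - 1"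
  have "0 < l * CARD('n)" using l by simp
  then have s0: "s0 \<ge> 1" "real (m + l * CARD('n)) = real s0 + 1"
    unfolding s0_def using m by linarith+
  define f where "f = (\<lambda>y :: (complex ^ 'n) \<times> complex. complex_of_real (indicator ?S y * log_weight (hY m y)))"
  have f [measurable]: "f \<in> borel_measurable borel" unfolding f_def by measurable
  have bm: "(\<lambda>y. indicator ?S y *\<^sub>R (norm (f y) powr p)) \<in> borel_measurable borel" by measurable
  obtain i0 :: 'n where True by simp
  define e :: "complex ^ 'n" where "e = axis i0 1"
  have e: "norm e = 1" by (simp add: e_def)
  define c where "c = real m * pi ^ (CARD('n) + 1) * fact 0 / fact (CARD('n) + 0)"
  have "(\<integral>\<^sup>+y. ennreal (indicator ?S y *\<^sub>R (norm (f y) powr p)) \<partial>lborel) =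
    (\<integral>\<^sup>+y\<in>?S. ennreal ((norm (hmono e 0 0 0 y))\<^sup>2) * (\<lambda>y. ennreal (log_weight y powr p)) (hY m y) \<partial>lborel)"
  proof (rule nn_integral_cong)
    fix y :: "(complex ^ 'n) \<times> complex"
    show "ennreal (indicator ?S y *\<^sub>R (norm (f y) powr p)) = ennreal ((norm (hmono e 0 0 0 y))\<^sup>2) * (\<lambda>y. ennreal (log_weight y powr p)) (hY m y) * indicator ?S y"
    proof (cases "y \<in> ?S")
      case True
      then have "log_weight (hY m y) \<ge> 0" using m l by (intro log_weight_bounds) (auto simp: mem_hartogs_iff)
      then show ?thesis using True by (simp add: f_def hmono_def)
    qed simp
  qed
  also have "\<dots> = ennreal c * (\<integral>\<^sup>+y\<in>{0<..<1}. ennreal (y ^ (l * 0 + (m + l * CARD('n) - 1) + m * 0) / y ^ (m * 0)) * ennreal (log_weight y powr p) \<partial>lborel)"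
    unfolding c_def by (rule hmono_moment[OF _ e m l]) measurable
  also have "\<dots> \<le> ennreal c * (\<integral>\<^sup>+y. indicator {0<..<1} y + ennreal (1 / (y * (1 - ln y) ^ 2)) * indicator {0<..<1} y \<partial>lborel)"
  proof (intro mult_left_mono nn_integral_mono)
    fix y :: real
    show "ennreal (y ^ (l * 0 + (m + l * CARD('n) - 1) + m * 0) / y ^ (m * 0)) * ennreal (log_weight y powr p) * indicator {0<..<1} y
       \<le> indicator {0<..<1} y + ennreal (1 / (y * (1 - ln y) ^ 2)) * indicator {0<..<1} y"
    proof (cases "y \<in> {0<..<1}")
      case True
      then have y: "0 < y" "y \<le> 1" by auto
      have "ennreal (y ^ s0 * log_weight y powr p) \<le> ennreal (1 + 1 / (y * (1 - ln y) ^ 2))"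
        using log_weight_powr_bound[OF y s0(1) p(1)] p(2) s0(2) by (intro ennreal_leI) simp
      then show ?thesis using True y by (simp add: s0_def ennreal_mult)
    qed simp
  qed simp
  also have "\<dots> = ennreal c * ((\<integral>\<^sup>+y. indicator {0<..<1::real} y \<partial>lborel) + (\<integral>\<^sup>+y\<in>{0<..<1}. ennreal (1 / (y * (1 - ln y) ^ 2)) \<partial>lborel))"
    by (subst nn_integral_add) auto
  also have "\<dots> \<le> ennreal c * (1 + 1)"
    by (intro mult_left_mono add_mono log_weight_square_moment) auto
  also have "\<dots> < \<infinity>" by (simp add: ennreal_mult_less_top)
  finally have "(\<integral>\<^sup>+y. ennreal (indicator ?S y *\<^sub>R (norm (f y) powr p)) \<partial>lborel) < \<infinity>" .
  then have "integrable lborel (\<lambda>y. indicator ?S y *\<^sub>R (norm (f y) powr p))"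
    using bm by (intro integrableI_nonneg) auto
  then have "integrable (lebesgue_on ?S) (\<lambda>y. norm (f y) powr p)"
    using lebesgue_on_integral(1)[OF S bm] by blast
  moreover have "f \<in> borel_measurable (lebesgue_on ?S)"
    by (intro measurable_restrict_space1 measurable_completion) simp
  ultimately show ?thesis unfolding f_def[symmetric] by (simp add: Lp_space_def)
qed

text \<open>\<open>kernel_weight_lower\<close> is stated for bounded weights, so it is applied to
  \<open>log_weight\<close> cut off to \<open>{\<delta>..1 / 2}\<close>. Its constant
  \<open>a\<close> does not depend on the weight, and letting \<open>\<delta>\<close> tend to 0
  contradicts a finite integral \<open>T\<close>.\<close>

lemma berezin_integrand_log_weight_not_integrable:
  fixes x :: "(complex ^ 'n) \<times> complex"
  assumes gcd: "gcd m l = 1" and x: "x \<in> hartogs m l" and x0: "fst x \<noteq> 0"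
  shows "\<not> integrable (lebesgue_on (hartogs m l)) (berezin_integrand (hartogs m l)
    (\<lambda>y. complex_of_real (indicator (hartogs m l) y * log_weight (hY m y))) x)"
proof
  let ?S = "hartogs m l :: ((complex ^ 'n) \<times> complex) set"
  have S [measurable]: "?S \<in> sets borel" by (rule hartogs_measurable[OF m l])
  define f where "f = (\<lambda>y :: (complex ^ 'n) \<times> complex. complex_of_real (indicator ?S y * log_weight (hY m y)))"
  assume "integrable (lebesgue_on ?S) (berezin_integrand ?S (\<lambda>y. complex_of_real (indicator ?S y * log_weight (hY m y))) x)"
  then have I: "integrable (lebesgue_on ?S) (\<lambda>y. norm (berezin_integrand ?S f x y))"
    unfolding f_def by (rule integrable_norm)
  have w0: "log_weight (hY m y) \<ge> 0" if "y \<in> ?S" for y :: "(complex ^ 'n) \<times> complex"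
    using that m l by (intro log_weight_bounds) (auto simp: mem_hartogs_iff)
  have eq: "indicator ?S y *\<^sub>R norm (berezin_integrand ?S f x y) = indicator ?S y * log_weight (hY m y) * bker m l x y" for y
    using w0[of y] by (cases "y \<in> ?S")
      (simp_all add: berezin_integrand_def bergman_kernel_hartogs[OF m l] bker_def[OF m l] f_def norm_mult norm_divide norm_power)
  have bm: "(\<lambda>y. indicator ?S y *\<^sub>R norm (berezin_integrand ?S f x y)) \<in> borel_measurable borel"
    unfolding eq using bker_measurable2(1)[OF m l, of x] by measurable
  have "integrable lborel (\<lambda>y. indicator ?S y * log_weight (hY m y) * bker m l x y)"
    using I lebesgue_on_integral(1)[OF S bm] unfolding eq by blast
  then have "integrable lborel (\<lambda>y. norm (hker m l x x) * (indicator ?S y * log_weight (hY m y) * bker m l x y))"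
    by (rule integrable_mult_right)
  moreover have pos: "norm (hker m l x x) > 0" by (rule hker_diagonal_pos[OF m l x])
  ultimately have I2: "integrable lborel (\<lambda>y. indicator ?S y * log_weight (hY m y) * (norm (hker m l x y))\<^sup>2)"
    by (simp add: bker_def[OF m l] mult.assoc)
  define T where "T = (LINT y|lborel. indicator ?S y * log_weight (hY m y) * (norm (hker m l x y))\<^sup>2)"
  obtain k where r: "ridx m l CARD('n) k = 0" using ridx_zero_exists[OF m l gcd] by blast
  obtain a where a: "a > 0" "\<And>W :: real \<Rightarrow> real. \<And>c. W \<in> borel_measurable borel \<Longrightarrow> (\<And>y. 0 \<le> W y) \<Longrightarrow> (\<And>y. W y \<le> c) \<Longrightarrow>
     a * (LINT y|lborel. indicator {0<..<1} y * W y) \<le>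
       (LINT y|lborel. indicator ?S y * W (hY m y) * (norm (hker m l x y))\<^sup>2)"
    using kernel_weight_lower[OF m l x x0 r] by blast
  define c0 where "c0 = ln (1 - ln (1 / 2 :: real))"
  have bound: "a * (ln (1 - ln \<delta>) - c0) \<le> T" if \<delta>: "0 < \<delta>" "\<delta> \<le> 1 / 2" for \<delta>
  proof -
    define W where "W = (\<lambda>y. log_weight y * indicator {\<delta>..1 / 2} y)"
    have Wm: "W \<in> borel_measurable borel" unfolding W_def by measurable
    have W0: "0 \<le> W y" for y using \<delta> log_weight_bounds(1)[of y] by (auto simp: W_def indicator_def)
    have W1: "W y \<le> 1 / \<delta>" for y
    proof (cases "y \<in> {\<delta>..1 / 2}")
      case True
      then have "log_weight y \<le> 1 / y" using \<delta> by (intro log_weight_bounds) auto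
      also have "\<dots> \<le> 1 / \<delta>" using True \<delta> by (intro divide_left_mono) auto
      finally show ?thesis using True by (simp add: W_def)
    qed (use \<delta> in \<open>simp add: W_def\<close>)
    have "(LINT y|lborel. indicator {0<..<1} y * W y) = (LINT y|lborel. log_weight y * indicator {\<delta>..1 / 2} y)"
      using \<delta> by (intro Bochner_Integration.integral_cong) (auto simp: W_def indicator_def)
    then have "a * (ln (1 - ln \<delta>) - c0) = a * (LINT y|lborel. indicator {0<..<1} y * W y)"
      using log_weight_mass[OF \<delta>] by (simp add: c0_def)
    also have "\<dots> \<le> (LINT y|lborel. indicator ?S y * W (hY m y) * (norm (hker m l x y))\<^sup>2)"
      by (rule a(2)[OF Wm W0 W1])
    also have "\<dots> \<le> T" unfolding T_def
    proof (rule integral_mono'[OF I2])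
      fix y
      show "indicator ?S y * W (hY m y) * (norm (hker m l x y))\<^sup>2 \<le> indicator ?S y * log_weight (hY m y) * (norm (hker m l x y))\<^sup>2"
        using w0[of y] by (auto simp: W_def indicator_def)
      show "0 \<le> indicator ?S y * log_weight (hY m y) * (norm (hker m l x y))\<^sup>2"
        using w0[of y] by (auto simp: indicator_def)
    qed
    finally show ?thesis .
  qed
  \<comment> \<open>For \<open>\<delta> = exp (1 - exp R)\<close> one has
    \<open>ln (1 - ln \<delta>) = R\<close>, so the bound reads \<open>a * (R - c0) \<le> T\<close>,
    which this \<open>R\<close> violates by at least \<open>a\<close>. The condition
    \<open>R \<ge> 1\<close> keeps \<open>\<delta>\<close> below \<open>1 / 2\<close>.\<close>
  define R where "R = max 1 (T / a + c0 + 1)"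
  have R: "R \<ge> 1" "R \<ge> T / a + c0 + 1" by (auto simp: R_def)
  define \<delta> where "\<delta> = exp (1 - exp R)"
  have "exp R \<ge> 2" using R exp_ge_add_one_self[of R] by linarith
  then have "\<delta> \<le> exp (- 1)" by (simp add: \<delta>_def)
  also have "\<dots> \<le> 1 / 2" using exp_ge_add_one_self[of "1 :: real"] by (simp add: exp_minus field_simps)
  finally have "a * (ln (1 - ln \<delta>) - c0) \<le> T" by (intro bound) (simp add: \<delta>_def)
  then have "a * (R - c0) \<le> T" by (simp add: \<delta>_def)
  moreover have "a * (T / a + 1) \<le> a * (R - c0)" using R a(1) by (intro mult_left_mono) auto
  moreover have "a * (T / a + 1) = T + a" using a(1) by (simp add: distrib_left)
  ultimately show False using a(1) by linarith
qed

text \<open>Boundedness includes absolute convergence at almost every point. It fails at every point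
  of the domain with \<open>fst x \<noteq> 0\<close>; these points form a nonempty open set, which
  is not negligible.\<close>

lemma berezin_unbounded_hartogs:
  assumes gcd: "gcd m l = 1" and p: "1 \<le> p" "p \<le> real (m + l * CARD('n))"
  shows "\<not> berezin_bounded_on_Lp p (hartogs m l :: ((complex ^ 'n) \<times> complex) set)"
proof
  let ?S = "hartogs m l :: ((complex ^ 'n) \<times> complex) set"
  have S [measurable]: "?S \<in> sets borel" by (rule hartogs_measurable[OF m l])
  define U where "U = {x \<in> ?S. fst x \<noteq> 0}"
  have "U = ?S \<inter> (UNIV - {0}) \<times> UNIV" by (auto simp: U_def)
  then have U: "open U" by (simp only:) (intro open_Int open_hartogs open_Times open_Diff open_UNIV closed_singleton)
  assume "berezin_bounded_on_Lp p ?S"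
  then have "AE x in lebesgue_on ?S. integrable (lebesgue_on ?S) (berezin_integrand ?S
    (\<lambda>y. complex_of_real (indicator ?S y * log_weight (hY m y))) x)"
    using log_weight_Lp_space[OF p] unfolding berezin_bounded_on_Lp_def by blast
  then have "AE x in lebesgue. x \<in> ?S \<longrightarrow> integrable (lebesgue_on ?S) (berezin_integrand ?S
    (\<lambda>y. complex_of_real (indicator ?S y * log_weight (hY m y))) x)"
    using S by (subst (asm) AE_restrict_space_iff) auto
  then have "AE x in lebesgue. x \<notin> U"
    by (rule eventually_mono) (use berezin_integrand_log_weight_not_integrable[OF gcd] in \<open>auto simp: U_def\<close>)
  then have "U \<in> null_sets lebesgue" using U by (subst AE_iff_null_sets) auto
  then have "U = {}" using open_not_negligible[OF U] negligible_iff_null_sets by blast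
  \<comment> \<open>A concrete point of \<open>U\<close>: with \<open>w = 1 / 2\<close>, a vector of
    norm \<open>(1 / 2) ^ (l + 1)\<close> satisfies the inequality for every
    \<open>m \<ge> 1\<close>, since raising a number below 1 to the power \<open>m\<close> does not
    increase it.\<close>
  moreover have "(complex_of_real ((1 / 2) ^ (l + 1)) *s axis undefined 1, 1 / 2) \<in> U"
  proof -
    define z where "z = complex_of_real ((1 / 2) ^ (l + 1)) *s (axis undefined 1 :: complex ^ 'n)"
    have z: "norm z = (1 / 2) ^ (l + 1)" by (simp add: z_def norm_scale_vec norm_power norm_divide)
    then have "z \<noteq> 0" by auto
    have "((1 / 2 :: real) ^ (l + 1)) ^ m \<le> ((1 / 2) ^ (l + 1)) ^ 1"
      using m by (intro power_decreasing power_le_one) auto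
    also have "\<dots> < (1 / 2) ^ l" by simp
    finally have "norm z ^ m < (1 / 2) ^ l" by (simp only: z)
    then show ?thesis using l \<open>z \<noteq> 0\<close>
      unfolding z_def[symmetric] by (simp add: U_def hartogs_def norm_divide power_less_one_iff)
  qed
  ultimately show False by blast
qed

end

theorem corollary1p3:
  fixes m l :: nat and p :: real
  assumes "m > 0" and "l > 0" and "gcd m l = 1" and "p \<ge> 1"
  shows "\<not> berezin_bounded_on_Lp p (hartogs m l :: ((complex ^ 'n) \<times> complex) set) \<longleftrightarrow>
    1 \<le> p \<and> p \<le> real m + real CARD('n) * real l"
proof -
  have "real m + real CARD('n) * real l = real (m + l * CARD('n))" by simp
  then show ?thesis
    using berezin_bounded_hartogs[OF assms(1,2), where 'n = 'n and p = p] berezin_unbounded_hartogs[OF assms(1-3), where 'n = 'n and p = p] assms(4)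
    by (simp only: not_le[symmetric]) blast
qed

end
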